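(* For each $n\ge 1$ let $p=p_n$ and $q=q_n$ be integers with $1\le p,q\le n$. Let $\boldsymbol{\Gamma}_n$ be an $n\times n$ random orthogonal matrix distributed according to the Haar (uniform) probability measure on the orthogonal group $O(n)$, let $\mathbf Z_n$ be the $p\times q$ upper-left submatrix of $\boldsymbol{\Gamma}_n$, and let $\mathbf G_n$ be a $p\times q$ matrix whose $pq$ entries are independent $N(0,1)$ random variables. Let $d(\sqrt n\mathbf Z_n,\mathbf G_n)$ denote any one of the following three quantities between the probability distribution $\mu_n$ of $\sqrt n\mathbf Z_n$ and the distribution $\nu_n$ of $\mathbf G_n$ (both viewed as probability measures on $\mathbb R^{pq}$): the total variation distance $\|\mu_n-\nu_n\|_{\rm TV}$, the Hellinger distance $H(\mu_n,\nu_n)$, or the Kullback–Leibler distance $D_{\rm KL}(\mu_n\|\nu_n)$. Then: (i) $\lim_{n\to\infty} d(\sqrt n\mathbf Z_n,\mathbf G_n)=0$ whenever $\lim_{n\to\infty} pq/n=0$; (ii) $\liminf_{n\to\infty} d(\sqrt n\mathbf Z_n,\mathbf G_n)>0$ whenever $\lim_{n\to\infty} pq/n=\sigma\in(0,\infty)$.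
   Context: For probability measures $\mu,\nu$ on $\mathbb R^m$ with Lebesgue densities $f,g$: $\|\mu-\nu\|_{\rm TV}=2\sup_{A}|\mu(A)-\nu(A)|=\int|f-g|\,dx$; $H^2(\mu,\nu)=\frac12\int(\sqrt f-\sqrt g)^2\,dx$; $D_{\rm KL}(\mu\|\nu)=\int \frac{d\mu}{d\nu}\log\frac{d\mu}{d\nu}\,d\nu$. *)

theory Defs
  imports "HOL-Probability.Probability"
begin

text \<open>Real matrices with r rows and c columns are encoded as (extensional) functions
  on the index set {..<r} x {..<c}; the measurable space is the Borel product space,
  i.e. R^(rc) with its Borel sigma algebra.\<close>

definition mat_space :: "nat \<Rightarrow> nat \<Rightarrow> (nat \<times> nat \<Rightarrow> real) measure" where
  "mat_space r c = PiM ({..<r} \<times> {..<c}) (\<lambda>_. lborel)"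

definition orthogonal_mat :: "nat \<Rightarrow> (nat \<times> nat \<Rightarrow> real) \<Rightarrow> bool" where
  "orthogonal_mat n A \<longleftrightarrow> A \<in> space (mat_space n n) \<and>
     (\<forall>i<n. \<forall>j<n. (\<Sum>k<n. A (k, i) * A (k, j)) = (if i = j then 1 else 0))"

definition mat_mult :: "nat \<Rightarrow> (nat \<times> nat \<Rightarrow> real) \<Rightarrow> (nat \<times> nat \<Rightarrow> real) \<Rightarrow> (nat \<times> nat \<Rightarrow> real)" where
  "mat_mult n G A = (\<lambda>(i, j) \<in> {..<n} \<times> {..<n}. \<Sum>k<n. G (i, k) * A (k, j))"

text \<open>Haar (uniform) probability measure on O(n): a probability measure on the n x n
  matrices, concentrated on O(n), invariant under left multiplication by O(n).
  (Such a measure exists and is unique.)\<close>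

definition is_haar_orthogonal :: "nat \<Rightarrow> (nat \<times> nat \<Rightarrow> real) measure \<Rightarrow> bool" where
  "is_haar_orthogonal n M \<longleftrightarrow> sets M = sets (mat_space n n) \<and> prob_space M \<and>
     (AE A in M. orthogonal_mat n A) \<and>
     (\<forall>G. orthogonal_mat n G \<longrightarrow> distr M M (mat_mult n G) = M)"

definition scaled_block :: "nat \<Rightarrow> nat \<Rightarrow> nat \<Rightarrow> (nat \<times> nat \<Rightarrow> real) \<Rightarrow> (nat \<times> nat \<Rightarrow> real)" where
  "scaled_block n p q A = (\<lambda>(i, j) \<in> {..<p} \<times> {..<q}. sqrt (real n) * A (i, j))"

definition gauss_mat :: "nat \<Rightarrow> nat \<Rightarrow> (nat \<times> nat \<Rightarrow> real) measure" where
  "gauss_mat p q = PiM ({..<p} \<times> {..<q}) (\<lambda>_. density lborel std_normal_density)"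

definition tv_dist :: "'a measure \<Rightarrow> 'a measure \<Rightarrow> real" where
  "tv_dist M N = 2 * (SUP A \<in> sets M. \<bar>measure M A - measure N A\<bar>)"

definition sum_measure :: "'a measure \<Rightarrow> 'a measure \<Rightarrow> 'a measure" where
  "sum_measure M N = measure_of (space M) (sets M) (\<lambda>A. emeasure M A + emeasure N A)"

text \<open>Squared Hellinger distance 1/2 int (sqrt f - sqrt g)^2, with f, g densities with
  respect to the dominating measure M + N (for Lebesgue densities this agrees with the
  definition via Lebesgue densities).\<close>

definition hellinger_sq :: "'a measure \<Rightarrow> 'a measure \<Rightarrow> real" where
  "hellinger_sq M N = (let L = sum_measure M N in
     enn2real (\<integral>\<^sup>+ x. ennreal ((sqrt (enn2real (RN_deriv L M x))
                              - sqrt (enn2real (RN_deriv L N x)))\<^sup>2) \<partial>L) / 2)"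

definition hellinger :: "'a measure \<Rightarrow> 'a measure \<Rightarrow> real" where
  "hellinger M N = sqrt (hellinger_sq M N)"

definition kl_div :: "'a measure \<Rightarrow> 'a measure \<Rightarrow> ereal" where
  "kl_div M N = (if absolutely_continuous N M then
     (let f = (\<lambda>x. enn2real (RN_deriv N M x)) in
        enn2ereal (\<integral>\<^sup>+ x. ennreal (f x * ln (f x)) \<partial>N)
      - enn2ereal (\<integral>\<^sup>+ x. ennreal (- (f x * ln (f x))) \<partial>N))
   else \<infinity>)"

end

theory Submission
  imports Defs "HOL-Combinatorics.Transposition" "HOL-Computational_Algebra.Polynomial"
begin

text \<open>Upper bound: writing a Haar matrix as a product of planar rotations with independent angles
  expresses the lower-right p x q block as a triangular function of pq independent coordinates, the
  coordinate at (i, j), counted from 0, being a corner entry of a Haar matrix of size n - p - q + i + j + 2.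
  Hence the block has an explicit density, and the triangular substitution gives its
  Kullback--Leibler distance to the Gaussian law; its terms cancel up to an error of
  order pq/n when p + q is at most n/2, say. Pinsker-type inequalities transfer the bound to the other two distances.

  Lower bound: split the rows (or the columns) of the block into two groups. Since the columns of an
  orthogonal matrix are orthonormal, the deviations of the two Gram matrices from their means are
  negatively correlated, while they are independent in the Gaussian case. The truncated inner product
  of the two deviations has mean of order pq/n times its standard deviation.\<close>

text \<open>The two halves face different obstacles. In the lower bound p may be as large as n, and
  for p + q > n the law of the block is singular, so that its Kullback--Leibler distance is
  infinite. Everything there therefore goes through a test function and total variation, which the
  other two distances dominate. In the upper bound pq / n tends to 0, hence p + q \<le> pq + 1 is a
  small part of n and a density exists.

  The truncation in the lower bound looks at the first group of rows only. Given those rows, the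
  test function is a quadratic form in the remaining ones, and its first two moments under the Haar
  measure need only the second moments of a random projection. Higher moments of the first Gram
  matrix are computed for the Gaussian law alone: the truncated mean is carried over to the Haar
  measure by total variation itself, which may be assumed small.

  The upper bound estimates the relative entropy because its logarithm splits into a sum over the
  coordinates. What remains are one-dimensional means, the second moment 1 / n of an entry, and a
  one-sided estimate of normalising constants.\<close>

section \<open>Comparison of the distances\<close>

text \<open>Replaces Cauchy--Schwarz in comparing the distances.\<close>

lemma young_sq_diff:
  fixes a b s :: real
  assumes "a \<ge> 0" "b \<ge> 0" and s: "s > 0"
  shows "\<bar>a\<^sup>2 - b\<^sup>2\<bar> \<le> s / 2 * (a - b)\<^sup>2 + (a\<^sup>2 + b\<^sup>2) / s"
proof -
  have "a\<^sup>2 - b\<^sup>2 = (a - b) * (a + b)" by (simp add: power2_eq_square algebra_simps)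
  then have eq: "\<bar>a\<^sup>2 - b\<^sup>2\<bar> = \<bar>a - b\<bar> * (a + b)" using assms by (simp add: abs_mult)
  have "0 \<le> (s * \<bar>a - b\<bar> - (a + b))\<^sup>2" by simp
  then have "2 * s * (\<bar>a - b\<bar> * (a + b)) \<le> s\<^sup>2 * (a - b)\<^sup>2 + (a + b)\<^sup>2"
    by (simp add: power2_diff power_mult_distrib algebra_simps)
  also have "(a + b)\<^sup>2 \<le> 2 * (a\<^sup>2 + b\<^sup>2)" using sum_squares_bound[of a b] by (simp add: power2_sum)
  finally show ?thesis
    unfolding eq using s by (simp add: field_simps power2_eq_square)
qed

locale prob_pair = M: prob_space M + N: prob_space N for M N :: "'a measure" +
  assumes sets_eq: "sets N = sets M"
begin

abbreviation "L \<equiv> sum_measure M N"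

lemma sets_L [simp, measurable_cong]: "sets L = sets M" and space_L [simp]: "space L = space M"
  by (auto simp: sum_measure_def sets.sigma_sets_eq)

lemma space_eq: "space N = space M"
  using sets_eq by (rule sets_eq_imp_space_eq)

lemma emeasure_L: "A \<in> sets M \<Longrightarrow> emeasure L A = emeasure M A + emeasure N A"
proof -
  assume A: "A \<in> sets M"
  have "countably_additive (sets M) (\<lambda>A. emeasure M A + emeasure N A)"
  proof (rule countably_additiveI)
    fix F :: "nat \<Rightarrow> 'a set"
    assume F: "range F \<subseteq> sets M" "disjoint_family F"
    then show "(\<Sum>i. emeasure M (F i) + emeasure N (F i)) = emeasure M (\<Union>i. F i) + emeasure N (\<Union>i. F i)"
      by (subst suminf_add[symmetric]) (auto simp: suminf_emeasure sets_eq)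
  qed
  then show ?thesis
    unfolding sum_measure_def using A
    by (intro emeasure_measure_of) (use sets.sets_into_space in \<open>auto simp: positive_def\<close>)
qed

lemma finite_L: "finite_measure L"
  by (rule finite_measureI) (simp add: emeasure_L M.emeasure_space_1 N.emeasure_space_1[unfolded space_eq])

sublocale L: finite_measure L by (rule finite_L)

lemma ac_M: "absolutely_continuous L M" and ac_N: "absolutely_continuous L N"
  by (auto simp: absolutely_continuous_def null_sets_def emeasure_L sets_eq)

text \<open>Finite real versions of the two Radon--Nikodym densities that enter
  \<open>hellinger_sq\<close>, so that Bochner integrals apply.\<close>

definition m where "m x = enn2real (RN_deriv L M x)"
definition v where "v x = enn2real (RN_deriv L N x)"

lemma m_meas [measurable]: "m \<in> borel_measurable M" and v_meas [measurable]: "v \<in> borel_measurable M"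
  unfolding m_def v_def by simp_all

lemma mv_nonneg [simp]: "0 \<le> m x" "0 \<le> v x"
  by (auto simp: m_def v_def)

lemma AE_RN: "AE x in L. RN_deriv L M x = ennreal (m x)" "AE x in L. RN_deriv L N x = ennreal (v x)"
proof -
  have "AE x in L. RN_deriv L M x \<noteq> \<infinity>"
    by (rule L.RN_deriv_finite) (auto intro: M.sigma_finite_measure_axioms ac_M)
  then show "AE x in L. RN_deriv L M x = ennreal (m x)"
    by eventually_elim (simp add: m_def less_top)
  have "AE x in L. RN_deriv L N x \<noteq> \<infinity>"
    by (rule L.RN_deriv_finite) (auto intro: N.sigma_finite_measure_axioms ac_N simp: sets_eq)
  then show "AE x in L. RN_deriv L N x = ennreal (v x)"
    by eventually_elim (simp add: v_def less_top)
qed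

lemma M_density: "M = density L (\<lambda>x. ennreal (m x))"
proof -
  have "M = density L (RN_deriv L M)"
    using L.density_RN_deriv[OF ac_M] by simp
  also have "\<dots> = density L (\<lambda>x. ennreal (m x))"
    by (rule density_cong) (use AE_RN in auto)
  finally show ?thesis .
qed

lemma N_density: "N = density L (\<lambda>x. ennreal (v x))"
proof -
  have "N = density L (RN_deriv L N)"
    using L.density_RN_deriv[OF ac_N] by (simp add: sets_eq)
  also have "\<dots> = density L (\<lambda>x. ennreal (v x))"
    by (rule density_cong) (use AE_RN in auto)
  finally show ?thesis .
qed

lemma integrable_mv [simp]: "integrable L m" "integrable L v"
  and integral_mv: "integral\<^sup>L L m = 1" "integral\<^sup>L L v = 1"
proof -
  have "emeasure M (space M) = (\<integral>\<^sup>+x. ennreal (m x) \<partial>L)"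
    by (subst M_density, subst emeasure_density) (auto intro!: nn_integral_cong)
  then have 1: "(\<integral>\<^sup>+x. ennreal (m x) \<partial>L) = 1" by (simp add: M.emeasure_space_1)
  have "emeasure N (space M) = (\<integral>\<^sup>+x. ennreal (v x) \<partial>L)"
    by (subst N_density, subst emeasure_density) (auto intro!: nn_integral_cong)
  then have 2: "(\<integral>\<^sup>+x. ennreal (v x) \<partial>L) = 1" using N.emeasure_space_1 by (simp add: space_eq)
  show "integrable L m" "integrable L v" using 1 2 by (auto intro!: integrableI_nonneg)
  show "integral\<^sup>L L m = 1" "integral\<^sup>L L v = 1" using 1 2 by (auto simp: integral_eq_nn_integral)
qed

lemma expectation_L:
  fixes g :: "'a \<Rightarrow> real"
  assumes [measurable]: "g \<in> borel_measurable M"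
  shows "integral\<^sup>L M g = (\<integral>x. m x * g x \<partial>L)" "integral\<^sup>L N g = (\<integral>x. v x * g x \<partial>L)"
    by (subst M_density, subst integral_density; simp)
       (subst N_density, subst integral_density; simp)

lemma measure_L:
  assumes [measurable]: "A \<in> sets M"
  shows "measure M A = (\<integral>x. m x * indicator A x \<partial>L)" "measure N A = (\<integral>x. v x * indicator A x \<partial>L)"
proof -
  have "measure M A = integral\<^sup>L M (indicator A)" by simp
  then show "measure M A = (\<integral>x. m x * indicator A x \<partial>L)" using expectation_L(1)[of "indicator A"] by simp
  have "measure N A = integral\<^sup>L N (indicator A)" using assms by (simp add: sets_eq)
  then show "measure N A = (\<integral>x. v x * indicator A x \<partial>L)" using expectation_L(2)[of "indicator A"] by simp
qed

lemma tv_upper: "A \<in> sets M \<Longrightarrow> \<bar>measure M A - measure N A\<bar> \<le> tv_dist M N / 2"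
proof -
  assume A: "A \<in> sets M"
  have "bdd_above ((\<lambda>A. \<bar>measure M A - measure N A\<bar>) ` sets M)"
  proof (rule bdd_aboveI2)
    fix B show "\<bar>measure M B - measure N B\<bar> \<le> 1"
      using M.prob_le_1[of B] N.prob_le_1[of B] measure_nonneg[of M B] measure_nonneg[of N B] by linarith
  qed
  from cSUP_upper[OF A this] show ?thesis by (simp add: tv_dist_def)
qed

lemma tv_least: "(\<And>A. A \<in> sets M \<Longrightarrow> \<bar>measure M A - measure N A\<bar> \<le> c) \<Longrightarrow> tv_dist M N \<le> 2 * c"
  unfolding tv_dist_def by (auto intro!: cSUP_least)

lemma tv_nonneg: "0 \<le> tv_dist M N"
  using tv_upper[of "{}"] by simp

definition P where "P = {x \<in> space M. v x < m x}"

lemma P_sets [measurable]: "P \<in> sets M" unfolding P_def by measurable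

text \<open>The supremum in \<open>tv_dist\<close> is tested on \<open>P\<close>, the set where the
  first density is the larger one.\<close>

lemma integral_pos_part: "(\<integral>x. max 0 (m x - v x) \<partial>L) \<le> tv_dist M N / 2"
proof -
  have "(\<integral>x. max 0 (m x - v x) \<partial>L) = (\<integral>x. m x * indicator P x - v x * indicator P x \<partial>L)"
    by (intro Bochner_Integration.integral_cong) (auto simp: P_def indicator_def)
  also have "\<dots> = measure M P - measure N P"
    by (subst Bochner_Integration.integral_diff)
      (auto simp: measure_L intro!: integrable_real_mult_indicator)
  finally show ?thesis using tv_upper[OF P_sets] by linarith
qed

text \<open>Both densities have integral 1, so the positive and negative parts of their difference
  have equal integrals. The factor 2 in \<open>tv_dist\<close> accounts for the two parts.\<close>

lemma integral_abs_diff: "(\<integral>x. \<bar>m x - v x\<bar> \<partial>L) \<le> tv_dist M N"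
proof -
  have "(\<integral>x. \<bar>m x - v x\<bar> \<partial>L) = (\<integral>x. 2 * max 0 (m x - v x) - (m x - v x) \<partial>L)"
    by (intro Bochner_Integration.integral_cong) (auto simp: max_def)
  also have "\<dots> = 2 * (\<integral>x. max 0 (m x - v x) \<partial>L)"
    by (subst Bochner_Integration.integral_diff) (auto simp: integral_mv intro!: integrable_max)
  finally show ?thesis using integral_pos_part by simp
qed

lemma expectation_diff_le:
  assumes [measurable]: "g \<in> borel_measurable M" and g: "\<And>x. x \<in> space M \<Longrightarrow> \<bar>g x\<bar> \<le> R"
  shows "\<bar>integral\<^sup>L M g - integral\<^sup>L N g\<bar> \<le> R * tv_dist M N"
proof -
  have i: "integrable L (\<lambda>x. m x * g x)" "integrable L (\<lambda>x. v x * g x)"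
  proof -
    have "\<bar>g x\<bar> \<le> \<bar>R\<bar>" if "x \<in> space M" for x using g[OF that] by linarith
    then have *: "AE x in L. norm (m x * g x) \<le> norm (R * m x)" "AE x in L. norm (v x * g x) \<le> norm (R * v x)"
      by (auto intro!: AE_I2 mult_right_mono simp: abs_mult mult.commute[of _ "\<bar>g _\<bar>"])
    show "integrable L (\<lambda>x. m x * g x)"
      by (rule Bochner_Integration.integrable_bound[OF _ _ *(1)]) auto
    show "integrable L (\<lambda>x. v x * g x)"
      by (rule Bochner_Integration.integrable_bound[OF _ _ *(2)]) auto
  qed
  have i': "integrable L (\<lambda>x. R * \<bar>m x - v x\<bar>)" by auto
  have "\<bar>integral\<^sup>L M g - integral\<^sup>L N g\<bar> = \<bar>\<integral>x. m x * g x - v x * g x \<partial>L\<bar>"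
    using i by (simp add: expectation_L)
  also have "\<dots> \<le> (\<integral>x. \<bar>m x * g x - v x * g x\<bar> \<partial>L)" by (rule integral_abs_bound)
  also have "\<dots> \<le> (\<integral>x. R * \<bar>m x - v x\<bar> \<partial>L)"
  proof (rule integral_mono)
    fix x assume "x \<in> space L"
    then have "\<bar>g x\<bar> \<le> R" using g by simp
    then show "\<bar>m x * g x - v x * g x\<bar> \<le> R * \<bar>m x - v x\<bar>"
      unfolding left_diff_distrib[symmetric] abs_mult by (subst mult.commute) (rule mult_right_mono, auto)
  qed (use i i' in auto)
  also have "\<dots> \<le> R * tv_dist M N"
  proof -
    obtain y where "y \<in> space M" using M.not_empty by blast
    then have "0 \<le> R" using g[of y] by linarith
    then show ?thesis using integral_abs_diff by (simp add: mult_left_mono)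
  qed
  finally show ?thesis .
qed

lemma hellinger_sq_eq: "hellinger_sq M N = (\<integral>x. (sqrt (m x) - sqrt (v x))\<^sup>2 \<partial>L) / 2"
  unfolding hellinger_sq_def Let_def m_def[symmetric] v_def[symmetric]
  by (subst integral_eq_nn_integral) auto

lemma sqrt_diff_sq_le: "0 \<le> a \<Longrightarrow> 0 \<le> b \<Longrightarrow> (sqrt a - sqrt b)\<^sup>2 \<le> \<bar>a - b\<bar>"
proof -
  assume ab: "0 \<le> a" "0 \<le> b"
  have "(sqrt a - sqrt b)\<^sup>2 = \<bar>sqrt a - sqrt b\<bar> * \<bar>sqrt a - sqrt b\<bar>" by (simp add: power2_eq_square)
  also have "\<dots> \<le> \<bar>sqrt a - sqrt b\<bar> * (sqrt a + sqrt b)"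
    using ab by (intro mult_left_mono) (auto simp: abs_le_iff)
  also have "\<dots> = \<bar>(sqrt a - sqrt b) * (sqrt a + sqrt b)\<bar>" using ab by (simp add: abs_mult)
  also have "\<dots> = \<bar>a - b\<bar>" using ab by (simp add: algebra_simps)
  finally show ?thesis .
qed

lemma integrable_hell: "integrable L (\<lambda>x. (sqrt (m x) - sqrt (v x))\<^sup>2)"
  by (rule Bochner_Integration.integrable_bound[of _ "\<lambda>x. \<bar>m x - v x\<bar>"]) (auto intro!: sqrt_diff_sq_le)

lemma hellinger_sq_le_tv: "hellinger_sq M N \<le> tv_dist M N / 2"
proof -
  have "(\<integral>x. (sqrt (m x) - sqrt (v x))\<^sup>2 \<partial>L) \<le> (\<integral>x. \<bar>m x - v x\<bar> \<partial>L)"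
    by (rule integral_mono) (auto intro!: sqrt_diff_sq_le integrable_hell)
  then show ?thesis using integral_abs_diff by (simp add: hellinger_sq_eq)
qed

lemma hellinger_nonneg: "0 \<le> hellinger M N" "0 \<le> hellinger_sq M N"
  by (auto simp: hellinger_def hellinger_sq_eq)

text \<open>Integrating \<open>young_sq_diff\<close> gives s H^2 + 2 / s for every s > 0, with H the
  Hellinger distance. The choice s = 1 / H gives 3 H, and \<open>tv_dist\<close> doubles it. For H =
  0 the parameter s is taken arbitrarily large.\<close>

lemma tv_le_hellinger: "tv_dist M N \<le> 6 * hellinger M N"
proof -
  let ?h = "\<lambda>x. (sqrt (m x) - sqrt (v x))\<^sup>2"
  have key: "\<bar>measure M A - measure N A\<bar> \<le> s * hellinger_sq M N + 2 / s" if [measurable]: "A \<in> sets M" and s: "s > 0" for A s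
  proof -
    have "\<bar>measure M A - measure N A\<bar> = \<bar>\<integral>x. m x * indicator A x - v x * indicator A x \<partial>L\<bar>"
      by (subst Bochner_Integration.integral_diff)
        (auto simp: measure_L[OF that(1)] intro!: integrable_real_mult_indicator)
    also have "\<dots> \<le> (\<integral>x. \<bar>m x * indicator A x - v x * indicator A x\<bar> \<partial>L)" by (rule integral_abs_bound)
    also have "\<dots> \<le> (\<integral>x. s / 2 * ?h x + (m x + v x) / s \<partial>L)"
    proof (rule integral_mono)
      fix x
      define a b where "a = sqrt (m x)" and "b = sqrt (v x)"
      have ab: "m x = a\<^sup>2" "v x = b\<^sup>2" "a \<ge> 0" "b \<ge> 0" by (auto simp: a_def b_def)
      have "\<bar>m x * indicator A x - v x * indicator A x\<bar> \<le> \<bar>a\<^sup>2 - b\<^sup>2\<bar>"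
        unfolding ab(1,2) by (auto simp: indicator_def)
      also have "\<dots> \<le> s / 2 * (a - b)\<^sup>2 + (a\<^sup>2 + b\<^sup>2) / s" by (rule young_sq_diff) (use ab s in auto)
      finally show "\<bar>m x * indicator A x - v x * indicator A x\<bar> \<le> s / 2 * ?h x + (m x + v x) / s"
        by (simp add: a_def b_def)
    next
      show "integrable L (\<lambda>x. s / 2 * ?h x + (m x + v x) / s)"
        by (intro Bochner_Integration.integrable_add integrable_divide integrable_mult_right integrable_hell integrable_mv)
    qed (auto intro!: integrable_real_mult_indicator integrable_abs Bochner_Integration.integrable_diff)
    also have "\<dots> = s * hellinger_sq M N + 2 / s"
      using integrable_hell by (simp add: hellinger_sq_eq integral_mv add_divide_distrib)
    finally show ?thesis .
  qed
  show ?thesis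
  proof (cases "hellinger M N = 0")
    case True
    then have 0: "hellinger_sq M N = 0" by (simp add: hellinger_def)
    have "\<bar>measure M A - measure N A\<bar> \<le> 0" if A: "A \<in> sets M" for A
    proof (rule field_le_epsilon)
      fix e :: real assume "e > 0"
      then show "\<bar>measure M A - measure N A\<bar> \<le> 0 + e" using key[OF A, of "2/e"] 0 by simp
    qed
    from tv_least[OF this] show ?thesis using True by simp
  next
    case False
    then have h: "hellinger M N > 0" using hellinger_nonneg by linarith
    have sq: "hellinger_sq M N = hellinger M N * hellinger M N" using hellinger_nonneg(2) by (simp add: hellinger_def)
    show ?thesis
    proof (rule tv_least[THEN order_trans])
      fix A assume "A \<in> sets M"
      from key[OF this, of "1 / hellinger M N"] h
      show "\<bar>measure M A - measure N A\<bar> \<le> 3 * hellinger M N" by (simp add: sq)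
    qed (use h in simp)
  qed
qed

text \<open>The Radon--Nikodym derivative is unique almost everywhere, and integrability makes both
  parts of the integrand finite, so the difference in \<open>kl_div\<close> is a difference of real
  numbers.\<close>

lemma kl_density:
  assumes [measurable]: "f \<in> borel_measurable N" and f: "\<And>x. 0 \<le> f x"
    and M: "M = density N (\<lambda>x. ennreal (f x))" and int: "integrable N (\<lambda>x. f x * ln (f x))"
  shows "kl_div M N = ereal (\<integral>x. f x * ln (f x) \<partial>N)"
proof -
  have "absolutely_continuous N M"
    unfolding M by (rule absolutely_continuousI_density) simp
  have "AE x in N. RN_deriv N M x = ennreal (f x)"
    using N.RN_deriv_unique[of "\<lambda>x. ennreal (f x)" M] M by (auto elim!: eventually_mono)
  then have ae: "AE x in N. enn2real (RN_deriv N M x) = f x" by eventually_elim (simp add: f)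
  have pos: "(\<integral>\<^sup>+ x. ennreal (enn2real (RN_deriv N M x) * ln (enn2real (RN_deriv N M x))) \<partial>N) = (\<integral>\<^sup>+ x. ennreal (f x * ln (f x)) \<partial>N)"
    by (rule nn_integral_cong_AE) (use ae in \<open>eventually_elim, simp\<close>)
  have neg: "(\<integral>\<^sup>+ x. ennreal (- (enn2real (RN_deriv N M x) * ln (enn2real (RN_deriv N M x)))) \<partial>N) = (\<integral>\<^sup>+ x. ennreal (- (f x * ln (f x))) \<partial>N)"
    by (rule nn_integral_cong_AE) (use ae in \<open>eventually_elim, simp\<close>)
  have fin: "(\<integral>\<^sup>+ x. ennreal (f x * ln (f x)) \<partial>N) \<noteq> \<infinity>" "(\<integral>\<^sup>+ x. ennreal (- (f x * ln (f x))) \<partial>N) \<noteq> \<infinity>"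
    using int by (auto simp: real_integrable_def)
  have e: "enn2ereal a = ereal (enn2real a)" if "a \<noteq> \<infinity>" for a :: ennreal
    using that by (cases a) (auto simp: enn2ereal_ennreal)
  have "kl_div M N = enn2ereal (\<integral>\<^sup>+ x. ennreal (f x * ln (f x)) \<partial>N) - enn2ereal (\<integral>\<^sup>+ x. ennreal (- (f x * ln (f x))) \<partial>N)"
    unfolding kl_div_def Let_def pos neg using \<open>absolutely_continuous N M\<close> by simp
  also have "\<dots> = ereal (\<integral>x. f x * ln (f x) \<partial>N)"
    unfolding real_lebesgue_integral_def[OF int] using fin by (simp add: e)
  finally show ?thesis .
qed

text \<open>This is \<open>ln (1 / sqrt f) \<le> 1 / sqrt f - 1\<close> multiplied by 2 f. For a
  probability density the term f - 1 integrates to 0, so the relative entropy dominates the integral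
  of (sqrt f - 1)^2.\<close>

lemma xlnx_lower: "0 \<le> (f::real) \<Longrightarrow> (sqrt f - 1)\<^sup>2 + f - 1 \<le> f * ln f"
proof (cases "f = 0")
  case False
  moreover assume "0 \<le> f"
  ultimately have f: "f > 0" by simp
  have "ln (1 / sqrt f) \<le> 1 / sqrt f - 1" using f by (intro ln_le_minus_one) simp
  then have "- ln f / 2 \<le> 1 / sqrt f - 1" using f by (simp add: ln_div ln_sqrt)
  then have "f * (- ln f / 2) \<le> f * (1 / sqrt f - 1)" using f by (intro mult_left_mono) auto
  also have "\<dots> = sqrt f - f" using f by (simp add: right_diff_distrib real_div_sqrt)
  finally show ?thesis using f by (simp add: power2_diff)
qed simp

lemma kl_finite_cases:
  assumes "kl_div M N \<noteq> \<infinity>"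
  obtains f where "f \<in> borel_measurable N" "\<And>x. 0 \<le> f x" "M = density N (\<lambda>x. ennreal (f x))"
    "integrable N (\<lambda>x. f x * ln (f x))" "kl_div M N = ereal (\<integral>x. f x * ln (f x) \<partial>N)"
proof -
  define f where "f = (\<lambda>x. enn2real (RN_deriv N M x))"
  have [measurable]: "f \<in> borel_measurable N" unfolding f_def by simp
  have f0: "0 \<le> f x" for x by (simp add: f_def)
  have ac: "absolutely_continuous N M" using assms by (auto simp: kl_div_def split: if_splits)
  have fin: "AE x in N. RN_deriv N M x \<noteq> \<infinity>"
    by (rule N.RN_deriv_finite) (auto intro: M.sigma_finite_measure_axioms ac simp: sets_eq)
  have "M = density N (RN_deriv N M)"
    using N.density_RN_deriv[OF ac] by (simp add: sets_eq)
  also have "\<dots> = density N (\<lambda>x. ennreal (f x))"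
    by (rule density_cong) (use fin in \<open>auto simp: f_def less_top elim!: eventually_mono\<close>)
  finally have M: "M = density N (\<lambda>x. ennreal (f x))" .
  let ?p = "\<integral>\<^sup>+ x. ennreal (f x * ln (f x)) \<partial>N" and ?n = "\<integral>\<^sup>+ x. ennreal (- (f x * ln (f x))) \<partial>N"
  have kl: "kl_div M N = enn2ereal ?p - enn2ereal ?n"
    unfolding kl_div_def Let_def f_def using ac by simp
  \<comment> \<open>Since x ln x is bounded below by -1, the negative part has integral at most 1.
    An infinite value can then come from the positive part only, and excluding it gives
    integrability.\<close>
  have "- (f x * ln (f x)) \<le> 1" for x
    using xlnx_lower[OF f0[of x]] f0[of x] zero_le_power2[of "sqrt (f x) - 1"] by linarith
  then have "?n \<le> (\<integral>\<^sup>+ x. 1 \<partial>N)" by (intro nn_integral_mono) (simp add: ennreal_le_1)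
  then have n: "?n \<le> 1" using N.emeasure_space_1 by simp
  then have n': "?n \<noteq> \<infinity>" by (auto simp: top_unique)
  have p: "?p \<noteq> \<infinity>"
  proof
    assume "?p = \<infinity>"
    then show False using assms kl n n' by (cases "?n") (auto simp: enn2ereal_ennreal)
  qed
  have int: "integrable N (\<lambda>x. f x * ln (f x))"
    using p n' by (simp add: real_integrable_def)
  show ?thesis using kl_density[OF _ f0 M int] by (intro that[OF _ f0 M int]) auto
qed

text \<open>A Pinsker inequality with constant 4: at s = 2 / sqrt \<kappa> the bound s \<kappa> / 2
  + 2 / s equals 2 sqrt \<kappa>, and \<open>tv_dist\<close> doubles it. The infinite value is a
  separate alternative because it does occur in the lower bound.\<close>

lemma tv_le_kl: "kl_div M N = \<infinity> \<or> (\<exists>\<kappa>\<ge>0. kl_div M N = ereal \<kappa> \<and> tv_dist M N \<le> 4 * sqrt \<kappa>)"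
proof (rule disj_imp[THEN iffD2], rule impI)
  assume "kl_div M N \<noteq> \<infinity>"
  then obtain f where f [measurable]: "f \<in> borel_measurable N" "\<And>x. 0 \<le> f x" "M = density N (\<lambda>x. ennreal (f x))"
    and int: "integrable N (\<lambda>x. f x * ln (f x))" and kl: "kl_div M N = ereal (\<integral>x. f x * ln (f x) \<partial>N)"
    by (erule kl_finite_cases)
  let ?h = "\<lambda>x. (sqrt (f x) - 1)\<^sup>2"
  define \<kappa> where "\<kappa> = (\<integral>x. f x * ln (f x) \<partial>N)"
  have "emeasure M (space M) = (\<integral>\<^sup>+x. ennreal (f x) \<partial>N)"
    by (subst f(3), subst emeasure_density) (auto intro!: nn_integral_cong simp: space_eq sets_eq)
  then have 1: "(\<integral>\<^sup>+x. ennreal (f x) \<partial>N) = 1" by (simp add: M.emeasure_space_1)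
  have intf: "integrable N f" using 1 f(2) by (auto intro!: integrableI_nonneg)
  have f1: "integral\<^sup>L N f = 1" using 1 f(2) by (auto simp: integral_eq_nn_integral)
  have inth: "integrable N ?h"
  proof (rule Bochner_Integration.integrable_bound[of _ "\<lambda>x. f x * ln (f x) - f x + 1"])
    show "AE x in N. norm (?h x) \<le> norm (f x * ln (f x) - f x + 1)"
    proof (rule AE_I2)
      fix x show "norm (?h x) \<le> norm (f x * ln (f x) - f x + 1)"
        using xlnx_lower[OF f(2)[of x]] zero_le_power2[of "sqrt (f x) - 1"] by simp
    qed
  qed (use int intf in auto)
  have "(\<integral>x. ?h x + f x - 1 \<partial>N) \<le> \<kappa>" unfolding \<kappa>_def
    by (rule integral_mono) (use int intf inth xlnx_lower[OF f(2)] in auto)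
  then have h\<kappa>: "(\<integral>x. ?h x \<partial>N) \<le> \<kappa>" using intf inth f1 by (simp add: N.prob_space)
  have \<kappa>0: "\<kappa> \<ge> 0" using order_trans[OF _ h\<kappa>] by simp
  have key: "\<bar>measure M A - measure N A\<bar> \<le> s / 2 * \<kappa> + 2 / s" if A [measurable]: "A \<in> sets M" and s: "s > 0" for A s
  proof -
    have [measurable]: "A \<in> sets N" using A by (simp add: sets_eq)
    have "measure M A = integral\<^sup>L M (indicator A)" by simp
    also have "\<dots> = (\<integral>x. f x * indicator A x \<partial>N)"
      by (subst f(3), subst integral_density) (auto simp: f(2))
    finally have "measure M A = (\<integral>x. f x * indicator A x \<partial>N)" .
    moreover have "measure N A = (\<integral>x. indicator A x \<partial>N)" by simp
    ultimately have "\<bar>measure M A - measure N A\<bar> = \<bar>\<integral>x. f x * indicator A x - indicator A x \<partial>N\<bar>"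
      by (subst Bochner_Integration.integral_diff) (auto intro!: integrable_real_mult_indicator intf simp: N.emeasure_eq_measure)
    also have "\<dots> \<le> (\<integral>x. \<bar>f x * indicator A x - indicator A x\<bar> \<partial>N)" by (rule integral_abs_bound)
    also have "\<dots> \<le> (\<integral>x. s / 2 * ?h x + (f x + 1) / s \<partial>N)"
    proof (rule integral_mono)
      fix x
      have "\<bar>f x * indicator A x - indicator A x\<bar> \<le> \<bar>(sqrt (f x))\<^sup>2 - 1\<^sup>2\<bar>"
        using f(2) by (auto simp: indicator_def)
      also have "\<dots> \<le> s / 2 * ?h x + ((sqrt (f x))\<^sup>2 + 1\<^sup>2) / s" 
        by (rule young_sq_diff) (use s f(2) in auto)
      finally show "\<bar>f x * indicator A x - indicator A x\<bar> \<le> s / 2 * ?h x + (f x + 1) / s" using f(2) by simp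
    next
      show "integrable N (\<lambda>x. s / 2 * ?h x + (f x + 1) / s)"
        by (intro Bochner_Integration.integrable_add integrable_divide integrable_mult_right inth intf) simp
    qed (auto intro!: intf integrable_real_mult_indicator integrable_abs Bochner_Integration.integrable_diff simp: N.emeasure_eq_measure)
    also have "\<dots> = s / 2 * (\<integral>x. ?h x \<partial>N) + 2 / s"
      using inth intf by (simp add: f1 N.prob_space add_divide_distrib)
    also have "\<dots> \<le> s / 2 * \<kappa> + 2 / s" using h\<kappa> s by simp
    finally show ?thesis .
  qed
  have "tv_dist M N \<le> 2 * (2 * sqrt \<kappa>)"
  proof (rule tv_least)
    fix A assume A: "A \<in> sets M"
    show "\<bar>measure M A - measure N A\<bar> \<le> 2 * sqrt \<kappa>"
    proof (cases "\<kappa> = 0")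
      case True
      have "\<bar>measure M A - measure N A\<bar> \<le> 0"
      proof (rule field_le_epsilon)
        fix e :: real assume "e > 0"
        then show "\<bar>measure M A - measure N A\<bar> \<le> 0 + e" using key[OF A, of "2/e"] True by simp
      qed
      then show ?thesis using True by simp
    next
      case False
      then have "sqrt \<kappa> > 0" "\<kappa> = sqrt \<kappa> * sqrt \<kappa>" using \<kappa>0 by auto
      then have "2 / sqrt \<kappa> / 2 * \<kappa> + 2 / (2 / sqrt \<kappa>) = 2 * sqrt \<kappa>" by (simp add: field_simps)
      then show ?thesis using key[OF A, of "2 / sqrt \<kappa>"] \<open>sqrt \<kappa> > 0\<close> by simp
    qed
  qed
  then show "\<exists>\<kappa>\<ge>0. kl_div M N = ereal \<kappa> \<and> tv_dist M N \<le> 4 * sqrt \<kappa>"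
    using kl \<kappa>0 by (auto simp: \<kappa>_def)
qed

text \<open>Truncate h at height R.\<close>

lemma test_function_bound:
  assumes [measurable]: "h \<in> borel_measurable M" and R: "R > 0"
    and M2: "integrable M (\<lambda>x. (h x)\<^sup>2)" "(\<integral>x. (h x)\<^sup>2 \<partial>M) \<le> V"
    and N2: "integrable N (\<lambda>x. (h x)\<^sup>2)" "(\<integral>x. (h x)\<^sup>2 \<partial>N) \<le> V"
  shows "\<bar>integral\<^sup>L M h - integral\<^sup>L N h\<bar> \<le> R * tv_dist M N + 2 * V / R"
proof -
  have [measurable]: "h \<in> borel_measurable N" using assms(1) sets_eq by (simp cong: measurable_cong_sets)
  define g where "g x = max (- R) (min R (h x))" for x
  have [measurable]: "g \<in> borel_measurable M" "g \<in> borel_measurable N" unfolding g_def by measurable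
  have gR: "\<bar>g x\<bar> \<le> R" for x using R by (auto simp: g_def)
  \<comment> \<open>Where the truncation acts one has |h| > R, so the loss is at most |h|, hence at
    most h^2 / R.\<close>
  have hg: "\<bar>h x - g x\<bar> \<le> (h x)\<^sup>2 / R" for x
  proof (cases "\<bar>h x\<bar> \<le> R")
    case False
    then have "\<bar>h x - g x\<bar> \<le> \<bar>h x\<bar>" using R by (auto simp: g_def)
    also have "\<bar>h x\<bar> * R \<le> \<bar>h x\<bar> * \<bar>h x\<bar>" using False by (intro mult_left_mono) auto
    then have "\<bar>h x\<bar> \<le> (h x)\<^sup>2 / R" using R by (simp add: field_simps power2_eq_square)
    finally show ?thesis .
  qed (use R in \<open>auto simp: g_def\<close>)
  have *: "\<bar>integral\<^sup>L K h - integral\<^sup>L K g\<bar> \<le> V / R"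
    if K: "prob_space K" and [measurable]: "h \<in> borel_measurable K" "g \<in> borel_measurable K"
      and K2: "integrable K (\<lambda>x. (h x)\<^sup>2)" "(\<integral>x. (h x)\<^sup>2 \<partial>K) \<le> V" for K
  proof -
    interpret K: prob_space K by (rule K)
    have ih: "integrable K h" by (rule K.square_integrable_imp_integrable) (use K2 in auto)
    have ig: "integrable K g" by (rule K.integrable_const_bound[of _ R]) (use gR in auto)
    have "\<bar>integral\<^sup>L K h - integral\<^sup>L K g\<bar> = \<bar>\<integral>x. h x - g x \<partial>K\<bar>" using ih ig by simp
    also have "\<dots> \<le> (\<integral>x. \<bar>h x - g x\<bar> \<partial>K)" by (rule integral_abs_bound)
    also have "\<dots> \<le> (\<integral>x. (h x)\<^sup>2 / R \<partial>K)"
      by (rule integral_mono) (use ih ig K2 hg in auto)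
    also have "\<dots> \<le> V / R" using K2 R by (simp add: divide_right_mono)
    finally show ?thesis .
  qed
  have "\<bar>integral\<^sup>L M g - integral\<^sup>L N g\<bar> \<le> R * tv_dist M N"
    by (rule expectation_diff_le) (use gR in auto)
  moreover have "\<bar>integral\<^sup>L M h - integral\<^sup>L M g\<bar> \<le> V / R"
    by (rule *) (use M2 M.prob_space_axioms in auto)
  moreover have "\<bar>integral\<^sup>L N h - integral\<^sup>L N g\<bar> \<le> V / R"
    by (rule *) (use N2 N.prob_space_axioms in auto)
  moreover have "2 * V / R = V / R + V / R" by simp
  ultimately show ?thesis by linarith
qed

end

section \<open>The Haar measure\<close>

abbreviation sqidx :: "nat \<Rightarrow> (nat \<times> nat) set" where
  "sqidx n \<equiv> {..<n} \<times> {..<n}"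

definition mat_transpose :: "nat \<Rightarrow> (nat \<times> nat \<Rightarrow> real) \<Rightarrow> (nat \<times> nat \<Rightarrow> real)" where
  "mat_transpose n A = (\<lambda>(i, j) \<in> sqidx n. A (j, i))"

lemma mat_transpose_apply [simp]: "i < n \<Longrightarrow> j < n \<Longrightarrow> mat_transpose n A (i, j) = A (j, i)"
  by (simp add: mat_transpose_def)

lemma mat_mult_apply [simp]: "i < n \<Longrightarrow> j < n \<Longrightarrow> mat_mult n G A (i, j) = (\<Sum>k<n. G (i, k) * A (k, j))"
  by (simp add: mat_mult_def)

lemma space_mat_space: "space (mat_space r c) = ({..<r} \<times> {..<c} \<rightarrow>\<^sub>E UNIV)"
  by (simp add: mat_space_def space_PiM)

lemma mat_space_eqI:
  assumes "A \<in> space (mat_space r c)" "B \<in> space (mat_space r c)"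
    "\<And>i j. i < r \<Longrightarrow> j < c \<Longrightarrow> A (i, j) = B (i, j)"
  shows "A = B"
proof (rule PiE_ext)
  show "A \<in> {..<r} \<times> {..<c} \<rightarrow>\<^sub>E UNIV" "B \<in> {..<r} \<times> {..<c} \<rightarrow>\<^sub>E UNIV"
    using assms(1,2) by (auto simp: space_mat_space)
qed (use assms(3) in auto)

lemma mat_transpose_space [simp]: "mat_transpose n A \<in> space (mat_space n n)"
  and mat_mult_space [simp]: "mat_mult n G A \<in> space (mat_space n n)"
  by (auto simp: space_mat_space mat_transpose_def mat_mult_def)

lemma mat_transpose_mult: "mat_transpose n (mat_mult n A B) = mat_mult n (mat_transpose n B) (mat_transpose n A)"
  by (rule mat_space_eqI[of _ n n]) (auto intro!: sum.cong)

lemma mat_transpose_transpose [simp]: "A \<in> space (mat_space n n) \<Longrightarrow> mat_transpose n (mat_transpose n A) = A"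
  by (rule mat_space_eqI[of _ n n]) auto

lemma mat_mult_assoc: "mat_mult n (mat_mult n A B) C = mat_mult n A (mat_mult n B C)"
proof (rule mat_space_eqI[of _ n n])
  fix i j assume ij: "i < n" "j < n"
  have "mat_mult n (mat_mult n A B) C (i, j) = (\<Sum>k<n. \<Sum>l<n. A (i, l) * B (l, k) * C (k, j))"
    using ij by (simp add: sum_distrib_right)
  also have "\<dots> = (\<Sum>l<n. \<Sum>k<n. A (i, l) * B (l, k) * C (k, j))" by (rule sum.swap)
  also have "\<dots> = mat_mult n A (mat_mult n B C) (i, j)" using ij by (simp add: sum_distrib_left mult.assoc)
  finally show "mat_mult n (mat_mult n A B) C (i, j) = mat_mult n A (mat_mult n B C) (i, j)" .
qed auto

lemma orthogonal_matD: "orthogonal_mat n A \<Longrightarrow> A \<in> space (mat_space n n)"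
  "orthogonal_mat n A \<Longrightarrow> i < n \<Longrightarrow> j < n \<Longrightarrow> (\<Sum>k<n. A (k, i) * A (k, j)) = (if i = j then 1 else 0)"
  by (auto simp: orthogonal_mat_def)

text \<open>The squared Frobenius norm of A A^T - I equals n - tr (A^T A) = 0.\<close>

lemma orthogonal_mat_rows:
  assumes A: "orthogonal_mat n A" and "i < n" "j < n"
  shows "(\<Sum>k<n. A (i, k) * A (j, k)) = (if i = j then 1 else 0)"
proof -
  define B where "B i j = (\<Sum>k<n. A (i, k) * A (j, k))" for i j
  let ?d = "\<lambda>i j. if i = j then 1 else 0 :: real"
  have tr: "(\<Sum>i<n. B i i) = real n"
  proof -
    have "(\<Sum>i<n. B i i) = (\<Sum>k<n. \<Sum>i<n. A (i, k) * A (i, k))" unfolding B_def by (rule sum.swap)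
    also have "\<dots> = real n" using orthogonal_matD(2)[OF A] by simp
    finally show ?thesis .
  qed
  \<comment> \<open>\<open>B\<close> is A A^T, and A^T A = I makes it a symmetric idempotent; so row
    i has squared norm \<open>B i i\<close>.\<close>
  have sq: "(\<Sum>j<n. B i j * B i j) = B i i" if "i < n" for i
  proof -
    have "(\<Sum>j<n. B i j * B i j) = (\<Sum>j<n. \<Sum>k<n. \<Sum>l<n. A (i, k) * A (i, l) * (A (j, k) * A (j, l)))"
      unfolding B_def sum_product by (intro sum.cong) auto
    also have "\<dots> = (\<Sum>k<n. \<Sum>l<n. \<Sum>j<n. A (i, k) * A (i, l) * (A (j, k) * A (j, l)))"
      by (subst sum.swap) (intro sum.cong refl sum.swap)
    also have "\<dots> = (\<Sum>k<n. \<Sum>l<n. A (i, k) * A (i, l) * ?d k l)"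
      by (intro sum.cong refl) (simp add: sum_distrib_left[symmetric] orthogonal_matD(2)[OF A])
    also have "\<dots> = B i i" by (simp add: B_def if_distrib[of "times _"] cong: if_cong)
    finally show ?thesis .
  qed
  have "(\<Sum>i<n. \<Sum>j<n. (B i j - ?d i j)\<^sup>2) = (\<Sum>i<n. \<Sum>j<n. B i j * B i j - 2 * (B i j * ?d i j) + ?d i j)"
    by (intro sum.cong refl) (auto simp: power2_eq_square algebra_simps)
  also have "\<dots> = (\<Sum>i<n. B i i - 2 * B i i + 1)"
    by (intro sum.cong refl)
      (simp add: sum.distrib sum_subtractf sq sum_distrib_left[symmetric] if_distrib[of "times _"] cong: if_cong)
  also have "\<dots> = 0" using tr by (simp add: sum_subtractf)
  finally have "(\<Sum>i<n. \<Sum>j<n. (B i j - ?d i j)\<^sup>2) = 0" .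
  then have "\<forall>i\<in>{..<n}. (\<Sum>j<n. (B i j - ?d i j)\<^sup>2) = 0"
    by (subst (asm) sum_nonneg_eq_0_iff) (auto intro: sum_nonneg)
  then have "(\<Sum>j<n. (B i j - ?d i j)\<^sup>2) = 0" using \<open>i < n\<close> by auto
  then have "\<forall>j\<in>{..<n}. (B i j - ?d i j)\<^sup>2 = 0"
    by (subst (asm) sum_nonneg_eq_0_iff) auto
  then have "(B i j - ?d i j)\<^sup>2 = 0" using \<open>j < n\<close> by blast
  then show ?thesis by (simp add: B_def)
qed

lemma orthogonal_transpose: "orthogonal_mat n A \<Longrightarrow> orthogonal_mat n (mat_transpose n A)"
  using orthogonal_mat_rows[of n A] by (auto simp: orthogonal_mat_def)

lemma orthogonal_transpose_mult:
  assumes A: "orthogonal_mat n A" and B: "B \<in> space (mat_space n n)"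
  shows "mat_mult n (mat_transpose n A) (mat_mult n A B) = B"
    "mat_mult n A (mat_mult n (mat_transpose n A) B) = B"
proof -
  have 1: "mat_mult n (mat_transpose n A) A (i, k) * c = (if k = i then c else 0)" if "i < n" "k < n" for i k c
    using that orthogonal_matD(2)[OF A that] by auto
  have 2: "mat_mult n A (mat_transpose n A) (i, k) * c = (if k = i then c else 0)" if "i < n" "k < n" for i k c
    using that orthogonal_mat_rows[OF A that] by auto
  show "mat_mult n (mat_transpose n A) (mat_mult n A B) = B"
    unfolding mat_mult_assoc[symmetric]
  proof (rule mat_space_eqI[of _ n n])
    fix i j assume ij: "i < n" "j < n"
    have "mat_mult n (mat_mult n (mat_transpose n A) A) B (i, j) = (\<Sum>k<n. mat_mult n (mat_transpose n A) A (i, k) * B (k, j))"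
      using ij by (rule mat_mult_apply)
    also have "\<dots> = (\<Sum>k<n. if k = i then B (k, j) else 0)" using ij by (intro sum.cong refl 1) auto
    also have "\<dots> = B (i, j)" using ij by simp
    finally show "mat_mult n (mat_mult n (mat_transpose n A) A) B (i, j) = B (i, j)" .
  qed (use B in auto)
  show "mat_mult n A (mat_mult n (mat_transpose n A) B) = B"
    unfolding mat_mult_assoc[symmetric]
  proof (rule mat_space_eqI[of _ n n])
    fix i j assume ij: "i < n" "j < n"
    have "mat_mult n (mat_mult n A (mat_transpose n A)) B (i, j) = (\<Sum>k<n. mat_mult n A (mat_transpose n A) (i, k) * B (k, j))"
      using ij by (rule mat_mult_apply)
    also have "\<dots> = (\<Sum>k<n. if k = i then B (k, j) else 0)" using ij by (intro sum.cong refl 2) auto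
    also have "\<dots> = B (i, j)" using ij by simp
    finally show "mat_mult n (mat_mult n A (mat_transpose n A)) B (i, j) = B (i, j)" .
  qed (use B in auto)
qed

lemma orthogonal_mat_iff:
  "orthogonal_mat n A \<longleftrightarrow> A \<in> space (mat_space n n) \<and>
    (\<forall>i<n. \<forall>j<n. mat_mult n (mat_transpose n A) A (i, j) = (if i = j then 1 else 0))"
  by (simp add: orthogonal_mat_def)

lemma orthogonal_mult:
  assumes A: "orthogonal_mat n A" and B: "orthogonal_mat n B"
  shows "orthogonal_mat n (mat_mult n A B)"
proof -
  have "mat_mult n (mat_transpose n (mat_mult n A B)) (mat_mult n A B) = mat_mult n (mat_transpose n B) B"
    unfolding mat_transpose_mult mat_mult_assoc
    by (simp add: orthogonal_transpose_mult(1)[OF A] orthogonal_matD(1)[OF B])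
  then show ?thesis unfolding orthogonal_mat_iff using B[unfolded orthogonal_mat_iff] by (simp del: mat_mult_apply)
qed

lemma orthogonal_mat_bound: "orthogonal_mat n A \<Longrightarrow> i < n \<Longrightarrow> j < n \<Longrightarrow> \<bar>A (i, j)\<bar> \<le> 1"
proof -
  assume A: "orthogonal_mat n A" and ij: "i < n" "j < n"
  have "A (i, j) * A (i, j) \<le> (\<Sum>k<n. A (k, j) * A (k, j))"
    by (rule member_le_sum) (use ij in auto)
  then have "\<bar>A (i, j)\<bar>\<^sup>2 \<le> 1\<^sup>2" using orthogonal_matD(2)[OF A ij(2) ij(2)] by (simp add: power2_eq_square)
  then show ?thesis by (rule power2_le_imp_le) simp
qed

lemma measurable_mat_entry [measurable]: "i < r \<Longrightarrow> j < c \<Longrightarrow> (\<lambda>A. A (i, j)) \<in> borel_measurable (mat_space r c)"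
  using measurable_component_singleton[of "(i, j)" "{..<r} \<times> {..<c}" "\<lambda>_. lborel"] by (simp add: mat_space_def)

lemma measurable_mat_spaceI:
  assumes "\<And>x. x \<in> space M \<Longrightarrow> f x \<in> space (mat_space r c)"
    and "\<And>i j. i < r \<Longrightarrow> j < c \<Longrightarrow> (\<lambda>x. f x (i, j)) \<in> borel_measurable M"
  shows "f \<in> measurable M (mat_space r c)"
  unfolding mat_space_def
  by (rule measurable_PiM_single') (use assms in \<open>auto simp: space_mat_space\<close>)

lemma measurable_transpose [measurable]: "mat_transpose n \<in> measurable (mat_space n n) (mat_space n n)"
  by (rule measurable_mat_spaceI) auto

lemma measurable_mat_mult [measurable]:
  assumes [measurable]: "f \<in> measurable M (mat_space n n)" "g \<in> measurable M (mat_space n n)"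
  shows "(\<lambda>x. mat_mult n (f x) (g x)) \<in> measurable M (mat_space n n)"
proof (rule measurable_mat_spaceI)
  fix i j assume "i < n" "j < n"
  then show "(\<lambda>x. mat_mult n (f x) (g x) (i, j)) \<in> borel_measurable M"
    by simp
qed auto

locale haar =
  fixes n :: nat and H :: "(nat \<times> nat \<Rightarrow> real) measure"
  assumes haar: "is_haar_orthogonal n H"
begin

lemma sets_H [simp, measurable_cong]: "sets H = sets (mat_space n n)"
  and AE_orth: "AE A in H. orthogonal_mat n A"
  and prob_H: "prob_space H"
  using haar by (auto simp: is_haar_orthogonal_def)

lemma space_H [simp]: "space H = space (mat_space n n)"
  using sets_H by (rule sets_eq_imp_space_eq)

sublocale prob_space H by (rule prob_H)

lemma distr_left: "orthogonal_mat n G \<Longrightarrow> distr H H (mat_mult n G) = H"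
  using haar by (auto simp: is_haar_orthogonal_def)

lemma nn_left:
  assumes [measurable]: "F \<in> borel_measurable (mat_space n n)" and G: "orthogonal_mat n G"
  shows "(\<integral>\<^sup>+A. F (mat_mult n G A) \<partial>H) = (\<integral>\<^sup>+A. F A \<partial>H)"
proof -
  have [measurable]: "G \<in> space (mat_space n n)" using G by (rule orthogonal_matD)
  have "(\<integral>\<^sup>+A. F A \<partial>H) = (\<integral>\<^sup>+A. F A \<partial>distr H H (mat_mult n G))" by (simp add: distr_left G)
  also have "\<dots> = (\<integral>\<^sup>+A. F (mat_mult n G A) \<partial>H)" by (rule nn_integral_distr) measurable
  finally show ?thesis ..
qed

text \<open>Only left invariance is assumed. Averaging F (B^T A) over independent Haar matrices A
  and B gives the mean of F when A is integrated first. Since B^T A is the transpose of A^T B,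
  integrating B first gives the mean of F composed with transposition.\<close>

lemma nn_transpose:
  assumes [measurable]: "F \<in> borel_measurable (mat_space n n)"
  shows "(\<integral>\<^sup>+A. F (mat_transpose n A) \<partial>H) = (\<integral>\<^sup>+A. F A \<partial>H)"
proof -
  interpret HH: pair_sigma_finite H H ..
  have "(\<integral>\<^sup>+A. F A \<partial>H) = (\<integral>\<^sup>+B. (\<integral>\<^sup>+A. F A \<partial>H) \<partial>H)" by (simp add: emeasure_space_1[unfolded space_H])
  also have "\<dots> = (\<integral>\<^sup>+B. (\<integral>\<^sup>+A. F (mat_mult n (mat_transpose n B) A) \<partial>H) \<partial>H)"
    by (rule nn_integral_cong_AE, use AE_orth in eventually_elim) (simp add: nn_left orthogonal_transpose)
  also have "\<dots> = (\<integral>\<^sup>+A. (\<integral>\<^sup>+B. F (mat_mult n (mat_transpose n B) A) \<partial>H) \<partial>H)"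
    by (rule HH.Fubini') measurable
  also have "\<dots> = (\<integral>\<^sup>+A. (\<integral>\<^sup>+B. F (mat_transpose n B) \<partial>H) \<partial>H)"
  proof (rule nn_integral_cong_AE, use AE_orth in eventually_elim)
    fix A assume A: "orthogonal_mat n A"
    have "(\<integral>\<^sup>+B. F (mat_mult n (mat_transpose n B) A) \<partial>H) = (\<integral>\<^sup>+B. F (mat_transpose n (mat_mult n (mat_transpose n A) B)) \<partial>H)"
      by (intro nn_integral_cong) (simp add: mat_transpose_mult orthogonal_matD(1)[OF A])
    also have "\<dots> = (\<integral>\<^sup>+B. F (mat_transpose n B) \<partial>H)"
      by (rule nn_left[where F="\<lambda>B. F (mat_transpose n B)"]) (use A in \<open>auto intro: orthogonal_transpose\<close>)
    finally show "(\<integral>\<^sup>+B. F (mat_mult n (mat_transpose n B) A) \<partial>H) = (\<integral>\<^sup>+B. F (mat_transpose n B) \<partial>H)" .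
  qed
  also have "\<dots> = (\<integral>\<^sup>+B. F (mat_transpose n B) \<partial>H)" by (simp add: emeasure_space_1[unfolded space_H])
  finally show ?thesis ..
qed

text \<open>Right multiplication is left multiplication conjugated by transposition.\<close>

lemma nn_right:
  assumes [measurable]: "F \<in> borel_measurable (mat_space n n)" and G: "orthogonal_mat n G"
  shows "(\<integral>\<^sup>+A. F (mat_mult n A G) \<partial>H) = (\<integral>\<^sup>+A. F A \<partial>H)"
proof -
  have [measurable]: "G \<in> space (mat_space n n)" using G by (rule orthogonal_matD)
  have "(\<integral>\<^sup>+A. F (mat_mult n A G) \<partial>H) = (\<integral>\<^sup>+A. F (mat_mult n (mat_transpose n A) G) \<partial>H)"
    by (rule nn_transpose[symmetric, where F="\<lambda>A. F (mat_mult n A G)"]) measurable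
  also have "\<dots> = (\<integral>\<^sup>+A. F (mat_transpose n (mat_mult n (mat_transpose n G) A)) \<partial>H)"
    by (intro nn_integral_cong) (simp add: mat_transpose_mult orthogonal_matD(1)[OF G])
  also have "\<dots> = (\<integral>\<^sup>+A. F (mat_transpose n A) \<partial>H)"
    by (rule nn_left[where F="\<lambda>B. F (mat_transpose n B)"]) (use G in \<open>auto intro: orthogonal_transpose\<close>)
  also have "\<dots> = (\<integral>\<^sup>+A. F A \<partial>H)" by (rule nn_transpose) measurable
  finally show ?thesis .
qed

lemma distr_eqI:
  assumes [measurable]: "f \<in> measurable H H"
    and "\<And>F. F \<in> borel_measurable (mat_space n n) \<Longrightarrow> (\<integral>\<^sup>+A. F (f A) \<partial>H) = (\<integral>\<^sup>+A. F A \<partial>H)"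
  shows "distr H H f = H"
proof (rule measure_eqI)
  fix X assume X: "X \<in> sets (distr H H f)"
  have "emeasure (distr H H f) X = (\<integral>\<^sup>+A. indicator X (f A) \<partial>H)"
    using X by (subst nn_integral_indicator[symmetric], simp, subst nn_integral_distr) auto
  also have "\<dots> = (\<integral>\<^sup>+A. indicator X A \<partial>H)" using X by (intro assms(2)) auto
  finally show "emeasure (distr H H f) X = emeasure H X" using X by simp
qed auto

lemma distr_transpose: "distr H H (mat_transpose n) = H"
  by (rule distr_eqI) (auto intro: nn_transpose)

lemma distr_right: "orthogonal_mat n G \<Longrightarrow> distr H H (\<lambda>A. mat_mult n A G) = H"
proof -
  assume G: "orthogonal_mat n G"
  then have [measurable]: "G \<in> space (mat_space n n)" by (rule orthogonal_matD)
  show ?thesis by (rule distr_eqI) (use G in \<open>auto intro: nn_right\<close>)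
qed

lemma int_left:
  fixes F :: "_ \<Rightarrow> real"
  assumes [measurable]: "F \<in> borel_measurable (mat_space n n)" and G: "orthogonal_mat n G"
  shows "(\<integral>A. F (mat_mult n G A) \<partial>H) = (\<integral>A. F A \<partial>H)"
proof -
  have [measurable]: "G \<in> space (mat_space n n)" using G by (rule orthogonal_matD)
  have "(\<integral>A. F A \<partial>H) = (\<integral>A. F A \<partial>distr H H (mat_mult n G))" by (simp add: distr_left G)
  also have "\<dots> = (\<integral>A. F (mat_mult n G A) \<partial>H)" by (rule integral_distr) measurable
  finally show ?thesis ..
qed

lemma int_right:
  fixes F :: "_ \<Rightarrow> real"
  assumes [measurable]: "F \<in> borel_measurable (mat_space n n)" and G: "orthogonal_mat n G"
  shows "(\<integral>A. F (mat_mult n A G) \<partial>H) = (\<integral>A. F A \<partial>H)"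
proof -
  have [measurable]: "G \<in> space (mat_space n n)" using G by (rule orthogonal_matD)
  have "(\<integral>A. F A \<partial>H) = (\<integral>A. F A \<partial>distr H H (\<lambda>A. mat_mult n A G))" by (simp add: distr_right G)
  also have "\<dots> = (\<integral>A. F (mat_mult n A G) \<partial>H)" by (rule integral_distr) measurable
  finally show ?thesis ..
qed

text \<open>\<open>H\<close> is a measure on all matrices, where polynomials in the entries are
  unbounded; a bound on the orthogonal matrices suffices because \<open>H\<close> is concentrated
  there.\<close>

lemma integrable_bounded:
  fixes F :: "_ \<Rightarrow> real"
  assumes [measurable]: "F \<in> borel_measurable (mat_space n n)" and "\<And>A. orthogonal_mat n A \<Longrightarrow> \<bar>F A\<bar> \<le> R"
  shows "integrable H F"
  by (rule integrable_const_bound[of _ R]) (use AE_orth assms(2) in \<open>auto elim!: eventually_mono\<close>)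

end

section \<open>Moments\<close>

lemma restrict_mat_space [simp]: "restrict f ({..<r} \<times> {..<c}) \<in> space (mat_space r c)"
  by (simp add: space_mat_space restrict_PiE_iff)

definition signed_perm :: "nat \<Rightarrow> (nat \<Rightarrow> real) \<Rightarrow> (nat \<Rightarrow> nat) \<Rightarrow> nat \<times> nat \<Rightarrow> real" where
  "signed_perm n \<epsilon> f = (\<lambda>(i, k) \<in> sqidx n. if k = f i then \<epsilon> i else 0)"

definition plane_rot :: "nat \<Rightarrow> nat \<Rightarrow> nat \<Rightarrow> real \<Rightarrow> real \<Rightarrow> nat \<times> nat \<Rightarrow> real" where
  "plane_rot n u v c s = (\<lambda>(i, k) \<in> sqidx n.
     if i = u then (if k = u then c else if k = v then s else 0)
     else if i = v then (if k = u then - s else if k = v then c else 0)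
     else if k = i then 1 else 0)"

lemma signed_perm_mult:
  assumes "f i < n" "i < n" "j < n"
  shows "mat_mult n (signed_perm n \<epsilon> f) A (i, j) = \<epsilon> i * A (f i, j)"
  using assms by (simp add: signed_perm_def if_distrib[of "\<lambda>x. x * _"] cong: if_cong)

lemma signed_perm_orthogonal:
  assumes f: "bij_betw f {..<n} {..<n}" and e: "\<And>i. i < n \<Longrightarrow> \<epsilon> i * \<epsilon> i = 1"
  shows "orthogonal_mat n (signed_perm n \<epsilon> f)"
  unfolding orthogonal_mat_def
proof (intro conjI allI impI)
  show "signed_perm n \<epsilon> f \<in> space (mat_space n n)" by (auto simp: signed_perm_def space_mat_space)
  fix i j assume ij: "i < n" "j < n"
  have "(\<Sum>k<n. signed_perm n \<epsilon> f (k, i) * signed_perm n \<epsilon> f (k, j)) = (\<Sum>k<n. if f k = i \<and> f k = j then 1 else 0)"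
    using ij e by (intro sum.cong) (auto simp: signed_perm_def)
  also have "\<dots> = (\<Sum>k<n. if k = i \<and> k = j then 1 else 0)"
    by (rule sum.reindex_bij_betw[OF f])
  also have "\<dots> = (if i = j then 1 else 0)" using ij by (cases "i = j") (auto intro!: sum.neutral)
  finally show "(\<Sum>k<n. signed_perm n \<epsilon> f (k, i) * signed_perm n \<epsilon> f (k, j)) = (if i = j then 1 else 0)" .
qed

lemma sum_two_delta:
  fixes f :: "nat \<Rightarrow> real"
  assumes "u < n" "v < n" "u \<noteq> v" "\<And>k. k < n \<Longrightarrow> k \<noteq> u \<Longrightarrow> k \<noteq> v \<Longrightarrow> f k = 0"
  shows "(\<Sum>k<n. f k) = f u + f v"
proof -
  have "(\<Sum>k<n. f k) = (\<Sum>k\<in>{u, v}. f k)"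
    by (rule sum.mono_neutral_right) (use assms in auto)
  then show ?thesis using assms by simp
qed

lemma plane_rot_mult:
  assumes "u < n" "v < n" "u \<noteq> v" "i < n" "j < n"
  shows "mat_mult n (plane_rot n u v c s) A (i, j) =
    (if i = u then c * A (u, j) + s * A (v, j) else if i = v then - s * A (u, j) + c * A (v, j) else A (i, j))"
proof (cases "i = u \<or> i = v")
  case True
  then show ?thesis using assms
    by (auto simp: plane_rot_def sum_two_delta[of u n v])
next
  case False
  then show ?thesis using assms by (simp add: plane_rot_def if_distrib[of "\<lambda>x. x * _"] cong: if_cong)
qed

lemma plane_rot_orthogonal:
  assumes "u < n" "v < n" "u \<noteq> v" and cs: "c * c + s * s = 1"
  shows "orthogonal_mat n (plane_rot n u v c s)"
proof -
  let ?G = "plane_rot n u v c s"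
  have sp: "plane_rot n u v c s' \<in> space (mat_space n n)" for s'
    unfolding plane_rot_def space_mat_space restrict_PiE_iff by simp
  note G = sp[of s]
  have e: "?G (i, k) = (if i = u then (if k = u then c else if k = v then s else 0)
     else if i = v then (if k = u then - s else if k = v then c else 0)
     else if k = i then 1 else 0)" if "i < n" "k < n" for i k
    using that by (simp add: plane_rot_def)
  have T: "mat_transpose n ?G = plane_rot n u v c (- s)"
  proof (rule mat_space_eqI[of _ n n])
    fix i j assume "i < n" "j < n"
    then show "mat_transpose n ?G (i, j) = plane_rot n u v c (- s) (i, j)"
      using \<open>u \<noteq> v\<close> by (simp add: plane_rot_def)
  qed (simp_all add: sp)
  show ?thesis unfolding orthogonal_mat_iff T
  proof (intro conjI allI impI G)
    fix i j assume ij: "i < n" "j < n"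
    have "c * s + - s * c = 0" "s * s + c * c = 1" "s * c + c * - s = 0" using cs by (simp_all only: add.commute mult.commute mult_minus_right add.right_inverse mult_minus_left)
    then show "mat_mult n (plane_rot n u v c (- s)) ?G (i, j) = (if i = j then 1 else 0)"
      unfolding plane_rot_mult[OF assms(1-3) ij] e[OF assms(1) ij(2)] e[OF assms(2) ij(2)] e[OF ij]
      using assms(3) cs by (cases "i = u"; cases "i = v"; cases "j = u"; cases "j = v") simp_all
  qed
qed

context haar begin

lemma int_col_signed_perm:
  fixes F :: "_ \<Rightarrow> real"
  assumes [measurable]: "F \<in> borel_measurable (mat_space n n)"
    and f: "bij_betw f {..<n} {..<n}" and e: "\<And>i. i < n \<Longrightarrow> \<epsilon> i * \<epsilon> i = 1"
  shows "(\<integral>A. F (\<lambda>(i, j) \<in> sqidx n. \<epsilon> j * A (i, f j)) \<partial>H) = (\<integral>A. F A \<partial>H)"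
proof -
  let ?G = "signed_perm n \<epsilon> f"
  have G: "orthogonal_mat n ?G" using f e by (rule signed_perm_orthogonal)
  have fn: "f j < n" if "j < n" for j using bij_betwE[OF f] that by auto
  have "mat_mult n A (mat_transpose n ?G) = (\<lambda>(i, j) \<in> sqidx n. \<epsilon> j * A (i, f j))" for A
  proof (rule mat_space_eqI[of _ n n])
    fix i j assume ij: "i < n" "j < n"
    then show "mat_mult n A (mat_transpose n ?G) (i, j) = (\<lambda>(i, j) \<in> sqidx n. \<epsilon> j * A (i, f j)) (i, j)"
      using ij fn by (simp add: signed_perm_def if_distrib[of "times _"] cong: if_cong)
  qed simp_all
  with int_right[OF assms(1) orthogonal_transpose[OF G]] show ?thesis by simp
qed

lemma int_col_rot:
  fixes F :: "_ \<Rightarrow> real"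
  assumes [measurable]: "F \<in> borel_measurable (mat_space n n)"
    and uv: "u < n" "v < n" "u \<noteq> v" and cs: "c * c + s * s = 1"
  shows "(\<integral>A. F (\<lambda>(i, j) \<in> sqidx n. if j = u then c * A (i, u) + s * A (i, v)
     else if j = v then - s * A (i, u) + c * A (i, v) else A (i, j)) \<partial>H) = (\<integral>A. F A \<partial>H)"
proof -
  let ?G = "plane_rot n u v c s"
  have G: "orthogonal_mat n ?G" using uv cs by (rule plane_rot_orthogonal)
  have "mat_transpose n (mat_mult n ?G (mat_transpose n A)) = (\<lambda>(i, j) \<in> sqidx n. if j = u then c * A (i, u) + s * A (i, v)
     else if j = v then - s * A (i, u) + c * A (i, v) else A (i, j))" for A
    by (rule mat_space_eqI[of _ n n])
      (use uv in \<open>simp_all add: plane_rot_mult del: mat_mult_apply\<close>)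
  moreover have "(\<integral>A. F (mat_transpose n (mat_mult n ?G (mat_transpose n A))) \<partial>H) = (\<integral>A. F A \<partial>H)"
    using int_right[OF assms(1) orthogonal_transpose[OF G]]
    by (subst Bochner_Integration.integral_cong[OF refl, of H _ "\<lambda>A. F (mat_mult n A (mat_transpose n ?G))"])
      (auto simp: mat_transpose_mult)
  ultimately show ?thesis by simp
qed

end

lemma integral_sum2:
  fixes f :: "_ \<Rightarrow> _ \<Rightarrow> _ \<Rightarrow> real"
  assumes "\<And>i j. i \<in> I \<Longrightarrow> j \<in> J \<Longrightarrow> integrable M (f i j)"
  shows "(\<integral>x. (\<Sum>i\<in>I. \<Sum>j\<in>J. f i j x) \<partial>M) = (\<Sum>i\<in>I. \<Sum>j\<in>J. \<integral>x. f i j x \<partial>M)"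
  using assms by (simp add: Bochner_Integration.integral_sum)

locale haar_rows = haar +
  fixes r :: nat
  assumes r: "r \<le> n"
begin

text \<open>The orthogonal projection onto the span of the first r rows of A. For Haar distributed A
  it is a uniformly distributed projection of rank r.\<close>

definition P :: "(nat \<times> nat \<Rightarrow> real) \<Rightarrow> nat \<Rightarrow> nat \<Rightarrow> real" where "P A u v = (\<Sum>l<r. A (l, u) * A (l, v))"

lemma P_commute: "P A u v = P A v u"
  unfolding P_def by (intro sum.cong refl mult.commute)

lemma P_measurable [measurable]: "u < n \<Longrightarrow> v < n \<Longrightarrow> (\<lambda>A. P A u v) \<in> borel_measurable (mat_space n n)"
  unfolding P_def using r by (intro borel_measurable_sum) auto

lemma P_bound: "orthogonal_mat n A \<Longrightarrow> u < n \<Longrightarrow> v < n \<Longrightarrow> \<bar>P A u v\<bar> \<le> real r"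
proof -
  assume A: "orthogonal_mat n A" and "u < n" "v < n"
  have "\<bar>A (l, u) * A (l, v)\<bar> \<le> 1" if "l < r" for l
    using mult_mono[OF orthogonal_mat_bound[OF A, of l u] orthogonal_mat_bound[OF A, of l v]] that r \<open>u < n\<close> \<open>v < n\<close>
    by (simp add: abs_mult)
  then have "\<bar>P A u v\<bar> \<le> (\<Sum>l<r. 1)" unfolding P_def by (intro order_trans[OF sum_abs] sum_mono) auto
  then show ?thesis by simp
qed

lemma P_trace: "orthogonal_mat n A \<Longrightarrow> (\<Sum>u<n. P A u u) = real r"
proof -
  assume A: "orthogonal_mat n A"
  have "(\<Sum>u<n. P A u u) = (\<Sum>l<r. \<Sum>u<n. A (l, u) * A (l, u))" unfolding P_def by (rule sum.swap)
  also have "\<dots> = (\<Sum>l<r. 1)" by (intro sum.cong refl) (use orthogonal_mat_rows[OF A] r in auto)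
  finally show ?thesis by simp
qed

lemma P_idem: "orthogonal_mat n A \<Longrightarrow> (\<Sum>v<n. P A u v * P A u v) = P A u u"
proof -
  assume A: "orthogonal_mat n A"
  have "(\<Sum>v<n. P A u v * P A u v) = (\<Sum>v<n. \<Sum>k<r. \<Sum>l<r. A (k, u) * A (l, u) * (A (k, v) * A (l, v)))"
    unfolding P_def sum_product by (intro sum.cong refl) auto
  also have "\<dots> = (\<Sum>k<r. \<Sum>l<r. \<Sum>v<n. A (k, u) * A (l, u) * (A (k, v) * A (l, v)))"
    by (subst sum.swap) (intro sum.cong refl sum.swap)
  also have "\<dots> = (\<Sum>k<r. \<Sum>l<r. if l = k then A (k, u) * A (k, u) else 0)"
    by (intro sum.cong refl) (use r in \<open>auto simp: sum_distrib_left[symmetric] orthogonal_mat_rows[OF A]\<close>)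
  also have "\<dots> = P A u u" by (simp add: P_def)
  finally show ?thesis .
qed

lemma P_integrable [simp]: "u < n \<Longrightarrow> v < n \<Longrightarrow> integrable H (\<lambda>A. P A u v)"
  by (rule integrable_bounded[of _ "real r"]) (auto intro: P_bound)

lemma PP_integrable [simp]: "a < n \<Longrightarrow> b < n \<Longrightarrow> c < n \<Longrightarrow> d < n \<Longrightarrow> integrable H (\<lambda>A. P A a b * P A c d)"
  by (rule integrable_bounded[of _ "real r * real r"]) (auto intro!: mult_mono P_bound simp: abs_mult)

definition E4 where "E4 a b c d = (\<integral>A. P A a b * P A c d \<partial>H)"

lemma E4_sym: "E4 a b c d = E4 b a c d" "E4 a b c d = E4 a b d c" "E4 a b c d = E4 c d a b"
  unfolding E4_def by (simp_all add: P_commute mult.commute)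

lemma E4_signed_perm:
  assumes f: "bij_betw f {..<n} {..<n}" and e: "\<And>i. i < n \<Longrightarrow> \<epsilon> i * \<epsilon> i = 1"
    and n: "a < n" "b < n" "c < n" "d < n"
  shows "\<epsilon> a * \<epsilon> b * \<epsilon> c * \<epsilon> d * E4 (f a) (f b) (f c) (f d) = E4 a b c d"
    "\<epsilon> a * \<epsilon> b * (\<integral>A. P A (f a) (f b) \<partial>H) = (\<integral>A. P A a b \<partial>H)"
proof -
  have P: "P (\<lambda>(i, j) \<in> sqidx n. \<epsilon> j * A (i, f j)) u v = \<epsilon> u * \<epsilon> v * P A (f u) (f v)" if "u < n" "v < n" for A u v
    unfolding P_def sum_distrib_left by (intro sum.cong refl) (use that r in auto)
  have "E4 a b c d = (\<integral>A. \<epsilon> a * \<epsilon> b * \<epsilon> c * \<epsilon> d * (P A (f a) (f b) * P A (f c) (f d)) \<partial>H)"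
    unfolding E4_def
  proof (subst int_col_signed_perm[symmetric, OF _ f e])
    show "(\<lambda>A. P A a b * P A c d) \<in> borel_measurable (mat_space n n)" using n by measurable
    show "(\<integral>A. P (\<lambda>(i, j)\<in>sqidx n. \<epsilon> j * A (i, f j)) a b * P (\<lambda>(i, j)\<in>sqidx n. \<epsilon> j * A (i, f j)) c d \<partial>H)
      = (\<integral>A. \<epsilon> a * \<epsilon> b * \<epsilon> c * \<epsilon> d * (P A (f a) (f b) * P A (f c) (f d)) \<partial>H)"
      unfolding P[OF n(1,2)] P[OF n(3,4)] by (intro Bochner_Integration.integral_cong refl) (simp only: mult_ac)
  qed
  then show "\<epsilon> a * \<epsilon> b * \<epsilon> c * \<epsilon> d * E4 (f a) (f b) (f c) (f d) = E4 a b c d" by (simp add: E4_def)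
  have "(\<integral>A. P A a b \<partial>H) = (\<integral>A. \<epsilon> a * \<epsilon> b * P A (f a) (f b) \<partial>H)"
  proof (subst int_col_signed_perm[symmetric, OF _ f e])
    show "(\<lambda>A. P A a b) \<in> borel_measurable (mat_space n n)" using n by measurable
    show "(\<integral>A. P (\<lambda>(i, j)\<in>sqidx n. \<epsilon> j * A (i, f j)) a b \<partial>H) = (\<integral>A. \<epsilon> a * \<epsilon> b * P A (f a) (f b) \<partial>H)"
      unfolding P[OF n(1,2)] ..
  qed
  then show "\<epsilon> a * \<epsilon> b * (\<integral>A. P A (f a) (f b) \<partial>H) = (\<integral>A. P A a b \<partial>H)" by simp
qed

text \<open>Changing the sign of column a changes the sign of the integrand when the index a occurs
  only once.\<close>

lemma E4_flip:
  assumes "a < n" "b < n" "c < n" "d < n"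
    and "b \<noteq> a" "c \<noteq> a" "d \<noteq> a"
  shows "E4 a b c d = 0"
  using E4_signed_perm(1)[of "\<lambda>i. i" "\<lambda>i. if i = a then -1 else 1" a b c d] assms
  by (simp add: bij_betw_def)

lemma P_mean_off: "u < n \<Longrightarrow> v < n \<Longrightarrow> u \<noteq> v \<Longrightarrow> (\<integral>A. P A u v \<partial>H) = 0"
  using E4_signed_perm(2)[of "\<lambda>i. i" "\<lambda>i. if i = u then -1 else 1" u v u v]
  by (simp add: bij_betw_def)

lemma bij_transpose: "u < n \<Longrightarrow> v < n \<Longrightarrow> bij_betw (Transposition.transpose u v) {..<n} {..<n}"
  by (rule bij_betwI[of _ _ _ "Transposition.transpose u v"]) (auto simp: Transposition.transpose_def)

text \<open>The diagonal entries of the projection have equal means by exchangeability of the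
  columns, and they add up to the trace r.\<close>

lemma P_mean: "u < n \<Longrightarrow> (\<integral>A. P A u u \<partial>H) = real r / real n"
proof -
  assume u: "u < n"
  have "(\<integral>A. P A v v \<partial>H) = (\<integral>A. P A u u \<partial>H)" if "v < n" for v
    using E4_signed_perm(2)[OF bij_transpose[of u v], of "\<lambda>_. 1" u u u u] u that by simp
  then have "real n * (\<integral>A. P A u u \<partial>H) = (\<Sum>v<n. \<integral>A. P A v v \<partial>H)" by simp
  also have "\<dots> = (\<integral>A. (\<Sum>v<n. P A v v) \<partial>H)" by (subst Bochner_Integration.integral_sum) auto
  also have "\<dots> = (\<integral>A. real r \<partial>H)"
    by (rule integral_cong_AE) (use AE_orth in \<open>auto elim!: eventually_mono simp: P_trace\<close>)
  finally show ?thesis using u prob_space by (simp add: field_simps)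
qed

text \<open>The second moments of P form an orthogonally invariant tensor, that is, a combination of
  the three pairings of four indices. Symmetry of P identifies two of the coefficients, which leaves
  \<open>x2\<close> and \<open>y2\<close>.\<close>

definition x2 where "x2 = E4 0 0 1 1"
definition y2 where "y2 = E4 0 1 0 1"

lemma E4_pairs:
  assumes "u < n" "v < n" "u \<noteq> v"
  shows "E4 u u v v = x2" "E4 u v u v = y2" "E4 u u u u = x2 + 2 * y2"
proof -
  \<comment> \<open>A permutation with 0 going to u and 1 going to v: the first swap places 0, the
    second corrects the image of 1.\<close>
  define f where "f = Transposition.transpose (Transposition.transpose 0 u 1) v \<circ> Transposition.transpose 0 u"
  have w: "Transposition.transpose 0 u 1 \<noteq> u" "Transposition.transpose 0 u 1 < n" using assms by (auto simp: Transposition.transpose_def)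
  have f: "bij_betw f {..<n} {..<n}" unfolding f_def
    by (rule bij_betw_trans; rule bij_transpose) (use assms w in auto)
  have fuv: "f 0 = u" "f 1 = v" using w assms by (auto simp: f_def Transposition.transpose_def)
  show xy: "E4 u u v v = x2" "E4 u v u v = y2"
    using E4_signed_perm(1)[OF f, of "\<lambda>_. 1" 0 0 1 1] E4_signed_perm(1)[OF f, of "\<lambda>_. 1" 0 1 0 1] assms
    by (simp_all add: fuv[unfolded One_nat_def] fuv x2_def y2_def)
  have vv: "E4 v v v v = E4 u u u u"
    using E4_signed_perm(1)[OF bij_transpose[of u v], of "\<lambda>_. 1" u u u u] assms by simp
  \<comment> \<open>Signed permutations do not determine the diagonal moment; a rotation by 45
    degrees in the plane of columns u and v does. It gives E = E / 2 + x2 / 2 + y2 for E =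
    \<open>E4 u u u u\<close>.\<close>
  define c where "c = sqrt (1/2 :: real)"
  have cc: "c * c = 1/2" unfolding c_def by simp
  let ?R = "\<lambda>A. \<lambda>(i, j) \<in> sqidx n. if j = u then c * A (i, u) + c * A (i, v)
     else if j = v then - c * A (i, u) + c * A (i, v) else A (i, j)"
  have P: "P (?R A) u u = (P A u u + P A v v) / 2 + P A u v" for A
  proof -
    have "P (?R A) u u = (\<Sum>l<r. (c * c) * (A (l, u) * A (l, u) + A (l, v) * A (l, v) + 2 * (A (l, u) * A (l, v))))"
      unfolding P_def by (intro sum.cong refl) (use assms r in \<open>auto simp: algebra_simps\<close>)
    also have "\<dots> = (P A u u + P A v v) / 2 + P A u v"
      unfolding cc P_def by (simp add: sum.distrib sum_distrib_left[symmetric] add_divide_distrib sum_divide_distrib algebra_simps)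
    finally show ?thesis .
  qed
  have "E4 u u u u = (\<integral>A. P (?R A) u u * P (?R A) u u \<partial>H)"
    unfolding E4_def by (rule int_col_rot[symmetric]) (use assms cc in auto)
  also have "\<dots> = (\<integral>A. P A u u * P A u u / 4 + P A v v * P A v v / 4 + P A u u * P A v v / 2 + P A u v * P A u v
      + P A u u * P A u v + P A v v * P A u v \<partial>H)"
    unfolding P by (intro Bochner_Integration.integral_cong refl) (simp add: field_simps)
  also have "\<dots> = E4 u u u u / 4 + E4 v v v v / 4 + E4 u u v v / 2 + E4 u v u v + E4 u u u v + E4 v v u v"
    unfolding E4_def using assms by simp
  also have "E4 u u u v = E4 v u u u" by (rule trans[OF E4_sym(3)[of u u u v] E4_sym(1)[of u v u u]])
  also have "E4 v u u u = 0" using assms by (intro E4_flip) auto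
  also have "E4 v v u v = E4 u v v v" by (rule E4_sym(3))
  also have "E4 u v v v = 0" using assms by (intro E4_flip) auto
  finally show "E4 u u u u = x2 + 2 * y2" using vv xy by simp
qed

text \<open>Either some index differs from the three others, and the moment vanishes by a sign
  change, or the indices match in pairs. When all four agree the three pairings add up to x2 + 2
  y2.\<close>

lemma E4_eq:
  assumes n: "a < n" "b < n" "c < n" "d < n" "2 \<le> n"
  shows "E4 a b c d = x2 * (of_bool (a = b) * of_bool (c = d)) + y2 * (of_bool (a = c) * of_bool (b = d))
    + y2 * (of_bool (a = d) * of_bool (b = c))"
proof -
  have diag: "E4 u u u u = x2 + 2 * y2" if u: "u < n" for u
  proof -
    have "\<exists>v<n. u \<noteq> v" using n(5) u by (intro exI[of _ "if u = 0 then 1 else 0"]) auto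
    then show ?thesis using E4_pairs(3)[OF u] by blast
  qed
  have fl: "E4 a b c d = 0" if "(b \<noteq> a \<and> c \<noteq> a \<and> d \<noteq> a) \<or> (a \<noteq> b \<and> c \<noteq> b \<and> d \<noteq> b) \<or>
      (a \<noteq> c \<and> b \<noteq> c \<and> d \<noteq> c) \<or> (a \<noteq> d \<and> b \<noteq> d \<and> c \<noteq> d)"
    using that
  proof (elim disjE)
    assume "a \<noteq> b \<and> c \<noteq> b \<and> d \<noteq> b"
    then show ?thesis using E4_flip[of b a c d] n by (subst E4_sym(1)) simp
  next
    assume "a \<noteq> c \<and> b \<noteq> c \<and> d \<noteq> c"
    then show ?thesis using E4_flip[of c d a b] n by (subst E4_sym(3)) simp
  next
    assume "a \<noteq> d \<and> b \<noteq> d \<and> c \<noteq> d"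
    then show ?thesis using E4_flip[of d c a b] n by (subst E4_sym(3), subst E4_sym(1)) simp
  qed (use E4_flip[of a b c d] n in simp)
  let ?odd = "(b \<noteq> a \<and> c \<noteq> a \<and> d \<noteq> a) \<or> (a \<noteq> b \<and> c \<noteq> b \<and> d \<noteq> b) \<or>
      (a \<noteq> c \<and> b \<noteq> c \<and> d \<noteq> c) \<or> (a \<noteq> d \<and> b \<noteq> d \<and> c \<noteq> d)"
  have "?odd \<or> (a = b \<and> c = d) \<or> (a \<noteq> b \<and> a = c \<and> b = d) \<or> (a \<noteq> b \<and> a = d \<and> b = c)"
    by (cases "a = b"; cases "a = c"; cases "a = d"; cases "b = c"; cases "b = d") simp_all
  then consider "a = b" "c = d" "a = c" | "a = b" "c = d" "a \<noteq> c" | "a \<noteq> b" "a = c" "b = d" | "a \<noteq> b" "a = d" "b = c" | ?odd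
    by (elim disjE[of ?odd]) blast+
  then show ?thesis
  proof cases
    case 1 then show ?thesis using diag[OF n(1)] by simp
  next
    case 2 then show ?thesis using E4_pairs(1)[of a c] n by simp
  next
    case 3 then show ?thesis using E4_pairs(2)[of a b] n by simp
  next
    case 4 then show ?thesis using E4_pairs(2)[of a b] E4_sym(2)[of a b b a] n by simp
  next
    case 5 
    then have z: "of_bool (a = b) * of_bool (c = d) = (0::real)" "of_bool (a = c) * of_bool (b = d) = (0::real)"
      "of_bool (a = d) * of_bool (b = c) = (0::real)" by (auto simp: of_bool_def)
    show ?thesis unfolding z fl[OF 5] by simp
  qed
qed

text \<open>Two linear relations: trace r gives n x2 + 2 y2 = r^2 / n, and idempotence gives n y2 +
  (x2 + y2) = r / n. Dropping nonnegative terms yields the bounds.\<close>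

lemma xy_bounds:
  assumes n: "2 \<le> n"
  shows "0 \<le> x2" "0 \<le> y2" "x2 \<le> (real r / real n)\<^sup>2" "y2 \<le> real r / (real n)\<^sup>2"
proof -
  show x0: "0 \<le> x2" unfolding x2_def E4_def by (rule Bochner_Integration.integral_nonneg) (simp add: P_def sum_nonneg)
  show y0: "0 \<le> y2" unfolding y2_def E4_def by (rule Bochner_Integration.integral_nonneg) simp
  have n0: "0 < n" using n by simp
  have s: "(\<Sum>v<n. of_bool (v = 0) :: real) = 1" using n0 by (simp add: of_bool_def)
  have "(\<Sum>v<n. E4 v v 0 0) = (\<integral>A. (\<Sum>v<n. P A v v) * P A 0 0 \<partial>H)"
    unfolding E4_def sum_distrib_right using n0 by (subst Bochner_Integration.integral_sum) auto
  also have "\<dots> = (\<integral>A. real r * P A 0 0 \<partial>H)"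
    by (rule integral_cong_AE) (use AE_orth n0 in \<open>auto elim!: eventually_mono simp: P_trace\<close>)
  also have "\<dots> = (real r)\<^sup>2 / real n" using P_mean[OF n0] n0 by (simp add: power2_eq_square)
  finally have "(\<Sum>v<n. E4 v v 0 0) = (real r)\<^sup>2 / real n" .
  moreover have "(\<Sum>v<n. E4 v v 0 0) = (\<Sum>v<n. x2 + 2 * y2 * of_bool (v = 0))"
    using n by (intro sum.cong refl) (subst E4_eq, auto)
  ultimately have 1: "real n * x2 + 2 * y2 = (real r)\<^sup>2 / real n"
    by (simp add: sum.distrib sum_distrib_left[symmetric] s)
  have "(\<Sum>v<n. E4 0 v 0 v) = (\<integral>A. (\<Sum>v<n. P A 0 v * P A 0 v) \<partial>H)"
    unfolding E4_def using n0 by (subst Bochner_Integration.integral_sum) auto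
  also have "\<dots> = (\<integral>A. P A 0 0 \<partial>H)"
    by (rule integral_cong_AE) (use AE_orth n0 in \<open>auto elim!: eventually_mono simp: P_idem intro!: borel_measurable_sum\<close>)
  also have "\<dots> = real r / real n" by (rule P_mean[OF n0])
  finally have "(\<Sum>v<n. E4 0 v 0 v) = real r / real n" .
  moreover have "(\<Sum>v<n. E4 0 v 0 v) = (\<Sum>v<n. y2 + (x2 + y2) * of_bool (v = 0))"
    using n by (intro sum.cong refl) (subst E4_eq, auto)
  ultimately have 2: "real n * y2 + (x2 + y2) = real r / real n"
    by (simp add: sum.distrib sum_distrib_left[symmetric] s)
  have "real n * x2 \<le> (real r)\<^sup>2 / real n" using 1 y0 by linarith
  then show "x2 \<le> (real r / real n)\<^sup>2" using n0 by (simp add: field_simps power2_eq_square)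
  have "real n * y2 \<le> real r / real n" using 2 y0 x0 by linarith
  then show "y2 \<le> real r / (real n)\<^sup>2" using n0 by (simp add: field_simps power2_eq_square)
qed

lemma sum_bool: "a < n \<Longrightarrow> (\<Sum>b<n. f b * (of_bool (a = b) :: real)) = f a"
  "a < n \<Longrightarrow> (\<Sum>b<n. f b * (of_bool (b = a) :: real)) = f a"
  by (simp_all add: of_bool_def if_distrib[of "times _"] cong: if_cong)

lemma quad_mean:
  assumes "2 \<le> n"
  shows "(\<integral>A. (\<Sum>u<n. \<Sum>v<n. M u v * P A u v) \<partial>H) = real r / real n * (\<Sum>u<n. M u u)"
proof -
  have "(\<integral>A. (\<Sum>u<n. \<Sum>v<n. M u v * P A u v) \<partial>H) = (\<Sum>u<n. \<Sum>v<n. M u v * (\<integral>A. P A u v \<partial>H))"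
    by (subst integral_sum2) simp_all
  also have "\<dots> = (\<Sum>u<n. \<Sum>v<n. M u v * (real r / real n) * of_bool (u = v))"
    by (intro sum.cong refl) (auto simp: P_mean P_mean_off)
  also have "\<dots> = (\<Sum>u<n. M u u * (real r / real n))" by (intro sum.cong refl sum_bool) simp
  finally show ?thesis by (simp add: sum_distrib_left mult.commute)
qed

text \<open>The statistic is tr (M P). In the expansion of its square, the pairing inside the two
  factors produces the squared trace of M, and each of the two crossed pairings the squared
  Frobenius norm.\<close>

lemma quad_second_moment:
  assumes n: "2 \<le> n" and sym: "\<And>u v. M u v = M v u"
  shows "(\<integral>A. (\<Sum>u<n. \<Sum>v<n. M u v * P A u v)\<^sup>2 \<partial>H)
    \<le> (real r / real n)\<^sup>2 * (\<Sum>u<n. M u u)\<^sup>2 + 2 * (real r / (real n)\<^sup>2) * (\<Sum>u<n. \<Sum>v<n. (M u v)\<^sup>2)"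
proof -
  have "(\<integral>A. (\<Sum>u<n. \<Sum>v<n. M u v * P A u v)\<^sup>2 \<partial>H)
    = (\<integral>A. (\<Sum>a<n. \<Sum>c<n. \<Sum>b<n. \<Sum>d<n. M a b * M c d * (P A a b * P A c d)) \<partial>H)"
    by (intro Bochner_Integration.integral_cong refl) (simp add: power2_eq_square sum_product mult_ac)
  also have "\<dots> = (\<Sum>a<n. \<Sum>c<n. \<integral>A. (\<Sum>b<n. \<Sum>d<n. M a b * M c d * (P A a b * P A c d)) \<partial>H)"
    by (rule integral_sum2) (intro Bochner_Integration.integrable_sum integrable_mult_right PP_integrable; simp)
  also have "\<dots> = (\<Sum>a<n. \<Sum>c<n. \<Sum>b<n. \<Sum>d<n. \<integral>A. M a b * M c d * (P A a b * P A c d) \<partial>H)"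
    by (intro sum.cong refl integral_sum2 integrable_mult_right PP_integrable) auto
  also have "\<dots> = (\<Sum>a<n. \<Sum>c<n. \<Sum>b<n. \<Sum>d<n. M a b * M c d * E4 a b c d)"
    by (simp add: E4_def)
  also have "\<dots> = (\<Sum>a<n. \<Sum>c<n. \<Sum>b<n. \<Sum>d<n.
      x2 * (M a b * of_bool (a = b)) * (M c d * of_bool (c = d))
      + y2 * (M a b * M c d * of_bool (b = d)) * of_bool (a = c)
      + y2 * (M a b * M c d * of_bool (a = d)) * of_bool (b = c))"
    by (intro sum.cong refl) (subst E4_eq, auto simp: n algebra_simps)
  also have "\<dots> = x2 * (\<Sum>u<n. M u u)\<^sup>2 + y2 * (\<Sum>a<n. \<Sum>b<n. (M a b)\<^sup>2) + y2 * (\<Sum>a<n. \<Sum>b<n. (M a b)\<^sup>2)"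
  proof -
    have 1: "(\<Sum>a<n. \<Sum>c<n. \<Sum>b<n. \<Sum>d<n. x2 * (M a b * of_bool (a = b)) * (M c d * of_bool (c = d))) = x2 * (\<Sum>u<n. M u u)\<^sup>2"
    proof -
      have "(\<Sum>a<n. \<Sum>c<n. \<Sum>b<n. \<Sum>d<n. x2 * (M a b * of_bool (a = b)) * (M c d * of_bool (c = d)))
        = (\<Sum>a<n. \<Sum>c<n. x2 * M a a * M c c)"
        by (intro sum.cong refl) (simp add: sum_bool sum_distrib_left[symmetric] sum_distrib_right[symmetric])
      then show ?thesis unfolding power2_eq_square sum_product by (simp add: sum_distrib_left mult.assoc)
    qed
    have 2: "(\<Sum>a<n. \<Sum>c<n. \<Sum>b<n. \<Sum>d<n. y2 * (M a b * M c d * of_bool (b = d)) * of_bool (a = c)) = y2 * (\<Sum>a<n. \<Sum>b<n. (M a b)\<^sup>2)"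
      by (simp add: sum_distrib_right[symmetric] sum_bool sum_distrib_left[symmetric] power2_eq_square)
    have 3: "(\<Sum>a<n. \<Sum>c<n. \<Sum>b<n. \<Sum>d<n. y2 * (M a b * M c d * of_bool (a = d)) * of_bool (b = c)) = y2 * (\<Sum>a<n. \<Sum>b<n. (M a b)\<^sup>2)"
    proof -
      have "(\<Sum>c<n. \<Sum>b<n. \<Sum>d<n. y2 * (M a b * M c d * of_bool (a = d)) * of_bool (b = c)) = y2 * (\<Sum>c<n. M a c * M c a)" if "a < n" for a
        using that by (simp add: sum_distrib_right[symmetric] sum_bool sum_distrib_left[symmetric])
      then have "(\<Sum>a<n. \<Sum>c<n. \<Sum>b<n. \<Sum>d<n. y2 * (M a b * M c d * of_bool (a = d)) * of_bool (b = c)) = (\<Sum>a<n. y2 * (\<Sum>c<n. M a c * M c a))"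
        by (intro sum.cong) auto
      also have "\<dots> = y2 * (\<Sum>a<n. \<Sum>c<n. (M a c)\<^sup>2)"
        unfolding sum_distrib_left[symmetric] by (intro arg_cong[of _ _ "times y2"] sum.cong refl) (metis sym power2_eq_square)
      finally show ?thesis .
    qed
    show ?thesis by (simp only: sum.distrib 1 2 3)
  qed
  also have "\<dots> \<le> (real r / real n)\<^sup>2 * (\<Sum>u<n. M u u)\<^sup>2 + real r / (real n)\<^sup>2 * (\<Sum>u<n. \<Sum>v<n. (M u v)\<^sup>2)
     + real r / (real n)\<^sup>2 * (\<Sum>u<n. \<Sum>v<n. (M u v)\<^sup>2)"
    using xy_bounds[OF n] by (intro add_mono mult_right_mono) (auto intro!: sum_nonneg)
  finally show ?thesis by simp
qed

end

section \<open>Random variables with moments of every order\<close>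

context prob_space begin

text \<open>A class closed under sums and products, which makes every polynomial in Gaussian entries
  integrable at once.\<close>

definition all_moments :: "('a \<Rightarrow> real) \<Rightarrow> bool" where
  "all_moments f \<longleftrightarrow> f \<in> borel_measurable M \<and> (\<forall>k. integrable M (\<lambda>x. \<bar>f x\<bar> ^ k))"

lemma all_moments_meas: "all_moments f \<Longrightarrow> f \<in> borel_measurable M"
  by (simp add: all_moments_def)

lemma all_moments_integrable: "all_moments f \<Longrightarrow> integrable M f"
proof -
  assume f: "all_moments f"
  then have "integrable M (\<lambda>x. \<bar>f x\<bar> ^ 1)" by (auto simp only: all_moments_def)
  then show ?thesis using all_moments_meas[OF f] by (simp add: integrable_abs_iff)
qed

lemma all_moments_const [intro, simp]: "all_moments (\<lambda>_. c)"
  by (simp add: all_moments_def)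

lemma all_moments_mult [intro]: "all_moments f \<Longrightarrow> all_moments g \<Longrightarrow> all_moments (\<lambda>x. f x * g x)"
proof -
  assume f: "all_moments f" and g: "all_moments g"
  note [measurable] = all_moments_meas[OF f] all_moments_meas[OF g]
  have "integrable M (\<lambda>x. \<bar>f x * g x\<bar> ^ k)" for k
  proof (rule Bochner_Integration.integrable_bound[of _ "\<lambda>x. \<bar>f x\<bar> ^ (k * 2) + \<bar>g x\<bar> ^ (k * 2)"])
    show "integrable M (\<lambda>x. \<bar>f x\<bar> ^ (k * 2) + \<bar>g x\<bar> ^ (k * 2))"
      using f g by (simp add: all_moments_def)
    show "AE x in M. norm (\<bar>f x * g x\<bar> ^ k) \<le> norm (\<bar>f x\<bar> ^ (k * 2) + \<bar>g x\<bar> ^ (k * 2))"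
    proof (rule AE_I2)
      fix x
      have ab: "a * b \<le> a\<^sup>2 + b\<^sup>2" if "a \<ge> 0" "b \<ge> 0" for a b :: real
        using sum_squares_bound[of a b] mult_nonneg_nonneg[OF that] by simp
      show "norm (\<bar>f x * g x\<bar> ^ k) \<le> norm (\<bar>f x\<bar> ^ (k * 2) + \<bar>g x\<bar> ^ (k * 2))"
        using ab[of "\<bar>f x\<bar> ^ k" "\<bar>g x\<bar> ^ k"] by (simp add: abs_mult power_mult_distrib power_mult)
    qed
  qed measurable
  then show ?thesis by (simp add: all_moments_def)
qed

lemma all_moments_add [intro]: "all_moments f \<Longrightarrow> all_moments g \<Longrightarrow> all_moments (\<lambda>x. f x + g x)"
proof -
  assume f: "all_moments f" and g: "all_moments g"
  note [measurable] = all_moments_meas[OF f] all_moments_meas[OF g]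
  have "integrable M (\<lambda>x. \<bar>f x + g x\<bar> ^ k)" for k
  proof (rule Bochner_Integration.integrable_bound[of _ "\<lambda>x. 2 ^ k * (\<bar>f x\<bar> ^ k + \<bar>g x\<bar> ^ k)"])
    show "integrable M (\<lambda>x. 2 ^ k * (\<bar>f x\<bar> ^ k + \<bar>g x\<bar> ^ k))"
      using f g by (simp add: all_moments_def)
    show "AE x in M. norm (\<bar>f x + g x\<bar> ^ k) \<le> norm (2 ^ k * (\<bar>f x\<bar> ^ k + \<bar>g x\<bar> ^ k))"
    proof (rule AE_I2)
      fix x
      have "\<bar>f x + g x\<bar> ^ k \<le> (2 * max \<bar>f x\<bar> \<bar>g x\<bar>) ^ k" by (rule power_mono) auto
      also have "\<dots> \<le> 2 ^ k * (\<bar>f x\<bar> ^ k + \<bar>g x\<bar> ^ k)"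
        by (auto simp: power_mult_distrib max_def)
      finally show "norm (\<bar>f x + g x\<bar> ^ k) \<le> norm (2 ^ k * (\<bar>f x\<bar> ^ k + \<bar>g x\<bar> ^ k))" by simp
    qed
  qed measurable
  then show ?thesis by (simp add: all_moments_def)
qed

lemma all_moments_diff [intro]: "all_moments f \<Longrightarrow> all_moments g \<Longrightarrow> all_moments (\<lambda>x. f x - g x)"
  using all_moments_add[of f "\<lambda>x. -1 * g x"] all_moments_mult[of "\<lambda>_. -1" g] by simp

lemma all_moments_sum [intro]: "(\<And>i. i \<in> I \<Longrightarrow> all_moments (f i)) \<Longrightarrow> all_moments (\<lambda>x. \<Sum>i\<in>I. f i x)"
  by (induction I rule: infinite_finite_induct) auto

lemma all_moments_power [intro]: "all_moments f \<Longrightarrow> all_moments (\<lambda>x. f x ^ k)"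
  by (induction k) auto

lemma all_moments_bounded: "f \<in> borel_measurable M \<Longrightarrow> (\<And>x. x \<in> space M \<Longrightarrow> \<bar>f x\<bar> \<le> B) \<Longrightarrow> all_moments f"
proof -
  assume [measurable]: "f \<in> borel_measurable M" and B: "\<And>x. x \<in> space M \<Longrightarrow> \<bar>f x\<bar> \<le> B"
  have "integrable M (\<lambda>x. \<bar>f x\<bar> ^ k)" for k
    by (rule integrable_const_bound[of _ "B ^ k"]) (use B in \<open>auto intro!: AE_I2 power_mono\<close>)
  then show ?thesis by (simp add: all_moments_def)
qed

end

section \<open>Gaussian matrices: moments and independence of entries\<close>

abbreviation std_gauss :: "real measure" where
  "std_gauss \<equiv> density lborel std_normal_density"

lemma std_gauss_moment:
  "integrable std_gauss (\<lambda>x. x ^ k)"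
  "(\<integral>x. x ^ k \<partial>std_gauss) = (if odd k then 0 else fact k / (2 ^ (k div 2) * fact (k div 2)))"
proof -
  show "integrable std_gauss (\<lambda>x. x ^ k)"
    using integrable_std_normal_moment[of k] by (subst integrable_density) auto
  have "(\<integral>x. std_normal_density x * x ^ k \<partial>lborel) = (if odd k then 0 else fact k / (2 ^ (k div 2) * fact (k div 2)))"
  proof (cases "odd k")
    case True
    then have "k = 2 * (k div 2) + 1" by presburger
    then show ?thesis using integral_std_normal_moment_odd[of "k div 2"] True by metis
  next
    case False
    then have "k = 2 * (k div 2)" by presburger
    then show ?thesis using integral_std_normal_moment_even[of "k div 2"] False by metis
  qed
  then show "(\<integral>x. x ^ k \<partial>std_gauss) = (if odd k then 0 else fact k / (2 ^ (k div 2) * fact (k div 2)))"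
    by (subst integral_density) auto
qed

text \<open>For even k this is the double factorial (k - 1)!!.\<close>

definition gauss_moment :: "nat \<Rightarrow> real" where
  "gauss_moment k = (if odd k then 0 else fact k / (2 ^ (k div 2) * fact (k div 2)))"

lemma gauss_moment_simps [simp]:
  "gauss_moment 0 = 1" "gauss_moment (Suc 0) = 0" "gauss_moment 2 = 1" "gauss_moment 3 = 0" "gauss_moment 4 = 3"
  "gauss_moment 6 = 15" "gauss_moment 8 = 105"
  by (simp_all add: gauss_moment_def fact_numeral)

locale gauss =
  fixes p q :: nat
  assumes pq_pos: "0 < p" "0 < q"
begin

abbreviation "G \<equiv> gauss_mat p q"
abbreviation "I \<equiv> {..<p} \<times> {..<q}"

lemma sets_G [simp, measurable_cong]: "sets G = sets (mat_space p q)"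
  unfolding gauss_mat_def mat_space_def by (intro sets_PiM_cong) auto

lemma space_G [simp]: "space G = space (mat_space p q)"
  using sets_G by (rule sets_eq_imp_space_eq)

lemma prob_G: "prob_space G"
  unfolding gauss_mat_def by (rule prob_space_PiM) (simp add: prob_space_normal_density)

sublocale prob_space G by (rule prob_G)

lemma monomial:
  "integrable G (\<lambda>\<omega>. \<Prod>x\<in>I. \<omega> x ^ e x)" "(\<integral>\<omega>. (\<Prod>x\<in>I. \<omega> x ^ e x) \<partial>G) = (\<Prod>x\<in>I. gauss_moment (e x))"
proof -
  interpret product_sigma_finite "\<lambda>_::nat \<times> nat. std_gauss"
    by (intro product_sigma_finite.intro prob_space_imp_sigma_finite prob_space_normal_density) simp
  show "integrable G (\<lambda>\<omega>. \<Prod>x\<in>I. \<omega> x ^ e x)"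
    unfolding gauss_mat_def by (rule product_integrable_prod) (auto intro: std_gauss_moment)
  show "(\<integral>\<omega>. (\<Prod>x\<in>I. \<omega> x ^ e x) \<partial>G) = (\<Prod>x\<in>I. gauss_moment (e x))"
    unfolding gauss_mat_def
    by (subst product_integral_prod) (auto intro: std_gauss_moment(1) simp: std_gauss_moment(2) gauss_moment_def)
qed

text \<open>Presents a power of a single entry as a monomial in all entries, so that products of
  such powers fall under \<open>monomial\<close> by adding exponents.\<close>

lemma coord_prod: "x \<in> I \<Longrightarrow> (\<Prod>z\<in>I. \<omega> z ^ (k * of_bool (z = x))) = (\<omega> x :: real) ^ k"
proof -
  assume x: "x \<in> I"
  have "(\<Prod>z\<in>I. \<omega> z ^ (k * of_bool (z = x))) = (\<Prod>z\<in>I. if z = x then \<omega> x ^ k else 1)"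
    by (intro prod.cong) auto
  also have "\<dots> = \<omega> x ^ k" using x by (subst prod.delta) auto
  finally show ?thesis .
qed

lemma coord_moment: 
  assumes x: "x \<in> I"
  shows "integrable G (\<lambda>\<omega>. \<omega> x ^ k)" "(\<integral>\<omega>. \<omega> x ^ k \<partial>G) = gauss_moment k"
proof -
  have "(\<Prod>z\<in>I. gauss_moment (k * of_bool (z = x))) = (\<Prod>z\<in>I. if z = x then gauss_moment k else 1)"
    by (intro prod.cong) auto
  also have "\<dots> = gauss_moment k" using x by (subst prod.delta) auto
  finally show "integrable G (\<lambda>\<omega>. \<omega> x ^ k)" "(\<integral>\<omega>. \<omega> x ^ k \<partial>G) = gauss_moment k"
    using monomial[of "\<lambda>z. k * of_bool (z = x)"] by (simp_all only: coord_prod[OF x])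
qed

lemma coord_all_moments [intro]: "x \<in> I \<Longrightarrow> all_moments (\<lambda>\<omega>. \<omega> x)"
  unfolding all_moments_def
  using coord_moment(1)[of x] by (auto simp: power_abs[symmetric] intro!: integrable_abs)

lemma coord_moment2:
  assumes x: "x \<in> I" and y: "y \<in> I" "x \<noteq> y"
  shows "(\<integral>\<omega>. \<omega> x ^ k * \<omega> y ^ l \<partial>G) = gauss_moment k * gauss_moment l"
proof -
  have "(\<integral>\<omega>. \<omega> x ^ k * \<omega> y ^ l \<partial>G) = (\<Prod>z\<in>I. gauss_moment (k * of_bool (z = x) + l * of_bool (z = y)))"
    using monomial(2)[of "\<lambda>z. k * of_bool (z = x) + l * of_bool (z = y)"]
    by (simp only: power_add prod.distrib coord_prod[OF x] coord_prod[OF y(1)])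
  also have "\<dots> = (\<Prod>z\<in>I. (if z = x then gauss_moment k else 1) * (if z = y then gauss_moment l else 1))"
    using y by (intro prod.cong) auto
  also have "\<dots> = gauss_moment k * gauss_moment l"
    unfolding prod.distrib using x y by (subst prod.delta, simp, subst prod.delta) auto
  finally show ?thesis .
qed

lemma isserlis2:
  assumes "x \<in> I" "y \<in> I"
  shows "(\<integral>\<omega>. \<omega> x * \<omega> y \<partial>G) = of_bool (x = y)"
  using coord_moment2[OF assms, of 1 1] coord_moment(2)[OF assms(1), of 2] by (auto simp: power2_eq_square)

text \<open>By independence the mean is a product over the entries, governed by the multiplicity
  \<open>e z\<close> of each entry. An odd multiplicity gives 0, multiplicity 2 gives 1, and
  multiplicity 4 gives 3, the number of pairings.\<close>

lemma isserlis4: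
  assumes x: "a \<in> I" "b \<in> I" "c \<in> I" "d \<in> I"
  shows "(\<integral>\<omega>. \<omega> a * \<omega> b * (\<omega> c * \<omega> d) \<partial>G) = of_bool (a = b) * of_bool (c = d)
    + of_bool (a = c) * of_bool (b = d) + of_bool (a = d) * of_bool (b = c)"
proof -
  define e :: "nat \<times> nat \<Rightarrow> nat" where "e z = 1 * of_bool (z = a) + 1 * of_bool (z = b) + (1 * of_bool (z = c) + 1 * of_bool (z = d))" for z
  have E: "(\<integral>\<omega>. \<omega> a * \<omega> b * (\<omega> c * \<omega> d) \<partial>G) = (\<Prod>z\<in>I. gauss_moment (e z))"
    using monomial(2)[of e] unfolding e_def
    by (simp only: power_add prod.distrib coord_prod[OF x(1)] coord_prod[OF x(2)] coord_prod[OF x(3)] coord_prod[OF x(4)] power_one_right)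
  have odd: "(\<Prod>z\<in>I. gauss_moment (e z)) = 0" if "z \<in> I" "odd (e z)" for z
    using that by (intro prod_zero) (auto simp: gauss_moment_def intro!: bexI[of _ z])
  have even: "(\<Prod>z\<in>I. gauss_moment (e z)) = 1" if "\<And>z. e z = 0 \<or> e z = 2"
    using that by (intro prod.neutral) (metis gauss_moment_simps(1,3))
  have "Suc (Suc (Suc (Suc 0))) = 4" by simp
  then have g4: "gauss_moment (Suc (Suc (Suc (Suc 0)))) = 3" by (metis gauss_moment_simps(5))
  consider "a = b" "c = d" "a = c" | "a = b" "c = d" "a \<noteq> c" | "a = b" "c \<noteq> d" "a \<noteq> c" | "a = b" "c \<noteq> d" "a = c"
    | "a \<noteq> b" "a = c" "b = d" | "a \<noteq> b" "a = d" "b = c" | "a \<noteq> b" "a \<noteq> c" "a \<noteq> d" | "a \<noteq> b" "a = c" "b \<noteq> d"  | "a \<noteq> b" "a = d" "b \<noteq> c" 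
    by blast
  then show ?thesis
  proof cases
    case 1
    then have "(\<Prod>z\<in>I. gauss_moment (e z)) = (\<Prod>z\<in>I. if z = a then 3 else 1)"
      by (intro prod.cong) (auto simp: e_def g4)
    also have "\<dots> = 3" using x(1) by (subst prod.delta) auto
    finally show ?thesis using 1 E by simp
  next
    case 2 then show ?thesis unfolding E by (subst even) (auto simp: e_def)
  next
    case 3 then show ?thesis unfolding E by (subst odd[of c]) (use x in \<open>auto simp: e_def\<close>)
  next
    case 4 then show ?thesis unfolding E by (subst odd[of d]) (use x in \<open>auto simp: e_def\<close>)
  next
    case 5 then show ?thesis unfolding E by (subst even) (auto simp: e_def)
  next
    case 6 then show ?thesis unfolding E by (subst even) (auto simp: e_def)
  next
    case 7 then show ?thesis unfolding E by (subst odd[of a]) (use x in \<open>auto simp: e_def\<close>)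
  next
    case 8 then show ?thesis unfolding E by (subst odd[of b]) (use x in \<open>auto simp: e_def\<close>)
  next
    case 9 then show ?thesis unfolding E by (subst odd[of b]) (use x in \<open>auto simp: e_def\<close>)
  qed
qed

lemma indep_coords: "indep_vars (\<lambda>_. borel) (\<lambda>x \<omega>. \<omega> x) I"
proof (subst indep_vars_iff_distr_eq_PiM')
  have c: "distr G borel (\<lambda>\<omega>. \<omega> x) = std_gauss" if "x \<in> I" for x
  proof -
    have "distr G borel (\<lambda>\<omega>. \<omega> x) = distr G std_gauss (\<lambda>\<omega>. \<omega> x)" by (intro distr_cong) auto
    also have "\<dots> = std_gauss" unfolding gauss_mat_def
      by (rule distr_PiM_component) (use that in \<open>auto simp: prob_space_normal_density\<close>)
    finally show ?thesis .
  qed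
  have "(\<Pi>\<^sub>M x\<in>I. distr G borel (\<lambda>\<omega>. \<omega> x)) = G"
    unfolding gauss_mat_def by (intro PiM_cong refl) (simp add: c[unfolded gauss_mat_def])
  moreover have "distr G (\<Pi>\<^sub>M x\<in>I. borel) (\<lambda>\<omega>. \<lambda>x\<in>I. \<omega> x) = distr G G (\<lambda>\<omega>. \<omega>)"
    by (rule distr_cong) (auto simp: mat_space_def space_PiM intro!: sets_PiM_cong)
  ultimately show "distr G (\<Pi>\<^sub>M x\<in>I. borel) (\<lambda>\<omega>. \<lambda>x\<in>I. \<omega> x) = (\<Pi>\<^sub>M x\<in>I. distr G borel (\<lambda>\<omega>. \<omega> x))"
    by (simp add: distr_id2)
qed (use pq_pos in auto)

lemma indep_disjoint_coords:
  fixes f g :: "(nat \<times> nat \<Rightarrow> real) \<Rightarrow> real"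
  assumes AB: "A \<subseteq> I" "B \<subseteq> I" "A \<inter> B = {}"
    and f: "\<And>\<omega> \<omega>'. (\<And>x. x \<in> A \<Longrightarrow> \<omega> x = \<omega>' x) \<Longrightarrow> f \<omega> = f \<omega>'"
    and g: "\<And>\<omega> \<omega>'. (\<And>x. x \<in> B \<Longrightarrow> \<omega> x = \<omega>' x) \<Longrightarrow> g \<omega> = g \<omega>'"
    and [measurable]: "f \<in> borel_measurable (mat_space p q)" "g \<in> borel_measurable (mat_space p q)"
    and int: "integrable G f" "integrable G g"
  shows "(\<integral>\<omega>. f \<omega> * g \<omega> \<partial>G) = (\<integral>\<omega>. f \<omega> \<partial>G) * (\<integral>\<omega>. g \<omega> \<partial>G)"
proof -
  \<comment> \<open>A function that ignores the entries outside C equals its composition with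
    restriction to C followed by extension by 0. This exhibits it as a measurable function of the
    restricted family, as independence requires.\<close>
  define ext where "ext C \<eta> = (\<lambda>x\<in>I. if x \<in> C then \<eta> x else (0::real))" for C and \<eta> :: "nat \<times> nat \<Rightarrow> real"
  have ext: "ext C \<in> measurable (\<Pi>\<^sub>M x\<in>C. borel) (mat_space p q)" if "C \<subseteq> I" for C
    unfolding ext_def mat_space_def
  proof (rule measurable_restrict)
    fix x show "(\<lambda>\<eta>. if x \<in> C then \<eta> x else 0) \<in> measurable (\<Pi>\<^sub>M x\<in>C. borel) lborel"
      by (cases "x \<in> C") auto
  qed
  have fe: "f (ext A (restrict \<omega> A)) = f \<omega>" for \<omega> by (rule f) (use AB in \<open>auto simp: ext_def\<close>)
  have ge: "g (ext B (restrict \<omega> B)) = g \<omega>" for \<omega> by (rule g) (use AB in \<open>auto simp: ext_def\<close>)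
  have "indep_var (PiM A (\<lambda>_. borel)) (\<lambda>\<omega>. restrict (\<lambda>x. \<omega> x) A) (PiM B (\<lambda>_. borel)) (\<lambda>\<omega>. restrict (\<lambda>x. \<omega> x) B)"
    by (rule indep_var_restrict[OF indep_coords]) (use AB in auto)
  then have "indep_var borel ((\<lambda>\<eta>. f (ext A \<eta>)) \<circ> (\<lambda>\<omega>. restrict (\<lambda>x. \<omega> x) A))
      borel ((\<lambda>\<eta>. g (ext B \<eta>)) \<circ> (\<lambda>\<omega>. restrict (\<lambda>x. \<omega> x) B))"
    by (rule indep_var_compose)
      (rule measurable_compose[OF ext[OF AB(1)]] measurable_compose[OF ext[OF AB(2)]], fact)+
  then have "indep_var borel f borel g" by (simp add: comp_def fe ge)
  then show ?thesis by (rule indep_var_lebesgue_integral[OF _ int])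
qed

end

text \<open>Entry (j, k) of X^T X - |R| I, where X consists of the rows R of A. The identity is
  subtracted row by row so that every summand is centred for standard Gaussian entries.\<close>

definition gram_dev :: "nat set \<Rightarrow> (nat \<times> nat \<Rightarrow> real) \<Rightarrow> nat \<Rightarrow> nat \<Rightarrow> real" where
  "gram_dev R A j k = (\<Sum>i\<in>R. A (i, j) * A (i, k) - of_bool (j = k))"

text \<open>The squared Frobenius norm of the deviation of the Gram matrix.\<close>

definition gram_norm :: "nat \<Rightarrow> nat set \<Rightarrow> (nat \<times> nat \<Rightarrow> real) \<Rightarrow> real" where
  "gram_norm q R A = (\<Sum>j<q. \<Sum>k<q. (gram_dev R A j k)\<^sup>2)"

lemma gram_dev_commute: "gram_dev R A j k = gram_dev R A k j"
  unfolding gram_dev_def by (intro sum.cong refl) (auto simp: mult.commute)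

lemma gram_dev_cong:
  "j < q \<Longrightarrow> k < q \<Longrightarrow> (\<And>x. x \<in> R \<times> {..<q} \<Longrightarrow> A x = B x) \<Longrightarrow> gram_dev R A j k = gram_dev R B j k"
  unfolding gram_dev_def by (intro sum.cong refl) auto

lemma gram_norm_cong:
  "(\<And>x. x \<in> R \<times> {..<q} \<Longrightarrow> A x = B x) \<Longrightarrow> gram_norm q R A = gram_norm q R B"
  unfolding gram_norm_def by (intro sum.cong refl arg_cong[of _ _ "\<lambda>x. x\<^sup>2"] gram_dev_cong[of _ q]) auto

lemma gram_dev_measurable [measurable]:
  "R \<subseteq> {..<p} \<Longrightarrow> j < q \<Longrightarrow> k < q \<Longrightarrow> (\<lambda>A. gram_dev R A j k) \<in> borel_measurable (mat_space p q)"
  unfolding gram_dev_def by (intro borel_measurable_sum borel_measurable_diff borel_measurable_times measurable_mat_entry) auto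

lemma gram_norm_measurable [measurable]:
  "R \<subseteq> {..<p} \<Longrightarrow> gram_norm q R \<in> borel_measurable (mat_space p q)"
  unfolding gram_norm_def by (intro borel_measurable_sum borel_measurable_power gram_dev_measurable) auto

lemma gram_norm_nonneg: "0 \<le> gram_norm q R A"
  by (simp add: gram_norm_def sum_nonneg)

text \<open>The test function separating the two laws: the inner product of the deviations of the Gram
  matrices of two groups of rows, truncated in terms of the first group only.\<close>

definition gram_test :: "nat \<Rightarrow> nat set \<Rightarrow> nat set \<Rightarrow> real \<Rightarrow> (nat \<times> nat \<Rightarrow> real) \<Rightarrow> real" where
  "gram_test q R S B A = (if gram_norm q R A \<le> B then \<Sum>j<q. \<Sum>k<q. gram_dev R A j k * gram_dev S A j k else 0)"

lemma gram_test_measurable [measurable]: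
  "R \<subseteq> {..<p} \<Longrightarrow> S \<subseteq> {..<p} \<Longrightarrow> gram_test q R S B \<in> borel_measurable (mat_space p q)"
proof -
  assume RS: "R \<subseteq> {..<p}" "S \<subseteq> {..<p}"
  note [measurable] = gram_norm_measurable[OF RS(1)]
  have [measurable]: "(\<lambda>A. \<Sum>j<q. \<Sum>k<q. gram_dev R A j k * gram_dev S A j k) \<in> borel_measurable (mat_space p q)"
    by (intro borel_measurable_sum borel_measurable_times gram_dev_measurable) (use RS in auto)
  show ?thesis unfolding gram_test_def by measurable
qed

context gauss begin

lemma prob_mat_space [simp]: "prob (space (mat_space p q)) = 1"
  using prob_space by simp

lemma all_moments_gram_dev [intro]: "R \<subseteq> {..<p} \<Longrightarrow> j < q \<Longrightarrow> k < q \<Longrightarrow> all_moments (\<lambda>A. gram_dev R A j k)"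
  unfolding gram_dev_def by (intro all_moments_sum all_moments_diff all_moments_mult coord_all_moments) auto

lemma gram_dev_mean:
  assumes R: "R \<subseteq> {..<p}" and jk: "j < q" "k < q"
  shows "(\<integral>A. gram_dev R A j k \<partial>G) = 0"
proof -
  have "integrable G (\<lambda>A. A (i, j) * A (i, k))" if "i \<in> R" for i
    by (intro all_moments_integrable all_moments_mult coord_all_moments) (use that R jk in auto)
  then have "(\<integral>A. gram_dev R A j k \<partial>G) = (\<Sum>i\<in>R. \<integral>A. A (i, j) * A (i, k) - of_bool (j = k) \<partial>G)"
    unfolding gram_dev_def by (subst Bochner_Integration.integral_sum) auto
  also have "\<dots> = (\<Sum>i\<in>R. 0)"
  proof (intro sum.cong refl)
    fix i assume i: "i \<in> R"
    have "integrable G (\<lambda>A. A (i, j) * A (i, k))" by (intro all_moments_integrable all_moments_mult coord_all_moments) (use i R jk in auto)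
    then show "(\<integral>A. A (i, j) * A (i, k) - of_bool (j = k) \<partial>G) = 0"
      using isserlis2[of "(i, j)" "(i, k)"] i R jk by (subst Bochner_Integration.integral_diff) (auto simp: prob_space)
  qed
  finally show ?thesis by simp
qed

text \<open>In the Isserlis formula the pairing of j with k and of j' with k' cancels against the
  centring. The crossed pairings need equal rows, so one term per row survives.\<close>

lemma gram_dev_cov:
  assumes R: "R \<subseteq> {..<p}" and jk: "j < q" "k < q" "j' < q" "k' < q"
  shows "(\<integral>A. gram_dev R A j k * gram_dev R A j' k' \<partial>G) =
    real (card R) * (of_bool (j = j') * of_bool (k = k') + of_bool (j = k') * of_bool (k = j'))"
proof -
  have fin: "finite R" using R by (rule finite_subset) simp
  let ?c = "of_bool (j = j') * of_bool (k = k') + of_bool (j = k') * of_bool (k = j') :: real"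
  have am: "all_moments (\<lambda>A. A (i, u) * A (i, v))" if "i \<in> R" "u < q" "v < q" for i u v
    by (intro all_moments_mult coord_all_moments) (use that R in auto)
  have "(\<integral>A. gram_dev R A j k * gram_dev R A j' k' \<partial>G) =
    (\<integral>A. (\<Sum>i\<in>R. \<Sum>l\<in>R. (A (i, j) * A (i, k) - of_bool (j = k)) * (A (l, j') * A (l, k') - of_bool (j' = k'))) \<partial>G)"
    unfolding gram_dev_def sum_product ..
  also have "\<dots> = (\<Sum>i\<in>R. \<Sum>l\<in>R. \<integral>A. (A (i, j) * A (i, k) - of_bool (j = k)) * (A (l, j') * A (l, k') - of_bool (j' = k')) \<partial>G)"
    by (intro integral_sum2 all_moments_integrable all_moments_mult all_moments_diff am) (use jk in auto)
  also have "\<dots> = (\<Sum>i\<in>R. \<Sum>l\<in>R. ?c * of_bool (i = l))"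
  proof (intro sum.cong refl)
    fix i l assume il: "i \<in> R" "l \<in> R"
    have "(\<integral>A. (A (i, j) * A (i, k) - of_bool (j = k)) * (A (l, j') * A (l, k') - of_bool (j' = k')) \<partial>G)
      = (\<integral>A. A (i, j) * A (i, k) * (A (l, j') * A (l, k')) - of_bool (j' = k') * (A (i, j) * A (i, k))
          - of_bool (j = k) * (A (l, j') * A (l, k')) + of_bool (j = k) * of_bool (j' = k') \<partial>G)"
      by (intro Bochner_Integration.integral_cong refl) (simp add: algebra_simps)
    also have "\<dots> = (\<integral>A. A (i, j) * A (i, k) * (A (l, j') * A (l, k')) \<partial>G) - of_bool (j' = k') * (\<integral>A. A (i, j) * A (i, k) \<partial>G)
      - of_bool (j = k) * (\<integral>A. A (l, j') * A (l, k') \<partial>G) + of_bool (j = k) * of_bool (j' = k')"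
      using am[OF il(1) jk(1,2)] am[OF il(2) jk(3,4)] all_moments_mult[OF am[OF il(1) jk(1,2)] am[OF il(2) jk(3,4)]]
      by (simp add: all_moments_integrable prob_space)
    also have "\<dots> = ?c * of_bool (i = l)"
      using il R jk by (subst isserlis4, (auto)[4], subst isserlis2, (auto)[2], subst isserlis2, (auto)[2]) auto
    finally show "(\<integral>A. (A (i, j) * A (i, k) - of_bool (j = k)) * (A (l, j') * A (l, k') - of_bool (j' = k')) \<partial>G) = ?c * of_bool (i = l)" .
  qed
  also have "\<dots> = (\<Sum>i\<in>R. ?c)" using fin by (intro sum.cong refl) (simp add: of_bool_def if_distrib[of "times _"] cong: if_cong)
  finally show ?thesis by simp
qed

text \<open>The extreme case is j = k, where (x^2 - 1)^4 has mean 105 - 4 * 15 + 6 * 3 - 4 + 1 = 60.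
  Off the diagonal the fourth moment is 3 * 3.\<close>

lemma gram_summand_moments:
  assumes i: "i < p" and jk: "j < q" "k < q"
  shows "(\<integral>A. (A (i, j) * A (i, k) - of_bool (j = k)) ^ 2 \<partial>G) \<le> 2"
    "(\<integral>A. (A (i, j) * A (i, k) - of_bool (j = k)) ^ 4 \<partial>G) \<le> 60"
proof -
  have x: "(i, j) \<in> I" "(i, k) \<in> I" using assms by auto
  have int: "integrable G (\<lambda>A. A (i, j) ^ l)" for l using x by (intro coord_moment) auto
  show "(\<integral>A. (A (i, j) * A (i, k) - of_bool (j = k)) ^ 2 \<partial>G) \<le> 2"
    using gram_dev_cov[of "{i}" j k j k] assms by (auto simp: gram_dev_def power2_eq_square of_bool_def)
  show "(\<integral>A. (A (i, j) * A (i, k) - of_bool (j = k)) ^ 4 \<partial>G) \<le> 60"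
  proof (cases "j = k")
    case False
    then show ?thesis using coord_moment2[OF x, of 4 4] by (simp add: power_mult_distrib)
  next
    case True
    have "(\<integral>A. (A (i, j) * A (i, k) - of_bool (j = k)) ^ 4 \<partial>G) =
      (\<integral>A. A (i, j) ^ 8 - 4 * A (i, j) ^ 6 + 6 * A (i, j) ^ 4 - 4 * A (i, j) ^ 2 + 1 \<partial>G)"
    proof (intro Bochner_Integration.integral_cong refl)
      have "(t * t - 1) ^ 4 = t ^ 8 - 4 * t ^ 6 + 6 * t ^ 4 - 4 * t ^ 2 + 1" for t :: real by algebra
      then show "(A (i, j) * A (i, k) - of_bool (j = k)) ^ 4 = A (i, j) ^ 8 - 4 * A (i, j) ^ 6 + 6 * A (i, j) ^ 4 - 4 * A (i, j) ^ 2 + 1" for A :: "nat \<times> nat \<Rightarrow> real"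
        using True by simp
    qed
    also have "\<dots> = gauss_moment 8 - 4 * gauss_moment 6 + 6 * gauss_moment 4 - 4 * gauss_moment 2 + 1"
      using int coord_moment(2)[OF x(1)] by (simp add: prob_space del: gauss_moment_simps)
    also have "\<dots> = 60" by simp
    finally show ?thesis by simp
  qed
qed

text \<open>Adding one row to a sum S adds an independent centred term x. The terms S^3 x and S x^3
  have mean 0, so the fourth moment grows by at most 6 * 2 m * 2 + 60, which is less than the growth
  of 60 m^2.\<close>

lemma gram_dev_fourth:
  assumes jk: "j < q" "k < q" and "m \<le> p"
  shows "(\<integral>A. gram_dev {..<m} A j k ^ 4 \<partial>G) \<le> 60 * (real m)\<^sup>2"
  using \<open>m \<le> p\<close>
proof (induction m)
  case 0
  then show ?case by (simp add: gram_dev_def)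
next
  case (Suc m)
  let ?S = "\<lambda>A. gram_dev {..<m} A j k" and ?x = "\<lambda>A. A (m, j) * A (m, k) - of_bool (j = k)"
  have aS: "all_moments ?S" using Suc jk by auto
  have ax: "all_moments ?x" using Suc jk by (intro all_moments_diff all_moments_mult coord_all_moments) auto
  note ints = all_moments_integrable[OF all_moments_power[OF aS]] all_moments_integrable[OF all_moments_power[OF ax]]
  have int2: "integrable G (\<lambda>A. ?S A ^ a * ?x A ^ b)" for a b
    by (intro all_moments_integrable all_moments_mult all_moments_power aS ax)
  have ind: "(\<integral>A. ?S A ^ a * ?x A ^ b \<partial>G) = (\<integral>A. ?S A ^ a \<partial>G) * (\<integral>A. ?x A ^ b \<partial>G)" for a b
  proof (rule indep_disjoint_coords[of "{..<m} \<times> {..<q}" "{m} \<times> {..<q}"])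
    fix A B :: "nat \<times> nat \<Rightarrow> real" assume "\<And>x. x \<in> {..<m} \<times> {..<q} \<Longrightarrow> A x = B x"
    then show "?S A ^ a = ?S B ^ a" using jk by (simp add: gram_dev_cong[of j q k _ A B])
  qed (use Suc jk ints all_moments_meas[OF all_moments_power[OF aS]] all_moments_meas[OF all_moments_power[OF ax]] in auto)
  have x1: "(\<integral>A. ?x A \<partial>G) = 0" using gram_dev_mean[of "{m}" j k] Suc jk by (simp add: gram_dev_def)
  have S1: "(\<integral>A. ?S A \<partial>G) = 0" using gram_dev_mean[of "{..<m}" j k] Suc jk by simp
  have S2: "(\<integral>A. ?S A ^ 2 \<partial>G) \<le> 2 * real m"
    using gram_dev_cov[of "{..<m}" j k j k] Suc jk by (auto simp: power2_eq_square of_bool_def)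
  have x2: "(\<integral>A. ?x A ^ 2 \<partial>G) \<le> 2" "(\<integral>A. ?x A ^ 4 \<partial>G) \<le> 60" using gram_summand_moments[of m j k] Suc jk by auto
  have "(\<integral>A. gram_dev {..<Suc m} A j k ^ 4 \<partial>G) = (\<integral>A. ?S A ^ 4 + 4 * (?S A ^ 3 * ?x A ^ 1) + 6 * (?S A ^ 2 * ?x A ^ 2)
      + 4 * (?S A ^ 1 * ?x A ^ 3) + ?x A ^ 4 \<partial>G)"
  proof (intro Bochner_Integration.integral_cong refl)
    fix A
    have "gram_dev {..<Suc m} A j k = ?S A + ?x A" by (simp add: gram_dev_def)
    then show "gram_dev {..<Suc m} A j k ^ 4 = ?S A ^ 4 + 4 * (?S A ^ 3 * ?x A ^ 1) + 6 * (?S A ^ 2 * ?x A ^ 2)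
      + 4 * (?S A ^ 1 * ?x A ^ 3) + ?x A ^ 4" by algebra
  qed
  also have "\<dots> = (\<integral>A. ?S A ^ 4 \<partial>G) + 4 * (\<integral>A. ?S A ^ 3 * ?x A ^ 1 \<partial>G) + 6 * (\<integral>A. ?S A ^ 2 * ?x A ^ 2 \<partial>G)
      + 4 * (\<integral>A. ?S A ^ 1 * ?x A ^ 3 \<partial>G) + (\<integral>A. ?x A ^ 4 \<partial>G)"
    using ints int2 int2[of _ 1] int2[of 1] by (simp del: power_one_right)
  also have "\<dots> = (\<integral>A. ?S A ^ 4 \<partial>G) + 6 * ((\<integral>A. ?S A ^ 2 \<partial>G) * (\<integral>A. ?x A ^ 2 \<partial>G)) + (\<integral>A. ?x A ^ 4 \<partial>G)"
    unfolding ind using x1 S1 by simp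
  also have "\<dots> \<le> 60 * (real m)\<^sup>2 + 6 * (2 * real m * 2) + 60"
    using S2 x2 Suc by (intro add_mono mult_left_mono mult_mono) auto
  also have "\<dots> \<le> 60 * (real (Suc m))\<^sup>2" by (simp add: power2_eq_square algebra_simps)
  finally show ?case .
qed

lemma gram_norm_mean:
  assumes "m \<le> p"
  shows "(\<integral>A. gram_norm q {..<m} A \<partial>G) = real m * real q * (real q + 1)"
proof -
  have "(\<integral>A. gram_norm q {..<m} A \<partial>G) = (\<Sum>j<q. \<Sum>k<q. \<integral>A. (gram_dev {..<m} A j k)\<^sup>2 \<partial>G)"
    unfolding gram_norm_def
    by (intro integral_sum2 all_moments_integrable all_moments_power all_moments_gram_dev) (use assms in auto)
  also have "\<dots> = (\<Sum>j<q. \<Sum>k<q. real m * (1 + of_bool (j = k)))"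
    by (intro sum.cong refl) (use assms in \<open>auto simp: power2_eq_square gram_dev_cov of_bool_def\<close>)
  also have "\<dots> = (\<Sum>j<q. real m * (real q + 1))"
    by (intro sum.cong refl) (simp add: sum_distrib_left[symmetric] sum.distrib of_bool_def)
  finally show ?thesis by simp
qed

text \<open>The second moment is at most 60 times the squared mean of \<open>gram_norm_mean\<close>.
  Cauchy--Schwarz over the q^2 entries reduces it to fourth moments of single entries and loses only
  a constant.\<close>

lemma gram_norm_second:
  assumes "m \<le> p"
  shows "(\<integral>A. (gram_norm q {..<m} A)\<^sup>2 \<partial>G) \<le> 60 * (real m * real q * (real q + 1))\<^sup>2"
proof -
  have i4: "integrable G (\<lambda>A. gram_dev {..<m} A j k ^ 4)" if "j < q" "k < q" for j k
    by (intro all_moments_integrable all_moments_power all_moments_gram_dev) (use assms that in auto)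
  have "(\<integral>A. (gram_norm q {..<m} A)\<^sup>2 \<partial>G) \<le> (\<integral>A. (\<Sum>j<q. \<Sum>k<q. (real q)\<^sup>2 * gram_dev {..<m} A j k ^ 4) \<partial>G)"
  proof (rule integral_mono)
    show "integrable G (\<lambda>A. (gram_norm q {..<m} A)\<^sup>2)" unfolding gram_norm_def
      by (intro all_moments_integrable all_moments_power all_moments_sum all_moments_gram_dev) (use assms in auto)
    show "integrable G (\<lambda>A. \<Sum>j<q. \<Sum>k<q. (real q)\<^sup>2 * gram_dev {..<m} A j k ^ 4)"
      using i4 by (intro Bochner_Integration.integrable_sum integrable_mult_right) auto
    fix A
    have "(gram_norm q {..<m} A)\<^sup>2 = (\<Sum>(j, k)\<in>{..<q} \<times> {..<q}. (gram_dev {..<m} A j k)\<^sup>2)\<^sup>2"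
      by (simp add: gram_norm_def sum.cartesian_product)
    also have "\<dots> \<le> (\<Sum>x\<in>{..<q} \<times> {..<q}. (case x of (j, k) \<Rightarrow> (gram_dev {..<m} A j k)\<^sup>2)\<^sup>2) * real (card ({..<q} \<times> {..<q}))"
      by (rule sum_squared_le_sum_of_squares)
    also have "\<dots> = (\<Sum>j<q. \<Sum>k<q. (real q)\<^sup>2 * gram_dev {..<m} A j k ^ 4)"
      by (simp add: sum.cartesian_product sum_distrib_right sum_distrib_left case_prod_unfold power2_eq_square power4_eq_xxxx mult_ac)
    finally show "(gram_norm q {..<m} A)\<^sup>2 \<le> (\<Sum>j<q. \<Sum>k<q. (real q)\<^sup>2 * gram_dev {..<m} A j k ^ 4)" .
  qed
  also have "\<dots> = (\<Sum>j<q. \<Sum>k<q. \<integral>A. (real q)\<^sup>2 * gram_dev {..<m} A j k ^ 4 \<partial>G)"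
    using i4 by (intro integral_sum2 integrable_mult_right) auto
  also have "\<dots> \<le> (\<Sum>j<q. \<Sum>k<q. (real q)\<^sup>2 * (60 * (real m)\<^sup>2))"
    using gram_dev_fourth assms by (intro sum_mono) (auto intro!: mult_left_mono)
  also have "\<dots> = 60 * (real m * real q * real q)\<^sup>2" by (simp add: power2_eq_square)
  also have "\<dots> \<le> 60 * (real m * real q * (real q + 1))\<^sup>2"
    by (intro mult_left_mono power_mono) auto
  finally show ?thesis .
qed

text \<open>Truncating Q at height b removes at most Q^2 / b. With second moment at most 60 w^2, the
  height b = 120 w removes at most half of the mean w.\<close>

lemma gram_norm_truncated:
  assumes m: "m \<le> p" "0 < m" and w: "w = real m * real q * (real q + 1)"
  shows "w / 2 \<le> (\<integral>A. (if gram_norm q {..<m} A \<le> 120 * w then gram_norm q {..<m} A else 0) \<partial>G)"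
proof -
  let ?Q = "gram_norm q {..<m}"
  have w0: "w > 0" using m pq_pos w by (auto intro!: mult_pos_pos)
  have aQ: "all_moments ?Q" unfolding gram_norm_def
    by (intro all_moments_sum all_moments_power all_moments_gram_dev) (use m in auto)
  note [simp] = all_moments_integrable[OF aQ] all_moments_integrable[OF all_moments_power[OF aQ]]
  have [measurable]: "?Q \<in> borel_measurable (mat_space p q)" using m by auto
  have it: "integrable G (\<lambda>A. if ?Q A \<le> 120 * w then ?Q A else 0)"
    by (rule Bochner_Integration.integrable_bound[of G ?Q]) auto
  have "w - 60 * w\<^sup>2 / (120 * w) \<le> (\<integral>A. ?Q A \<partial>G) - (\<integral>A. (?Q A)\<^sup>2 \<partial>G) / (120 * w)"
    using gram_norm_mean[OF m(1)] gram_norm_second[OF m(1)] w w0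
    by (intro diff_mono divide_right_mono) auto
  also have "\<dots> = (\<integral>A. ?Q A - (?Q A)\<^sup>2 / (120 * w) \<partial>G)" by simp
  also have "\<dots> \<le> (\<integral>A. (if ?Q A \<le> 120 * w then ?Q A else 0) \<partial>G)"
  proof (rule integral_mono[OF _ it])
    fix A
    show "?Q A - (?Q A)\<^sup>2 / (120 * w) \<le> (if ?Q A \<le> 120 * w then ?Q A else 0)"
    proof (cases "?Q A \<le> 120 * w")
      case False
      then have "?Q A * (120 * w) \<le> ?Q A * ?Q A" using w0 by (intro mult_left_mono gram_norm_nonneg) auto
      then show ?thesis using False w0 by (simp add: power2_eq_square field_simps)
    qed (use w0 in auto)
  qed simp
  finally show ?thesis using w0 by (simp add: power2_eq_square field_simps)
qed

text \<open>The truncated deviation \<open>c\<close> depends on the rows R and the other factor on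
  the rows S, so they are independent. The second factor is centred, and its covariance is |S| times
  two pairings; the truncation bounds the squared norm of \<open>c\<close> by B.\<close>

lemma gram_test_gauss:
  assumes RS: "R \<subseteq> {..<p}" "S \<subseteq> {..<p}" "R \<inter> S = {}" and B: "0 \<le> B"
  shows "(\<integral>A. gram_test q R S B A \<partial>G) = 0"
    "integrable G (\<lambda>A. (gram_test q R S B A)\<^sup>2)"
    "(\<integral>A. (gram_test q R S B A)\<^sup>2 \<partial>G) \<le> 2 * real (card S) * B"
proof -
  define c where "c j k A = (if gram_norm q R A \<le> B then gram_dev R A j k else 0)" for j k A
  have c_meas: "c j k \<in> borel_measurable (mat_space p q)" if "j < q" "k < q" for j k
    using that RS unfolding c_def by measurable
  \<comment> \<open>A crude bound that serves integrability: each squared entry is at most the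
    squared norm, hence at most B.\<close>
  have c_bound: "\<bar>c j k A\<bar> \<le> max 1 B" if "j < q" "k < q" for j k A
  proof (cases "gram_norm q R A \<le> B")
    case True
    have "(gram_dev R A j k)\<^sup>2 \<le> (\<Sum>k<q. (gram_dev R A j k)\<^sup>2)" by (rule member_le_sum) (use that in auto)
    also have "\<dots> \<le> gram_norm q R A" unfolding gram_norm_def
      by (rule member_le_sum[of j _ "\<lambda>j. \<Sum>k<q. (gram_dev R A j k)\<^sup>2"]) (use that in \<open>auto intro: sum_nonneg\<close>)
    finally have "\<bar>gram_dev R A j k\<bar>\<^sup>2 \<le> B" using True by simp
    show ?thesis
    proof (cases "\<bar>gram_dev R A j k\<bar> \<le> 1")
      case False
      then have "\<bar>gram_dev R A j k\<bar> * 1 \<le> \<bar>gram_dev R A j k\<bar> * \<bar>gram_dev R A j k\<bar>" by (intro mult_left_mono) auto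
      then show ?thesis using \<open>\<bar>gram_dev R A j k\<bar>\<^sup>2 \<le> B\<close> by (simp add: c_def power2_eq_square le_max_iff_disj)
    qed (simp add: c_def le_max_iff_disj)
  qed (simp add: c_def le_max_iff_disj)
  have ac: "all_moments (c j k)" if "j < q" "k < q" for j k
    by (rule all_moments_bounded[OF _ c_bound]) (use that c_meas in auto)
  have ag: "all_moments (\<lambda>A. gram_dev S A j k)" if "j < q" "k < q" for j k using that RS by auto
  have h: "gram_test q R S B A = (\<Sum>j<q. \<Sum>k<q. c j k A * gram_dev S A j k)" for A
    by (simp add: gram_test_def c_def)
  have c_cong: "c j k A = c j k A'" if "j < q" "k < q" "\<And>x. x \<in> R \<times> {..<q} \<Longrightarrow> A x = A' x" for j k A A'
    unfolding c_def using gram_norm_cong[of R q A A'] gram_dev_cong[of j q k R A A'] that by simp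
  have RSq: "R \<times> {..<q} \<subseteq> I" "S \<times> {..<q} \<subseteq> I" "(R \<times> {..<q}) \<inter> (S \<times> {..<q}) = {}" using RS by auto
  have "(\<integral>A. gram_test q R S B A \<partial>G) = (\<Sum>j<q. \<Sum>k<q. \<integral>A. c j k A * gram_dev S A j k \<partial>G)"
    unfolding h by (intro integral_sum2 all_moments_integrable all_moments_mult ac ag) auto
  also have "\<dots> = (\<Sum>j<q. \<Sum>k<q. (\<integral>A. c j k A \<partial>G) * (\<integral>A. gram_dev S A j k \<partial>G))"
  proof (intro sum.cong refl indep_disjoint_coords[OF RSq])
    fix j k assume "j \<in> {..<q}" "k \<in> {..<q}" 
    then show "integrable G (c j k)" "integrable G (\<lambda>A. gram_dev S A j k)"
      "c j k \<in> borel_measurable (mat_space p q)" "(\<lambda>A. gram_dev S A j k) \<in> borel_measurable (mat_space p q)"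
      using ac ag c_meas RS by (auto intro: all_moments_integrable)
  qed (auto intro: c_cong gram_dev_cong[of _ q])
  also have "\<dots> = 0" using gram_dev_mean[OF RS(2)] by simp
  finally show "(\<integral>A. gram_test q R S B A \<partial>G) = 0" .
  show "integrable G (\<lambda>A. (gram_test q R S B A)\<^sup>2)"
    unfolding h by (intro all_moments_integrable all_moments_power all_moments_sum all_moments_mult ac ag) auto
  have "(\<integral>A. (gram_test q R S B A)\<^sup>2 \<partial>G)
    = (\<integral>A. (\<Sum>j<q. \<Sum>j'<q. \<Sum>k<q. \<Sum>k'<q. (c j k A * c j' k' A) * (gram_dev S A j k * gram_dev S A j' k')) \<partial>G)"
    unfolding h power2_eq_square sum_product by (simp add: mult_ac)
  also have "\<dots> = (\<Sum>j<q. \<Sum>j'<q. \<integral>A. (\<Sum>k<q. \<Sum>k'<q. (c j k A * c j' k' A) * (gram_dev S A j k * gram_dev S A j' k')) \<partial>G)"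
    by (intro integral_sum2 all_moments_integrable all_moments_sum all_moments_mult ac ag) auto
  also have "\<dots> = (\<Sum>j<q. \<Sum>j'<q. \<Sum>k<q. \<Sum>k'<q. \<integral>A. (c j k A * c j' k' A) * (gram_dev S A j k * gram_dev S A j' k') \<partial>G)"
    by (intro sum.cong refl integral_sum2 all_moments_integrable all_moments_sum all_moments_mult ac ag) auto
  also have "\<dots> = (\<Sum>j<q. \<Sum>j'<q. \<Sum>k<q. \<Sum>k'<q. (\<integral>A. c j k A * c j' k' A \<partial>G) * (\<integral>A. gram_dev S A j k * gram_dev S A j' k' \<partial>G))"
  proof (intro sum.cong refl indep_disjoint_coords[OF RSq])
    fix j k j' k' assume n: "j \<in> {..<q}" "k \<in> {..<q}" "j' \<in> {..<q}" "k' \<in> {..<q}" 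
    then show "integrable G (\<lambda>A. c j k A * c j' k' A)" "integrable G (\<lambda>A. gram_dev S A j k * gram_dev S A j' k')"
      "(\<lambda>A. c j k A * c j' k' A) \<in> borel_measurable (mat_space p q)" "(\<lambda>A. gram_dev S A j k * gram_dev S A j' k') \<in> borel_measurable (mat_space p q)"
      using ac ag c_meas RS by (auto intro!: all_moments_integrable)
    fix A A' :: "nat \<times> nat \<Rightarrow> real"
    show "c j k A * c j' k' A = c j k A' * c j' k' A'" if "\<And>x. x \<in> R \<times> {..<q} \<Longrightarrow> A x = A' x"
      using c_cong[of j k A A'] c_cong[of j' k' A A'] n that by simp
    show "gram_dev S A j k * gram_dev S A j' k' = gram_dev S A' j k * gram_dev S A' j' k'" if "\<And>x. x \<in> S \<times> {..<q} \<Longrightarrow> A x = A' x"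
      using gram_dev_cong[of j q k S A A'] gram_dev_cong[of j' q k' S A A'] n that by simp
  qed
  also have "\<dots> = (\<Sum>j<q. \<Sum>j'<q. \<Sum>k<q. \<Sum>k'<q. real (card S) * (\<integral>A. c j k A * c j' k' A \<partial>G) * of_bool (k = k') * of_bool (j = j')
      + real (card S) * (\<integral>A. c j k A * c j' k' A \<partial>G) * of_bool (j = k') * of_bool (k = j'))"
    by (intro sum.cong refl) (subst gram_dev_cov[OF RS(2)], auto simp: algebra_simps)
  also have "\<dots> = (\<Sum>j<q. \<Sum>k<q. real (card S) * (\<integral>A. c j k A * c j k A \<partial>G)) + (\<Sum>j<q. \<Sum>k<q. real (card S) * (\<integral>A. c j k A * c k j A \<partial>G))"
  proof -
    have d: "(\<Sum>b<q. f b * (of_bool (a = b) :: real)) = f a" if "a < q" for a f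
      using that by (simp add: of_bool_def if_distrib[of "times _"] cong: if_cong)
    have 1: "(\<Sum>j<q. \<Sum>j'<q. \<Sum>k<q. \<Sum>k'<q. real (card S) * (\<integral>A. c j k A * c j' k' A \<partial>G) * of_bool (k = k') * of_bool (j = j'))
      = (\<Sum>j<q. \<Sum>k<q. real (card S) * (\<integral>A. c j k A * c j k A \<partial>G))"
    proof (rule sum.cong[OF refl])
      fix j assume j: "j \<in> {..<q}"
      have "(\<Sum>j'<q. \<Sum>k<q. \<Sum>k'<q. real (card S) * (\<integral>A. c j k A * c j' k' A \<partial>G) * of_bool (k = k') * of_bool (j = j'))
        = (\<Sum>j'<q. (\<Sum>k<q. \<Sum>k'<q. real (card S) * (\<integral>A. c j k A * c j' k' A \<partial>G) * of_bool (k = k')) * of_bool (j = j'))"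
        by (simp only: sum_distrib_right)
      also have "\<dots> = (\<Sum>k<q. \<Sum>k'<q. real (card S) * (\<integral>A. c j k A * c j k' A \<partial>G) * of_bool (k = k'))"
        by (rule d) (use j in simp)
      also have "\<dots> = (\<Sum>k<q. real (card S) * (\<integral>A. c j k A * c j k A \<partial>G))"
        by (intro sum.cong refl d) simp
      finally show "(\<Sum>j'<q. \<Sum>k<q. \<Sum>k'<q. real (card S) * (\<integral>A. c j k A * c j' k' A \<partial>G) * of_bool (k = k') * of_bool (j = j'))
        = (\<Sum>k<q. real (card S) * (\<integral>A. c j k A * c j k A \<partial>G))" .
    qed
    have 2: "(\<Sum>j<q. \<Sum>j'<q. \<Sum>k<q. \<Sum>k'<q. real (card S) * (\<integral>A. c j k A * c j' k' A \<partial>G) * of_bool (j = k') * of_bool (k = j'))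
      = (\<Sum>j<q. \<Sum>k<q. real (card S) * (\<integral>A. c j k A * c k j A \<partial>G))"
    proof (rule sum.cong[OF refl])
      fix j assume j: "j \<in> {..<q}"
      have "(\<Sum>j'<q. \<Sum>k<q. \<Sum>k'<q. real (card S) * (\<integral>A. c j k A * c j' k' A \<partial>G) * of_bool (j = k') * of_bool (k = j'))
        = (\<Sum>j'<q. \<Sum>k<q. (real (card S) * (\<integral>A. c j k A * c j' j A \<partial>G)) * of_bool (k = j'))"
        unfolding sum_distrib_right[symmetric] by (intro sum.cong refl arg_cong2[of _ _ _ _ "times"] d) (use j in simp)
      also have "\<dots> = (\<Sum>k<q. \<Sum>j'<q. (real (card S) * (\<integral>A. c j k A * c j' j A \<partial>G)) * of_bool (k = j'))" by (rule sum.swap)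
      also have "\<dots> = (\<Sum>k<q. real (card S) * (\<integral>A. c j k A * c k j A \<partial>G))"
        by (intro sum.cong refl d) simp
      finally show "(\<Sum>j'<q. \<Sum>k<q. \<Sum>k'<q. real (card S) * (\<integral>A. c j k A * c j' k' A \<partial>G) * of_bool (j = k') * of_bool (k = j'))
        = (\<Sum>k<q. real (card S) * (\<integral>A. c j k A * c k j A \<partial>G))" .
    qed
    show ?thesis by (simp only: sum.distrib 1 2)
  qed
  \<comment> \<open>\<open>c\<close> is a symmetric matrix, so the two pairings contribute
    equally.\<close>
  also have "\<dots> = 2 * real (card S) * (\<Sum>j<q. \<Sum>k<q. \<integral>A. (c j k A)\<^sup>2 \<partial>G)"
  proof -
    have "c k j = c j k" for j k by (rule ext) (simp add: c_def gram_dev_commute[of R _ k j])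
    then show ?thesis by (simp add: sum_distrib_left power2_eq_square mult.assoc)
  qed
  also have "(\<Sum>j<q. \<Sum>k<q. \<integral>A. (c j k A)\<^sup>2 \<partial>G) = (\<integral>A. (\<Sum>j<q. \<Sum>k<q. (c j k A)\<^sup>2) \<partial>G)"
    by (intro integral_sum2[symmetric] all_moments_integrable all_moments_power ac) auto
  also have "\<dots> \<le> (\<integral>A. B \<partial>G)"
  proof (rule integral_mono)
    show "integrable G (\<lambda>A. \<Sum>j<q. \<Sum>k<q. (c j k A)\<^sup>2)"
      by (intro all_moments_integrable all_moments_power all_moments_sum ac) auto
    fix A show "(\<Sum>j<q. \<Sum>k<q. (c j k A)\<^sup>2) \<le> B"
      using B by (cases "gram_norm q R A \<le> B") (simp_all add: c_def gram_norm_def)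
  qed simp
  also have "\<dots> = B" by (simp add: prob_space)
  finally show "(\<integral>A. (gram_test q R S B A)\<^sup>2 \<partial>G) \<le> 2 * real (card S) * B"
    by (simp add: mult_left_mono)
qed

end

section \<open>Conditioning on the first rows\<close>

text \<open>The block diagonal matrix with blocks I of order m and U. Multiplying by it from the
  left keeps the first m rows and mixes the others.\<close>

definition embed_tail :: "nat \<Rightarrow> nat \<Rightarrow> (nat \<times> nat \<Rightarrow> real) \<Rightarrow> (nat \<times> nat \<Rightarrow> real)" where
  "embed_tail m n U = (\<lambda>(i, j) \<in> sqidx n. if i < m \<or> j < m then of_bool (i = j) else U (i - m, j - m))"

lemma embed_tail_space [simp]: "embed_tail m n U \<in> space (mat_space n n)"
  by (simp add: embed_tail_def)

lemma measurable_embed_tail [measurable]: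
  "embed_tail m (m + N) \<in> measurable (mat_space N N) (mat_space (m + N) (m + N))"
proof (rule measurable_mat_spaceI)
  fix i j assume "i < m + N" "j < m + N"
  then show "(\<lambda>U. embed_tail m (m + N) U (i, j)) \<in> borel_measurable (mat_space N N)"
    by (cases "i < m \<or> j < m") (auto simp: embed_tail_def)
qed simp

lemma sum_lessThan_add:
  fixes f :: "nat \<Rightarrow> real"
  shows "(\<Sum>k<m + N. f k) = (\<Sum>k<m. f k) + (\<Sum>u<N. f (m + u))"
  by (induction N) simp_all

lemma embed_tail_mult:
  assumes "i < m + N" "j < m + N"
  shows "mat_mult (m + N) (embed_tail m (m + N) U) A (i, j) =
    (if i < m then A (i, j) else \<Sum>u<N. U (i - m, u) * A (m + u, j))"
proof (cases "i < m")
  case True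
  then have "mat_mult (m + N) (embed_tail m (m + N) U) A (i, j) = (\<Sum>k<m + N. if k = i then A (i, j) else 0)"
    using assms by (simp add: embed_tail_def)
  then show ?thesis using True assms by simp
next
  case False
  then have "mat_mult (m + N) (embed_tail m (m + N) U) A (i, j) =
      (\<Sum>k<m. embed_tail m (m + N) U (i, k) * A (k, j)) + (\<Sum>u<N. embed_tail m (m + N) U (i, m + u) * A (m + u, j))"
    using assms by (simp add: sum_lessThan_add)
  also have "(\<Sum>k<m. embed_tail m (m + N) U (i, k) * A (k, j)) = 0"
    using False assms by (intro sum.neutral) (auto simp: embed_tail_def)
  also have "(\<Sum>u<N. embed_tail m (m + N) U (i, m + u) * A (m + u, j)) = (\<Sum>u<N. U (i - m, u) * A (m + u, j))"
    using False assms by (intro sum.cong refl) (auto simp: embed_tail_def)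
  finally show ?thesis using False by simp
qed

lemma embed_tail_orthogonal:
  assumes U: "orthogonal_mat N U"
  shows "orthogonal_mat (m + N) (embed_tail m (m + N) U)"
  unfolding orthogonal_mat_def
proof (intro conjI allI impI)
  fix i j assume ij: "i < m + N" "j < m + N"
  have 1: "(\<Sum>k<m. embed_tail m (m + N) U (k, i) * embed_tail m (m + N) U (k, j)) = of_bool (i = j \<and> i < m)"
  proof -
    have "(\<Sum>k<m. embed_tail m (m + N) U (k, i) * embed_tail m (m + N) U (k, j)) = (\<Sum>k<m. if k = i then of_bool (i = j) else 0)"
      using ij by (intro sum.cong refl) (auto simp: embed_tail_def)
    then show ?thesis by simp
  qed
  have 2: "(\<Sum>u<N. embed_tail m (m + N) U (m + u, i) * embed_tail m (m + N) U (m + u, j)) = of_bool (i = j \<and> m \<le> i)"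
  proof (cases "m \<le> i \<and> m \<le> j")
    case True
    then have "(\<Sum>u<N. embed_tail m (m + N) U (m + u, i) * embed_tail m (m + N) U (m + u, j)) = (\<Sum>u<N. U (u, i - m) * U (u, j - m))"
      using ij by (intro sum.cong refl) (auto simp: embed_tail_def)
    also have "\<dots> = of_bool (i - m = j - m)" using True ij by (subst orthogonal_matD(2)[OF U]) auto
    finally show ?thesis using True by auto
  next
    case False
    then have "(\<Sum>u<N. embed_tail m (m + N) U (m + u, i) * embed_tail m (m + N) U (m + u, j)) = 0"
      using ij by (intro sum.neutral) (auto simp: embed_tail_def)
    then show ?thesis using False by auto
  qed
  show "(\<Sum>k<m + N. embed_tail m (m + N) U (k, i) * embed_tail m (m + N) U (k, j)) = (if i = j then 1 else 0)"
    unfolding sum_lessThan_add 1 2 by auto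
qed simp

lemma scaled_block_apply [simp]: "i < p \<Longrightarrow> j < q \<Longrightarrow> scaled_block n p q A (i, j) = sqrt (real n) * A (i, j)"
  by (simp add: scaled_block_def)

lemma scaled_block_measurable [measurable]:
  "p \<le> n \<Longrightarrow> q \<le> n \<Longrightarrow> scaled_block n p q \<in> measurable (mat_space n n) (mat_space p q)"
  by (rule measurable_mat_spaceI) (auto simp: scaled_block_def[abs_def])

text \<open>Some columns of an orthogonal matrix form an isometry, and dropping rows can only
  shorten the image.\<close>

lemma orthogonal_contraction:
  assumes A: "orthogonal_mat (m + N) A" and q: "q \<le> m + N"
  shows "(\<Sum>u<N. (\<Sum>j<q. A (m + u, j) * y j)\<^sup>2) \<le> (\<Sum>j<q. (y j)\<^sup>2)"
proof -
  have "(\<Sum>u<N. (\<Sum>j<q. A (m + u, j) * y j)\<^sup>2) \<le> (\<Sum>k<m + N. (\<Sum>j<q. A (k, j) * y j)\<^sup>2)"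
    unfolding sum_lessThan_add by (simp add: sum_nonneg)
  also have "\<dots> = (\<Sum>k<m + N. \<Sum>i<q. \<Sum>j<q. y i * y j * (A (k, i) * A (k, j)))"
    unfolding power2_eq_square sum_product by (simp add: mult_ac)
  also have "\<dots> = (\<Sum>i<q. \<Sum>j<q. y i * y j * (\<Sum>k<m + N. A (k, i) * A (k, j)))"
    unfolding sum_distrib_left by (subst sum.swap) (intro sum.cong refl sum.swap)
  also have "\<dots> = (\<Sum>i<q. \<Sum>j<q. if j = i then y i * y i else 0)"
    using q by (intro sum.cong refl) (simp add: orthogonal_matD(2)[OF A])
  also have "\<dots> = (\<Sum>j<q. (y j)\<^sup>2)" by (simp add: power2_eq_square)
  finally show ?thesis .
qed

lemma (in haar) prob_mat_space [simp]: "prob (space (mat_space n n)) = 1"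
  using prob_space by simp

context haar_rows begin

text \<open>Here H is the Haar measure on O(n), acting on the last n rows of a fixed orthogonal matrix A
  of size m + n, and r is the number of those rows that enter the statistic.\<close>

lemma conditional_moments:
  assumes A: "orthogonal_mat (m + n) A" and q: "q \<le> m + n" and n: "2 \<le> n" "m \<le> n"
  defines "X \<equiv> \<lambda>U. scaled_block (m + n) (m + r) q (mat_mult (m + n) (embed_tail m (m + n) U) A)"
    and "Q \<equiv> gram_norm q {..<m} (scaled_block (m + n) (m + r) q A)"
  shows "gram_norm q {..<m} (X U) = Q"
    "(\<integral>U. (\<Sum>j<q. \<Sum>k<q. gram_dev {..<m} (X U) j k * gram_dev {m..<m + r} (X U) j k) \<partial>H) = - (real r / real n) * Q"
    "(\<integral>U. (\<Sum>j<q. \<Sum>k<q. gram_dev {..<m} (X U) j k * gram_dev {m..<m + r} (X U) j k)\<^sup>2 \<partial>H)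
      \<le> (real r / real n)\<^sup>2 * Q\<^sup>2 + 8 * real r * Q"
proof -
  define D where "D = gram_dev {..<m} (scaled_block (m + n) (m + r) q A)"
  \<comment> \<open>With A' for the last n rows and first q columns of A and D for the deviation of
    the first group, M = A' D A'^T. The statistic becomes s tr (M P) - r tr D, an affine function of
    the random projection P.\<close>
  define M where "M u v = (\<Sum>j<q. A (m + u, j) * (\<Sum>k<q. A (m + v, k) * D j k))" for u v
  define s where "s = real (m + n)"
  have D_sym: "D j k = D k j" for j k unfolding D_def by (rule gram_dev_commute)
  have s0: "sqrt s * sqrt s = s" by (simp add: s_def)
  have X1: "X U (i, j) = scaled_block (m + n) (m + r) q A (i, j)" if "i < m" "j < q" for U i j
    using that q by (simp add: X_def embed_tail_mult del: mat_mult_apply)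
  show Qeq: "gram_norm q {..<m} (X U) = Q" for U
    unfolding Q_def by (rule gram_norm_cong) (auto intro: X1)
  have Deq: "gram_dev {..<m} (X U) j k = D j k" if "j < q" "k < q" for U j k
    unfolding D_def by (rule gram_dev_cong[OF that]) (auto intro: X1)
  have X2: "X U (m + l, j) = sqrt s * (\<Sum>u<n. U (l, u) * A (m + u, j))" if "l < r" "j < q" for U l j
    using that q r by (simp add: X_def embed_tail_mult s_def del: mat_mult_apply)
  have S: "gram_dev {m..<m + r} (X U) j k = s * (\<Sum>u<n. \<Sum>v<n. A (m + u, j) * A (m + v, k) * P U u v) - real r * of_bool (j = k)"
    if "j < q" "k < q" for U j k
  proof -
    have "gram_dev {m..<m + r} (X U) j k = (\<Sum>l<r. X U (m + l, j) * X U (m + l, k) - of_bool (j = k))"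
      unfolding gram_dev_def by (rule sum.reindex_bij_witness[of _ "\<lambda>l. m + l" "\<lambda>i. i - m"]) auto
    also have "\<dots> = (\<Sum>l<r. s * (\<Sum>u<n. \<Sum>v<n. A (m + u, j) * A (m + v, k) * (U (l, u) * U (l, v))) - of_bool (j = k))"
    proof (intro sum.cong refl)
      fix l assume "l \<in> {..<r}"
      then have "X U (m + l, j) * X U (m + l, k) = (sqrt s * sqrt s) * ((\<Sum>u<n. U (l, u) * A (m + u, j)) * (\<Sum>v<n. U (l, v) * A (m + v, k)))"
        using that by (simp add: X2)
      also have "\<dots> = s * (\<Sum>u<n. \<Sum>v<n. A (m + u, j) * A (m + v, k) * (U (l, u) * U (l, v)))"
        unfolding s0 sum_product by (simp add: mult_ac)
      finally show "X U (m + l, j) * X U (m + l, k) - of_bool (j = k) = s * (\<Sum>u<n. \<Sum>v<n. A (m + u, j) * A (m + v, k) * (U (l, u) * U (l, v))) - of_bool (j = k)"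
        by simp
    qed
    also have "\<dots> = s * (\<Sum>l<r. \<Sum>u<n. \<Sum>v<n. A (m + u, j) * A (m + v, k) * (U (l, u) * U (l, v))) - real r * of_bool (j = k)"
      by (simp add: sum_subtractf sum_distrib_left[symmetric])
    also have "(\<Sum>l<r. \<Sum>u<n. \<Sum>v<n. A (m + u, j) * A (m + v, k) * (U (l, u) * U (l, v))) = (\<Sum>u<n. \<Sum>v<n. A (m + u, j) * A (m + v, k) * P U u v)"
      unfolding P_def sum_distrib_left by (subst sum.swap) (intro sum.cong refl sum.swap)
    finally show ?thesis .
  qed
  define trD where "trD = (\<Sum>j<q. D j j)"
  have T: "(\<Sum>j<q. \<Sum>k<q. gram_dev {..<m} (X U) j k * gram_dev {m..<m + r} (X U) j k) = s * (\<Sum>u<n. \<Sum>v<n. M u v * P U u v) - real r * trD" for U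
  proof -
    have "(\<Sum>j<q. \<Sum>k<q. gram_dev {..<m} (X U) j k * gram_dev {m..<m + r} (X U) j k) =
       (\<Sum>j<q. \<Sum>k<q. s * (\<Sum>u<n. \<Sum>v<n. A (m + u, j) * (A (m + v, k) * D j k) * P U u v) - real r * (D j k * of_bool (j = k)))"
      by (intro sum.cong refl) (simp add: Deq S right_diff_distrib sum_distrib_left mult_ac)
    also have "\<dots> = s * (\<Sum>j<q. \<Sum>k<q. \<Sum>u<n. \<Sum>v<n. A (m + u, j) * (A (m + v, k) * D j k) * P U u v) - real r * (\<Sum>j<q. \<Sum>k<q. D j k * of_bool (j = k))"
      by (simp only: sum_subtractf sum_distrib_left)
    also have "(\<Sum>j<q. \<Sum>k<q. D j k * of_bool (j = k)) = trD"
      unfolding trD_def by (intro sum.cong refl) (simp add: of_bool_def if_distrib[of "times _"] cong: if_cong)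
    also have "(\<Sum>j<q. \<Sum>k<q. \<Sum>u<n. \<Sum>v<n. A (m + u, j) * (A (m + v, k) * D j k) * P U u v)
      = (\<Sum>j<q. \<Sum>u<n. \<Sum>k<q. \<Sum>v<n. A (m + u, j) * (A (m + v, k) * D j k) * P U u v)"
      by (intro sum.cong refl sum.swap)
    also have "\<dots> = (\<Sum>j<q. \<Sum>u<n. \<Sum>v<n. \<Sum>k<q. A (m + u, j) * (A (m + v, k) * D j k) * P U u v)"
      by (intro sum.cong refl sum.swap)
    also have "\<dots> = (\<Sum>u<n. \<Sum>j<q. \<Sum>v<n. \<Sum>k<q. A (m + u, j) * (A (m + v, k) * D j k) * P U u v)"
      by (rule sum.swap)
    also have "\<dots> = (\<Sum>u<n. \<Sum>v<n. \<Sum>j<q. \<Sum>k<q. A (m + u, j) * (A (m + v, k) * D j k) * P U u v)"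
      by (intro sum.cong refl sum.swap)
    also have "\<dots> = (\<Sum>u<n. \<Sum>v<n. M u v * P U u v)"
      by (intro sum.cong refl) (simp add: M_def sum_distrib_left sum_distrib_right)
    finally show ?thesis .
  qed
  have M_sym: "M u v = M v u" for u v
  proof -
    have "M u v = (\<Sum>j<q. \<Sum>k<q. A (m + u, j) * (A (m + v, k) * D j k))" by (simp add: M_def sum_distrib_left)
    also have "\<dots> = (\<Sum>k<q. \<Sum>j<q. A (m + v, k) * (A (m + u, j) * D k j))"
      by (subst sum.swap) (intro sum.cong refl, simp add: D_sym[of _ k] mult_ac, metis D_sym)
    also have "\<dots> = M v u" by (simp add: M_def sum_distrib_left)
    finally show ?thesis .
  qed
  have Q: "Q = (\<Sum>j<q. \<Sum>k<q. (D j k)\<^sup>2)" by (simp add: Q_def gram_norm_def D_def)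
  \<comment> \<open>Source of the negative correlation: the columns of A are orthonormal, so the
    scaled Gram matrix of the last n rows is n I - D, and an excess in the first rows is a deficit
    in the others.\<close>
  have C: "s * (\<Sum>u<n. A (m + u, j) * A (m + u, k)) = real n * of_bool (j = k) - D j k" if "j < q" "k < q" for j k
  proof -
    have "s * of_bool (j = k) = s * (\<Sum>i<m + n. A (i, j) * A (i, k))"
      using that q orthogonal_matD(2)[OF A, of j k] by simp
    also have "\<dots> = s * (\<Sum>i<m. A (i, j) * A (i, k)) + s * (\<Sum>u<n. A (m + u, j) * A (m + u, k))"
      by (simp only: sum_lessThan_add distrib_left)
    also have "s * (\<Sum>i<m. A (i, j) * A (i, k)) = D j k + real m * of_bool (j = k)"
    proof -
      have "D j k = (\<Sum>i<m. (sqrt s * sqrt s) * (A (i, j) * A (i, k)) - of_bool (j = k))"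
        unfolding D_def gram_dev_def by (intro sum.cong refl) (use that in \<open>simp add: s_def mult_ac\<close>)
      then show ?thesis unfolding s0 by (simp add: sum_subtractf sum_distrib_left)
    qed
    finally show ?thesis by (simp add: s_def algebra_simps)
  qed
  \<comment> \<open>Pairing D with n I - D gives n tr D - Q. In the mean of the statistic the trace
    of D cancels, and only the multiple of -Q remains.\<close>
  have trM: "s * (\<Sum>u<n. M u u) = real n * trD - Q"
  proof -
    have "(\<Sum>u<n. M u u) = (\<Sum>u<n. \<Sum>j<q. \<Sum>k<q. D j k * (A (m + u, j) * A (m + u, k)))"
      unfolding M_def by (simp add: sum_distrib_left mult_ac)
    also have "\<dots> = (\<Sum>j<q. \<Sum>u<n. \<Sum>k<q. D j k * (A (m + u, j) * A (m + u, k)))" by (rule sum.swap)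
    also have "\<dots> = (\<Sum>j<q. \<Sum>k<q. \<Sum>u<n. D j k * (A (m + u, j) * A (m + u, k)))"
      by (intro sum.cong refl sum.swap)
    finally have "(\<Sum>u<n. M u u) = (\<Sum>j<q. \<Sum>k<q. \<Sum>u<n. D j k * (A (m + u, j) * A (m + u, k)))" .
    then have "s * (\<Sum>u<n. M u u) = (\<Sum>j<q. \<Sum>k<q. D j k * (s * (\<Sum>u<n. A (m + u, j) * A (m + u, k))))"
      by (simp add: sum_distrib_left mult_ac)
    also have "\<dots> = (\<Sum>j<q. \<Sum>k<q. real n * (D j k * of_bool (j = k)) - (D j k)\<^sup>2)"
      by (intro sum.cong refl) (subst C, auto simp: algebra_simps power2_eq_square)
    also have "\<dots> = real n * (\<Sum>j<q. \<Sum>k<q. D j k * of_bool (j = k)) - Q"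
      unfolding Q by (simp only: sum_subtractf sum_distrib_left)
    also have "(\<Sum>j<q. \<Sum>k<q. D j k * of_bool (j = k)) = trD"
      unfolding trD_def by (intro sum.cong refl) (simp add: of_bool_def if_distrib[of "times _"] cong: if_cong)
    finally show ?thesis .
  qed
  \<comment> \<open>The contraction A' acts on both sides of D, so the contraction lemma is applied
    once for each side.\<close>
  have MQ: "(\<Sum>u<n. \<Sum>v<n. (M u v)\<^sup>2) \<le> Q"
  proof -
    have "(\<Sum>u<n. \<Sum>v<n. (M u v)\<^sup>2) = (\<Sum>v<n. \<Sum>u<n. (M u v)\<^sup>2)" by (rule sum.swap)
    also have "\<dots> \<le> (\<Sum>v<n. \<Sum>j<q. (\<Sum>k<q. A (m + v, k) * D j k)\<^sup>2)"
      unfolding M_def by (intro sum_mono orthogonal_contraction[OF A q])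
    also have "\<dots> = (\<Sum>j<q. \<Sum>v<n. (\<Sum>k<q. A (m + v, k) * D j k)\<^sup>2)" by (rule sum.swap)
    also have "\<dots> \<le> Q"
      unfolding Q by (intro sum_mono orthogonal_contraction[OF A q])
    finally show ?thesis .
  qed
  have n0: "real n > 0" using n by simp
  let ?Y = "\<lambda>U. \<Sum>u<n. \<Sum>v<n. M u v * P U u v"
  have iY: "integrable H ?Y" by (intro Bochner_Integration.integrable_sum integrable_mult_right P_integrable) auto
  have iY2: "integrable H (\<lambda>U. (?Y U)\<^sup>2)"
  proof -
    have "(\<lambda>U. (?Y U)\<^sup>2) = (\<lambda>U. \<Sum>a<n. \<Sum>c<n. \<Sum>b<n. \<Sum>d<n. M a b * M c d * (P U a b * P U c d))"
      by (simp add: power2_eq_square sum_product mult_ac)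
    then show ?thesis by (simp only:) (intro Bochner_Integration.integrable_sum integrable_mult_right PP_integrable; simp)
  qed
  have EY: "s * (\<integral>U. ?Y U \<partial>H) = real r * trD - real r / real n * Q"
  proof -
    have "s * (\<integral>U. ?Y U \<partial>H) = real r / real n * (s * (\<Sum>u<n. M u u))" unfolding quad_mean[OF n(1)] by simp
    then show ?thesis unfolding trM using n0 by (simp add: field_simps)
  qed
  show "(\<integral>U. (\<Sum>j<q. \<Sum>k<q. gram_dev {..<m} (X U) j k * gram_dev {m..<m + r} (X U) j k) \<partial>H) = - (real r / real n) * Q"
    unfolding T using iY EY by simp
  have Q0: "Q \<ge> 0" unfolding Q_def by (rule gram_norm_nonneg)
  have "(\<integral>U. (s * ?Y U - real r * trD)\<^sup>2 \<partial>H) = (\<integral>U. s\<^sup>2 * (?Y U)\<^sup>2 - 2 * real r * trD * (s * ?Y U) + (real r * trD)\<^sup>2 \<partial>H)"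
    by (intro Bochner_Integration.integral_cong refl) (simp add: power2_eq_square algebra_simps)
  also have "\<dots> = s\<^sup>2 * (\<integral>U. (?Y U)\<^sup>2 \<partial>H) - 2 * real r * trD * (s * (\<integral>U. ?Y U \<partial>H)) + (real r * trD)\<^sup>2"
    using iY iY2 prob_space by simp
  also have "\<dots> \<le> s\<^sup>2 * ((real r / real n)\<^sup>2 * (\<Sum>u<n. M u u)\<^sup>2 + 2 * (real r / (real n)\<^sup>2) * Q) - 2 * real r * trD * (s * (\<integral>U. ?Y U \<partial>H)) + (real r * trD)\<^sup>2"
  proof -
    have "(\<integral>U. (?Y U)\<^sup>2 \<partial>H) \<le> (real r / real n)\<^sup>2 * (\<Sum>u<n. M u u)\<^sup>2 + 2 * (real r / (real n)\<^sup>2) * (\<Sum>u<n. \<Sum>v<n. (M u v)\<^sup>2)"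
      by (rule quad_second_moment[OF n(1) M_sym])
    also have "\<dots> \<le> (real r / real n)\<^sup>2 * (\<Sum>u<n. M u u)\<^sup>2 + 2 * (real r / (real n)\<^sup>2) * Q"
      using MQ by (intro add_mono mult_left_mono) auto
    finally show ?thesis by (simp add: mult_left_mono)
  qed
  also have "\<dots> = (real r / real n * (s * (\<Sum>u<n. M u u)) - real r * trD)\<^sup>2 + 2 * (s / real n)\<^sup>2 * real r * Q"
  proof -
    have "s * (\<integral>U. ?Y U \<partial>H) = real r / real n * (s * (\<Sum>u<n. M u u))" unfolding quad_mean[OF n(1)] by simp
    then show ?thesis by (simp only:) (simp add: power2_eq_square algebra_simps)
  qed
  also have "real r / real n * (s * (\<Sum>u<n. M u u)) - real r * trD = - (real r / real n * Q)"
    unfolding trM using n0 by (simp add: field_simps)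
  \<comment> \<open>Since m \<le> n, s = m + n is at most 2 n; this produces the constant 2 * 2^2 =
    8.\<close>
  also have "(- (real r / real n * Q))\<^sup>2 + 2 * (s / real n)\<^sup>2 * real r * Q \<le> (real r / real n)\<^sup>2 * Q\<^sup>2 + 2 * 2\<^sup>2 * real r * Q"
  proof (intro add_mono mult_right_mono mult_left_mono power_mono Q0)
    show "s / real n \<le> 2" using n n0 by (simp add: s_def field_simps)
  qed (auto simp: s_def power_mult_distrib power_divide)
  finally show "(\<integral>U. (\<Sum>j<q. \<Sum>k<q. gram_dev {..<m} (X U) j k * gram_dev {m..<m + r} (X U) j k)\<^sup>2 \<partial>H)
      \<le> (real r / real n)\<^sup>2 * Q\<^sup>2 + 8 * real r * Q"
    unfolding T by simp
qed

end

section \<open>The lower bound\<close>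

context haar begin

text \<open>Left invariance holds for every fixed \<open>embed_tail m n U\<close>. Averaging over U
  and exchanging the integrals amounts to rotating the last N rows of A by an independent Haar
  matrix, which plays the part of conditioning on the first m rows.\<close>

lemma tail_average:
  fixes F :: "_ \<Rightarrow> real"
  assumes n: "n = m + N" and H': "is_haar_orthogonal N H'"
    and [measurable]: "F \<in> borel_measurable (mat_space n n)"
    and R: "\<And>A. orthogonal_mat n A \<Longrightarrow> \<bar>F A\<bar> \<le> R"
  shows "integrable H (\<lambda>A. \<integral>U. F (mat_mult n (embed_tail m n U) A) \<partial>H')"
    and "(\<integral>A. F A \<partial>H) = (\<integral>A. (\<integral>U. F (mat_mult n (embed_tail m n U) A) \<partial>H') \<partial>H)"
proof -
  interpret U: haar N H' using H' by unfold_locales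
  interpret HU: pair_prob_space H H' ..
  have [measurable]: "embed_tail m n \<in> measurable (mat_space N N) (mat_space n n)"
    unfolding n by measurable
  \<comment> \<open>\<open>F\<close> is bounded on orthogonal matrices only. Clipping it at height R
    makes it bounded everywhere, so that Fubini applies on the product of the two measures, and
    changes nothing almost everywhere.\<close>
  define F' where "F' A = max (- R) (min R (F A))" for A
  have [measurable]: "F' \<in> borel_measurable (mat_space n n)" unfolding F'_def by measurable
  have FF: "F' A = F A" if "orthogonal_mat n A" for A using R[OF that] by (auto simp: F'_def)
  have F'R: "\<bar>F' A\<bar> \<le> \<bar>R\<bar>" for A by (auto simp: F'_def)
  let ?G = "\<lambda>A. \<integral>U. F' (mat_mult n (embed_tail m n U) A) \<partial>H'"
  have emb: "orthogonal_mat n (embed_tail m n U)" if "orthogonal_mat N U" for U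
    using embed_tail_orthogonal[OF that, of m] n by simp
  have G: "(\<integral>U. F (mat_mult n (embed_tail m n U) A) \<partial>H') = ?G A" if A: "orthogonal_mat n A" for A
  proof (rule integral_cong_AE)
    have [measurable]: "A \<in> space (mat_space n n)" using A by (rule orthogonal_matD)
    show "(\<lambda>U. F (mat_mult n (embed_tail m n U) A)) \<in> borel_measurable H'"
      "(\<lambda>U. F' (mat_mult n (embed_tail m n U) A)) \<in> borel_measurable H'" by measurable
    show "AE U in H'. F (mat_mult n (embed_tail m n U) A) = F' (mat_mult n (embed_tail m n U) A)"
      using U.AE_orth by eventually_elim (simp add: FF emb orthogonal_mult A)
  qed
  have G_meas [measurable]: "(\<lambda>A. \<integral>U. F (mat_mult n (embed_tail m n U) A) \<partial>H') \<in> borel_measurable H"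
    by (rule U.borel_measurable_lebesgue_integral) (simp, measurable)
  have G'_meas [measurable]: "?G \<in> borel_measurable H"
    by (rule U.borel_measurable_lebesgue_integral) (simp, measurable)
  have int: "integrable (H \<Otimes>\<^sub>M H') (\<lambda>(A, U). F' (mat_mult n (embed_tail m n U) A))"
    by (rule HU.integrable_const_bound[of _ "\<bar>R\<bar>"]) (use F'R in \<open>auto simp: case_prod_unfold\<close>)
  have "integrable H ?G" using HU.integrable_fst'[OF int] by simp
  then show "integrable H (\<lambda>A. \<integral>U. F (mat_mult n (embed_tail m n U) A) \<partial>H')"
    by (rule integrable_cong_AE_imp[OF _ G_meas]) (use AE_orth G in \<open>auto elim!: eventually_mono\<close>)
  have "(\<integral>A. F A \<partial>H) = (\<integral>A. F' A \<partial>H)"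
    by (rule integral_cong_AE) (use AE_orth FF in \<open>auto elim!: eventually_mono\<close>)
  also have "\<dots> = (\<integral>U. (\<integral>A. F' A \<partial>H) \<partial>H')" using U.prob_space by simp
  also have "\<dots> = (\<integral>U. (\<integral>A. F' (mat_mult n (embed_tail m n U) A) \<partial>H) \<partial>H')"
  proof (rule integral_cong_AE)
    show "(\<lambda>U. \<integral>A. F' (mat_mult n (embed_tail m n U) A) \<partial>H) \<in> borel_measurable H'"
      by (rule borel_measurable_lebesgue_integral) (simp, measurable)
    show "AE U in H'. (\<integral>A. F' A \<partial>H) = (\<integral>A. F' (mat_mult n (embed_tail m n U) A) \<partial>H)"
      using U.AE_orth by eventually_elim (subst int_left, auto intro: emb)
  qed simp
  also have "\<dots> = (\<integral>A. ?G A \<partial>H)" by (rule HU.Fubini_integral[OF int])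
  also have "\<dots> = (\<integral>A. (\<integral>U. F (mat_mult n (embed_tail m n U) A) \<partial>H') \<partial>H)"
    by (rule integral_cong_AE) (use AE_orth G in \<open>auto elim!: eventually_mono\<close>)
  finally show "(\<integral>A. F A \<partial>H) = (\<integral>A. (\<integral>U. F (mat_mult n (embed_tail m n U) A) \<partial>H') \<partial>H)" .
qed

text \<open>Supplies the boundedness on orthogonal matrices that \<open>tail_average\<close> asks
  for; the value of the bound does not enter any estimate.\<close>

lemma gram_test_bounded:
  assumes "p \<le> n" "q \<le> n" "R \<subseteq> {..<p}" "S \<subseteq> {..<p}"
  shows "\<exists>K. \<forall>A. orthogonal_mat n A \<longrightarrow> \<bar>gram_test q R S B (scaled_block n p q A)\<bar> \<le> K"
proof -
  define b where "b T = real (card T) * (real n + 1)" for T :: "nat set"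
  have dev: "\<bar>gram_dev T (scaled_block n p q A) j k\<bar> \<le> b T" if A: "orthogonal_mat n A" and "T \<subseteq> {..<p}" "j < q" "k < q" for T A j k
  proof -
    have y: "\<bar>y\<bar> \<le> real n \<Longrightarrow> \<bar>y - of_bool b\<bar> \<le> real n + 1" for y b by (cases b) auto
    have "\<bar>gram_dev T (scaled_block n p q A) j k\<bar> \<le> (\<Sum>i\<in>T. real n + 1)"
      unfolding gram_dev_def
    proof (rule order_trans[OF sum_abs sum_mono])
      fix i assume "i \<in> T"
      then have i: "i < p" using that by auto
      have "\<bar>A (i, j) * A (i, k)\<bar> \<le> 1"
        using mult_mono[OF orthogonal_mat_bound[OF A, of i j] orthogonal_mat_bound[OF A, of i k]] i that assms by (simp add: abs_mult)
      then have "real n * \<bar>A (i, j) * A (i, k)\<bar> \<le> real n * 1" by (intro mult_left_mono) auto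
      moreover have "scaled_block n p q A (i, j) * scaled_block n p q A (i, k) = (sqrt (real n) * sqrt (real n)) * (A (i, j) * A (i, k))"
        using i that by (simp add: mult_ac)
      then have "\<bar>scaled_block n p q A (i, j) * scaled_block n p q A (i, k)\<bar> = real n * \<bar>A (i, j) * A (i, k)\<bar>"
        by (simp add: abs_mult)
      ultimately show "\<bar>scaled_block n p q A (i, j) * scaled_block n p q A (i, k) - of_bool (j = k)\<bar> \<le> real n + 1"
        using y by simp
    qed
    then show ?thesis by (simp add: b_def)
  qed
  have "\<bar>gram_test q R S B (scaled_block n p q A)\<bar> \<le> (\<Sum>j<q. \<Sum>k<q. b R * b S)" if A: "orthogonal_mat n A" for A
  proof -
    have b0: "0 \<le> b T" for T by (simp add: b_def)
    have "\<bar>gram_test q R S B (scaled_block n p q A)\<bar> \<le> \<bar>\<Sum>j<q. \<Sum>k<q. gram_dev R (scaled_block n p q A) j k * gram_dev S (scaled_block n p q A) j k\<bar>"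
      by (simp add: gram_test_def)
    also have "\<dots> \<le> (\<Sum>j<q. \<Sum>k<q. b R * b S)"
      by (intro order_trans[OF sum_abs] sum_mono) (use dev[OF A] assms b0 in \<open>auto simp: abs_mult intro!: mult_mono\<close>)
    finally show ?thesis .
  qed
  then show ?thesis by blast
qed

text \<open>Mixing the last N rows leaves the first group, hence the truncation, unchanged. So
  \<open>conditional_moments\<close> applies to each A with \<open>Q A\<close> fixed, and its
  conclusions are integrated over A.\<close>

lemma gram_test_haar:
  assumes n: "n = m + N" "2 \<le> N" "m \<le> N" and H': "is_haar_orthogonal N H'" and r: "r \<le> N" and q: "q \<le> n" and B: "0 \<le> B"
  defines "h \<equiv> \<lambda>A. gram_test q {..<m} {m..<m + r} B (scaled_block n (m + r) q A)"
    and "Q \<equiv> \<lambda>A. gram_norm q {..<m} (scaled_block n (m + r) q A)"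
  shows "(\<integral>A. h A \<partial>H) = - (real r / real N) * (\<integral>A. (if Q A \<le> B then Q A else 0) \<partial>H)"
    and "integrable H (\<lambda>A. (h A)\<^sup>2)"
    and "(\<integral>A. (h A)\<^sup>2 \<partial>H) \<le> (real r / real N)\<^sup>2 * B\<^sup>2 + 8 * real r * B"
proof -
  interpret U: haar_rows N H' r using H' r by unfold_locales
  have pr: "m + r \<le> n" using n r by simp
  have [measurable]: "h \<in> borel_measurable (mat_space n n)"
    unfolding h_def by (rule measurable_compose[OF scaled_block_measurable[OF pr q] gram_test_measurable]) auto
  have [measurable]: "Q \<in> borel_measurable (mat_space n n)"
    unfolding Q_def by (rule measurable_compose[OF scaled_block_measurable[OF pr q] gram_norm_measurable]) auto
  obtain K where K: "\<And>A. orthogonal_mat n A \<Longrightarrow> \<bar>h A\<bar> \<le> K"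
    using gram_test_bounded[OF pr q, of "{..<m}" "{m..<m + r}" B] unfolding h_def by force
  have K2: "\<bar>(h A)\<^sup>2\<bar> \<le> K\<^sup>2" if "orthogonal_mat n A" for A
    using power_mono[OF K[OF that], of 2] by simp
  have Q0: "0 \<le> Q A" for A unfolding Q_def by (rule gram_norm_nonneg)
  let ?G = "\<lambda>A U. mat_mult n (embed_tail m n U) A"
  have q': "q \<le> m + N" using q n by simp
  have one: "(\<integral>U. h (?G A U) \<partial>H') = - (real r / real N) * (if Q A \<le> B then Q A else 0)"
    "(\<integral>U. (h (?G A U))\<^sup>2 \<partial>H') \<le> (real r / real N)\<^sup>2 * B\<^sup>2 + 8 * real r * B" if A: "orthogonal_mat n A" for A
  proof -
    have QA: "gram_norm q {..<m} (scaled_block n (m + r) q A) = Q A" by (simp add: Q_def)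
    note cm = U.conditional_moments[OF A[unfolded n(1)] q' n(2,3), folded n(1), unfolded QA]
    have h: "h (?G A U) = (if Q A \<le> B then \<Sum>j<q. \<Sum>k<q. gram_dev {..<m} (scaled_block n (m + r) q (?G A U)) j k *
         gram_dev {m..<m + r} (scaled_block n (m + r) q (?G A U)) j k else 0)" for U
      unfolding h_def gram_test_def cm(1) ..
    show "(\<integral>U. h (?G A U) \<partial>H') = - (real r / real N) * (if Q A \<le> B then Q A else 0)"
      unfolding h using cm(2) by auto
    show "(\<integral>U. (h (?G A U))\<^sup>2 \<partial>H') \<le> (real r / real N)\<^sup>2 * B\<^sup>2 + 8 * real r * B"
    proof (cases "Q A \<le> B")
      case True
      have "(\<integral>U. (h (?G A U))\<^sup>2 \<partial>H') \<le> (real r / real N)\<^sup>2 * (Q A)\<^sup>2 + 8 * real r * Q A"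
        unfolding h using cm(3) True by simp
      also have "\<dots> \<le> (real r / real N)\<^sup>2 * B\<^sup>2 + 8 * real r * B"
        using True Q0 by (intro add_mono mult_left_mono power_mono) auto
      finally show ?thesis .
    next
      case False
      then show ?thesis unfolding h using B by simp
    qed
  qed
  have "(\<integral>A. h A \<partial>H) = (\<integral>A. (\<integral>U. h (?G A U) \<partial>H') \<partial>H)"
    by (rule tail_average(2)[OF n(1) H' _ K]) auto
  also have "\<dots> = (\<integral>A. - (real r / real N) * (if Q A \<le> B then Q A else 0) \<partial>H)"
  proof (rule integral_cong_AE)
    show "(\<lambda>A. \<integral>U. h (?G A U) \<partial>H') \<in> borel_measurable H"
      by (rule borel_measurable_integrable, rule tail_average(1)[OF n(1) H' _ K]) auto
    show "AE A in H. (\<integral>U. h (?G A U) \<partial>H') = - (real r / real N) * (if Q A \<le> B then Q A else 0)"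
      using AE_orth by eventually_elim (rule one)
  qed measurable
  also have "\<dots> = - (real r / real N) * (\<integral>A. (if Q A \<le> B then Q A else 0) \<partial>H)"
    by (rule Bochner_Integration.integral_mult_right_zero)
  finally show "(\<integral>A. h A \<partial>H) = - (real r / real N) * (\<integral>A. (if Q A \<le> B then Q A else 0) \<partial>H)" .
  show "integrable H (\<lambda>A. (h A)\<^sup>2)" by (rule integrable_bounded[OF _ K2]) measurable
  have "(\<integral>A. (h A)\<^sup>2 \<partial>H) = (\<integral>A. (\<integral>U. (h (?G A U))\<^sup>2 \<partial>H') \<partial>H)"
    by (rule tail_average(2)[OF n(1) H' _ K2]) measurable
  also have "\<dots> \<le> (\<integral>A. (real r / real N)\<^sup>2 * B\<^sup>2 + 8 * real r * B \<partial>H)"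
  proof (rule integral_mono_AE)
    show "integrable H (\<lambda>A. \<integral>U. (h (?G A U))\<^sup>2 \<partial>H')"
      by (rule tail_average(1)[OF n(1) H' _ K2]) measurable
    show "AE A in H. (\<integral>U. (h (?G A U))\<^sup>2 \<partial>H') \<le> (real r / real N)\<^sup>2 * B\<^sup>2 + 8 * real r * B"
      using AE_orth by eventually_elim (rule one)
  qed simp
  also have "\<dots> = (real r / real N)\<^sup>2 * B\<^sup>2 + 8 * real r * B" using prob_space by simp
  finally show "(\<integral>A. (h A)\<^sup>2 \<partial>H) \<le> (real r / real N)\<^sup>2 * B\<^sup>2 + 8 * real r * B" .
qed

lemma block_prob_pair:
  assumes "p \<le> n" "q \<le> n" "0 < p" "0 < q"
  shows "prob_pair (distr H (mat_space p q) (scaled_block n p q)) (gauss_mat p q)"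
proof -
  interpret G: gauss p q using assms by unfold_locales
  have "prob_space (distr H (mat_space p q) (scaled_block n p q))"
    by (rule prob_space_distr) (use assms in measurable)
  then show ?thesis using G.prob_G
    by (intro prob_pair.intro prob_pair_axioms.intro) auto
qed

text \<open>The test function has mean 0 for the Gaussian law and a mean of order -\<beta> for the
  Haar measure, while both second moments are at most V, which is of order \<beta>^2 when pq / n
  stays away from 0. Either total variation exceeds 1 / 480, or the truncated mean survives the
  passage from the Gaussian law to the block.\<close>

lemma tv_lower_bound:
  assumes H': "\<And>N. N \<ge> 1 \<Longrightarrow> \<exists>H'. is_haar_orthogonal N H'"
    and p: "2 \<le> p" "p \<le> n" and q: "1 \<le> q" "q \<le> n" and n: "4 \<le> n"
    and \<rho>: "0 < \<rho>" "\<rho> \<le> (real (p * q) / real n)\<^sup>2 / 8"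
  shows "min (1 / 480) (1 / (256 * (960 / \<rho> + 14400))) \<le> tv_dist (distr H (mat_space p q) (scaled_block n p q)) (gauss_mat p q)"
    (is "_ \<le> ?tv")
proof -
  \<comment> \<open>The first group of rows is the smaller half, so at least n / 2 rows remain to be
    randomised and m \<le> N holds.\<close>
  define m where "m = p div 2"
  define r where "r = p - m"
  define N where "N = n - m"
  have mr: "p = m + r" "0 < m" "m \<le> r" "r \<le> N" "m \<le> N" "2 \<le> N" "n = m + N" "2 * N \<ge> n"
    using p n by (auto simp: m_def r_def N_def)
  interpret G: gauss p q using p q by unfold_locales auto
  interpret pp: prob_pair "distr H (mat_space p q) (scaled_block n p q)" "gauss_mat p q"
    using block_prob_pair[of p q] p q by simp
  obtain H' where HN: "is_haar_orthogonal N H'" using H'[of N] mr by auto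
  define w where "w = real m * real q * (real q + 1)"
  have w0: "w > 0" unfolding w_def using mr q by (intro mult_pos_pos) auto
  define B where "B = 120 * w"
  have B0: "B \<ge> 0" using w0 by (simp add: B_def)
  let ?h = "gram_test q {..<m} {m..<p} B" and ?Q = "gram_norm q {..<m}"
  let ?t = "\<lambda>A. if ?Q A \<le> B then ?Q A else 0"
  have mp: "{..<m} \<subseteq> {..<p}" "{m..<p} \<subseteq> {..<p}" "{..<m} \<inter> {m..<p} = {}" using mr by auto
  note [measurable] = gram_test_measurable[OF mp(1,2)] gram_norm_measurable[OF mp(1)] scaled_block_measurable[OF p(2) q(2)]
  note hh = gram_test_haar[OF mr(7,6,5) HN mr(4) q(2) B0, folded mr(1)]
  define \<beta> where "\<beta> = real r / real N * w"
  \<comment> \<open>The Haar second moment at truncation height B = 120 w: 8 r B = 960 r w and (r /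
    N)^2 B^2 = 14400 \<beta>^2.\<close>
  define V where "V = 960 * (real r * w) + 14400 * \<beta>\<^sup>2"
  have rw0: "real r * w > 0" using w0 mr by simp
  have \<beta>0: "\<beta> > 0" unfolding \<beta>_def using w0 mr by (intro mult_pos_pos divide_pos_pos) auto
  have EM: "integral\<^sup>L (distr H (mat_space p q) (scaled_block n p q)) ?h = - (real r / real N) * integral\<^sup>L (distr H (mat_space p q) (scaled_block n p q)) ?t"
    using hh(1) by (subst (1 2) integral_distr) auto
  have EN: "integral\<^sup>L (gauss_mat p q) ?h = 0" by (rule G.gram_test_gauss(1)[OF mp B0])
  have M2: "integrable (distr H (mat_space p q) (scaled_block n p q)) (\<lambda>A. (?h A)\<^sup>2)"
    using hh(2) by (subst integrable_distr_eq) auto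
  have MV: "(\<integral>A. (?h A)\<^sup>2 \<partial>distr H (mat_space p q) (scaled_block n p q)) \<le> V"
  proof -
    have "(\<integral>A. (?h A)\<^sup>2 \<partial>distr H (mat_space p q) (scaled_block n p q)) \<le> (real r / real N)\<^sup>2 * B\<^sup>2 + 8 * real r * B"
      using hh(3) by (subst integral_distr) auto
    also have "\<dots> = V" by (simp add: V_def B_def \<beta>_def power_mult_distrib power_divide)
    finally show ?thesis .
  qed
  have NV: "(\<integral>A. (?h A)\<^sup>2 \<partial>gauss_mat p q) \<le> V"
  proof -
    have "(\<integral>A. (?h A)\<^sup>2 \<partial>gauss_mat p q) \<le> 2 * real (card {m..<p}) * B" by (rule G.gram_test_gauss(3)[OF mp B0])
    also have "\<dots> = 240 * (real r * w)" using mr by (simp add: B_def)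
    also have "\<dots> \<le> V" unfolding V_def using rw0 zero_le_power2[of \<beta>] by linarith
    finally show ?thesis .
  qed
  have tN: "w / 2 \<le> integral\<^sup>L (gauss_mat p q) ?t"
    unfolding B_def by (rule G.gram_norm_truncated) (use mr w_def in auto)
  have tdiff: "\<bar>integral\<^sup>L (distr H (mat_space p q) (scaled_block n p q)) ?t - integral\<^sup>L (gauss_mat p q) ?t\<bar> \<le> B * ?tv"
    by (rule pp.expectation_diff_le) (use B0 in \<open>auto simp: gram_norm_nonneg abs_of_nonneg\<close>)
  show ?thesis
  proof (cases "?tv \<le> 1 / 480")
    case False then show ?thesis by simp
  next
    case True
    \<comment> \<open>Origin of 1 / 480: it makes the transfer error 120 w / 480 half of the
      Gaussian truncated mean w / 2.\<close>
    have "B * ?tv \<le> w / 4" using mult_left_mono[OF True B0] by (simp add: B_def)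
    then have tM: "w / 4 \<le> integral\<^sup>L (distr H (mat_space p q) (scaled_block n p q)) ?t" using tN tdiff by linarith
    have V0: "V > 0" using rw0 by (simp add: V_def add_pos_nonneg)
    have "\<beta> / 4 = real r / real N * (w / 4)" by (simp add: \<beta>_def)
    also have "\<dots> \<le> real r / real N * integral\<^sup>L (distr H (mat_space p q) (scaled_block n p q)) ?t"
      by (rule mult_left_mono[OF tM]) simp
    also have "\<dots> = \<bar>integral\<^sup>L (distr H (mat_space p q) (scaled_block n p q)) ?h - integral\<^sup>L (gauss_mat p q) ?h\<bar>"
      unfolding EM EN using tM w0 by (simp add: abs_mult)
    \<comment> \<open>The truncation height 16 V / \<beta> makes the second error term \<beta> / 8,
      half of the difference of means established so far.\<close>
    also have "\<dots> \<le> 16 * V / \<beta> * ?tv + 2 * V / (16 * V / \<beta>)"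
      by (rule pp.test_function_bound) (use M2 MV NV V0 \<beta>0 G.gram_test_gauss(2)[OF mp B0] in auto)
    finally have "\<beta> / 4 \<le> 16 * V / \<beta> * ?tv + \<beta> / 8" using V0 \<beta>0 by simp
    then have "\<beta>\<^sup>2 \<le> 128 * V * ?tv" using \<beta>0 by (simp add: field_simps power2_eq_square)
    then have 1: "\<beta>\<^sup>2 / (128 * V) \<le> ?tv" using V0 by (simp add: field_simps)
    have N2: "\<beta>\<^sup>2 \<ge> \<rho> * (real r * w)"
    proof -
      \<comment> \<open>The worst cases are p = 3 for the smaller half and even p for the larger
        one. They give p^2 \<le> 6 m r, which explains the 8 in the hypothesis on \<rho>.\<close>
      have "p \<le> 3 * m" "p \<le> 2 * r" using p by (auto simp: m_def r_def)
      then have "real p * real p \<le> (3 * real m) * (2 * real r)" by (intro mult_mono) (auto simp flip: of_nat_mult)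
      moreover have "0 \<le> real m * real r" by simp
      ultimately have pm: "real p * real p / 8 \<le> real m * real r" by linarith
      have "\<rho> * (real n * real n) \<le> ((real (p * q) / real n)\<^sup>2 / 8) * (real n * real n)"
        using \<rho> by (intro mult_right_mono) auto
      also have "\<dots> = (real p * real p / 8) * (real q * real q)" using n by (simp add: power2_eq_square field_simps)
      also have "\<dots> \<le> (real m * real r) * (real q * (real q + 1))"
        by (rule mult_mono[OF pm]) (auto intro: mult_left_mono)
      also have "\<dots> = real r * w" by (simp add: w_def)
      finally have a: "\<rho> * (real n * real n) \<le> real r * w" .
      have "\<rho> * (real N * real N) \<le> \<rho> * (real n * real n)" using \<rho> mr by (intro mult_left_mono mult_mono) auto
      then have "\<rho> * (real N * real N) \<le> real r * w" using a by simp
      then have "\<rho> * (real N * real N) * (real r * w) \<le> real r * w * (real r * w)" using rw0 by (intro mult_right_mono) auto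
      moreover have "real N > 0" using mr by simp
      moreover have "\<beta>\<^sup>2 = (real r * w * (real r * w)) / (real N * real N)" by (simp add: \<beta>_def power2_eq_square)
      ultimately show ?thesis by (simp add: pos_le_divide_eq mult_ac)
    qed
    have "V \<le> (960 / \<rho> + 14400) * \<beta>\<^sup>2"
      using N2 \<rho> by (simp add: V_def field_simps)
    then have "128 * V \<le> 256 * (960 / \<rho> + 14400) * \<beta>\<^sup>2" unfolding mult.assoc using V0 by linarith
    then have "\<beta>\<^sup>2 / (256 * (960 / \<rho> + 14400) * \<beta>\<^sup>2) \<le> \<beta>\<^sup>2 / (128 * V)"
      using V0 \<beta>0 by (intro divide_left_mono) auto
    then have "1 / (256 * (960 / \<rho> + 14400)) \<le> \<beta>\<^sup>2 / (128 * V)" using \<beta>0 by simp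
    then show ?thesis using 1 by linarith
  qed
qed

end

section \<open>Exchanging rows and columns of the block\<close>

lemma (in prob_pair) tv_distr_le:
  assumes [measurable]: "f \<in> measurable M K"
  shows "tv_dist (distr M K f) (distr N K f) \<le> tv_dist M N"
proof -
  have [measurable]: "f \<in> measurable N K" using assms sets_eq by (simp cong: measurable_cong_sets)
  interpret D: prob_pair "distr M K f" "distr N K f"
    by (intro prob_pair.intro prob_pair_axioms.intro M.prob_space_distr N.prob_space_distr) auto
  have "tv_dist (distr M K f) (distr N K f) \<le> 2 * (tv_dist M N / 2)"
  proof (rule D.tv_least)
    fix A assume "A \<in> sets (distr M K f)"
    then have A: "A \<in> sets K" by simp
    have "measure (distr N K f) A = measure N (f -` A \<inter> space M)"
      using A space_eq by (simp add: measure_distr)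
    then show "\<bar>measure (distr M K f) A - measure (distr N K f) A\<bar> \<le> tv_dist M N / 2"
      using A tv_upper[of "f -` A \<inter> space M"] by (simp add: measure_distr)
  qed
  then show ?thesis by simp
qed

definition block_transpose :: "nat \<Rightarrow> nat \<Rightarrow> (nat \<times> nat \<Rightarrow> real) \<Rightarrow> (nat \<times> nat \<Rightarrow> real)" where
  "block_transpose p q A = (\<lambda>(i, j) \<in> {..<p} \<times> {..<q}. A (j, i))"

lemma block_transpose_measurable [measurable]:
  "block_transpose p q \<in> measurable (mat_space q p) (mat_space p q)"
  by (rule measurable_mat_spaceI) (auto simp: block_transpose_def[abs_def])

lemma gauss_mat_transpose: "distr (gauss_mat q p) (mat_space p q) (block_transpose p q) = gauss_mat p q"
proof -
  have "gauss_mat p q = distr (gauss_mat q p) (gauss_mat p q) (\<lambda>\<omega>. \<lambda>x\<in>{..<p} \<times> {..<q}. \<omega> (prod.swap x))"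
    unfolding gauss_mat_def
    by (subst distr_PiM_reindex[where f = prod.swap]) (auto simp: prob_space_normal_density)
  also have "\<dots> = distr (gauss_mat q p) (mat_space p q) (block_transpose p q)"
    by (rule distr_cong) (auto simp: block_transpose_def gauss_mat_def mat_space_def intro!: sets_PiM_cong)
  finally show ?thesis ..
qed

context haar begin

lemma block_transpose_distr:
  assumes "p \<le> n" "q \<le> n"
  shows "distr (distr H (mat_space q p) (scaled_block n q p)) (mat_space p q) (block_transpose p q)
    = distr H (mat_space p q) (scaled_block n p q)"
proof -
  note [measurable] = scaled_block_measurable[of p n q] scaled_block_measurable[of q n p]
  have "distr (distr H (mat_space q p) (scaled_block n q p)) (mat_space p q) (block_transpose p q)
    = distr H (mat_space p q) (block_transpose p q \<circ> scaled_block n q p)"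
    by (rule distr_distr) (use assms in measurable)
  also have "\<dots> = distr H (mat_space p q) (scaled_block n p q \<circ> mat_transpose n)"
  proof (rule distr_cong[OF refl refl])
    fix A show "(block_transpose p q \<circ> scaled_block n q p) A = (scaled_block n p q \<circ> mat_transpose n) A"
      using assms by (auto simp: block_transpose_def scaled_block_def fun_eq_iff)
  qed
  also have "\<dots> = distr (distr H H (mat_transpose n)) (mat_space p q) (scaled_block n p q)"
    by (rule distr_distr[symmetric]) (use assms in measurable)
  finally show ?thesis by (simp add: distr_transpose)
qed

lemma tv_transpose_le:
  assumes "p \<le> n" "q \<le> n" "0 < p" "0 < q"
  shows "tv_dist (distr H (mat_space p q) (scaled_block n p q)) (gauss_mat p q)
    \<le> tv_dist (distr H (mat_space q p) (scaled_block n q p)) (gauss_mat q p)"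
proof -
  interpret pp: prob_pair "distr H (mat_space q p) (scaled_block n q p)" "gauss_mat q p"
    using block_prob_pair[of q p] assms by simp
  show ?thesis
    using pp.tv_distr_le[of "block_transpose p q" "mat_space p q"] assms
    by (simp add: block_transpose_distr gauss_mat_transpose)
qed

text \<open>A single row cannot be split into two groups. If p = 1 then q \<ge> 2, and the
  transposed block is used; transposition preserves both laws.\<close>

lemma tv_lower_bound':
  assumes H': "\<And>N. N \<ge> 1 \<Longrightarrow> \<exists>H'. is_haar_orthogonal N H'"
    and p: "1 \<le> p" "p \<le> n" and q: "1 \<le> q" "q \<le> n" and pq: "2 \<le> p * q" and n: "4 \<le> n"
    and \<rho>: "0 < \<rho>" "\<rho> \<le> (real (p * q) / real n)\<^sup>2 / 8"
  shows "min (1 / 480) (1 / (256 * (960 / \<rho> + 14400))) \<le> tv_dist (distr H (mat_space p q) (scaled_block n p q)) (gauss_mat p q)"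
proof (cases "2 \<le> p")
  case True
  show ?thesis by (rule tv_lower_bound[OF H' True p(2) q n \<rho>])
next
  case False
  then have q2: "2 \<le> q" using pq p by (cases "p = 1") auto
  have "min (1 / 480) (1 / (256 * (960 / \<rho> + 14400))) \<le> tv_dist (distr H (mat_space q p) (scaled_block n q p)) (gauss_mat q p)"
    by (rule tv_lower_bound[OF H' q2 q(2) p n \<rho>(1)]) (use \<rho> in \<open>simp_all add: mult.commute\<close>)
  also have "\<dots> \<le> tv_dist (distr H (mat_space p q) (scaled_block n p q)) (gauss_mat p q)"
    by (rule tv_transpose_le) (use p q in auto)
  finally show ?thesis .
qed

end

section \<open>Independent coordinates for the Haar measure\<close>

text \<open>The block diagonal matrix with blocks U and 1: it embeds O(k) in O(k + 1) as the
  stabiliser of the last basis vector.\<close>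

definition embed_head :: "nat \<Rightarrow> (nat \<times> nat \<Rightarrow> real) \<Rightarrow> (nat \<times> nat \<Rightarrow> real)" where
  "embed_head k U = (\<lambda>(i, j) \<in> sqidx (Suc k). if i < k \<and> j < k then U (i, j) else of_bool (i = j))"

lemma embed_head_space [simp]: "embed_head k U \<in> space (mat_space (Suc k) (Suc k))"
  by (simp add: embed_head_def)

lemma embed_head_apply:
  "i < Suc k \<Longrightarrow> j < Suc k \<Longrightarrow> embed_head k U (i, j) = (if i < k \<and> j < k then U (i, j) else of_bool (i = j))"
  by (simp add: embed_head_def)

lemma measurable_embed_head [measurable]:
  "embed_head k \<in> measurable (mat_space k k) (mat_space (Suc k) (Suc k))"
proof (rule measurable_mat_spaceI)
  fix i j assume "i < Suc k" "j < Suc k"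
  then have e: "(\<lambda>U. embed_head k U (i, j)) = (\<lambda>U. if i < k \<and> j < k then U (i, j) else of_bool (i = j))"
    by (intro ext embed_head_apply)
  show "(\<lambda>U. embed_head k U (i, j)) \<in> borel_measurable (mat_space k k)"
  proof (cases "i < k \<and> j < k")
    case True
    then show ?thesis unfolding e by simp
  next
    case False
    then show ?thesis unfolding e if_not_P[OF False] by simp
  qed
qed simp

lemma embed_head_mult_left:
  assumes "i < Suc k" "j < Suc k"
  shows "mat_mult (Suc k) (embed_head k U) A (i, j) = (if i < k then \<Sum>u<k. U (i, u) * A (u, j) else A (k, j))"
proof (cases "i < k")
  case True
  then have "(\<Sum>u<k. embed_head k U (i, u) * A (u, j)) = (\<Sum>u<k. U (i, u) * A (u, j))"
    using assms by (intro sum.cong refl) (simp add: embed_head_apply)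
  then show ?thesis using True assms by (simp add: embed_head_apply)
next
  case False
  then have "(\<Sum>u<k. embed_head k U (i, u) * A (u, j)) = 0"
    using assms by (intro sum.neutral) (auto simp: embed_head_apply)
  then show ?thesis using False assms by (simp add: embed_head_apply)
qed

lemma embed_head_mult_right:
  assumes "i < Suc k" "j < Suc k"
  shows "mat_mult (Suc k) A (embed_head k U) (i, j) = (if j < k then \<Sum>u<k. A (i, u) * U (u, j) else A (i, k))"
proof (cases "j < k")
  case True
  then have "(\<Sum>u<k. A (i, u) * embed_head k U (u, j)) = (\<Sum>u<k. A (i, u) * U (u, j))"
    using assms by (intro sum.cong refl) (simp add: embed_head_apply)
  then show ?thesis using True assms by (simp add: embed_head_apply)
next
  case False
  then have "(\<Sum>u<k. A (i, u) * embed_head k U (u, j)) = 0"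
    using assms by (intro sum.neutral) (auto simp: embed_head_apply)
  then show ?thesis using False assms by (simp add: embed_head_apply)
qed

lemma embed_head_mult: "mat_mult (Suc k) (embed_head k U) (embed_head k V) = embed_head k (mat_mult k U V)"
proof (rule mat_space_eqI[of _ "Suc k" "Suc k"])
  fix i j assume ij: "i < Suc k" "j < Suc k"
  show "mat_mult (Suc k) (embed_head k U) (embed_head k V) (i, j) = embed_head k (mat_mult k U V) (i, j)"
  proof (cases "i < k \<and> j < k")
    case True
    then have "(\<Sum>u<k. U (i, u) * embed_head k V (u, j)) = (\<Sum>u<k. U (i, u) * V (u, j))"
      by (intro sum.cong refl) (simp add: embed_head_apply)
    then show ?thesis using True by (simp add: embed_head_mult_left embed_head_apply del: mat_mult_apply) simp
  next
    case False
    have "(\<Sum>u<k. U (i, u) * embed_head k V (u, j)) = 0" if "i < k" "j = k"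
      using that by (intro sum.neutral) (auto simp: embed_head_apply)
    then show ?thesis using False ij by (auto simp: embed_head_mult_left embed_head_apply simp del: mat_mult_apply)
  qed
qed simp_all

lemma embed_head_transpose: "mat_transpose (Suc k) (embed_head k U) = embed_head k (mat_transpose k U)"
  by (rule mat_space_eqI[of _ "Suc k" "Suc k"]) (auto simp: embed_head_apply)

lemma embed_head_orthogonal:
  assumes U: "orthogonal_mat k U"
  shows "orthogonal_mat (Suc k) (embed_head k U)"
  unfolding orthogonal_mat_iff embed_head_transpose embed_head_mult
  using U[unfolded orthogonal_mat_iff] by (auto simp: embed_head_apply simp del: mat_mult_apply)

text \<open>Rows are unit vectors too, so an entry 1 in the corner forces the rest of the last row
  to vanish.\<close>

lemma orthogonal_fixing_last:
  assumes B: "orthogonal_mat (Suc k) B" and last: "\<And>i. i \<le> k \<Longrightarrow> B (i, k) = of_bool (i = k)"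
  shows "\<exists>U. orthogonal_mat k U \<and> B = embed_head k U"
proof (intro exI conjI)
  let ?U = "\<lambda>(i, j) \<in> sqidx k. B (i, j)"
  have row: "B (k, j) = 0" if "j < k" for j
  proof -
    have "(\<Sum>j<Suc k. B (k, j) * B (k, j)) = 1" using orthogonal_mat_rows[OF B, of k k] by simp
    then have "(\<Sum>j<k. B (k, j) * B (k, j)) = 0" using last[of k] by simp
    then have "\<forall>j\<in>{..<k}. B (k, j) * B (k, j) = 0" by (subst (asm) sum_nonneg_eq_0_iff) auto
    then show ?thesis using that by simp
  qed
  show "B = embed_head k ?U"
  proof (rule mat_space_eqI[of _ "Suc k" "Suc k"])
    fix i j assume "i < Suc k" "j < Suc k"
    then show "B (i, j) = embed_head k ?U (i, j)"
      using row[of j] last[of i] by (auto simp: embed_head_apply less_Suc_eq)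
  qed (use orthogonal_matD(1)[OF B] in auto)
  show "orthogonal_mat k ?U"
    unfolding orthogonal_mat_def
  proof (intro conjI allI impI)
    fix i j assume ij: "i < k" "j < k"
    have "(\<Sum>l<k. ?U (l, i) * ?U (l, j)) = (\<Sum>l<Suc k. B (l, i) * B (l, j))" using ij row by simp
    also have "\<dots> = (if i = j then 1 else 0)" by (rule orthogonal_matD(2)[OF B]) (use ij in auto)
    finally show "(\<Sum>l<k. ?U (l, i) * ?U (l, j)) = (if i = j then 1 else 0)" .
  qed simp
qed

text \<open>The Householder reflection exchanging u and the last basis vector.\<close>

lemma orthogonal_with_last_column:
  assumes u: "(\<Sum>i<Suc k. u i * u i) = (1::real)"
  shows "\<exists>A. orthogonal_mat (Suc k) A \<and> (\<forall>i<Suc k. A (i, k) = u i)"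
\<comment> \<open>The reflection direction u - e_k vanishes when u is itself the last basis vector;
  the identity matrix serves then. Otherwise its squared length W is 2 - 2 u_k.\<close>
proof (cases "u k = 1")
  case True
  then have "(\<Sum>i<k. u i * u i) = 0" using u by simp
  then have "\<forall>i\<in>{..<k}. u i * u i = 0" by (subst (asm) sum_nonneg_eq_0_iff) auto
  then have u0: "u i = of_bool (i = k)" if "i < Suc k" for i using that True by (auto simp: less_Suc_eq)
  let ?A = "\<lambda>(i, j) \<in> sqidx (Suc k). of_bool (i = j) :: real"
  have "orthogonal_mat (Suc k) ?A"
    unfolding orthogonal_mat_def by (auto simp: of_bool_def if_distrib[of "times _"] if_distrib[of "\<lambda>x. x * _"] sum.delta simp del: sum.lessThan_Suc cong: if_cong)
  then show ?thesis using u0 by (intro exI[of _ ?A]) auto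
next
  case False
  define w where "w i = u i - of_bool (i = k)" for i
  define W where "W = (\<Sum>i<Suc k. w i * w i)"
  have "W = (\<Sum>i<Suc k. u i * u i - 2 * (u i * of_bool (i = k)) + of_bool (i = k))"
    unfolding W_def w_def by (intro sum.cong refl) (auto simp: algebra_simps)
  also have "\<dots> = 2 - 2 * u k"
    unfolding sum.distrib sum_subtractf u sum_distrib_left[symmetric] by simp
  finally have W: "W = 2 - 2 * u k" .
  then have W0: "W \<noteq> 0" using False by simp
  let ?A = "\<lambda>(i, j) \<in> sqidx (Suc k). of_bool (i = j) - 2 / W * w i * w j"
  have "orthogonal_mat (Suc k) ?A"
    unfolding orthogonal_mat_def
  proof (intro conjI allI impI)
    fix i j assume ij: "i < Suc k" "j < Suc k"
    have "(\<Sum>l<Suc k. ?A (l, i) * ?A (l, j)) = (\<Sum>l<Suc k. of_bool (l = j) * of_bool (l = i)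
        - 2 / W * w j * (w l * of_bool (l = i)) - 2 / W * w i * (w l * of_bool (l = j)) + (2 / W)\<^sup>2 * w i * w j * (w l * w l))"
      using ij by (intro sum.cong refl) (simp add: power2_eq_square algebra_simps)
    also have "\<dots> = of_bool (i = j) - 2 / W * w j * w i - 2 / W * w i * w j + (2 / W)\<^sup>2 * w i * w j * W"
    proof -
      have d: "(\<Sum>l<Suc k. f l * of_bool (l = i)) = f i" if "i < Suc k" for f :: "nat \<Rightarrow> real" and i
        using that by (simp add: of_bool_def if_distrib[of "times _"] del: sum.lessThan_Suc cong: if_cong)
      show ?thesis
        unfolding sum.distrib sum_subtractf sum_distrib_left[symmetric] W_def[symmetric] d[OF ij(1)] d[OF ij(2)] by simp
    qed
    also have "\<dots> = (if i = j then 1 else 0)" using W0 by (simp add: power2_eq_square field_simps)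
    finally show "(\<Sum>l<Suc k. ?A (l, i) * ?A (l, j)) = (if i = j then 1 else 0)" .
  qed simp
  moreover have "?A (i, k) = u i" if "i < Suc k" for i
  proof -
    have "2 / W * w k = -1" using W0 by (simp add: w_def W field_simps)
    then have "2 / W * w i * w k = - w i" by (metis mult.assoc mult.commute mult_minus1)
    then show ?thesis using that by (simp add: w_def)
  qed
  ultimately show ?thesis by (intro exI[of _ ?A]) auto
qed

lemma plane_rot_space [simp]: "plane_rot n u v c s \<in> space (mat_space n n)"
  by (simp add: plane_rot_def)

text \<open>The rotation of the last two coordinates with cosine t and nonnegative sine; the sign of
  the sine can be moved into the neighbouring factors from O(k).\<close>

abbreviation last_rot :: "nat \<Rightarrow> real \<Rightarrow> nat \<times> nat \<Rightarrow> real" where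
  "last_rot k t \<equiv> plane_rot (Suc k) (k - Suc 0) k t (sqrt (1 - t * t))"

text \<open>The double coset decomposition of O(k + 1) by O(k). The factor A is chosen so that the
  product with the rotation has the same last column as G; the remaining quotient fixes the last
  basis vector and hence lies in O(k).\<close>

lemma orthogonal_corner_decomposition:
  assumes G: "orthogonal_mat (Suc k) G" and k: "1 \<le> k"
  shows "\<exists>A B. orthogonal_mat k A \<and> orthogonal_mat k B \<and>
    G = mat_mult (Suc k) (mat_mult (Suc k) (embed_head k A) (last_rot k (G (k, k)))) (embed_head k B)"
proof -
  define t where "t = G (k, k)"
  define s where "s = sqrt (1 - t * t)"
  have "(\<Sum>i<Suc k. G (i, k) * G (i, k)) = 1" using orthogonal_matD(2)[OF G, of k k] by simp
  then have rest: "(\<Sum>i<k. G (i, k) * G (i, k)) = 1 - t * t" by (simp add: t_def)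
  moreover have "0 \<le> (\<Sum>i<k. G (i, k) * G (i, k))" by (intro sum_nonneg) simp
  ultimately have "0 \<le> 1 - t * t" by linarith
  then have s: "s * s = 1 - t * t" by (simp add: s_def)
  \<comment> \<open>The direction of the last column above the corner. If that part vanishes, any
    unit vector will do, for instance the first basis vector.\<close>
  obtain u where u: "(\<Sum>i<k. u i * u i) = (1::real)" "\<And>i. i < k \<Longrightarrow> G (i, k) = s * u i"
  proof (cases "s = 0")
    case True
    have "(\<Sum>i<k. G (i, k) * G (i, k)) = 0" using rest s True by simp
    then have "\<forall>i\<in>{..<k}. G (i, k) * G (i, k) = 0" by (subst (asm) sum_nonneg_eq_0_iff) auto
    then have "\<And>i. i < k \<Longrightarrow> G (i, k) = s * of_bool (i = 0)" using True by simp
    moreover have "(\<Sum>i<k. of_bool (i = 0) * of_bool (i = 0)) = (\<Sum>i<k. if i = 0 then 1 else 0 :: real)"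
      by (intro sum.cong) auto
    then have "(\<Sum>i<k. of_bool (i = 0) * of_bool (i = 0)) = (1::real)" using k by simp
    ultimately show ?thesis by (rule that[rotated])
  next
    case False
    have "(\<Sum>i<k. G (i, k) / s * (G (i, k) / s)) = (\<Sum>i<k. G (i, k) * G (i, k)) / (s * s)"
      by (simp add: sum_divide_distrib)
    also have "\<dots> = 1" unfolding rest s[symmetric] using False by simp
    finally show ?thesis using False by (intro that[of "\<lambda>i. G (i, k) / s"]) auto
  qed
  obtain k' where k': "k = Suc k'" using k by (cases k) auto
  obtain A where A: "orthogonal_mat k A" "\<And>i. i < k \<Longrightarrow> A (i, k - 1) = u i"
    using orthogonal_with_last_column[of u k'] u(1) k' by auto
  have R: "orthogonal_mat (Suc k) (last_rot k t)"
    unfolding s_def[symmetric] by (rule plane_rot_orthogonal) (use k s in linarith)+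
  have Rk: "last_rot k t (v, k) = (if v = k - 1 then s else if v = k then t else 0)" if "v < Suc k" for v
    unfolding s_def[symmetric] using that k by (cases k) (auto simp: plane_rot_def)
  let ?E = "mat_mult (Suc k) (embed_head k A) (last_rot k t)"
  have E: "orthogonal_mat (Suc k) ?E" by (rule orthogonal_mult[OF embed_head_orthogonal[OF A(1)] R])
  have Ek: "?E (i, k) = G (i, k)" if "i < Suc k" for i
  proof (cases "i < k")
    case True
    have "?E (i, k) = (\<Sum>u<k. A (i, u) * last_rot k t (u, k))"
      using True by (subst embed_head_mult_left) auto
    also have "\<dots> = (\<Sum>u<k. if u = k - 1 then A (i, k - 1) * s else 0)"
      by (intro sum.cong refl) (use k in \<open>simp add: Rk\<close>)
    also have "\<dots> = A (i, k - 1) * s" using k by simp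
    also have "\<dots> = G (i, k)" unfolding A(2)[OF True] u(2)[OF True] by (rule mult.commute)
    finally show ?thesis .
  next
    case False
    then have "i = k" using that by simp
    then have "?E (i, k) = last_rot k t (k, k)" by (subst embed_head_mult_left) auto
    also have "\<dots> = G (i, k)" using k \<open>i = k\<close> by (subst Rk) (auto simp: t_def)
    finally show ?thesis .
  qed
  let ?B = "mat_mult (Suc k) (mat_transpose (Suc k) ?E) G"
  have "orthogonal_mat (Suc k) ?B" by (rule orthogonal_mult[OF orthogonal_transpose[OF E] G])
  moreover have "?B (i, k) = of_bool (i = k)" if "i \<le> k" for i
  proof -
    have "?B (i, k) = (\<Sum>l<Suc k. mat_transpose (Suc k) ?E (i, l) * G (l, k))"
      using that by (intro mat_mult_apply) auto
    also have "\<dots> = (\<Sum>l<Suc k. ?E (l, i) * ?E (l, k))"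
      using that by (intro sum.cong refl arg_cong2[of _ _ _ _ "times"] mat_transpose_apply Ek[symmetric]) auto
    also have "\<dots> = (if i = k then 1 else 0)" by (rule orthogonal_matD(2)[OF E]) (use that in auto)
    also have "\<dots> = of_bool (i = k)" by simp
    finally show ?thesis .
  qed
  ultimately obtain B where B: "orthogonal_mat k B" "?B = embed_head k B"
    using orthogonal_fixing_last by blast
  have "G = mat_mult (Suc k) ?E ?B" using orthogonal_transpose_mult(2)[OF E orthogonal_matD(1)[OF G]] by simp
  also have "\<dots> = mat_mult (Suc k) ?E (embed_head k B)" by (simp only: B(2))
  finally show ?thesis unfolding t_def[symmetric] by (intro exI[of _ A] exI[of _ B] conjI A(1) B(1))
qed

text \<open>Size 0 is included because the recursion on the size ends in O(0).\<close>

locale haar_family =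
  fixes H :: "nat \<Rightarrow> (nat \<times> nat \<Rightarrow> real) measure"
  assumes H: "\<And>n. is_haar_orthogonal n (H n)"
begin

lemma haar_H: "haar n (H n)" by (rule haar.intro[OF H])

lemma measurable_last_rot [measurable (raw)]:
  "1 \<le> k \<Longrightarrow> f \<in> borel_measurable M \<Longrightarrow> (\<lambda>x. last_rot k (f x)) \<in> measurable M (mat_space (Suc k) (Suc k))"
proof (rule measurable_mat_spaceI)
  fix i j assume [measurable]: "f \<in> borel_measurable M" and ij: "i < Suc k" "j < Suc k"
  have "(\<lambda>x. last_rot k (f x) (i, j)) = (if i = k - 1 then (if j = k - 1 then f else if j = k then (\<lambda>x. sqrt (1 - f x * f x)) else (\<lambda>_. 0))
     else if i = k then (if j = k - 1 then (\<lambda>x. - sqrt (1 - f x * f x)) else if j = k then f else (\<lambda>_. 0))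
     else (\<lambda>_. of_bool (j = i)))"
    using ij by (simp add: plane_rot_def fun_eq_iff)
  moreover have "(\<lambda>x. sqrt (1 - f x * f x)) \<in> borel_measurable M" "(\<lambda>x. - sqrt (1 - f x * f x)) \<in> borel_measurable M"
    by measurable
  ultimately show "(\<lambda>x. last_rot k (f x) (i, j)) \<in> borel_measurable M"
    by (simp split del: if_split) (cases "i = k - 1"; cases "i = k"; cases "j = k - 1"; cases "j = k"; simp)
qed simp

text \<open>By invariance on both sides, G may be multiplied by independent Haar elements A and B of
  O(k). In the decomposition A0 R B0 of G, the factors A0 and B0 are absorbed by A and B, so G
  enters only through its corner entry.\<close>

lemma nn_corner:
  assumes [measurable]: "F \<in> borel_measurable (mat_space (Suc k) (Suc k))" and k: "1 \<le> k"
  shows "(\<integral>\<^sup>+G. F G \<partial>H (Suc k)) = (\<integral>\<^sup>+G. \<integral>\<^sup>+A. \<integral>\<^sup>+B.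
    F (mat_mult (Suc k) (mat_mult (Suc k) (embed_head k A) (last_rot k (G (k, k)))) (embed_head k B)) \<partial>H k \<partial>H k \<partial>H (Suc k))"
proof -
  interpret S: haar "Suc k" "H (Suc k)" by (rule haar_H)
  interpret k: haar k "H k" by (rule haar_H)
  interpret Sk: pair_sigma_finite "H (Suc k)" "H k" ..
  interpret kS: pair_sigma_finite "H k" "H (Suc k)" ..
  let ?m = "mat_mult (Suc k)" and ?e = "embed_head k"
  have "(\<integral>\<^sup>+G. F G \<partial>H (Suc k)) = (\<integral>\<^sup>+A. \<integral>\<^sup>+B. \<integral>\<^sup>+G. F G \<partial>H (Suc k) \<partial>H k \<partial>H k)"
    by (simp add: k.emeasure_space_1[unfolded k.space_H])
  also have "\<dots> = (\<integral>\<^sup>+A. \<integral>\<^sup>+B. \<integral>\<^sup>+G. F (?m (?m (?e A) G) (?e B)) \<partial>H (Suc k) \<partial>H k \<partial>H k)"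
  proof (intro nn_integral_cong_AE)
    show "AE A in H k. (\<integral>\<^sup>+B. \<integral>\<^sup>+G. F G \<partial>H (Suc k) \<partial>H k) = (\<integral>\<^sup>+B. \<integral>\<^sup>+G. F (?m (?m (?e A) G) (?e B)) \<partial>H (Suc k) \<partial>H k)"
      using k.AE_orth
    proof eventually_elim
      fix A assume A: "orthogonal_mat k A"
      show "(\<integral>\<^sup>+B. \<integral>\<^sup>+G. F G \<partial>H (Suc k) \<partial>H k) = (\<integral>\<^sup>+B. \<integral>\<^sup>+G. F (?m (?m (?e A) G) (?e B)) \<partial>H (Suc k) \<partial>H k)"
      proof (intro nn_integral_cong_AE)
        show "AE B in H k. (\<integral>\<^sup>+G. F G \<partial>H (Suc k)) = (\<integral>\<^sup>+G. F (?m (?m (?e A) G) (?e B)) \<partial>H (Suc k))"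
          using k.AE_orth
        proof eventually_elim
          fix B assume B: "orthogonal_mat k B"
          have [measurable]: "?e A \<in> space (mat_space (Suc k) (Suc k))" "?e B \<in> space (mat_space (Suc k) (Suc k))" by simp_all
          have "(\<integral>\<^sup>+G. F (?m (?m (?e A) G) (?e B)) \<partial>H (Suc k)) = (\<integral>\<^sup>+G. F (?m G (?e B)) \<partial>H (Suc k))"
            by (rule S.nn_left[OF _ embed_head_orthogonal[OF A]]) measurable
          also have "\<dots> = (\<integral>\<^sup>+G. F G \<partial>H (Suc k))"
            by (rule S.nn_right[OF _ embed_head_orthogonal[OF B]]) measurable
          finally show "(\<integral>\<^sup>+G. F G \<partial>H (Suc k)) = (\<integral>\<^sup>+G. F (?m (?m (?e A) G) (?e B)) \<partial>H (Suc k))" ..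
        qed
      qed
    qed
  qed
  also have "\<dots> = (\<integral>\<^sup>+A. \<integral>\<^sup>+G. \<integral>\<^sup>+B. F (?m (?m (?e A) G) (?e B)) \<partial>H k \<partial>H (Suc k) \<partial>H k)"
  proof (intro nn_integral_cong)
    fix A assume "A \<in> space (H k)"
    then have [measurable]: "?e A \<in> space (mat_space (Suc k) (Suc k))" by simp
    show "(\<integral>\<^sup>+B. \<integral>\<^sup>+G. F (?m (?m (?e A) G) (?e B)) \<partial>H (Suc k) \<partial>H k) = (\<integral>\<^sup>+G. \<integral>\<^sup>+B. F (?m (?m (?e A) G) (?e B)) \<partial>H k \<partial>H (Suc k))"
      by (rule Sk.Fubini') measurable
  qed
  also have "\<dots> = (\<integral>\<^sup>+G. \<integral>\<^sup>+A. \<integral>\<^sup>+B. F (?m (?m (?e A) G) (?e B)) \<partial>H k \<partial>H k \<partial>H (Suc k))"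
    by (rule Sk.Fubini') measurable
  also have "\<dots> = (\<integral>\<^sup>+G. \<integral>\<^sup>+A. \<integral>\<^sup>+B. F (?m (?m (?e A) (last_rot k (G (k, k)))) (?e B)) \<partial>H k \<partial>H k \<partial>H (Suc k))"
  proof (rule nn_integral_cong_AE, use S.AE_orth in eventually_elim)
    fix G assume "orthogonal_mat (Suc k) G"
    from orthogonal_corner_decomposition[OF this k] obtain A0 B0 where
      A0: "orthogonal_mat k A0" and B0: "orthogonal_mat k B0" and G: "G = ?m (?m (?e A0) (last_rot k (G (k, k)))) (?e B0)" by blast
    define R where "R = last_rot k (G (k, k))"
    have [measurable]: "A0 \<in> space (mat_space k k)" "B0 \<in> space (mat_space k k)" "R \<in> space (mat_space (Suc k) (Suc k))"
      using A0 B0 by (auto intro: orthogonal_matD simp: R_def)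
    have "(\<integral>\<^sup>+A. \<integral>\<^sup>+B. F (?m (?m (?e A) G) (?e B)) \<partial>H k \<partial>H k) =
       (\<integral>\<^sup>+A. \<integral>\<^sup>+B. F (?m (?m (?e (mat_mult k A A0)) R) (?e (mat_mult k B0 B))) \<partial>H k \<partial>H k)"
      by (intro nn_integral_cong, subst G) (simp add: mat_mult_assoc embed_head_mult[symmetric] R_def)
    also have "\<dots> = (\<integral>\<^sup>+A. \<integral>\<^sup>+B. F (?m (?m (?e (mat_mult k A A0)) R) (?e B)) \<partial>H k \<partial>H k)"
    proof (rule nn_integral_cong)
      fix A assume "A \<in> space (H k)"
      then have [measurable]: "A \<in> space (mat_space k k)" by simp
      show "(\<integral>\<^sup>+B. F (?m (?m (?e (mat_mult k A A0)) R) (?e (mat_mult k B0 B))) \<partial>H k) = (\<integral>\<^sup>+B. F (?m (?m (?e (mat_mult k A A0)) R) (?e B)) \<partial>H k)"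
        by (rule k.nn_left[OF _ B0]) measurable
    qed
    also have "\<dots> = (\<integral>\<^sup>+A. \<integral>\<^sup>+B. F (?m (?m (?e A) R) (?e B)) \<partial>H k \<partial>H k)"
      by (rule k.nn_right[OF _ A0]) measurable
    finally show "(\<integral>\<^sup>+A. \<integral>\<^sup>+B. F (?m (?m (?e A) G) (?e B)) \<partial>H k \<partial>H k) = (\<integral>\<^sup>+A. \<integral>\<^sup>+B. F (?m (?m (?e A) (last_rot k (G (k, k)))) (?e B)) \<partial>H k \<partial>H k)"
      by (simp add: R_def)
  qed
  finally show ?thesis .
qed

end

text \<open>The product of the planar rotations with corner entries t(0), ..., t(n - 1), an
  upper Hessenberg matrix. Its last column is the point of the sphere with spherical coordinates t.\<close>

definition hess :: "nat \<Rightarrow> (nat \<Rightarrow> real) \<Rightarrow> nat \<times> nat \<Rightarrow> real" where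
  "hess n t = (\<lambda>(i, j) \<in> sqidx n.
     if j = n - 1 then t i * (\<Prod>l\<in>{i<..<n}. sqrt (1 - t l * t l))
     else if i = Suc j then - sqrt (1 - t i * t i)
     else if i \<le> j then t i * t (Suc j) * (\<Prod>l\<in>{i<..j}. sqrt (1 - t l * t l)) else 0)"

lemma hess_space [simp]: "hess n t \<in> space (mat_space n n)"
  by (simp add: hess_def)

lemma hess_apply: "i < n \<Longrightarrow> j < n \<Longrightarrow> hess n t (i, j) =
   (if j = n - 1 then t i * (\<Prod>l\<in>{i<..<n}. sqrt (1 - t l * t l))
     else if i = Suc j then - sqrt (1 - t i * t i)
     else if i \<le> j then t i * t (Suc j) * (\<Prod>l\<in>{i<..j}. sqrt (1 - t l * t l)) else 0)"
  unfolding hess_def restrict_apply by (simp only: mem_Sigma_iff lessThan_iff prod.case simp_thms if_True)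

lemma hess_cong:
  assumes t: "\<And>i. i < n \<Longrightarrow> t i = t' i"
  shows "hess n t = hess n t'"
proof (rule mat_space_eqI[of _ n n])
  fix i j assume ij: "i < n" "j < n"
  have p: "(\<Prod>l\<in>{i<..<n}. sqrt (1 - t l * t l)) = (\<Prod>l\<in>{i<..<n}. sqrt (1 - t' l * t' l))"
    by (rule prod.cong[OF refl]) (simp add: t)
  have p': "(\<Prod>l\<in>{i<..j}. sqrt (1 - t l * t l)) = (\<Prod>l\<in>{i<..j}. sqrt (1 - t' l * t' l))"
    by (rule prod.cong[OF refl]) (use ij in \<open>simp add: t\<close>)
  show "hess n t (i, j) = hess n t' (i, j)"
  proof (cases "j = n - 1")
    case True
    then show ?thesis unfolding hess_apply[OF ij] by (simp add: p t[OF ij(1)])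
  next
    case False
    then have "t (Suc j) = t' (Suc j)" by (intro t) (use ij in auto)
    then show ?thesis using False unfolding hess_apply[OF ij] by (simp add: p' t[OF ij(1)])
  qed
qed (rule hess_space)+

lemma hess_Suc:
  "hess (Suc (Suc k)) t = mat_mult (Suc (Suc k)) (embed_head (Suc k) (hess (Suc k) t)) (last_rot (Suc k) (t (Suc k)))"
proof (rule mat_space_eqI[of _ "Suc (Suc k)" "Suc (Suc k)"])
  let ?n = "Suc (Suc k)"
  fix i j assume ij: "i < ?n" "j < ?n"
  let ?s = "\<lambda>l. sqrt (1 - t l * t l)"
  define s where "s = ?s (Suc k)"
  let ?R = "last_rot (Suc k) (t (Suc k))" and ?E = "embed_head (Suc k) (hess (Suc k) t)"
  have R: "?R (m, j) = (if m = k then (if j = k then t (Suc k) else if j = Suc k then s else 0)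
     else if m = Suc k then (if j = k then - s else if j = Suc k then t (Suc k) else 0)
     else if j = m then 1 else 0)" if "m < ?n" for m
    using that ij by (simp add: plane_rot_def s_def)
  have prodk: "(\<Prod>l\<in>{i<..<?n}. ?s l) = (\<Prod>l\<in>{i<..<Suc k}. ?s l) * s" if "i < Suc k"
  proof -
    have "{i<..<?n} = insert (Suc k) {i<..<Suc k}" using that by auto
    then show ?thesis by (simp add: s_def mult.commute)
  qed
  have prodk': "{i<..k} = {i<..<Suc k}" by auto
  have M: "mat_mult ?n ?E ?R (i, j) = (if j < k then ?E (i, j) else if j = k then ?E (i, k) * t (Suc k) - ?E (i, Suc k) * s
     else ?E (i, k) * s + ?E (i, Suc k) * t (Suc k))"
  proof -
    have mm: "mat_mult ?n ?E ?R (i, j) = (\<Sum>m<?n. ?E (i, m) * ?R (m, j))" using ij by (rule mat_mult_apply)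
    show ?thesis
    proof (cases "j < k")
      case True
      have "(\<Sum>m<?n. ?E (i, m) * ?R (m, j)) = (\<Sum>m<?n. if m = j then ?E (i, j) else 0)"
        by (intro sum.cong refl, subst R) (use True in auto)
      then show ?thesis unfolding mm using True ij by (simp del: sum.lessThan_Suc)
    next
      case False
      then have j: "j = k \<or> j = Suc k" using ij by auto
      have "(\<Sum>m<?n. ?E (i, m) * ?R (m, j)) = ?E (i, k) * ?R (k, j) + ?E (i, Suc k) * ?R (Suc k, j)"
        by (rule sum_two_delta, simp, simp, simp, subst R) (use j in auto)
      then show ?thesis unfolding mm using j R[of k] R[of "Suc k"] by auto
    qed
  qed
  show "hess ?n t (i, j) = mat_mult ?n ?E ?R (i, j)"
  proof (cases "i < Suc k")
    case True
    have E: "?E (i, m) = (if m = k then t i * (\<Prod>l\<in>{i<..<Suc k}. ?s l)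
       else if i = Suc m then - ?s i else if i \<le> m then t i * t (Suc m) * (\<Prod>l\<in>{i<..m}. ?s l) else 0)" if "m < Suc k" for m
      using that True by (simp add: embed_head_apply hess_apply)
    have Ek: "?E (i, Suc k) = 0" using True by (simp add: embed_head_apply)
    consider "j < k" | "j = k" | "j = Suc k" using ij by linarith
    then show ?thesis
    proof cases
      case 1
      then have "mat_mult ?n ?E ?R (i, j) = ?E (i, j)" unfolding M by simp
      also have "\<dots> = hess ?n t (i, j)" unfolding hess_apply[OF ij] using 1 by (subst E) auto
      finally show ?thesis ..
    next
      case 2
      then have "mat_mult ?n ?E ?R (i, j) = ?E (i, k) * t (Suc k)" unfolding M Ek by simp
      also have "\<dots> = t i * t (Suc k) * (\<Prod>l\<in>{i<..<Suc k}. ?s l)" by (subst E) auto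
      also have "\<dots> = hess ?n t (i, j)" unfolding hess_apply[OF ij] using 2 True by (simp add: prodk')
      finally show ?thesis ..
    next
      case 3
      then have "mat_mult ?n ?E ?R (i, j) = ?E (i, k) * s" unfolding M Ek by simp
      also have "\<dots> = t i * (\<Prod>l\<in>{i<..<Suc k}. ?s l) * s" by (subst E) auto
      also have "\<dots> = hess ?n t (i, j)" unfolding hess_apply[OF ij] using 3 True by (simp add: prodk)
      finally show ?thesis ..
    qed
  next
    case False
    then have i: "i = Suc k" using ij by simp
    have E: "?E (i, m) = of_bool (m = Suc k)" if "m \<le> Suc k" for m using that i by (auto simp: embed_head_apply)
    have e: "{Suc k<..<?n} = {}" by auto
    consider "j < k" | "j = k" | "j = Suc k" using ij by linarith
    then show ?thesis
    proof cases
      case 1 then show ?thesis unfolding M hess_apply[OF ij] using E[of j] i by simp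
    next
      case 2 then show ?thesis unfolding M hess_apply[OF ij] using E[of k] E[of "Suc k"] i by (simp add: s_def)
    next
      case 3 then show ?thesis unfolding M hess_apply[OF ij] using E[of k] E[of "Suc k"] i by (simp add: e)
    qed
  qed
qed (rule hess_space mat_mult_space)+

text \<open>The two factors act on complementary sets of coordinates: the first k, and the last
  two.\<close>

lemma embed_head2_commute:
  "mat_mult (Suc (Suc k)) (embed_head (Suc k) (embed_head k U)) (last_rot (Suc k) t) =
   mat_mult (Suc (Suc k)) (last_rot (Suc k) t) (embed_head (Suc k) (embed_head k U))"
proof (rule mat_space_eqI[of _ "Suc (Suc k)" "Suc (Suc k)"])
  let ?n = "Suc (Suc k)"
  define s where "s = sqrt (1 - t * t)"
  let ?R = "last_rot (Suc k) t" and ?E = "embed_head (Suc k) (embed_head k U)"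
  have E: "?E (i, j) = (if i < k \<and> j < k then U (i, j) else of_bool (i = j))" if "i < ?n" "j < ?n" for i j
    using that by (auto simp: embed_head_apply)
  fix i j assume ij: "i < ?n" "j < ?n"
  have R: "?R (m, j) = (if m = k then (if j = k then t else if j = Suc k then s else 0)
     else if m = Suc k then (if j = k then - s else if j = Suc k then t else 0)
     else if j = m then 1 else 0)" if "m < ?n" "j < ?n" for m j
    using that by (simp add: plane_rot_def s_def)
  have "mat_mult ?n ?R ?E (i, j) = (if i = k then t * ?E (k, j) + s * ?E (Suc k, j) else if i = Suc k then - s * ?E (k, j) + t * ?E (Suc k, j) else ?E (i, j))"
    unfolding s_def using ij by (subst plane_rot_mult) auto
  moreover have "mat_mult ?n ?E ?R (i, j) = (if j = k then ?E (i, k) * t - ?E (i, Suc k) * s else if j = Suc k then ?E (i, k) * s + ?E (i, Suc k) * t else ?E (i, j))"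
  proof (cases "j < k")
    case True
    have "(\<Sum>m<?n. ?E (i, m) * ?R (m, j)) = (\<Sum>m<?n. if m = j then ?E (i, j) else 0)"
      by (intro sum.cong refl, subst R[OF _ ij(2)]) (use True in auto)
    then show ?thesis unfolding mat_mult_apply[OF ij] using True ij by (simp del: sum.lessThan_Suc)
  next
    case False
    then have j: "j = k \<or> j = Suc k" using ij by auto
    have "(\<Sum>m<?n. ?E (i, m) * ?R (m, j)) = ?E (i, k) * ?R (k, j) + ?E (i, Suc k) * ?R (Suc k, j)"
      by (rule sum_two_delta, simp, simp, simp, subst R[OF _ ij(2)]) (use j in auto)
    then show ?thesis unfolding mat_mult_apply[OF ij] using j R[of k, OF _ ij(2)] R[of "Suc k", OF _ ij(2)] by auto
  qed
  ultimately show "mat_mult ?n ?E ?R (i, j) = mat_mult ?n ?R ?E (i, j)"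
    using ij by (auto simp: E simp del: mat_mult_apply)
qed simp_all

lemma measurable_hess [measurable]:
  assumes [measurable]: "\<And>i. i < n \<Longrightarrow> (\<lambda>x. t x i) \<in> borel_measurable M"
  shows "(\<lambda>x. hess n (t x)) \<in> measurable M (mat_space n n)"
proof (rule measurable_mat_spaceI)
  fix i j assume ij: "i < n" "j < n"
  have 1: "(\<lambda>x. t x i * (\<Prod>l\<in>{i<..<n}. sqrt (1 - t x l * t x l))) \<in> borel_measurable M"
    using ij by (intro borel_measurable_times borel_measurable_prod) auto
  have 2: "(\<lambda>x. - sqrt (1 - t x i * t x i)) \<in> borel_measurable M" using ij by measurable
  have 3: "(\<lambda>x. t x i * t x (Suc j) * (\<Prod>l\<in>{i<..j}. sqrt (1 - t x l * t x l))) \<in> borel_measurable M" if "j \<noteq> n - 1"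
    using ij that by (intro borel_measurable_times borel_measurable_prod) auto
  show "(\<lambda>x. hess n (t x) (i, j)) \<in> borel_measurable M"
  proof (cases "j = n - 1")
    case True
    show ?thesis unfolding hess_apply[OF ij] if_P[OF True] by (rule 1)
  next
    case j: False
    show ?thesis
    proof (cases "i = Suc j")
      case True
      show ?thesis unfolding hess_apply[OF ij] if_not_P[OF j] if_P[OF True] by (rule 2)
    next
      case i: False
      show ?thesis
      proof (cases "i \<le> j")
        case True
        show ?thesis unfolding hess_apply[OF ij] if_not_P[OF j] if_not_P[OF i] if_P[OF True] by (rule 3[OF j])
      next
        case False
        show ?thesis unfolding hess_apply[OF ij] if_not_P[OF j] if_not_P[OF i] if_not_P[OF False] by simp
      qed
    qed
  qed
qed (rule hess_space)

context haar_family begin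

text \<open>Index shift: \<open>corner i\<close> belongs to O(i + 1), and it is also the law of one
  coordinate of a uniform point of the sphere in dimension i + 1.\<close>

definition corner :: "nat \<Rightarrow> real measure" where
  "corner i = distr (H (Suc i)) borel (\<lambda>A. A (i, i))"

lemma sets_corner [simp, measurable_cong]: "sets (corner i) = sets borel"
  and space_corner [simp]: "space (corner i) = UNIV"
  by (simp_all add: corner_def)

lemma measurable_corner_entry [measurable]: "(\<lambda>A. A (i, i)) \<in> borel_measurable (H (Suc i))"
proof -
  interpret haar "Suc i" "H (Suc i)" by (rule haar_H)
  show ?thesis by (simp add: measurable_mat_entry cong: measurable_cong_sets)
qed

lemma prob_corner: "prob_space (corner i)"
proof -
  interpret haar "Suc i" "H (Suc i)" by (rule haar_H)
  show ?thesis unfolding corner_def by (rule prob_space_distr) simp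
qed

lemma nn_integral_corner:
  assumes [measurable]: "f \<in> borel_measurable borel"
  shows "(\<integral>\<^sup>+A. f (A (i, i)) \<partial>H (Suc i)) = (\<integral>\<^sup>+t. f t \<partial>corner i)"
proof -
  interpret haar "Suc i" "H (Suc i)" by (rule haar_H)
  show ?thesis unfolding corner_def by (subst nn_integral_distr) auto
qed

sublocale corner: product_prob_space corner "{}::nat set"
  using prob_corner by (auto simp: product_prob_space_def product_prob_space_axioms_def product_sigma_finite_def intro: prob_space_imp_sigma_finite)

text \<open>\<open>nn_corner\<close> gives a product A R B. The induction hypothesis expands A and
  leaves a factor U from the next smaller group, which commutes with the rotation R and is absorbed
  into B. What accumulates on the left is the product of rotations with independent corner
  entries.\<close>

theorem hess_representation:
  assumes "F \<in> borel_measurable (mat_space (Suc k) (Suc k))"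
  shows "(\<integral>\<^sup>+G. F G \<partial>H (Suc k)) = (\<integral>\<^sup>+t. \<integral>\<^sup>+U. F (mat_mult (Suc k) (hess (Suc k) t) (embed_head k U)) \<partial>H k \<partial>PiM {..<Suc k} corner)"
  using assms
proof (induction k arbitrary: F)
  case 0
  note [measurable] = 0
  interpret S: haar "Suc 0" "H (Suc 0)" by (rule haar_H)
  interpret Z: haar 0 "H 0" by (rule haar_H)
  let ?one = "\<lambda>x. \<lambda>(i, j)\<in>sqidx (Suc 0). x"
  have one: "(\<lambda>x::real. ?one x) \<in> measurable borel (mat_space (Suc 0) (Suc 0))"
    by (rule measurable_mat_spaceI) auto
  have F1: "(\<lambda>x. F (?one x)) \<in> borel_measurable borel" by (rule measurable_compose[OF one 0])
  have "(\<integral>\<^sup>+G. F G \<partial>H (Suc 0)) = (\<integral>\<^sup>+G. F (?one (G (0, 0))) \<partial>H (Suc 0))"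
  proof (intro nn_integral_cong arg_cong[of _ _ F])
    fix G assume "G \<in> space (H (Suc 0))"
    then show "G = ?one (G (0, 0))" by (intro mat_space_eqI[of _ "Suc 0" "Suc 0"]) auto
  qed
  also have "\<dots> = (\<integral>\<^sup>+x. F (?one x) \<partial>corner 0)" by (rule nn_integral_corner[OF F1])
  also have "\<dots> = (\<integral>\<^sup>+t. F (?one (t 0)) \<partial>PiM {0} corner)"
    by (rule corner.product_nn_integral_singleton[symmetric]) (subst measurable_cong_sets[OF sets_corner refl], rule F1)
  also have "\<dots> = (\<integral>\<^sup>+t. \<integral>\<^sup>+U. F (mat_mult (Suc 0) (hess (Suc 0) t) (embed_head 0 U)) \<partial>H 0 \<partial>PiM {0} corner)"
  proof (rule nn_integral_cong)
    fix t
    have e: "{0<..<Suc 0} = {}" by auto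
    have "mat_mult (Suc 0) (hess (Suc 0) t) (embed_head 0 U) = ?one (t 0)" for U
      by (rule mat_space_eqI[of _ "Suc 0" "Suc 0"]) (simp_all add: embed_head_apply hess_apply e)
    then show "F (?one (t 0)) = (\<integral>\<^sup>+U. F (mat_mult (Suc 0) (hess (Suc 0) t) (embed_head 0 U)) \<partial>H 0)"
      using Z.emeasure_space_1 by simp
  qed
  also have "{0} = {..<Suc 0}" by auto
  finally show ?case .
next
  case (Suc k)
  note [measurable] = Suc.prems
  let ?n = "Suc (Suc k)"
  interpret S: haar ?n "H ?n" by (rule haar_H)
  interpret k: haar "Suc k" "H (Suc k)" by (rule haar_H)
  interpret k0: haar k "H k" by (rule haar_H)
  let ?m = "mat_mult ?n" and ?e = "embed_head (Suc k)"
  have I: "insert (Suc k) {..<Suc k} = {..<?n}" by auto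
  have "(\<integral>\<^sup>+G. F G \<partial>H ?n) = (\<integral>\<^sup>+G. \<integral>\<^sup>+A. \<integral>\<^sup>+B. F (?m (?m (?e A) (last_rot (Suc k) (G (Suc k, Suc k)))) (?e B)) \<partial>H (Suc k) \<partial>H (Suc k) \<partial>H ?n)"
    by (rule nn_corner) (use Suc.prems in auto)
  also have "\<dots> = (\<integral>\<^sup>+x. \<integral>\<^sup>+A. \<integral>\<^sup>+B. F (?m (?m (?e A) (last_rot (Suc k) x)) (?e B)) \<partial>H (Suc k) \<partial>H (Suc k) \<partial>corner (Suc k))"
    by (rule nn_integral_corner) measurable
  also have "\<dots> = (\<integral>\<^sup>+x. \<integral>\<^sup>+t. \<integral>\<^sup>+U. \<integral>\<^sup>+B. F (?m (?m (?e (mat_mult (Suc k) (hess (Suc k) t) (embed_head k U))) (last_rot (Suc k) x)) (?e B))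
      \<partial>H (Suc k) \<partial>H k \<partial>PiM {..<Suc k} corner \<partial>corner (Suc k))"
  proof (rule nn_integral_cong)
    fix x
    show "(\<integral>\<^sup>+A. \<integral>\<^sup>+B. F (?m (?m (?e A) (last_rot (Suc k) x)) (?e B)) \<partial>H (Suc k) \<partial>H (Suc k)) =
     (\<integral>\<^sup>+t. \<integral>\<^sup>+U. \<integral>\<^sup>+B. F (?m (?m (?e (mat_mult (Suc k) (hess (Suc k) t) (embed_head k U))) (last_rot (Suc k) x)) (?e B))
      \<partial>H (Suc k) \<partial>H k \<partial>PiM {..<Suc k} corner)"
      by (rule Suc.IH) measurable
  qed
  also have "\<dots> = (\<integral>\<^sup>+x. \<integral>\<^sup>+t. \<integral>\<^sup>+B. F (?m (hess ?n (t(Suc k := x))) (?e B)) \<partial>H (Suc k) \<partial>PiM {..<Suc k} corner \<partial>corner (Suc k))"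
  proof (intro nn_integral_cong)
    fix x t
    have "(\<integral>\<^sup>+U. \<integral>\<^sup>+B. F (?m (?m (?e (mat_mult (Suc k) (hess (Suc k) t) (embed_head k U))) (last_rot (Suc k) x)) (?e B)) \<partial>H (Suc k) \<partial>H k)
      = (\<integral>\<^sup>+U. \<integral>\<^sup>+B. F (?m (hess ?n (t(Suc k := x))) (?e B)) \<partial>H (Suc k) \<partial>H k)"
    proof (rule nn_integral_cong_AE, use k0.AE_orth in eventually_elim)
      fix U assume U: "orthogonal_mat k U"
      have h: "hess (Suc k) t = hess (Suc k) (t(Suc k := x))" by (rule hess_cong) auto
      have e: "?m (?m (?e (mat_mult (Suc k) (hess (Suc k) t) (embed_head k U))) (last_rot (Suc k) x)) (?e B) =
        ?m (hess ?n (t(Suc k := x))) (?e (mat_mult (Suc k) (embed_head k U) B))" for B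
        unfolding embed_head_mult[symmetric] mat_mult_assoc
        by (subst (2) mat_mult_assoc[symmetric], subst embed_head2_commute)
          (simp add: h hess_Suc[of k "t(Suc k := x)"] mat_mult_assoc)
      show "(\<integral>\<^sup>+B. F (?m (?m (?e (mat_mult (Suc k) (hess (Suc k) t) (embed_head k U))) (last_rot (Suc k) x)) (?e B)) \<partial>H (Suc k))
        = (\<integral>\<^sup>+B. F (?m (hess ?n (t(Suc k := x))) (?e B)) \<partial>H (Suc k))"
        unfolding e by (rule k.nn_left[OF _ embed_head_orthogonal[OF U]]) measurable
    qed
    also have "\<dots> = (\<integral>\<^sup>+B. F (?m (hess ?n (t(Suc k := x))) (?e B)) \<partial>H (Suc k))"
      using k0.emeasure_space_1 by simp
    finally show "(\<integral>\<^sup>+U. \<integral>\<^sup>+B. F (?m (?m (?e (mat_mult (Suc k) (hess (Suc k) t) (embed_head k U))) (last_rot (Suc k) x)) (?e B)) \<partial>H (Suc k) \<partial>H k)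
      = (\<integral>\<^sup>+B. F (?m (hess ?n (t(Suc k := x))) (?e B)) \<partial>H (Suc k))" .
  qed
  also have "\<dots> = (\<integral>\<^sup>+t. \<integral>\<^sup>+B. F (?m (hess ?n t) (?e B)) \<partial>H (Suc k) \<partial>PiM (insert (Suc k) {..<Suc k}) corner)"
  proof (rule corner.product_nn_integral_insert_rev[symmetric])
    show "(\<lambda>t. \<integral>\<^sup>+B. F (?m (hess ?n t) (?e B)) \<partial>H (Suc k)) \<in> borel_measurable (PiM (insert (Suc k) {..<Suc k}) corner)"
      unfolding I by measurable
  qed simp_all
  finally show ?case unfolding I .
qed

end

text \<open>One step of the recursion for the lower-right block. The new last column consists of the
  last p coordinates of a point of the sphere given by \<open>t\<close>, and the smaller block W is
  transformed by the Hessenberg matrix, up to the sign of W.\<close>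

definition add_column :: "(real \<Rightarrow> real) \<Rightarrow> nat \<Rightarrow> nat \<Rightarrow> (nat \<Rightarrow> real) \<Rightarrow> (nat \<times> nat \<Rightarrow> real) \<Rightarrow> nat \<times> nat \<Rightarrow> real" where
  "add_column \<sigma> p q t W = (\<lambda>(i, j). if j = q then t i * (\<Prod>l\<in>{i<..<p}. \<sigma> (t l))
     else \<sigma> (t i) * W (i, j) - t i * (\<Sum>m\<in>{i<..<p}. t m * (\<Prod>l\<in>{i<..<m}. \<sigma> (t l)) * W (m, j)))"

text \<open>The block as a function of independent coordinates, one per entry; \<sigma> t stands for sqrt (1 - t^2).\<close>

primrec block_coords :: "(real \<Rightarrow> real) \<Rightarrow> nat \<Rightarrow> nat \<Rightarrow> (nat \<times> nat \<Rightarrow> real) \<Rightarrow> nat \<times> nat \<Rightarrow> real" where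
  "block_coords \<sigma> p 0 T = (\<lambda>_. 0)"
| "block_coords \<sigma> p (Suc q) T = add_column \<sigma> p q (\<lambda>i. T (i, q)) (block_coords \<sigma> p q T)"

definition corner_block :: "nat \<Rightarrow> nat \<Rightarrow> nat \<Rightarrow> (nat \<times> nat \<Rightarrow> real) \<Rightarrow> nat \<times> nat \<Rightarrow> real" where
  "corner_block n p q A = (\<lambda>(i, j) \<in> {..<p} \<times> {..<q}. A (n - p + i, n - q + j))"

lemma add_column_cong:
  assumes "i < p" "j \<le> q" "\<And>l. i \<le> l \<Longrightarrow> l < p \<Longrightarrow> t l = t' l" "\<And>l. i \<le> l \<Longrightarrow> l < p \<Longrightarrow> j < q \<Longrightarrow> W (l, j) = W' (l, j)"
  shows "add_column \<sigma> p q t W (i, j) = add_column \<sigma> p q t' W' (i, j)"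
proof (cases "j = q")
  case True
  then show ?thesis using assms by (simp add: add_column_def cong: prod.cong_simp)
next
  case False
  have "(\<Sum>m\<in>{i<..<p}. t m * (\<Prod>l\<in>{i<..<m}. \<sigma> (t l)) * W (m, j)) = (\<Sum>m\<in>{i<..<p}. t' m * (\<Prod>l\<in>{i<..<m}. \<sigma> (t' l)) * W' (m, j))"
    by (intro sum.cong refl arg_cong2[of _ _ _ _ "times"] prod.cong) (use assms False in auto)
  then show ?thesis using assms False by (simp add: add_column_def)
qed

text \<open>The triangular structure: an entry depends only on the coordinates weakly below and to
  the right of its position.\<close>

lemma block_coords_cong:
  "i < p \<Longrightarrow> j < q \<Longrightarrow> (\<And>l k. i \<le> l \<Longrightarrow> l < p \<Longrightarrow> j \<le> k \<Longrightarrow> k < q \<Longrightarrow> T (l, k) = T' (l, k)) \<Longrightarrow>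
   block_coords \<sigma> p q T (i, j) = block_coords \<sigma> p q T' (i, j)"
proof (induction q arbitrary: i j)
  case (Suc q)
  show ?case unfolding block_coords.simps
    by (rule add_column_cong) (use Suc in auto)
qed simp

lemma add_column_measurable:
  assumes i: "i < p" and j: "j \<le> q"
    and [measurable]: "\<sigma> \<in> borel_measurable borel"
    and t: "\<And>l. l < p \<Longrightarrow> (\<lambda>x. t x l) \<in> borel_measurable M"
    and W: "\<And>l. l < p \<Longrightarrow> j < q \<Longrightarrow> (\<lambda>x. W x (l, j)) \<in> borel_measurable M"
  shows "(\<lambda>x. add_column \<sigma> p q (t x) (W x) (i, j)) \<in> borel_measurable M"
proof -
  have s: "(\<lambda>x. \<sigma> (t x l)) \<in> borel_measurable M" if "l < p" for l
    using measurable_compose[OF t[OF that] assms(3)] .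
  show ?thesis
  proof (cases "j = q")
    case True
    then show ?thesis unfolding add_column_def using i
      by (simp, intro borel_measurable_times borel_measurable_prod t s) auto
  next
    case False
    then show ?thesis unfolding add_column_def using i j
      by (simp, intro borel_measurable_diff borel_measurable_times borel_measurable_prod borel_measurable_sum t s W) auto
  qed
qed

lemma block_coords_measurable:
  assumes [measurable]: "\<sigma> \<in> borel_measurable borel"
  shows "i < p \<Longrightarrow> j < q \<Longrightarrow> (\<And>l k. l < p \<Longrightarrow> k < q \<Longrightarrow> (\<lambda>x. T x (l, k)) \<in> borel_measurable M) \<Longrightarrow>
    (\<lambda>x. block_coords \<sigma> p q (T x) (i, j)) \<in> borel_measurable M"
proof (induction q arbitrary: i j)
  case (Suc q)
  show ?case unfolding block_coords.simps
    by (rule add_column_measurable) (use Suc in auto)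
qed simp

lemma corner_block_measurable [measurable]:
  "p \<le> n \<Longrightarrow> q \<le> n \<Longrightarrow> corner_block n p q \<in> measurable (mat_space n n) (mat_space p q)"
proof (rule measurable_mat_spaceI)
  fix i j assume "p \<le> n" "q \<le> n" "i < p" "j < q"
  then show "(\<lambda>A. corner_block n p q A (i, j)) \<in> borel_measurable (mat_space n n)"
    by (simp add: corner_block_def)
qed (simp add: corner_block_def)

lemma prod_shift: "(\<Prod>l\<in>{(a::nat) + i<..<a + m}. f l) = (\<Prod>l\<in>{i<..<m}. f (a + l) :: real)"
  by (rule prod.reindex_bij_witness[of _ "\<lambda>l. a + l" "\<lambda>l. l - a"]) auto

text \<open>A row r of \<open>hess\<close> vanishes to the left of column r - 1. So the last p rows
  of the product involve only the last p rows of V, and a block with q + 1 columns in size k + 1 is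
  a function of one with q columns in size k. The sign of V turns the negative subdiagonal into a
  positive slope.\<close>

lemma corner_block_hess:
  assumes k: "p + q \<le> k" and i: "i < p" and j: "j \<le> q" and V: "\<And>i j. i < k \<Longrightarrow> j < k \<Longrightarrow> V (i, j) = - U (i, j)"
  shows "corner_block (Suc k) p (Suc q) (mat_mult (Suc k) (hess (Suc k) t) (embed_head k V)) (i, j) =
    add_column (\<lambda>t. sqrt (1 - t * t)) p q (\<lambda>i. t (Suc (k - p) + i)) (corner_block k p q U) (i, j)"
proof -
  let ?s = "\<lambda>l. sqrt (1 - t l * t l)"
  define a where "a = Suc (k - p)"
  have a: "Suc k - p = a" "Suc k = a + p" using k by (auto simp: a_def)
  have r: "a + i < Suc k" using i a by simp
  have L: "corner_block (Suc k) p (Suc q) (mat_mult (Suc k) (hess (Suc k) t) (embed_head k V)) (i, j) =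
    mat_mult (Suc k) (hess (Suc k) t) (embed_head k V) (a + i, k - q + j)"
    using i j by (simp add: corner_block_def a(1))
  show ?thesis
  proof (cases "j = q")
    case True
    then have "k - q + j = k" using k by simp
    then have "mat_mult (Suc k) (hess (Suc k) t) (embed_head k V) (a + i, k - q + j) = hess (Suc k) t (a + i, k)"
      using r by (simp only:) (subst embed_head_mult_right, auto)
    also have "\<dots> = t (a + i) * (\<Prod>l\<in>{a + i<..<a + p}. ?s l)"
      using r a(2) by (subst hess_apply) auto
    also have "\<dots> = add_column (\<lambda>t. sqrt (1 - t * t)) p q (\<lambda>i. t (a + i)) (corner_block k p q U) (i, j)"
      using True by (simp add: add_column_def prod_shift)
    finally show ?thesis unfolding L a_def .
  next
    case False
    define c where "c = k - q + j"
    have c: "c < k" using False j k by (auto simp: c_def)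
    have ak: "a + i = Suc (k - p + i)" by (simp add: a_def)
    have h: "hess (Suc k) t (a + i, u) = (if u = k - p + i then - ?s (a + i)
        else if k - p + i < u then t (a + i) * t (Suc u) * (\<Prod>l\<in>{a + i<..u}. ?s l) else 0)" if "u < k" for u
      using that r by (subst hess_apply) (auto simp: ak)
    have "mat_mult (Suc k) (hess (Suc k) t) (embed_head k V) (a + i, c) = (\<Sum>u<k. hess (Suc k) t (a + i, u) * V (u, c))"
      using r c by (subst embed_head_mult_right) auto
    also have "\<dots> = (\<Sum>u\<in>insert (k - p + i) {k - p + i<..<k}. hess (Suc k) t (a + i, u) * V (u, c))"
      by (rule sum.mono_neutral_right) (use i k in \<open>auto simp: h\<close>)
    also have "\<dots> = ?s (a + i) * U (k - p + i, c) + (\<Sum>u\<in>{k - p + i<..<k}. hess (Suc k) t (a + i, u) * V (u, c))"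
      using i k c by (subst sum.insert) (auto simp: h V)
    also have "(\<Sum>u\<in>{k - p + i<..<k}. hess (Suc k) t (a + i, u) * V (u, c))
      = (\<Sum>u\<in>{k - p + i<..<k}. - (t (a + i) * (t (Suc u) * (\<Prod>l\<in>{a + i<..<Suc u}. ?s l) * U (u, c))))"
    proof (rule sum.cong[OF refl])
      fix u assume u: "u \<in> {k - p + i<..<k}"
      have "{a + i<..<Suc u} = {a + i<..u}" by auto
      then show "hess (Suc k) t (a + i, u) * V (u, c) = - (t (a + i) * (t (Suc u) * (\<Prod>l\<in>{a + i<..<Suc u}. ?s l) * U (u, c)))"
        using u c by (simp add: h V)
    qed
    also have "\<dots> = (\<Sum>m\<in>{i<..<p}. - (t (a + i) * (t (a + m) * (\<Prod>l\<in>{a + i<..<a + m}. ?s l) * U (k - p + m, c))))"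
      by (rule sum.reindex_bij_witness[of _ "\<lambda>m. k - p + m" "\<lambda>u. u - (k - p)"]) (use k in \<open>auto simp: a_def\<close>)
    also have "\<dots> = - (t (a + i) * (\<Sum>m\<in>{i<..<p}. t (a + m) * (\<Prod>l\<in>{i<..<m}. ?s (a + l)) * U (k - p + m, c)))"
      by (simp add: sum_negf sum_distrib_left prod_shift)
    also have "?s (a + i) * U (k - p + i, c) + \<dots> =
       add_column (\<lambda>t. sqrt (1 - t * t)) p q (\<lambda>i. t (a + i)) (corner_block k p q U) (i, j)"
      using False i j by (simp add: add_column_def corner_block_def c_def)
    finally show ?thesis unfolding L c_def[symmetric] a_def .
  qed
qed

context haar_family begin

lemma nn_integral_negate:
  assumes [measurable]: "F \<in> borel_measurable (mat_space k k)"
  shows "(\<integral>\<^sup>+U. F U \<partial>H k) = (\<integral>\<^sup>+U. F (mat_mult k (signed_perm k (\<lambda>_. -1) (\<lambda>i. i)) U) \<partial>H k)"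
proof -
  interpret haar k "H k" by (rule haar_H)
  show ?thesis
    by (rule nn_left[symmetric]) (auto intro!: signed_perm_orthogonal simp: bij_betw_def)
qed

abbreviation coord_law :: "nat \<Rightarrow> nat \<times> nat \<Rightarrow> real measure" where
  "coord_law d \<equiv> \<lambda>x. corner (Suc (d + fst x + snd x))"

text \<open>Induction on the number of columns. One use of \<open>hess_representation\<close> splits
  off the last column with its p coordinates and lowers the size by one; the coordinates of smaller
  index do not reach the block and integrate out.\<close>

theorem block_representation:
  assumes "F \<in> borel_measurable (mat_space p q)"
  shows "(\<integral>\<^sup>+G. F (corner_block (d + p + q) p q G) \<partial>H (d + p + q)) =
    (\<integral>\<^sup>+T. F (restrict (block_coords (\<lambda>t. sqrt (1 - t * t)) p q T) ({..<p} \<times> {..<q})) \<partial>PiM ({..<p} \<times> {..<q}) (coord_law d))"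
  using assms
proof (induction q arbitrary: F)
  case 0
  interpret haar "d + p" "H (d + p)" by (rule haar_H)
  have "corner_block (d + p) p 0 G = (\<lambda>_. undefined)" for G by (simp add: corner_block_def restrict_def)
  then show ?case using emeasure_space_1 by (simp add: restrict_def PiM_empty nn_integral_count_space_finite)
next
  case (Suc q)
  note [measurable] = Suc.prems
  let ?\<sigma> = "\<lambda>t::real. sqrt (1 - t * t)"
  let ?k = "d + p + q" and ?I = "{..<p} \<times> {..<q}" and ?J = "{..<p} \<times> {q}"
  let ?r = "\<lambda>f. restrict f ({..<p} \<times> {..<Suc q})"
  have k: "d + p + Suc q = Suc ?k" by simp
  interpret P: product_prob_space "coord_law d" "{}"
    using prob_corner by (auto simp: product_prob_space_def product_prob_space_axioms_def product_sigma_finite_def intro: prob_space_imp_sigma_finite)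
  interpret k: haar ?k "H ?k" by (rule haar_H)
  \<comment> \<open>The last p of the d + p + q + 1 corner entries.\<close>
  let ?t = "\<lambda>t i. t (Suc (d + q) + i)"
  let ?neg = "mat_mult ?k (signed_perm ?k (\<lambda>_. -1) (\<lambda>i. i))"
  have neg: "?neg U (i, j) = - U (i, j)" if "i < ?k" "j < ?k" for U i j
    using that by (subst signed_perm_mult) auto
  have cb: "(\<lambda>A. F (corner_block (Suc ?k) p (Suc q) A)) \<in> borel_measurable (mat_space (Suc ?k) (Suc ?k))"
    by (rule measurable_compose[OF corner_block_measurable]) auto
  have rm: "(\<lambda>x. F (?r (add_column ?\<sigma> p q (f x) (W x)))) \<in> borel_measurable M"
    if "\<And>l. l < p \<Longrightarrow> (\<lambda>x. f x l) \<in> borel_measurable M" "\<And>l j. l < p \<Longrightarrow> j < q \<Longrightarrow> (\<lambda>x. W x (l, j)) \<in> borel_measurable M"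
    for f W and M :: "'z measure"
  proof (rule measurable_compose[OF _ Suc.prems], rule measurable_mat_spaceI)
    fix i j assume "i < p" "j < Suc q"
    then show "(\<lambda>x. ?r (add_column ?\<sigma> p q (f x) (W x)) (i, j)) \<in> borel_measurable M"
      by (simp, intro add_column_measurable) (auto intro: that)
  qed (rule restrict_mat_space)
  have "(\<integral>\<^sup>+G. F (corner_block (Suc ?k) p (Suc q) G) \<partial>H (Suc ?k)) =
     (\<integral>\<^sup>+t. \<integral>\<^sup>+U. F (corner_block (Suc ?k) p (Suc q) (mat_mult (Suc ?k) (hess (Suc ?k) t) (embed_head ?k U))) \<partial>H ?k \<partial>PiM {..<Suc ?k} corner)"
    by (rule hess_representation[OF cb])
  also have "\<dots> = (\<integral>\<^sup>+t. \<integral>\<^sup>+U. F (?r (add_column ?\<sigma> p q (?t t) (corner_block ?k p q U))) \<partial>H ?k \<partial>PiM {..<Suc ?k} corner)"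
  proof (rule nn_integral_cong)
    fix t
    have "(\<integral>\<^sup>+U. F (corner_block (Suc ?k) p (Suc q) (mat_mult (Suc ?k) (hess (Suc ?k) t) (embed_head ?k U))) \<partial>H ?k) =
      (\<integral>\<^sup>+U. F (corner_block (Suc ?k) p (Suc q) (mat_mult (Suc ?k) (hess (Suc ?k) t) (embed_head ?k (?neg U)))) \<partial>H ?k)"
      by (rule nn_integral_negate, rule measurable_compose[OF _ cb]) measurable
    also have "\<dots> = (\<integral>\<^sup>+U. F (?r (add_column ?\<sigma> p q (?t t) (corner_block ?k p q U))) \<partial>H ?k)"
    proof (intro nn_integral_cong arg_cong[of _ _ F])
      fix U
      show "corner_block (Suc ?k) p (Suc q) (mat_mult (Suc ?k) (hess (Suc ?k) t) (embed_head ?k (?neg U))) = ?r (add_column ?\<sigma> p q (?t t) (corner_block ?k p q U))"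
      proof (rule mat_space_eqI[of _ p "Suc q"])
        fix i j assume ij: "i < p" "j < Suc q"
        have "corner_block (Suc ?k) p (Suc q) (mat_mult (Suc ?k) (hess (Suc ?k) t) (embed_head ?k (?neg U))) (i, j)
          = add_column ?\<sigma> p q (\<lambda>i. t (Suc (?k - p) + i)) (corner_block ?k p q U) (i, j)"
          by (rule corner_block_hess) (use ij neg in auto)
        also have "?k - p = d + q" by simp
        finally show "corner_block (Suc ?k) p (Suc q) (mat_mult (Suc ?k) (hess (Suc ?k) t) (embed_head ?k (?neg U))) (i, j) =
          ?r (add_column ?\<sigma> p q (?t t) (corner_block ?k p q U)) (i, j)" using ij by simp
      qed (simp_all add: corner_block_def)
    qed
    finally show "(\<integral>\<^sup>+U. F (corner_block (Suc ?k) p (Suc q) (mat_mult (Suc ?k) (hess (Suc ?k) t) (embed_head ?k U))) \<partial>H ?k) =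
      (\<integral>\<^sup>+U. F (?r (add_column ?\<sigma> p q (?t t) (corner_block ?k p q U))) \<partial>H ?k)" .
  qed
  also have "\<dots> = (\<integral>\<^sup>+t. \<integral>\<^sup>+T. F (?r (add_column ?\<sigma> p q (?t t) (block_coords ?\<sigma> p q T))) \<partial>PiM ?I (coord_law d) \<partial>PiM {..<Suc ?k} corner)"
  proof (rule nn_integral_cong)
    fix t
    have "(\<integral>\<^sup>+U. F (?r (add_column ?\<sigma> p q (?t t) (corner_block ?k p q U))) \<partial>H ?k) =
       (\<integral>\<^sup>+T. F (?r (add_column ?\<sigma> p q (?t t) (restrict (block_coords ?\<sigma> p q T) ?I))) \<partial>PiM ?I (coord_law d))"
      by (rule Suc.IH[of "\<lambda>W. F (?r (add_column ?\<sigma> p q (?t t) W))"], rule rm) auto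
    also have "\<dots> = (\<integral>\<^sup>+T. F (?r (add_column ?\<sigma> p q (?t t) (block_coords ?\<sigma> p q T))) \<partial>PiM ?I (coord_law d))"
    proof (intro nn_integral_cong arg_cong[of _ _ F] restrict_ext)
      fix T x assume "x \<in> {..<p} \<times> {..<Suc q}"
      then show "add_column ?\<sigma> p q (?t t) (restrict (block_coords ?\<sigma> p q T) ?I) x = add_column ?\<sigma> p q (?t t) (block_coords ?\<sigma> p q T) x"
        by (cases x) (auto intro!: add_column_cong)
    qed
    finally show "(\<integral>\<^sup>+U. F (?r (add_column ?\<sigma> p q (?t t) (corner_block ?k p q U))) \<partial>H ?k) =
      (\<integral>\<^sup>+T. F (?r (add_column ?\<sigma> p q (?t t) (block_coords ?\<sigma> p q T))) \<partial>PiM ?I (coord_law d))" .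
  qed
  also have "\<dots> = (\<integral>\<^sup>+t. \<integral>\<^sup>+T. F (?r (add_column ?\<sigma> p q (\<lambda>i. t (i, q)) (block_coords ?\<sigma> p q T))) \<partial>PiM ?I (coord_law d) \<partial>PiM ?J (coord_law d))"
  proof -
    let ?f = "\<lambda>x::nat \<times> nat. Suc (d + q) + fst x"
    \<comment> \<open>Marginal of the product law on the coordinates in use, relabelled by the
      positions of the new column.\<close>
    have D: "distr (PiM {..<Suc ?k} corner) (PiM ?J (\<lambda>x. corner (?f x))) (\<lambda>\<omega>. \<lambda>x\<in>?J. \<omega> (?f x)) = PiM ?J (\<lambda>x. corner (?f x))"
      by (rule distr_PiM_reindex) (auto simp: prob_corner inj_on_def)
    have J: "PiM ?J (coord_law d) = PiM ?J (\<lambda>x. corner (?f x))" by (rule PiM_cong) (auto simp: add_ac)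
    have meas: "(\<lambda>t. \<integral>\<^sup>+T. F (?r (add_column ?\<sigma> p q (\<lambda>i. t (i, q)) (block_coords ?\<sigma> p q T))) \<partial>PiM ?I (coord_law d)) \<in> borel_measurable (PiM ?J (\<lambda>x. corner (?f x)))"
    proof -
      interpret sigma_finite_measure "PiM ?I (coord_law d)" by (intro prob_space_imp_sigma_finite prob_space_PiM prob_corner)
      have [measurable]: "(\<lambda>x. fst x (l, q)) \<in> borel_measurable (PiM ?J (\<lambda>x. corner (?f x)) \<Otimes>\<^sub>M PiM ?I (coord_law d))" if "l < p" for l
      proof -
        have "(\<lambda>t. t (l, q)) \<in> measurable (PiM ?J (\<lambda>x. corner (?f x))) (corner (?f (l, q)))"
          by (rule measurable_component_singleton) (use that in auto)
        then have "(\<lambda>t. t (l, q)) \<in> borel_measurable (PiM ?J (\<lambda>x. corner (?f x)))" by (simp cong: measurable_cong_sets)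
        then show ?thesis by (rule measurable_compose[OF measurable_fst])
      qed
      have [measurable]: "(\<lambda>x. snd x (l, j)) \<in> borel_measurable (PiM ?J (\<lambda>x. corner (?f x)) \<Otimes>\<^sub>M PiM ?I (coord_law d))" if "l < p" "j < q" for l j
      proof -
        have "(\<lambda>t. t (l, j)) \<in> measurable (PiM ?I (coord_law d)) (coord_law d (l, j))"
          by (rule measurable_component_singleton) (use that in auto)
        then have "(\<lambda>t. t (l, j)) \<in> borel_measurable (PiM ?I (coord_law d))" by (simp cong: measurable_cong_sets)
        then show ?thesis by (rule measurable_compose[OF measurable_snd])
      qed
      have "(\<lambda>x. F (?r (add_column ?\<sigma> p q (\<lambda>i. fst x (i, q)) (block_coords ?\<sigma> p q (snd x))))) \<in> borel_measurable (PiM ?J (\<lambda>x. corner (?f x)) \<Otimes>\<^sub>M PiM ?I (coord_law d))"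
        by (rule rm) (auto intro!: block_coords_measurable)
      then show ?thesis by (intro borel_measurable_nn_integral) (simp add: case_prod_unfold)
    qed
    have "(\<integral>\<^sup>+t. \<integral>\<^sup>+T. F (?r (add_column ?\<sigma> p q (\<lambda>i. t (i, q)) (block_coords ?\<sigma> p q T))) \<partial>PiM ?I (coord_law d) \<partial>PiM ?J (coord_law d)) =
      (\<integral>\<^sup>+t. \<integral>\<^sup>+T. F (?r (add_column ?\<sigma> p q (\<lambda>i. (\<lambda>x\<in>?J. t (?f x)) (i, q)) (block_coords ?\<sigma> p q T))) \<partial>PiM ?I (coord_law d) \<partial>PiM {..<Suc ?k} corner)"
    proof -
      let ?h = "\<lambda>t. \<integral>\<^sup>+T. F (?r (add_column ?\<sigma> p q (\<lambda>i. t (i, q)) (block_coords ?\<sigma> p q T))) \<partial>PiM ?I (coord_law d)"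
      have res: "(\<lambda>\<omega>. \<lambda>x\<in>?J. \<omega> (?f x)) \<in> measurable (PiM {..<Suc ?k} corner) (PiM ?J (\<lambda>x. corner (?f x)))"
        by (intro measurable_restrict measurable_component_singleton) auto
      have "(\<integral>\<^sup>+t. ?h t \<partial>PiM ?J (coord_law d)) = (\<integral>\<^sup>+t. ?h t \<partial>distr (PiM {..<Suc ?k} corner) (PiM ?J (\<lambda>x. corner (?f x))) (\<lambda>\<omega>. \<lambda>x\<in>?J. \<omega> (?f x)))"
        unfolding J D ..
      also have "\<dots> = (\<integral>\<^sup>+t. ?h (\<lambda>x\<in>?J. t (?f x)) \<partial>PiM {..<Suc ?k} corner)"
        by (rule nn_integral_distr[OF res]) (simp only: measurable_distr_eq1 meas)
      finally show ?thesis .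
    qed
    also have "\<dots> = (\<integral>\<^sup>+t. \<integral>\<^sup>+T. F (?r (add_column ?\<sigma> p q (?t t) (block_coords ?\<sigma> p q T))) \<partial>PiM ?I (coord_law d) \<partial>PiM {..<Suc ?k} corner)"
    proof (intro nn_integral_cong arg_cong[of _ _ F] restrict_ext)
      fix t T x assume "x \<in> {..<p} \<times> {..<Suc q}"
      then show "add_column ?\<sigma> p q (\<lambda>i. (\<lambda>x\<in>?J. t (?f x)) (i, q)) (block_coords ?\<sigma> p q T) x = add_column ?\<sigma> p q (?t t) (block_coords ?\<sigma> p q T) x"
        by (cases x) (auto intro!: add_column_cong)
    qed
    finally show ?thesis ..
  qed
  also have "\<dots> = (\<integral>\<^sup>+T. F (?r (block_coords ?\<sigma> p (Suc q) T)) \<partial>PiM (?J \<union> ?I) (coord_law d))"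
  proof (subst P.product_nn_integral_fold)
    show "(\<lambda>T. F (?r (block_coords ?\<sigma> p (Suc q) T))) \<in> borel_measurable (PiM (?J \<union> ?I) (coord_law d))"
    proof (simp only: block_coords.simps, rule rm)
      have c: "(\<lambda>t. t (l, j)) \<in> borel_measurable (PiM (?J \<union> ?I) (coord_law d))" if "(l, j) \<in> ?J \<union> ?I" for l j
        using measurable_component_singleton[OF that, of "coord_law d"] by (simp cong: measurable_cong_sets)
      show "(\<lambda>T. T (l, q)) \<in> borel_measurable (PiM (?J \<union> ?I) (coord_law d))" if "l < p" for l using that by (intro c) auto
      show "(\<lambda>T. block_coords ?\<sigma> p q T (l, j)) \<in> borel_measurable (PiM (?J \<union> ?I) (coord_law d))" if "l < p" "j < q" for l j
        using that by (intro block_coords_measurable c) auto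
    qed
    show "(\<integral>\<^sup>+t. \<integral>\<^sup>+T. F (?r (add_column ?\<sigma> p q (\<lambda>i. t (i, q)) (block_coords ?\<sigma> p q T))) \<partial>PiM ?I (coord_law d) \<partial>PiM ?J (coord_law d)) =
      (\<integral>\<^sup>+t. \<integral>\<^sup>+T. F (?r (block_coords ?\<sigma> p (Suc q) (merge ?J ?I (t, T)))) \<partial>PiM ?I (coord_law d) \<partial>PiM ?J (coord_law d))"
    proof (intro nn_integral_cong arg_cong[of _ _ F] restrict_ext)
      fix t T x assume "x \<in> {..<p} \<times> {..<Suc q}"
      then show "add_column ?\<sigma> p q (\<lambda>i. t (i, q)) (block_coords ?\<sigma> p q T) x = block_coords ?\<sigma> p (Suc q) (merge ?J ?I (t, T)) x"
        by (cases x) (auto intro!: add_column_cong block_coords_cong simp: merge_def)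
    qed
  qed auto
  also have "?J \<union> ?I = {..<p} \<times> {..<Suc q}" by auto
  finally show ?case unfolding k .
qed

end

text \<open>The coordinate of largest rank enters only its own component, and there affinely: Fubini
  and a one-dimensional substitution remove it, leaving a triangular map in fewer variables. The
  measurable left inverse is carried along because the density of the image law has to be a function
  of the image point.\<close>

lemma triangular_change_of_variables:
  fixes a b :: "'i \<Rightarrow> ('i \<Rightarrow> real) \<Rightarrow> real" and rank :: "'i \<Rightarrow> nat"
  assumes "finite I" and "inj_on rank I"
    and "\<And>x. x \<in> I \<Longrightarrow> a x \<in> borel_measurable (PiM I (\<lambda>_. lborel))"
    and "\<And>x. x \<in> I \<Longrightarrow> b x \<in> borel_measurable (PiM I (\<lambda>_. lborel))"
    and "\<And>x t. x \<in> I \<Longrightarrow> 0 < b x t"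
    and "\<And>x t t'. x \<in> I \<Longrightarrow> (\<And>y. y \<in> I \<Longrightarrow> rank y < rank x \<Longrightarrow> t y = t' y) \<Longrightarrow> a x t = a x t'"
    and "\<And>x t t'. x \<in> I \<Longrightarrow> (\<And>y. y \<in> I \<Longrightarrow> rank y < rank x \<Longrightarrow> t y = t' y) \<Longrightarrow> b x t = b x t'"
  shows "(\<forall>F \<in> borel_measurable (PiM I (\<lambda>_. lborel)).
      (\<integral>\<^sup>+t. F (\<lambda>x\<in>I. a x t + b x t * t x) * ennreal (\<Prod>x\<in>I. b x t) \<partial>PiM I (\<lambda>_. lborel)) = (\<integral>\<^sup>+z. F z \<partial>PiM I (\<lambda>_. lborel)))
    \<and> (\<exists>\<Psi> \<in> measurable (PiM I (\<lambda>_. lborel)) (PiM I (\<lambda>_. lborel)).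
      \<forall>t \<in> space (PiM I (\<lambda>_. lborel)). \<Psi> (\<lambda>x\<in>I. a x t + b x t * t x) = t)"
  using assms
proof (induction "card I" arbitrary: I a b)
  case 0
  have I: "I = {}" using 0(1,2) by simp
  have e: "restrict f {} = t" if "t \<in> space (PiM {} (\<lambda>_::'i. lborel :: real measure))" for f t
  proof (rule ext)
    fix x
    have "t x = undefined" using that unfolding space_PiM_empty by (rule singletonD[THEN fun_cong])
    then show "restrict f {} x = t x" by (simp only: restrict_apply empty_iff if_False)
  qed
  show ?case unfolding I
  proof (intro conjI ballI bexI[of _ "\<lambda>t. t"])
    fix F :: "('i \<Rightarrow> real) \<Rightarrow> ennreal"
    show "(\<integral>\<^sup>+t. F (\<lambda>x\<in>{}. a x t + b x t * t x) * ennreal (\<Prod>x\<in>{}. b x t) \<partial>PiM {} (\<lambda>_. lborel)) = (\<integral>\<^sup>+z. F z \<partial>PiM {} (\<lambda>_. lborel))"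
      by (intro nn_integral_cong) (simp only: e prod.empty ennreal_1 mult_1_right)
  qed (rule e measurable_ident_sets[OF refl] | assumption)+
next
  case (Suc n)
  note fin = Suc.prems(1) and inj = Suc.prems(2) and am = Suc.prems(3) and bm = Suc.prems(4)
    and bpos = Suc.prems(5) and ac = Suc.prems(6) and bc = Suc.prems(7)
  have "I \<noteq> {}" using Suc.hyps(2) by auto
  define w where "w = (ARG_MAX rank x. x \<in> I)"
  have w: "w \<in> I" "\<And>y. y \<in> I \<Longrightarrow> rank y \<le> rank w"
  proof -
    obtain z where z: "z \<in> I" using \<open>I \<noteq> {}\<close> by blast
    have bd: "\<forall>y. y \<in> I \<longrightarrow> rank y < Suc (Max (rank ` I))" using fin by (auto simp: less_Suc_eq_le)
    show "w \<in> I" unfolding w_def by (rule arg_max_natI[OF z bd])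
    show "\<And>y. y \<in> I \<Longrightarrow> rank y \<le> rank w" unfolding w_def by (rule arg_max_nat_le[OF _ bd])
  qed
  define J where "J = I - {w}"
  have IJ: "I = insert w J" "w \<notin> J" "finite J" using w fin by (auto simp: J_def)
  have IJu: "I = J \<union> {w}" using IJ(1) by auto
  have rw: "rank y < rank w" if "y \<in> J" for y
  proof -
    have "rank y \<noteq> rank w" using inj_onD[OF inj, of y w] that w(1) by (auto simp: J_def)
    then show ?thesis using w(2)[of y] that by (auto simp: J_def)
  qed
  have rnw: "\<not> rank w < rank x" if "x \<in> I" for x using w(2)[OF that] by simp
  let ?L = "\<lambda>K. PiM K (\<lambda>_::'i. lborel :: real measure)"
  interpret product_sigma_finite "\<lambda>_::'i. lborel :: real measure" ..
  \<comment> \<open>The value 0 is arbitrary: no \<open>a x\<close> or \<open>b x\<close> depends on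
    the coordinate of largest rank.\<close>
  let ?ext = "\<lambda>t. t(w := 0)"
  have extm: "?ext \<in> measurable (?L J) (?L I)"
    by (rule measurable_fun_upd[OF IJu]) auto
  define a' where "a' x t = a x (?ext t)" for x t
  define b' where "b' x t = b x (?ext t)" for x t
  have a'm: "a' x \<in> borel_measurable (?L J)" and b'm: "b' x \<in> borel_measurable (?L J)" if "x \<in> I" for x
    unfolding a'_def b'_def using measurable_compose[OF extm am[OF that]] measurable_compose[OF extm bm[OF that]] by auto
  have ae: "a x t = a' x t'" "b x t = b' x t'" if x: "x \<in> I" and tt: "\<And>y. y \<in> J \<Longrightarrow> t y = t' y" for x t t'
  proof -
    have tt2: "t y = (?ext t') y" if "y \<in> I" "rank y < rank x" for y
      using rnw[OF x] that tt[of y] by (cases "y = w") (simp_all add: J_def)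
    show "a x t = a' x t'" unfolding a'_def by (rule ac[OF x tt2])
    show "b x t = b' x t'" unfolding b'_def by (rule bc[OF x tt2])
  qed
  have IH: "(\<forall>F \<in> borel_measurable (?L J).
      (\<integral>\<^sup>+t. F (\<lambda>x\<in>J. a' x t + b' x t * t x) * ennreal (\<Prod>x\<in>J. b' x t) \<partial>?L J) = (\<integral>\<^sup>+z. F z \<partial>?L J))
    \<and> (\<exists>\<Psi> \<in> measurable (?L J) (?L J). \<forall>t \<in> space (?L J). \<Psi> (\<lambda>x\<in>J. a' x t + b' x t * t x) = t)"
  proof (rule Suc.hyps(1))
    show "n = card J" using Suc.hyps(2) IJ by simp
    show "inj_on rank J" using inj by (rule inj_on_subset) (auto simp: J_def)
    fix x assume x: "x \<in> J"
    then have xI: "x \<in> I" by (simp add: J_def)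
    show "a' x \<in> borel_measurable (?L J)" "b' x \<in> borel_measurable (?L J)" using a'm[OF xI] b'm[OF xI] by auto
    show "0 < b' x t" for t unfolding b'_def by (rule bpos[OF xI])
    show "a' x t = a' x t'" "b' x t = b' x t'" if "\<And>y. y \<in> J \<Longrightarrow> rank y < rank x \<Longrightarrow> t y = t' y" for t t'
    proof -
      have tt2: "(?ext t) y = (?ext t') y" if "y \<in> I" "rank y < rank x" for y
        using that \<open>\<And>y. y \<in> J \<Longrightarrow> rank y < rank x \<Longrightarrow> t y = t' y\<close>[of y] by (cases "y = w") (simp_all add: J_def)
      show "a' x t = a' x t'" unfolding a'_def by (rule ac[OF xI tt2])
      show "b' x t = b' x t'" unfolding b'_def by (rule bc[OF xI tt2])
    qed
  qed (use IJ in auto)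
  let ?\<Phi> = "\<lambda>t. \<lambda>x\<in>I. a x t + b x t * t x" and ?\<Phi>' = "\<lambda>t. \<lambda>x\<in>J. a' x t + b' x t * t x"
  have comp: "(\<lambda>t. t x) \<in> borel_measurable (?L K)" if "x \<in> K" for x K
    using measurable_component_singleton[OF that, of "\<lambda>_. lborel :: real measure"] by simp
  have \<Phi>m: "?\<Phi> \<in> measurable (?L I) (?L I)"
  proof (rule measurable_restrict)
    fix x assume x: "x \<in> I"
    note [measurable] = am[OF x] bm[OF x] comp[OF x]
    show "(\<lambda>t. a x t + b x t * t x) \<in> measurable (?L I) lborel" by simp
  qed
  have \<Phi>'m: "?\<Phi>' \<in> measurable (?L J) (?L J)"
  proof (rule measurable_restrict)
    fix x assume x: "x \<in> J"
    then have xI: "x \<in> I" by (simp add: J_def)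
    note [measurable] = a'm[OF xI] b'm[OF xI] comp[OF x]
    show "(\<lambda>t. a' x t + b' x t * t x) \<in> measurable (?L J) lborel" by simp
  qed
  have \<Phi>upd: "?\<Phi> (t(w := s)) = (?\<Phi>' t)(w := a' w t + b' w t * s)" for t s
  proof (rule ext)
    fix x
    have e: "a x (t(w := s)) = a' x t" "b x (t(w := s)) = b' x t" if "x \<in> I"
    proof -
      have "(t(w := s)) y = t y" if "y \<in> J" for y using that by (auto simp: J_def)
      then show "a x (t(w := s)) = a' x t" "b x (t(w := s)) = b' x t" using ae[OF that, of "t(w := s)" t] by blast+
    qed
    show "?\<Phi> (t(w := s)) x = ((?\<Phi>' t)(w := a' w t + b' w t * s)) x"
      using e w(1) by (cases "x = w") (auto simp: J_def)
  qed
  have prod: "(\<Prod>x\<in>I. b x (t(w := s))) = b' w t * (\<Prod>x\<in>J. b' x t)" for t s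
  proof -
    have e: "b x (t(w := s)) = b' x t" if "x \<in> I" for x
      by (rule ae(2)[OF that]) (auto simp: J_def)
    have "(\<Prod>x\<in>I. b x (t(w := s))) = (\<Prod>x\<in>I. b' x t)" by (rule prod.cong) (auto simp: e)
    then show ?thesis using IJ by simp
  qed
  have b'pos: "0 < b' x t" if "x \<in> I" for x t unfolding b'_def by (rule bpos[OF that])
  have 1: "(\<integral>\<^sup>+t. F (?\<Phi> t) * ennreal (\<Prod>x\<in>I. b x t) \<partial>?L I) = (\<integral>\<^sup>+z. F z \<partial>?L I)"
    if F[measurable]: "F \<in> borel_measurable (?L I)" for F
  proof -
    have upd: "(\<lambda>x. (fst x)(w := snd x)) \<in> measurable (?L J \<Otimes>\<^sub>M lborel) (?L I)"
      by (rule measurable_fun_upd[OF IJu]) auto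
    have updz: "(\<lambda>s. z(w := s)) \<in> measurable lborel (?L I)" if "z \<in> space (?L J)" for z
      using that by (intro measurable_fun_upd[OF IJu]) auto
    have G: "(\<lambda>z. \<integral>\<^sup>+s. F (z(w := s)) \<partial>lborel) \<in> borel_measurable (?L J)"
      by (rule lborel.borel_measurable_nn_integral) (use measurable_compose[OF upd F] in \<open>simp add: case_prod_unfold\<close>)
    have Fm: "(\<lambda>t. F (?\<Phi> t) * ennreal (\<Prod>x\<in>I. b x t)) \<in> borel_measurable (?L I)"
    proof -
      have "(\<lambda>t. \<Prod>x\<in>I. b x t) \<in> borel_measurable (?L I)" by (intro borel_measurable_prod bm)
      then show ?thesis using measurable_compose[OF \<Phi>m F] by measurable
    qed
    have "(\<integral>\<^sup>+t. F (?\<Phi> t) * ennreal (\<Prod>x\<in>I. b x t) \<partial>?L I) =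
      (\<integral>\<^sup>+t. \<integral>\<^sup>+s. F (?\<Phi> (t(w := s))) * ennreal (\<Prod>x\<in>I. b x (t(w := s))) \<partial>lborel \<partial>?L J)"
      using product_nn_integral_insert[OF IJ(3,2), of "\<lambda>t. F (?\<Phi> t) * ennreal (\<Prod>x\<in>I. b x t)"] Fm
      unfolding IJ(1)[symmetric] by simp
    also have "\<dots> = (\<integral>\<^sup>+t. (\<integral>\<^sup>+s. F ((?\<Phi>' t)(w := s)) \<partial>lborel) * ennreal (\<Prod>x\<in>J. b' x t) \<partial>?L J)"
    proof (rule nn_integral_cong)
      fix t assume t: "t \<in> space (?L J)"
      have Ft: "(\<lambda>s. F ((?\<Phi>' t)(w := s))) \<in> borel_measurable borel"
        using measurable_compose[OF updz F, of "?\<Phi>' t"] measurable_space[OF \<Phi>'m t] by simp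
      have P0: "0 \<le> (\<Prod>x\<in>J. b' x t)" by (intro prod_nonneg) (auto simp: J_def intro: less_imp_le b'pos)
      have "(\<integral>\<^sup>+s. F (?\<Phi> (t(w := s))) * ennreal (\<Prod>x\<in>I. b x (t(w := s))) \<partial>lborel) =
        (\<integral>\<^sup>+s. ennreal (\<Prod>x\<in>J. b' x t) * (ennreal (b' w t) * F ((?\<Phi>' t)(w := a' w t + b' w t * s))) \<partial>lborel)"
        unfolding \<Phi>upd prod using P0 b'pos[OF w(1), of t] by (intro nn_integral_cong) (simp add: ennreal_mult' mult_ac)
      also have "\<dots> = ennreal (\<Prod>x\<in>J. b' x t) * (ennreal \<bar>b' w t\<bar> * (\<integral>\<^sup>+s. F ((?\<Phi>' t)(w := a' w t + b' w t * s)) \<partial>lborel))"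
        using b'pos[OF w(1), of t] Ft
        by (subst nn_integral_cmult; (subst nn_integral_cmult)?)
          (auto intro!: measurable_compose[OF _ Ft] borel_measurable_times_ennreal borel_measurable_const)
      also have "\<dots> = ennreal (\<Prod>x\<in>J. b' x t) * (\<integral>\<^sup>+s. F ((?\<Phi>' t)(w := s)) \<partial>lborel)"
        using nn_integral_real_affine[OF Ft, of "b' w t" "a' w t"] b'pos[OF w(1), of t] by simp
      finally show "(\<integral>\<^sup>+s. F (?\<Phi> (t(w := s))) * ennreal (\<Prod>x\<in>I. b x (t(w := s))) \<partial>lborel) =
        (\<integral>\<^sup>+s. F ((?\<Phi>' t)(w := s)) \<partial>lborel) * ennreal (\<Prod>x\<in>J. b' x t)" by (simp add: mult.commute)
    qed
    also have "\<dots> = (\<integral>\<^sup>+z. \<integral>\<^sup>+s. F (z(w := s)) \<partial>lborel \<partial>?L J)"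
      by (rule IH[THEN conjunct1, rule_format, OF G])
    also have "\<dots> = (\<integral>\<^sup>+z. F z \<partial>?L I)"
      using product_nn_integral_insert[OF IJ(3,2), of F] F unfolding IJ(1)[symmetric] by simp
    finally show ?thesis .
  qed
  obtain \<Psi> where \<Psi>: "\<Psi> \<in> measurable (?L J) (?L J)" "\<And>t. t \<in> space (?L J) \<Longrightarrow> \<Psi> (?\<Phi>' t) = t"
    using IH by blast
  \<comment> \<open>Recover the coordinates in J first; they determine the affine equation for the
    last one.\<close>
  define \<Psi>' where "\<Psi>' z = (let t = \<Psi> (restrict z J) in t(w := (z w - a' w t) / b' w t))" for z
  have res: "(\<lambda>z. restrict z J) \<in> measurable (?L I) (?L J)"
    by (rule measurable_restrict_subset) (auto simp: J_def)
  have 2: "\<Psi>' \<in> measurable (?L I) (?L I)"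
  proof -
    have t: "(\<lambda>z. \<Psi> (restrict z J)) \<in> measurable (?L I) (?L J)" by (rule measurable_compose[OF res \<Psi>(1)])
    note [measurable] = measurable_compose[OF t a'm[OF w(1)]] measurable_compose[OF t b'm[OF w(1)]] comp[OF w(1)]
    have "(\<lambda>z. (z w - a' w (\<Psi> (restrict z J))) / b' w (\<Psi> (restrict z J))) \<in> borel_measurable (?L I)" by measurable
    then show ?thesis unfolding \<Psi>'_def Let_def using t
      by (intro measurable_fun_upd[OF IJu]) auto
  qed
  have 3: "\<Psi>' (?\<Phi> t) = t" if t: "t \<in> space (?L I)" for t
  proof -
    have tJ: "restrict t J \<in> space (?L J)" using measurable_space[OF res t] .
    have r: "restrict (?\<Phi> t) J = ?\<Phi>' (restrict t J)"
    proof (rule ext)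
      fix x
      show "restrict (?\<Phi> t) J x = ?\<Phi>' (restrict t J) x"
      proof (cases "x \<in> J")
        case True
        then have "x \<in> I" by (simp add: J_def)
        then show ?thesis using ae[of x t "restrict t J"] True by simp
      qed simp
    qed
    have e: "a w t = a' w (restrict t J)" "b w t = b' w (restrict t J)" using ae[OF w(1), of t "restrict t J"] by auto
    have "\<Psi>' (?\<Phi> t) = (restrict t J)(w := t w)"
      unfolding \<Psi>'_def Let_def r \<Psi>(2)[OF tJ] using w(1) b'pos[OF w(1), of "restrict t J"] e by (simp add: fun_upd_def)
    also have "\<dots> = t" using t by (auto simp: space_PiM J_def PiE_def extensional_def fun_eq_iff)
    finally show ?thesis .
  qed
  show ?case using 1 2 3 by blast
qed

section \<open>The law of a corner entry\<close>

text \<open>On [-1, 1] all absolute moments are at most 1, so the Taylor polynomial of degree n of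
  the characteristic function has error at most 2 |t|^n / n!. Equal moments therefore give equal
  characteristic functions.\<close>

lemma real_distribution_eqI_moments:
  assumes M: "real_distribution M" "AE x in M. \<bar>x\<bar> \<le> 1" and N: "real_distribution N" "AE x in N. \<bar>x\<bar> \<le> 1"
    and eq: "\<And>k. (\<integral>x. x ^ k \<partial>M) = (\<integral>x. x ^ k \<partial>N)"
  shows "M = N"
proof (rule Levy_uniqueness[OF M(1) N(1)])
  have approx: "cmod (char K t - (\<Sum>k\<le>n. ((\<i> * t) ^ k / fact k) * (\<integral>x. x ^ k \<partial>K))) \<le> 2 * \<bar>t\<bar> ^ n / fact n"
    if K: "real_distribution K" "AE x in K. \<bar>x\<bar> \<le> 1" for K t n
  proof -
    interpret real_distribution K by (rule K)
    have b: "AE x in K. \<bar>x ^ k\<bar> \<le> 1" for k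
      using K(2) by eventually_elim (simp add: power_abs power_le_one)
    have int: "integrable K (\<lambda>x. x ^ k)" for k
      by (rule integrable_const_bound[of _ 1]) (use b in auto)
    have "(\<integral>x. \<bar>x\<bar> ^ n \<partial>K) \<le> (\<integral>x. 1 \<partial>K)"
    proof (rule integral_mono_AE)
      show "integrable K (\<lambda>x. \<bar>x\<bar> ^ n)" using integrable_abs[OF int[of n]] by (simp add: power_abs)
    qed (use b[of n] in \<open>auto simp: power_abs\<close>)
    then have "(\<integral>x. \<bar>x\<bar> ^ n \<partial>K) \<le> 1" using prob_space by simp
    then have "2 * \<bar>t\<bar> ^ n / fact n * (\<integral>x. \<bar>x\<bar> ^ n \<partial>K) \<le> 2 * \<bar>t\<bar> ^ n / fact n * 1"
      by (intro mult_left_mono) auto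
    then show ?thesis using char_approx1[of n t] int by simp
  qed
  show "char M = char N"
  proof (rule ext)
    fix t
    have "cmod (char M t - char N t) \<le> 4 * (\<bar>t\<bar> ^ n / fact n)" for n
    proof -
      let ?S = "\<Sum>k\<le>n. ((\<i> * t) ^ k / fact k) * complex_of_real (\<integral>x. x ^ k \<partial>N)"
      have "char M t - char N t = (char M t - ?S) - (char N t - ?S)" by simp
      then have "cmod (char M t - char N t) \<le> cmod (char M t - ?S) + cmod (char N t - ?S)"
        by (simp only: norm_triangle_ineq4)
      then show ?thesis using approx[OF M, of t n, unfolded eq] approx[OF N, of t n] by simp
    qed
    moreover have "(\<lambda>n. 4 * (\<bar>t\<bar> ^ n / fact n)) \<longlonglongrightarrow> 4 * 0"
      by (intro tendsto_mult_left summable_LIMSEQ_zero) (use summable_exp[of "\<bar>t\<bar>"] in \<open>simp add: field_simps\<close>)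
    ultimately have "cmod (char M t - char N t) \<le> 4 * 0"
      by (intro LIMSEQ_le_const[of "\<lambda>n. 4 * (\<bar>t\<bar> ^ n / fact n)"]) auto
    then show "char M t = char N t" by simp
  qed
qed

lemma coeff_one_plus_square_power:
  "coeff ([:1, 0, 1:] ^ k :: real poly) 0 = 1" "coeff ([:1, 0, 1:] ^ k :: real poly) 1 = 0"
  "coeff ([:1, 0, 1:] ^ k :: real poly) 2 = real k"
proof (induction k)
  case (Suc k)
  have "[:1, 0, 1:] ^ Suc k = [:1, 0, 1:] ^ k + pCons 0 (pCons 0 ([:1, 0, 1:] ^ k :: real poly))"
    by (simp add: algebra_simps)
  then show "coeff ([:1, 0, 1:] ^ Suc k :: real poly) 0 = 1" "coeff ([:1, 0, 1:] ^ Suc k :: real poly) 1 = 0"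
    "coeff ([:1, 0, 1:] ^ Suc k :: real poly) 2 = real (Suc k)"
    using Suc by (simp_all only: coeff_add coeff_pCons_0) (simp_all add: coeff_pCons numeral_2_eq_2)
qed (simp_all add: coeff_1 )

context haar_family begin

lemma corner_AE: "AE t in corner i. \<bar>t\<bar> \<le> 1"
proof -
  interpret haar "Suc i" "H (Suc i)" by (rule haar_H)
  show ?thesis unfolding corner_def
    by (subst AE_distr_iff) (use AE_orth in \<open>auto elim!: eventually_mono intro!: orthogonal_mat_bound\<close>)
qed

lemma corner_real_distribution: "real_distribution (corner i)"
  by (intro real_distribution.intro prob_corner real_distribution_axioms.intro) auto

lemma integral_corner: "f \<in> borel_measurable borel \<Longrightarrow> (\<integral>t. f t \<partial>corner i) = (\<integral>A. f (A (i, i)) \<partial>H (Suc i) :: real)"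
  unfolding corner_def by (rule integral_distr) auto

lemma corner_power_integrable: "integrable (corner i) (\<lambda>t. t ^ k)"
proof -
  have [measurable]: "(\<lambda>t. t ^ k) \<in> borel_measurable (corner i)"
    by (subst measurable_cong_sets[OF sets_corner refl]) simp
  show ?thesis
    by (rule finite_measure.integrable_const_bound[OF prob_space.finite_measure[OF prob_corner], of _ 1]) (use corner_AE[of i] in \<open>auto elim!: eventually_mono simp: power_abs power_le_one\<close>)
qed

lemma corner_odd: "odd k \<Longrightarrow> (\<integral>t. t ^ k \<partial>corner i) = 0"
proof -
  assume k: "odd k"
  interpret haar "Suc i" "H (Suc i)" by (rule haar_H)
  have "(\<integral>A. A (i, i) ^ k \<partial>H (Suc i)) = (\<integral>A. (mat_mult (Suc i) (signed_perm (Suc i) (\<lambda>_. -1) (\<lambda>x. x)) A (i, i)) ^ k \<partial>H (Suc i))"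
    by (rule int_left[symmetric]) (auto intro!: signed_perm_orthogonal simp: bij_betw_def)
  also have "\<dots> = (\<integral>A. - (A (i, i) ^ k) \<partial>H (Suc i))"
    by (intro Bochner_Integration.integral_cong refl, subst signed_perm_mult) (use k in \<open>auto simp: power_minus_odd\<close>)
  finally have "(\<integral>A. A (i, i) ^ k \<partial>H (Suc i)) = 0" by simp
  then show ?thesis by (simp add: integral_corner)
qed

text \<open>Rotation invariance of a column of the Haar matrix, in the form of an identity
  between polynomials in the tangent z of the angle.\<close>

lemma corner_mixed_moment:
  assumes w: "w < i" and k: "1 \<le> k"
  shows "real (2 * k - 1) * (\<integral>A. A (i, i) ^ (2 * k - 2) * (A (w, i))\<^sup>2 \<partial>H (Suc i)) = (\<integral>A. A (i, i) ^ (2 * k) \<partial>H (Suc i))"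
proof -
  interpret haar "Suc i" "H (Suc i)" by (rule haar_H)
  let ?m = "\<integral>A. A (i, i) ^ (2 * k) \<partial>H (Suc i)"
  have int: "integrable (H (Suc i)) (\<lambda>A. A (i, i) ^ a * A (w, i) ^ b)" for a b
  proof (rule integrable_bounded[of _ 1])
    show "(\<lambda>A. A (i, i) ^ a * A (w, i) ^ b) \<in> borel_measurable (mat_space (Suc i) (Suc i))"
      using w by (intro borel_measurable_times borel_measurable_power measurable_mat_entry) auto
    fix A assume A: "orthogonal_mat (Suc i) A"
    then show "\<bar>A (i, i) ^ a * A (w, i) ^ b\<bar> \<le> 1"
      using orthogonal_mat_bound[OF A, of i i] orthogonal_mat_bound[OF A, of w i] w
      by (auto simp: abs_mult power_abs intro!: mult_le_one power_le_one)
  qed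
  define c where "c l = real (2 * k choose l) * (\<integral>A. A (i, i) ^ (2 * k - l) * A (w, i) ^ l \<partial>H (Suc i))" for l
  let ?P = "\<Sum>l\<le>2 * k. monom (c l) l"
  have "poly ?P z = poly (smult ?m ([:1, 0, 1:] ^ k)) z" for z
  proof -
    \<comment> \<open>The cosine of the angle with tangent z; the sine is z d.\<close>
    define d where "d = 1 / sqrt (1 + z * z)"
    have p: "1 + z * z > 0" by (rule add_pos_nonneg) auto
    have d2: "d * d = 1 / (1 + z * z)" using p by (simp add: d_def)
    have cs: "d * d + (z * d) * (z * d) = 1"
    proof -
      have "d * d + (z * d) * (z * d) = (1 + z * z) * (d * d)" by (simp add: algebra_simps)
      then show ?thesis unfolding d2 using p by simp
    qed
    let ?G = "plane_rot (Suc i) i w d (z * d)"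
    have G: "orthogonal_mat (Suc i) ?G" by (rule plane_rot_orthogonal) (use w cs in auto)
    have "?m = (\<integral>A. (mat_mult (Suc i) ?G A (i, i)) ^ (2 * k) \<partial>H (Suc i))"
      by (rule int_left[symmetric, OF _ G]) auto
    also have "\<dots> = (\<integral>A. (d * d) ^ k * (z * A (w, i) + A (i, i)) ^ (2 * k) \<partial>H (Suc i))"
    proof (intro Bochner_Integration.integral_cong refl)
      fix A
      have "mat_mult (Suc i) ?G A (i, i) = d * (z * A (w, i) + A (i, i))"
        using w by (subst plane_rot_mult) (auto simp: algebra_simps)
      then show "(mat_mult (Suc i) ?G A (i, i)) ^ (2 * k) = (d * d) ^ k * (z * A (w, i) + A (i, i)) ^ (2 * k)"
        by (simp add: power_mult_distrib power_mult power2_eq_square)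
    qed
    also have "\<dots> = (\<integral>A. (d * d) ^ k * (\<Sum>l\<le>2 * k. (real (2 * k choose l) * z ^ l) * (A (i, i) ^ (2 * k - l) * A (w, i) ^ l)) \<partial>H (Suc i))"
      by (simp add: binomial_ring power_mult_distrib mult_ac)
    also have "\<dots> = (d * d) ^ k * (\<Sum>l\<le>2 * k. c l * z ^ l)"
    proof -
      have "(\<integral>A. (\<Sum>l\<le>2 * k. (real (2 * k choose l) * z ^ l) * (A (i, i) ^ (2 * k - l) * A (w, i) ^ l)) \<partial>H (Suc i)) = (\<Sum>l\<le>2 * k. c l * z ^ l)"
      proof -
        have "(\<integral>A. (\<Sum>l\<le>2 * k. (real (2 * k choose l) * z ^ l) * (A (i, i) ^ (2 * k - l) * A (w, i) ^ l)) \<partial>H (Suc i)) =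
          (\<Sum>l\<le>2 * k. \<integral>A. (real (2 * k choose l) * z ^ l) * (A (i, i) ^ (2 * k - l) * A (w, i) ^ l) \<partial>H (Suc i))"
          by (intro Bochner_Integration.integral_sum integrable_mult_right int)
        also have "\<dots> = (\<Sum>l\<le>2 * k. c l * z ^ l)"
          unfolding Bochner_Integration.integral_mult_right_zero c_def by (intro sum.cong refl) (simp only: mult_ac)
        finally show ?thesis .
      qed
      then show ?thesis by (simp only: Bochner_Integration.integral_mult_right_zero)
    qed
    finally have "?m = (1 / (1 + z * z)) ^ k * (\<Sum>l\<le>2 * k. c l * z ^ l)" unfolding d2 .
    then have "?m * (1 + z * z) ^ k = (\<Sum>l\<le>2 * k. c l * z ^ l)" using p by (simp add: power_divide field_simps)
    then show ?thesis by (simp add: poly_sum poly_monom poly_power)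
  qed
  then have "?P = smult ?m ([:1, 0, 1:] ^ k)" by (simp add: poly_eq_poly_eq_iff[symmetric] fun_eq_iff)
  \<comment> \<open>Coefficients of z^2 are compared: on one side 2k choose 2, which is k (2k - 1),
    times the mixed moment, and on the other side k times the moment of order 2k.\<close>
  then have "coeff ?P 2 = ?m * real k" by (simp add: coeff_one_plus_square_power)
  moreover have "coeff ?P 2 = c 2" using k by (simp add: coeff_sum)
  ultimately have "c 2 = ?m * real k" by simp
  moreover have "real (2 * k choose 2) = real k * real (2 * k - 1)" using k by (simp add: choose_two)
  ultimately have "real k * (real (2 * k - 1) * (\<integral>A. A (i, i) ^ (2 * k - 2) * (A (w, i))\<^sup>2 \<partial>H (Suc i))) = real k * ?m"
    by (simp add: c_def mult_ac)
  then show ?thesis using k by simp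
qed

text \<open>\<open>corner_mixed_moment\<close> is summed over the i other entries of the column,
  which has length 1. The resulting recursion is that of \<open>sphere_moment_rec\<close> with i = m
  + 2.\<close>

lemma corner_even:
  assumes k: "1 \<le> k"
  shows "real (2 * k - 1) * ((\<integral>t. t ^ (2 * k - 2) \<partial>corner i) - (\<integral>t. t ^ (2 * k) \<partial>corner i)) = real i * (\<integral>t. t ^ (2 * k) \<partial>corner i)"
proof -
  interpret haar "Suc i" "H (Suc i)" by (rule haar_H)
  have int: "integrable (H (Suc i)) (\<lambda>A. A (i, i) ^ a * (A (w, i))\<^sup>2)" if "w < Suc i" for a w
  proof (rule integrable_bounded[of _ 1])
    show "(\<lambda>A. A (i, i) ^ a * (A (w, i))\<^sup>2) \<in> borel_measurable (mat_space (Suc i) (Suc i))"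
      using that by (intro borel_measurable_times borel_measurable_power measurable_mat_entry) auto
    fix A assume A: "orthogonal_mat (Suc i) A"
    have "\<bar>A (i, i) ^ a * (A (w, i))\<^sup>2\<bar> = \<bar>A (i, i)\<bar> ^ a * \<bar>A (w, i)\<bar>\<^sup>2" by (simp add: abs_mult power_abs)
    also have "\<dots> \<le> 1"
      using orthogonal_mat_bound[OF A, of i i] orthogonal_mat_bound[OF A, of w i] that
      by (intro mult_le_one power_le_one) auto
    finally show "\<bar>A (i, i) ^ a * (A (w, i))\<^sup>2\<bar> \<le> 1" .
  qed
  have "real i * (\<integral>A. A (i, i) ^ (2 * k) \<partial>H (Suc i)) = (\<Sum>w<i. real (2 * k - 1) * (\<integral>A. A (i, i) ^ (2 * k - 2) * (A (w, i))\<^sup>2 \<partial>H (Suc i)))"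
    using corner_mixed_moment[OF _ k] by simp
  also have "\<dots> = real (2 * k - 1) * (\<integral>A. (\<Sum>w<i. A (i, i) ^ (2 * k - 2) * (A (w, i))\<^sup>2) \<partial>H (Suc i))"
  proof -
    have "(\<integral>A. (\<Sum>w<i. A (i, i) ^ (2 * k - 2) * (A (w, i))\<^sup>2) \<partial>H (Suc i)) = (\<Sum>w<i. \<integral>A. A (i, i) ^ (2 * k - 2) * (A (w, i))\<^sup>2 \<partial>H (Suc i))"
      by (intro Bochner_Integration.integral_sum int) auto
    then show ?thesis by (simp only: sum_distrib_left)
  qed
  also have "(\<integral>A. (\<Sum>w<i. A (i, i) ^ (2 * k - 2) * (A (w, i))\<^sup>2) \<partial>H (Suc i)) = (\<integral>A. A (i, i) ^ (2 * k - 2) - A (i, i) ^ (2 * k) \<partial>H (Suc i))"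
  proof (rule integral_cong_AE)
    show "(\<lambda>A. \<Sum>w<i. A (i, i) ^ (2 * k - 2) * (A (w, i))\<^sup>2) \<in> borel_measurable (H (Suc i))"
      using int by (intro borel_measurable_sum borel_measurable_integrable) auto
    show "AE A in H (Suc i). (\<Sum>w<i. A (i, i) ^ (2 * k - 2) * (A (w, i))\<^sup>2) = A (i, i) ^ (2 * k - 2) - A (i, i) ^ (2 * k)"
      using AE_orth
    proof eventually_elim
      fix A assume A: "orthogonal_mat (Suc i) A"
      have "(\<Sum>w<i. (A (w, i))\<^sup>2) = 1 - (A (i, i))\<^sup>2"
        using orthogonal_matD(2)[OF A, of i i] by (simp add: power2_eq_square)
      moreover have "A (i, i) ^ (2 * k) = A (i, i) ^ (2 * k - 2) * (A (i, i))\<^sup>2"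
        using k by (cases k) (simp_all add: power2_eq_square)
      ultimately show "(\<Sum>w<i. A (i, i) ^ (2 * k - 2) * (A (w, i))\<^sup>2) = A (i, i) ^ (2 * k - 2) - A (i, i) ^ (2 * k)"
        unfolding sum_distrib_left[symmetric] by (simp only: right_diff_distrib mult_1_right)
    qed
  qed simp
  also have "\<dots> = (\<integral>A. A (i, i) ^ (2 * k - 2) \<partial>H (Suc i)) - (\<integral>A. A (i, i) ^ (2 * k) \<partial>H (Suc i))"
  proof (rule Bochner_Integration.integral_diff)
    show "integrable (H (Suc i)) (\<lambda>A. A (i, i) ^ l)" for l
      using corner_power_integrable[of i l] unfolding corner_def by (subst (asm) integrable_distr_eq) auto
    then show "integrable (H (Suc i)) (\<lambda>A. A (i, i) ^ (2 * k))" .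
  qed
  finally show ?thesis by (simp add: integral_corner)
qed

end

section \<open>The weight (1 - t^2)^(m/2) on [-1, 1] and its moments\<close>

definition sphere_weight :: "nat \<Rightarrow> real \<Rightarrow> real" where
  "sphere_weight m t = indicator {-1..1} t * sqrt (1 - t * t) ^ m"

definition sphere_moment :: "nat \<Rightarrow> nat \<Rightarrow> real" where
  "sphere_moment m k = (\<integral>t. sphere_weight m t * t ^ k \<partial>lborel)"

lemma sphere_weight_nonneg [simp]: "0 \<le> sphere_weight m t"
proof (cases "t \<in> {-1..1}")
  case True
  then have "t * t \<le> 1" using abs_square_le_1[of t] by (simp add: power2_eq_square abs_le_iff)
  then show ?thesis by (simp add: sphere_weight_def)
qed (simp add: sphere_weight_def)

lemma sphere_weight_measurable [measurable]: "sphere_weight m \<in> borel_measurable borel"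
  unfolding sphere_weight_def by measurable

lemma sphere_weight_set_integrable: "set_integrable lborel {-1..1} (\<lambda>t. sqrt (1 - t * t) ^ m * t ^ k)"
  by (intro borel_integrable_atLeastAtMost' continuous_intros)

lemma sphere_weight_integrable: "integrable lborel (\<lambda>t. sphere_weight m t * t ^ k)"
  using sphere_weight_set_integrable[of m k] by (simp add: set_integrable_def sphere_weight_def mult_ac)

lemma sphere_moment_integral: "sphere_moment m k = integral {-1..1} (\<lambda>t. sqrt (1 - t * t) ^ m * t ^ k)"
  using set_borel_integral_eq_integral(2)[OF sphere_weight_set_integrable[of m k]]
  by (simp add: set_lebesgue_integral_def sphere_moment_def sphere_weight_def mult_ac)

text \<open>The function t^(k + 1) (1 - t^2)^((m + 2)/2) vanishes at both ends, so its derivative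
  has integral 0.\<close>

lemma sphere_moment_rec:
  "real (k + 1) * (sphere_moment m k - sphere_moment m (k + 2)) = real (m + 2) * sphere_moment m (k + 2)"
proof -
  let ?s = "\<lambda>t::real. sqrt (1 - t * t)"
  define F where "F t = t ^ (k + 1) * ?s t ^ (m + 2)" for t
  define f where "f t = real (k + 1) * (?s t ^ m * t ^ k - ?s t ^ m * t ^ (k + 2)) - real (m + 2) * (?s t ^ m * t ^ (k + 2))" for t
  have "(f has_integral F 1 - F (-1)) {-1..1}"
  \<comment> \<open>The square root is not differentiable at the end points, so the version for the
    open interval is used.\<close>
  proof (rule fundamental_theorem_of_calculus_interior)
    show "continuous_on {-1..1} F" unfolding F_def by (intro continuous_intros)
    fix t :: real assume t: "t \<in> {-1<..<1}"
    then have p: "1 - t * t > 0" using abs_square_less_1[of t] by (simp add: power2_eq_square abs_less_iff)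
    define s where "s = ?s t"
    have s: "s > 0" "s * s = 1 - t * t" using p by (auto simp: s_def)
    have ds: "(?s has_real_derivative - t / s) (at t)"
      using p by (auto intro!: derivative_eq_intros simp: s_def field_simps)
    have "(F has_real_derivative f t) (at t)"
      unfolding F_def
    proof (rule DERIV_cong[OF DERIV_mult[OF DERIV_pow[of "k + 1" t] DERIV_power[OF ds, of "m + 2"]]])
      have a: "- t / s * s ^ (m + 2 - Suc 0) = - t * s ^ m" using s(1) by simp
      have b: "s ^ (m + 2) = s ^ m * (1 - t * t)" using s(2) by (simp add: power2_eq_square power_add)
      show "real (k + 1) * t ^ (k + 1 - Suc 0) * ?s t ^ (m + 2) + real (m + 2) * (- t / s * ?s t ^ (m + 2 - Suc 0)) * t ^ (k + 1) = f t"
        unfolding f_def s_def[symmetric] a b by (simp add: algebra_simps power_add power2_eq_square)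
    qed
    then show "(F has_vector_derivative f t) (at t)"
      by (simp add: has_real_derivative_iff_has_vector_derivative)
  qed simp
  moreover have "F 1 - F (-1) = 0" by (simp add: F_def)
  ultimately have I: "integral {-1..1} f = 0" by (simp add: integral_unique)
  have int: "(\<lambda>t. ?s t ^ m * t ^ l) integrable_on {-1..1}" for l
    by (rule set_borel_integral_eq_integral(1)[OF sphere_weight_set_integrable])
  have "integral {-1..1} f = real (k + 1) * (sphere_moment m k - sphere_moment m (k + 2)) - real (m + 2) * sphere_moment m (k + 2)"
    unfolding f_def sphere_moment_integral
    by (subst integral_diff; (subst integral_mult_right)?; (subst integral_diff)?; (intro integrable_on_mult_right integrable_diff int)?) (auto intro: int)
  then show ?thesis using I by simp
qed

lemma sphere_moment_odd: "odd k \<Longrightarrow> sphere_moment m k = 0"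
proof -
  assume k: "odd k"
  have "sphere_moment m k = (\<integral>t. sphere_weight m (0 + -1 * t) * (0 + -1 * t) ^ k \<partial>lborel)"
    unfolding sphere_moment_def using lborel_integral_real_affine[of "-1" "\<lambda>t. sphere_weight m t * t ^ k" 0] by simp
  also have "\<dots> = - sphere_moment m k"
  proof -
    have "sphere_weight m (- t) = sphere_weight m t" for t by (auto simp: sphere_weight_def indicator_def)
    then show ?thesis using k by (simp add: sphere_moment_def power_minus_odd)
  qed
  finally show ?thesis by simp
qed

text \<open>From (1 - t^2)^(m/2) \<ge> exp (- m t^2 / 2) (1 - m t^4), valid on the whole line for m \<ge> 8.\<close>

lemma sphere_moment_0_lower:
  assumes m: "8 \<le> m"
  shows "sqrt (2 * pi / real m) * (1 - 3 / real m) \<le> sphere_moment m 0"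
proof -
  \<comment> \<open>The standard deviation of the Gaussian weight exp (- m t^2 / 2). Its fourth
    moment 3 / m^2, multiplied by m, is the error 3 / m.\<close>
  define s where "s = 1 / sqrt (real m)"
  have m0: "real m > 0" "s > 0" using m by (auto simp: s_def)
  have s2: "s\<^sup>2 = 1 / real m" using m0 by (simp add: s_def power_divide)
  have nd: "exp (- (real m * t\<^sup>2 / 2)) = sqrt (2 * pi / real m) * normal_density 0 s t" for t
  proof -
    have "sqrt (2 * pi * s\<^sup>2) = sqrt (2 * pi / real m)" unfolding s2 by simp
    then have "normal_density 0 s t = 1 / sqrt (2 * pi / real m) * exp (- t\<^sup>2 / (2 * s\<^sup>2))"
      unfolding normal_density_def by simp
    moreover have "- t\<^sup>2 / (2 * s\<^sup>2) = - (real m * t\<^sup>2 / 2)" unfolding s2 using m0 by simp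
    ultimately show ?thesis using m0 by simp
  qed
  have i4: "has_bochner_integral lborel (\<lambda>t. normal_density 0 s t * t ^ 4) (3 / (real m)\<^sup>2)"
  proof -
    have "fact (2 * 2) / ((2 / s\<^sup>2) ^ 2 * fact 2) = 3 / (real m)\<^sup>2"
      unfolding s2 using m0 by (simp add: fact_numeral power_mult_distrib)
    then show ?thesis using normal_moment_even[OF m0(2), of 0 2] by simp
  qed
  have "sqrt (2 * pi / real m) * (1 - 3 / real m) = (\<integral>t. sqrt (2 * pi / real m) * (normal_density 0 s t - real m * (normal_density 0 s t * t ^ 4)) \<partial>lborel)"
  proof -
    have "(\<integral>t. sqrt (2 * pi / real m) * (normal_density 0 s t - real m * (normal_density 0 s t * t ^ 4)) \<partial>lborel)
      = sqrt (2 * pi / real m) * (1 - real m * (3 / (real m)\<^sup>2))"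
      using i4 m0 unfolding Bochner_Integration.integral_mult_right_zero has_bochner_integral_iff
      by (subst Bochner_Integration.integral_diff) auto
    also have "real m * (3 / (real m)\<^sup>2) = 3 / real m" using m0 by (simp add: power2_eq_square)
    finally show ?thesis ..
  qed
  also have "\<dots> \<le> (\<integral>t. sphere_weight m t * t ^ 0 \<partial>lborel)"
  proof (rule integral_mono[OF _ sphere_weight_integrable])
    show "integrable lborel (\<lambda>t. sqrt (2 * pi / real m) * (normal_density 0 s t - real m * (normal_density 0 s t * t ^ 4)))"
      using i4 m0 by (simp add: has_bochner_integral_iff)
    fix t :: real
    have e: "sqrt (2 * pi / real m) * (normal_density 0 s t - real m * (normal_density 0 s t * t ^ 4)) = exp (- (real m * t\<^sup>2 / 2)) * (1 - real m * t ^ 4)"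
      unfolding nd by (simp add: algebra_simps)
    have "exp (- (real m * t\<^sup>2 / 2)) * (1 - real m * t ^ 4) \<le> sphere_weight m t"
    proof (cases "t\<^sup>2 \<le> 1 / 2")
      case True
      have t4: "t ^ 4 = (t\<^sup>2)\<^sup>2" by simp
      have t1: "t \<in> {-1..1}" using True abs_square_le_1[of t] by (simp add: abs_le_iff)
      have p: "1 - t\<^sup>2 > 0" using True by simp
      have "- t\<^sup>2 - 2 * (t\<^sup>2)\<^sup>2 \<le> ln (1 - t\<^sup>2)" by (rule ln_one_minus_pos_lower_bound) (use True in auto)
      then have "real m / 2 * (- t\<^sup>2 - 2 * (t\<^sup>2)\<^sup>2) \<le> real m / 2 * ln (1 - t\<^sup>2)" by (intro mult_left_mono) auto
      then have "exp (real m / 2 * (- t\<^sup>2 - 2 * (t\<^sup>2)\<^sup>2)) \<le> exp (real m * ln (sqrt (1 - t\<^sup>2)))" using p by (simp add: ln_sqrt)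
      also have "\<dots> = sqrt (1 - t\<^sup>2) ^ m" using p by (simp add: exp_of_nat_mult)
      also have "\<dots> = sphere_weight m t" using t1 by (simp add: sphere_weight_def power2_eq_square)
      finally have "exp (real m / 2 * (- t\<^sup>2 - 2 * (t\<^sup>2)\<^sup>2)) \<le> sphere_weight m t" .
      moreover have "real m / 2 * (- t\<^sup>2 - 2 * (t\<^sup>2)\<^sup>2) = - (real m * t\<^sup>2 / 2) + - (real m * t ^ 4)"
        unfolding t4 by (simp add: algebra_simps)
      ultimately have 1: "exp (- (real m * t\<^sup>2 / 2)) * exp (- (real m * t ^ 4)) \<le> sphere_weight m t"
        by (simp only: exp_add)
      have "1 - real m * t ^ 4 \<le> exp (- (real m * t ^ 4))" using exp_ge_add_one_self[of "- (real m * t ^ 4)"] by simp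
      then have "exp (- (real m * t\<^sup>2 / 2)) * (1 - real m * t ^ 4) \<le> exp (- (real m * t\<^sup>2 / 2)) * exp (- (real m * t ^ 4))"
        by (intro mult_left_mono) auto
      then show ?thesis using 1 by linarith
    next
      case False
      \<comment> \<open>Here m t^4 is at least m / 4, hence at least 2, so the lower estimate is
        negative. This covers the points outside [-1, 1] as well, where the weight is 0.\<close>
      have "(1 / 2)\<^sup>2 \<le> (t\<^sup>2)\<^sup>2" using False by (intro power_mono) auto
      then have "1 / 4 \<le> t ^ 4" by (simp add: power_divide)
      then have "8 * (1 / 4) \<le> real m * t ^ 4" using m by (intro mult_mono) auto
      then have "exp (- (real m * t\<^sup>2 / 2)) * (1 - real m * t ^ 4) \<le> 0" by (intro mult_nonneg_nonpos) auto
      then show ?thesis using sphere_weight_nonneg[of m t] by linarith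
    qed
    then show "sqrt (2 * pi / real m) * (normal_density 0 s t - real m * (normal_density 0 s t * t ^ 4)) \<le> sphere_weight m t * t ^ 0"
      unfolding e by simp
  qed
  finally show ?thesis by (simp add: sphere_moment_def)
qed

lemma sphere_moment_0_pos:
  assumes m: "8 \<le> m"
  shows "0 < sphere_moment m 0"
proof -
  have "0 < sqrt (2 * pi / real m) * (1 - 3 / real m)" using m by (intro mult_pos_pos) (auto simp: field_simps)
  then show ?thesis using sphere_moment_0_lower[OF m] by linarith
qed

text \<open>With x = 3 / m \<le> 1/2, -ln (1 - x) is at most x + 2 x^2, hence at most 2 x = 6 /
  m.\<close>

lemma sphere_norm_upper:
  assumes m: "8 \<le> m"
  shows "ln (1 / sphere_moment m 0) \<le> ln (real m / (2 * pi)) / 2 + 6 / real m"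
proof -
  have m0: "real m > 0" using m by simp
  define x where "x = 3 / real m"
  have x: "0 \<le> x" "x \<le> 1/2" using m by (auto simp: x_def field_simps)
  have "ln (sqrt (2 * pi / real m) * (1 - x)) \<le> ln (sphere_moment m 0)"
    using sphere_moment_0_lower[OF m] sphere_moment_0_pos[OF m] m x by (subst ln_le_cancel_iff) (auto simp: x_def[symmetric])
  moreover have "ln (sqrt (2 * pi / real m) * (1 - x)) = ln (2 * pi / real m) / 2 + ln (1 - x)"
    using m0 x by (simp add: ln_mult ln_sqrt)
  moreover have "ln (2 * pi / real m) = - ln (real m / (2 * pi))" using m0 by (simp add: ln_div)
  moreover have "- x - 2 * x\<^sup>2 \<le> ln (1 - x)" by (rule ln_one_minus_pos_lower_bound[OF x])
  moreover have "2 * x\<^sup>2 \<le> x" using mult_left_mono[OF x(2) x(1)] by (simp add: power2_eq_square)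
  moreover have "ln (1 / sphere_moment m 0) = - ln (sphere_moment m 0)" using sphere_moment_0_pos[OF m] by (simp add: ln_div)
  moreover have "2 * x = 6 / real m" by (simp add: x_def)
  ultimately show ?thesis by linarith
qed

text \<open>The density of one coordinate of a uniform point of the unit sphere in dimension m +
  3.\<close>

definition sphere_density :: "nat \<Rightarrow> real \<Rightarrow> real" where
  "sphere_density m t = sphere_weight m t / sphere_moment m 0"

lemma sphere_density_measurable [measurable]: "sphere_density m \<in> borel_measurable borel"
  unfolding sphere_density_def by measurable

lemma sphere_density_nonneg: "8 \<le> m \<Longrightarrow> 0 \<le> sphere_density m t"
  using sphere_moment_0_pos[of m] by (simp add: sphere_density_def)

context haar_family begin

text \<open>Both laws live on [-1, 1], so moments decide. The odd ones vanish by symmetry, and the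
  even ones obey the same recursion with initial value 1.\<close>

theorem corner_density:
  assumes m: "8 \<le> m"
  shows "corner (m + 2) = density lborel (\<lambda>t. ennreal (sphere_density m t))"
proof (rule real_distribution_eqI_moments)
  let ?D = "density lborel (\<lambda>t. ennreal (sphere_density m t))"
  note pos = sphere_moment_0_pos[OF m]
  have mom: "(\<integral>t. t ^ k \<partial>?D) = sphere_moment m k / sphere_moment m 0" for k
  proof -
    have "(\<integral>t. t ^ k \<partial>?D) = (\<integral>t. sphere_density m t * t ^ k \<partial>lborel)"
      by (subst integral_density) (auto simp: sphere_density_nonneg[OF m])
    also have "\<dots> = (\<integral>t. sphere_weight m t * t ^ k / sphere_moment m 0 \<partial>lborel)" by (simp add: sphere_density_def)
    finally show ?thesis by (simp add: sphere_moment_def)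
  qed
  have int1: "integrable lborel (sphere_density m)"
    using sphere_weight_integrable[of m 0] by (simp add: sphere_density_def[abs_def])
  have "(\<integral>\<^sup>+t. ennreal (sphere_density m t) \<partial>lborel) = ennreal (\<integral>t. sphere_density m t \<partial>lborel)"
    by (rule nn_integral_eq_integral[OF int1]) (auto simp: sphere_density_nonneg[OF m])
  also have "(\<integral>t. sphere_density m t \<partial>lborel) = 1"
    using pos by (simp add: sphere_density_def[abs_def] sphere_moment_def[of m 0, simplified, symmetric])
  finally have "prob_space ?D" by (intro prob_spaceI) (simp add: emeasure_density)
  then show "real_distribution ?D" by (intro real_distribution.intro real_distribution_axioms.intro) auto
  show "AE t in ?D. \<bar>t\<bar> \<le> 1"
    by (subst AE_density) (auto simp: sphere_density_def sphere_weight_def indicator_def abs_le_iff split: if_splits)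
  show "real_distribution (corner (m + 2))" by (rule corner_real_distribution)
  show "AE t in corner (m + 2). \<bar>t\<bar> \<le> 1" by (rule corner_AE)
  have even: "(\<integral>t. t ^ (2 * k) \<partial>corner (m + 2)) = sphere_moment m (2 * k) / sphere_moment m 0" for k
  proof (induction k)
    case 0
    have "prob_space.prob (corner (m + 2)) UNIV = 1" using prob_space.prob_space[OF prob_corner[of "m + 2"]] by simp
    then show ?case using pos by simp
  next
    case (Suc k)
    let ?a = "real (2 * k + 1)" and ?b = "real (m + 2)"
    have 1: "?a * ((\<integral>t. t ^ (2 * k) \<partial>corner (m + 2)) - (\<integral>t. t ^ (2 * Suc k) \<partial>corner (m + 2))) = ?b * (\<integral>t. t ^ (2 * Suc k) \<partial>corner (m + 2))"
      using corner_even[of "Suc k" "m + 2"] by simp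
    have 2: "?a * (sphere_moment m (2 * k) - sphere_moment m (2 * Suc k)) = ?b * sphere_moment m (2 * Suc k)"
      using sphere_moment_rec[of "2 * k" m] by simp
    have "?a * (\<integral>t. t ^ (2 * k) \<partial>corner (m + 2)) = (?a + ?b) * (\<integral>t. t ^ (2 * Suc k) \<partial>corner (m + 2))"
      using 1 by (simp add: algebra_simps)
    moreover have "?a * sphere_moment m (2 * k) = (?a + ?b) * sphere_moment m (2 * Suc k)" using 2 by (simp add: algebra_simps)
    moreover have "?a * (\<integral>t. t ^ (2 * k) \<partial>corner (m + 2)) = ?a * sphere_moment m (2 * k) / sphere_moment m 0"
      unfolding Suc.IH by simp
    ultimately have "(?a + ?b) * (\<integral>t. t ^ (2 * Suc k) \<partial>corner (m + 2)) = (?a + ?b) * (sphere_moment m (2 * Suc k) / sphere_moment m 0)"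
      by (metis times_divide_eq_right)
    moreover have "?a + ?b \<noteq> 0" by linarith
    ultimately show ?case using mult_left_cancel by blast
  qed
  show "(\<integral>t. t ^ k \<partial>corner (m + 2)) = (\<integral>t. t ^ k \<partial>?D)" for k
  proof (cases "odd k")
    case True
    then show ?thesis unfolding mom by (simp add: corner_odd sphere_moment_odd)
  next
    case False
    then obtain l where "k = 2 * l" by (auto elim: evenE)
    then show ?thesis unfolding mom using even[of l] by simp
  qed
qed

lemma corner_second_moment: "(\<integral>t. t\<^sup>2 \<partial>corner i) = 1 / (real i + 1)"
proof -
  have "(\<integral>t. t ^ 0 \<partial>corner i) = 1" using prob_space.prob_space[OF prob_corner[of i]] by simp
  then have "1 - (\<integral>t. t\<^sup>2 \<partial>corner i) = real i * (\<integral>t. t\<^sup>2 \<partial>corner i)" using corner_even[of 1 i] by simp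
  then show ?thesis by (simp add: field_simps)
qed

end

section \<open>The upper bound\<close>

lemma PiM_density:
  fixes h :: "'i \<Rightarrow> real \<Rightarrow> real"
  assumes I: "finite I" and [measurable]: "\<And>i. i \<in> I \<Longrightarrow> h i \<in> borel_measurable borel"
    and h0: "\<And>i t. i \<in> I \<Longrightarrow> 0 \<le> h i t"
    and M: "\<And>i. prob_space (M i)" and Mh: "\<And>i. i \<in> I \<Longrightarrow> M i = density lborel (\<lambda>t. ennreal (h i t))"
  shows "PiM I M = density (PiM I (\<lambda>_. lborel)) (\<lambda>T. ennreal (\<Prod>i\<in>I. h i (T i)))"
proof -
  interpret M: product_sigma_finite M
    using M by (intro product_sigma_finite.intro prob_space_imp_sigma_finite)
  interpret L: product_sigma_finite "\<lambda>_::'i. lborel :: real measure" ..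
  have comp [measurable]: "(\<lambda>T. T i) \<in> borel_measurable (PiM I (\<lambda>_. lborel :: real measure))" if "i \<in> I" for i
    using measurable_component_singleton[OF that, of "\<lambda>_. lborel :: real measure"] by simp
  have hm [measurable]: "(\<lambda>T. ennreal (\<Prod>i\<in>I. h i (T i))) \<in> borel_measurable (PiM I (\<lambda>_. lborel))"
    by (intro measurable_compose[OF _ measurable_ennreal] borel_measurable_prod measurable_compose[OF comp assms(2)])
  have "density (PiM I (\<lambda>_. lborel)) (\<lambda>T. ennreal (\<Prod>i\<in>I. h i (T i))) = PiM I M"
  proof (rule M.PiM_eqI[OF I])
    show "sets (density (PiM I (\<lambda>_. lborel)) (\<lambda>T. ennreal (\<Prod>i\<in>I. h i (T i)))) = sets (PiM I M)"
      unfolding sets_density by (intro sets_PiM_cong refl) (simp add: Mh)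
    fix A assume "\<And>i. i \<in> I \<Longrightarrow> A i \<in> sets (M i)"
    then have A: "A i \<in> sets borel" if "i \<in> I" for i using that by (simp add: Mh)
    then have Am: "Pi\<^sub>E I A \<in> sets (PiM I (\<lambda>_. lborel :: real measure))" by (intro sets_PiM_I_finite I) auto
    have "emeasure (density (PiM I (\<lambda>_. lborel)) (\<lambda>T. ennreal (\<Prod>i\<in>I. h i (T i)))) (Pi\<^sub>E I A)
      = (\<integral>\<^sup>+T. ennreal (\<Prod>i\<in>I. h i (T i)) * indicator (Pi\<^sub>E I A) T \<partial>PiM I (\<lambda>_. lborel))"
      by (rule emeasure_density[OF hm Am])
    also have "\<dots> = (\<integral>\<^sup>+T. (\<Prod>i\<in>I. ennreal (h i (T i)) * indicator (A i) (T i)) \<partial>PiM I (\<lambda>_. lborel))"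
    proof (rule nn_integral_cong)
      fix T assume T: "T \<in> space (PiM I (\<lambda>_. lborel :: real measure))"
      have "indicator (Pi\<^sub>E I A) T = (\<Prod>i\<in>I. indicator (A i) (T i) :: ennreal)"
        using T I by (auto simp: indicator_def space_PiM PiE_iff)
      then show "ennreal (\<Prod>i\<in>I. h i (T i)) * indicator (Pi\<^sub>E I A) T = (\<Prod>i\<in>I. ennreal (h i (T i)) * indicator (A i) (T i))"
        using h0 by (simp add: prod.distrib prod_ennreal)
    qed
    also have "\<dots> = (\<Prod>i\<in>I. \<integral>\<^sup>+t. ennreal (h i t) * indicator (A i) t \<partial>lborel)"
    proof (rule L.product_nn_integral_prod[OF I])
      fix i assume i: "i \<in> I"
      have "(\<lambda>t. ennreal (h i t)) \<in> borel_measurable borel"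
        by (rule measurable_compose[OF assms(2)[OF i] measurable_ennreal])
      moreover have "(indicator (A i) :: real \<Rightarrow> ennreal) \<in> borel_measurable borel"
        by (rule borel_measurable_indicator[OF A[OF i]])
      ultimately show "(\<lambda>t. ennreal (h i t) * indicator (A i) t) \<in> borel_measurable lborel" by simp
    qed
    also have "\<dots> = (\<Prod>i\<in>I. emeasure (M i) (A i))"
      by (intro prod.cong refl) (use A in \<open>simp add: Mh emeasure_density\<close>)
    finally show "emeasure (density (PiM I (\<lambda>_. lborel)) (\<lambda>T. ennreal (\<Prod>i\<in>I. h i (T i)))) (Pi\<^sub>E I A) = (\<Prod>i\<in>I. emeasure (M i) (A i))" .
  qed
  then show ?thesis ..
qed

text \<open>An entry is affine in its own coordinate. The slope collects the factors of the
  coordinates below it in its column and to its right in its row; these slopes form the diagonal of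
  the triangular map.\<close>

lemma block_coords_affine:
  "i < p \<Longrightarrow> j < q \<Longrightarrow> block_coords \<sigma> p q T (i, j) = block_coords \<sigma> p q (T((i, j) := 0)) (i, j)
    + (\<Prod>l\<in>{i<..<p}. \<sigma> (T (l, j))) * (\<Prod>k\<in>{j<..<q}. \<sigma> (T (i, k))) * T (i, j)"
proof (induction q)
  case (Suc q)
  show ?case
  proof (cases "j = q")
    case True
    have "{q<..<Suc q} = {}" by auto
    then show ?thesis using True by (simp add: add_column_def mult.commute)
  next
    case False
    then have j: "j < q" using Suc.prems by simp
    let ?T = "T((i, j) := 0)"
    have upd: "?T (l, q) = T (l, q)" for l using False by simp
    have W: "block_coords \<sigma> p q ?T (m, j) = block_coords \<sigma> p q T (m, j)" if "m \<in> {i<..<p}" for m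
      by (rule block_coords_cong) (use that j in auto)
    have sum: "(\<Sum>m\<in>{i<..<p}. T (m, q) * (\<Prod>l\<in>{i<..<m}. \<sigma> (T (l, q))) * block_coords \<sigma> p q ?T (m, j))
      = (\<Sum>m\<in>{i<..<p}. T (m, q) * (\<Prod>l\<in>{i<..<m}. \<sigma> (T (l, q))) * block_coords \<sigma> p q T (m, j))"
      by (intro sum.cong refl) (simp add: W)
    have ins: "{j<..<Suc q} = insert q {j<..<q}" using j by auto
    obtain W0 where W0: "block_coords \<sigma> p q ?T (i, j) = W0" by blast
    show ?thesis
      unfolding block_coords.simps add_column_def using False
      by (simp only: prod.case if_False upd sum ins W0 Suc.IH[OF Suc.prems(1) j]) (simp add: algebra_simps)
  qed
qed simp

text \<open>As i counts the smaller indices, the sum of i / (D + i) is a sum of tails of the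
  harmonic series, and 1 / x \<le> ln (x / (x - 1)) makes each tail telescope. In the induction, the
  new index raises each of the p earlier logarithms by ln (x / (x - 1)).\<close>

lemma harmonic_tail_sum:
  assumes D: "1 < D"
  shows "(\<Sum>i<p. real (i + 1) / (D + real i)) \<le> (\<Sum>i<p. 1 / (D + real i) + ln ((D + real p - 1) / (D + real i)))"
proof (induction p)
  case (Suc p)
  show ?case
  proof (cases "p = 0")
    case True
    then show ?thesis using D by simp
  next
    case False
    let ?x = "D + real p"
    have x: "?x > 1" "?x - 1 > 0" using D by auto
    have "1 - (?x - 1) / ?x \<le> - ln ((?x - 1) / ?x)" using ln_le_minus_one[of "(?x - 1) / ?x"] x by simp
    then have l: "1 / ?x \<le> ln (?x / (?x - 1))" using x by (simp add: ln_div field_simps)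
    have t: "1 / (D + real i) + ln ((D + real p - 1) / (D + real i)) + ln (?x / (?x - 1))
      = 1 / (D + real i) + ln (?x / (D + real i))" for i
      using x D by (simp add: ln_div add_pos_nonneg)
    have "(\<Sum>i<Suc p. real (i + 1) / (D + real i)) = (\<Sum>i<p. real (i + 1) / (D + real i)) + real p * (1 / ?x) + 1 / ?x"
      by (simp add: add_divide_distrib)
    also have "\<dots> \<le> (\<Sum>i<p. 1 / (D + real i) + ln ((D + real p - 1) / (D + real i))) + real p * ln (?x / (?x - 1)) + 1 / ?x"
      using Suc.IH l by (intro add_mono mult_left_mono) auto
    also have "\<dots> = (\<Sum>i<p. 1 / (D + real i) + ln (?x / (D + real i))) + 1 / ?x"
    proof -
      have "(\<Sum>i<p. 1 / (D + real i) + ln ((D + real p - 1) / (D + real i))) + real p * ln (?x / (?x - 1))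
        = (\<Sum>i<p. 1 / (D + real i) + ln ((D + real p - 1) / (D + real i)) + ln (?x / (?x - 1)))"
        by (simp add: sum.distrib)
      then show ?thesis unfolding t by simp
    qed
    also have "\<dots> = (\<Sum>i<Suc p. 1 / (D + real i) + ln ((D + real (Suc p) - 1) / (D + real i)))"
      using x by simp
    finally show ?thesis .
  qed
qed simp

text \<open>The main cancellation: (n - i')(n - j') = n (n - i' - j') + i' j' for the indices counted from the far corner.\<close>

lemma relative_entropy_sum:
  assumes d: "9 \<le> d" and n: "n = d + p + q"
  shows "(\<Sum>i<p. \<Sum>j<q. ln (real (d + i + j + 2) / real n) + real (i + j + 3) / real (d + i + j + 2) + 12 / real (d + i + j - 1))
    \<le> real (p * q) * (real (p * q) / (real n * real d) + 15 / (real d - 1))"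
proof -
  let ?N = "\<lambda>i j. real (d + i + j + 2)"
  have n0: "real n > 0" and d0: "real d > 0" "real d > 1" using d n by auto
  have A: "(\<Sum>i<p. real (i + 1) / ?N i j) \<le> (\<Sum>i<p. 1 / ?N i j + ln (real (d + 1 + p + j) / ?N i j))" for j
    using harmonic_tail_sum[of "real (d + 2 + j)" p] by (simp add: add_ac)
  have B: "(\<Sum>j<q. real (j + 1) / ?N i j) \<le> (\<Sum>j<q. 1 / ?N i j + ln (real (d + 1 + q + i) / ?N i j))" for i
    using harmonic_tail_sum[of "real (d + 2 + i)" q] by (simp add: add_ac)
  have "(\<Sum>i<p. \<Sum>j<q. ln (?N i j / real n) + real (i + j + 3) / ?N i j + 12 / real (d + i + j - 1))
    = (\<Sum>i<p. \<Sum>j<q. ln (?N i j / real n) + 1 / ?N i j + 12 / real (d + i + j - 1)) + (\<Sum>i<p. \<Sum>j<q. real (i + 1) / ?N i j) + (\<Sum>i<p. \<Sum>j<q. real (j + 1) / ?N i j)"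
  proof -
    \<comment> \<open>One unit is split off at once; the other two turn i and j into the numerators
      of \<open>harmonic_tail_sum\<close>.\<close>
    have "real (i + j + 3) / ?N i j = 1 / ?N i j + real (i + 1) / ?N i j + real (j + 1) / ?N i j" for i j
      unfolding add_divide_distrib[symmetric] by simp
    then show ?thesis by (simp only: sum.distrib[symmetric] add_ac)
  qed
  also have "\<dots> \<le> (\<Sum>i<p. \<Sum>j<q. ln (?N i j / real n) + 1 / ?N i j + 12 / real (d + i + j - 1))
    + (\<Sum>i<p. \<Sum>j<q. 1 / ?N i j + ln (real (d + 1 + p + j) / ?N i j)) + (\<Sum>i<p. \<Sum>j<q. 1 / ?N i j + ln (real (d + 1 + q + i) / ?N i j))"
  proof (intro add_mono order_refl)
    show "(\<Sum>i<p. \<Sum>j<q. real (i + 1) / ?N i j) \<le> (\<Sum>i<p. \<Sum>j<q. 1 / ?N i j + ln (real (d + 1 + p + j) / ?N i j))"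
      by (subst (1 2) sum.swap) (intro sum_mono A)
    show "(\<Sum>i<p. \<Sum>j<q. real (j + 1) / ?N i j) \<le> (\<Sum>i<p. \<Sum>j<q. 1 / ?N i j + ln (real (d + 1 + q + i) / ?N i j))"
      by (intro sum_mono B)
  qed
  also have "\<dots> = (\<Sum>i<p. \<Sum>j<q. (ln (?N i j / real n) + ln (real (d + 1 + p + j) / ?N i j) + ln (real (d + 1 + q + i) / ?N i j))
      + (3 / ?N i j + 12 / real (d + i + j - 1)))"
    by (simp only: sum.distrib[symmetric]) (intro sum.cong refl, simp)
  also have "\<dots> \<le> (\<Sum>i<p. \<Sum>j<q. real (p * q) / (real n * real d) + 15 / (real d - 1))"
  proof (intro sum_mono add_mono)
    fix i j assume "i \<in> {..<p}" "j \<in> {..<q}"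
    then have ij: "i < p" "j < q" by auto
    \<comment> \<open>Indices counted from the opposite corner. In these terms X - 1 is a b / (n N),
      where N = d + i + j + 2.\<close>
    define a b where "a = p - 1 - i" and "b = q - 1 - j"
    have ab: "p = a + i + 1" "q = b + j + 1" using ij by (auto simp: a_def b_def)
    have N0: "?N i j > 0" by simp
    define X where "X = real (d + 1 + p + j) * real (d + 1 + q + i) / (real n * ?N i j)"
    have X0: "X > 0" unfolding X_def using n0 N0 by (intro divide_pos_pos mult_pos_pos) auto
    have "ln (?N i j / real n) + ln (real (d + 1 + p + j) / ?N i j) + ln (real (d + 1 + q + i) / ?N i j) = ln X"
      unfolding X_def using n0 N0 by (simp add: ln_div ln_mult)
    also have "\<dots> \<le> X - 1" by (rule ln_le_minus_one[OF X0])
    also have "\<dots> = real (a * b) / (real n * ?N i j)"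
    proof -
      have "real (d + 1 + p + j) * real (d + 1 + q + i) = real n * ?N i j + real (a * b)"
        unfolding n ab by (simp add: algebra_simps)
      then show ?thesis unfolding X_def using n0 N0 by (simp add: add_divide_distrib)
    qed
    also have "\<dots> \<le> real (p * q) / (real n * real d)"
    proof (rule frac_le)
      show "real (a * b) \<le> real (p * q)" unfolding of_nat_le_iff by (rule mult_le_mono) (auto simp: a_def b_def)
      show "real n * real d \<le> real n * ?N i j" by (intro mult_left_mono) auto
    qed (use n0 d0 in auto)
    finally show "ln (?N i j / real n) + ln (real (d + 1 + p + j) / ?N i j) + ln (real (d + 1 + q + i) / ?N i j) \<le> real (p * q) / (real n * real d)" .
    \<comment> \<open>The 3 collects the unit split off above and one term from each use of
      \<open>harmonic_tail_sum\<close>; together with the 12 it makes 15.\<close>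
    have "3 / ?N i j \<le> 3 / (real d - 1)" using d0 by (intro divide_left_mono) auto
    moreover have "12 / real (d + i + j - 1) \<le> 12 / (real d - 1)" using d by (intro divide_left_mono) auto
    ultimately show "3 / ?N i j + 12 / real (d + i + j - 1) \<le> 15 / (real d - 1)" by (simp add: add_divide_distrib[symmetric])
  qed
  finally show ?thesis by simp
qed

context haar begin

text \<open>The square of the entry is the increment of a diagonal entry of the projection when row
  i joins the first i rows.\<close>

lemma entry_second_moment:
  assumes "i < n" "j < n"
  shows "(\<integral>A. (A (i, j))\<^sup>2 \<partial>H) = 1 / real n"
proof -
  interpret a: haar_rows n H "Suc i" by unfold_locales (use assms in simp)
  interpret b: haar_rows n H i by unfold_locales (use assms in simp)
  have "(\<integral>A. (A (i, j))\<^sup>2 \<partial>H) = (\<integral>A. a.P A j j - b.P A j j \<partial>H)"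
    by (intro Bochner_Integration.integral_cong refl) (simp add: a.P_def b.P_def power2_eq_square)
  also have "\<dots> = real (Suc i) / real n - real i / real n"
    using a.P_integrable b.P_integrable assms by (simp add: a.P_mean b.P_mean)
  also have "\<dots> = 1 / real n" by (simp add: diff_divide_distrib[symmetric])
  finally show ?thesis .
qed

text \<open>Cyclic shifts of rows and columns move the upper-left block to the lower-right one.\<close>

lemma nn_corner_block:
  assumes [measurable]: "F \<in> borel_measurable (mat_space p q)" and p: "1 \<le> p" "p \<le> n" and q: "1 \<le> q" "q \<le> n"
  shows "(\<integral>\<^sup>+A. F (scaled_block n p q A) \<partial>H) = (\<integral>\<^sup>+A. F (\<lambda>x\<in>{..<p} \<times> {..<q}. sqrt (real n) * corner_block n p q A x) \<partial>H)"
proof -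
  \<comment> \<open>The cyclic shift that carries the first r indices to the last r in the same
    order.\<close>
  define f where "f r i = (if i < r then i + (n - r) else i - r)" for r i :: nat
  have n: "n > 0" using p by simp
  have fn: "f r i < n" if "r \<le> n" "i < n" for r i using that by (auto simp: f_def)
  have bij: "bij_betw (f r) {..<n} {..<n}" if "r \<le> n" for r
    by (rule bij_betw_byWitness[where f' = "\<lambda>i. if i < n - r then i + r else i - (n - r)"])
      (use that in \<open>auto simp: f_def\<close>)
  let ?R = "signed_perm n (\<lambda>_. 1) (f p)" and ?C = "mat_transpose n (signed_perm n (\<lambda>_. 1) (f q))"
  have R: "orthogonal_mat n ?R" and C: "orthogonal_mat n ?C"
    using bij p q by (auto intro!: orthogonal_transpose signed_perm_orthogonal)
  have [measurable]: "?R \<in> space (mat_space n n)" "?C \<in> space (mat_space n n)" using R C by (auto intro: orthogonal_matD)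
  have Fm [measurable]: "(\<lambda>A. F (scaled_block n p q A)) \<in> borel_measurable (mat_space n n)"
    by (rule measurable_compose[OF scaled_block_measurable]) (use p q in auto)
  have "(\<integral>\<^sup>+A. F (scaled_block n p q A) \<partial>H) = (\<integral>\<^sup>+A. F (scaled_block n p q (mat_mult n ?R A)) \<partial>H)"
    by (rule nn_left[OF Fm R, symmetric])
  also have "\<dots> = (\<integral>\<^sup>+A. F (scaled_block n p q (mat_mult n ?R (mat_mult n A ?C))) \<partial>H)"
    by (rule nn_right[OF _ C, symmetric]) measurable
  also have "\<dots> = (\<integral>\<^sup>+A. F (\<lambda>x\<in>{..<p} \<times> {..<q}. sqrt (real n) * corner_block n p q A x) \<partial>H)"
  proof (intro nn_integral_cong arg_cong[of _ _ F])
    fix A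
    show "scaled_block n p q (mat_mult n ?R (mat_mult n A ?C)) = (\<lambda>x\<in>{..<p} \<times> {..<q}. sqrt (real n) * corner_block n p q A x)"
    proof (rule mat_space_eqI[of _ p q])
      fix i j assume ij: "i < p" "j < q"
      have fi: "f p i = n - p + i" "f q j = n - q + j" using ij p q by (auto simp: f_def)
      have "mat_mult n ?R (mat_mult n A ?C) (i, j) = mat_mult n A ?C (f p i, j)"
        using ij p q fn by (subst signed_perm_mult) auto
      also have "\<dots> = mat_transpose n (mat_mult n (signed_perm n (\<lambda>_. 1) (f q)) (mat_transpose n A)) (f p i, j)"
        using ij p q fn by (simp add: mat_transpose_mult mult.commute)
      also have "\<dots> = mat_mult n (signed_perm n (\<lambda>_. 1) (f q)) (mat_transpose n A) (j, f p i)"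
        using ij p q fn by (subst mat_transpose_apply) auto
      also have "\<dots> = A (f p i, f q j)" using ij p q fn by (subst signed_perm_mult) auto
      finally show "scaled_block n p q (mat_mult n ?R (mat_mult n A ?C)) (i, j) = (\<lambda>x\<in>{..<p} \<times> {..<q}. sqrt (real n) * corner_block n p q A x) (i, j)"
        using ij by (simp add: corner_block_def fi del: mat_mult_apply)
    qed (simp_all add: scaled_block_def)
  qed
  finally show ?thesis .
qed

end

text \<open>A version of sqrt (1 - t^2) that is positive on the whole line, as the triangular
  substitution requires of its slopes. The coordinate laws in use give no mass to the points where
  it is altered.\<close>

definition circ :: "real \<Rightarrow> real" where
  "circ t = (if \<bar>t\<bar> < 1 then sqrt (1 - t * t) else 1)"

lemma circ_pos: "0 < circ t"
proof (cases "\<bar>t\<bar> < 1")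
  case True
  then have "t * t < 1" using abs_square_less_1[of t] by (simp add: power2_eq_square)
  then show ?thesis using True by (simp add: circ_def)
qed (simp add: circ_def)

lemma circ_nonzero [simp]: "circ t \<noteq> 0"
  using circ_pos[of t] by simp

lemma circ_measurable [measurable]: "circ \<in> borel_measurable borel"
  unfolding circ_def[abs_def] by measurable

lemma add_column_sigma_cong:
  assumes "i < p" "\<And>l. l < p \<Longrightarrow> \<sigma> (t l) = \<sigma>' (t l)"
  shows "add_column \<sigma> p q t W (i, j) = add_column \<sigma>' p q t W (i, j)"
proof -
  have P: "(\<Prod>l\<in>{i<..<m}. \<sigma> (t l)) = (\<Prod>l\<in>{i<..<m}. \<sigma>' (t l))" if "m \<le> p" for m
    by (rule prod.cong[OF refl], rule assms(2)) (use that in auto)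
  have S: "(\<Sum>m\<in>{i<..<p}. t m * (\<Prod>l\<in>{i<..<m}. \<sigma> (t l)) * W (m, j)) = (\<Sum>m\<in>{i<..<p}. t m * (\<Prod>l\<in>{i<..<m}. \<sigma>' (t l)) * W (m, j))"
    by (intro sum.cong refl arg_cong2[of _ _ _ _ "times"] P) auto
  show ?thesis unfolding add_column_def prod.case S P[OF order_refl] assms(2)[OF assms(1)] ..
qed

lemma block_coords_sigma_cong:
  "i < p \<Longrightarrow> j < q \<Longrightarrow> (\<And>l k. l < p \<Longrightarrow> k < q \<Longrightarrow> \<sigma> (T (l, k)) = \<sigma>' (T (l, k))) \<Longrightarrow>
   block_coords \<sigma> p q T (i, j) = block_coords \<sigma>' p q T (i, j)"
proof (induction q arbitrary: i j)
  case (Suc q)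
  have "add_column \<sigma> p q (\<lambda>i. T (i, q)) (block_coords \<sigma> p q T) (i, j) = add_column \<sigma>' p q (\<lambda>i. T (i, q)) (block_coords \<sigma> p q T) (i, j)"
    by (rule add_column_sigma_cong[OF Suc.prems(1)], rule Suc.prems(3)) auto
  also have "\<dots> = add_column \<sigma>' p q (\<lambda>i. T (i, q)) (block_coords \<sigma>' p q T) (i, j)"
    by (rule add_column_cong[OF Suc.prems(1)]) (use Suc.prems Suc.IH in auto)
  finally show ?case by simp
qed simp

lemma sum_greaterThan_triangle: "(\<Sum>i<p. \<Sum>l\<in>{i<..<p}. g l) = (\<Sum>l<p. real l * (g l :: real))"
proof (induction p)
  case (Suc p)
  have "(\<Sum>i<Suc p. \<Sum>l\<in>{i<..<Suc p}. g l) = (\<Sum>i<p. (\<Sum>l\<in>{i<..<p}. g l) + g p)"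
  proof -
    have "{p<..<Suc p} = {}" by auto
    moreover have "(\<Sum>l\<in>{i<..<Suc p}. g l) = (\<Sum>l\<in>{i<..<p}. g l) + g p" if "i < p" for i
    proof -
      have "{i<..<Suc p} = insert p {i<..<p}" using that by auto
      then show ?thesis by simp
    qed
    ultimately show ?thesis by simp
  qed
  also have "\<dots> = (\<Sum>l<Suc p. real l * g l)" using Suc by (simp add: sum.distrib)
  finally show ?case .
qed simp

text \<open>The rank reads the block column by column from the lower-right corner, so every position
  comes after all positions weakly below and to the right of it, on whose coordinates its entry
  depends.\<close>

lemma rank_inj:
  fixes p :: nat
  shows "inj_on (\<lambda>x. (q - 1 - snd x) * p + (p - 1 - fst x)) ({..<p} \<times> {..<q})"
proof (rule inj_onI)
  fix x y assume xy: "x \<in> {..<p} \<times> {..<q}" "y \<in> {..<p} \<times> {..<q}"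
    "(q - 1 - snd x) * p + (p - 1 - fst x) = (q - 1 - snd y) * p + (p - 1 - fst y)"
  let ?r = "\<lambda>x::nat \<times> nat. (q - 1 - snd x) * p + (p - 1 - fst x)"
  have "?r z div p = q - 1 - snd z" "?r z mod p = p - 1 - fst z" if "z \<in> {..<p} \<times> {..<q}" for z
  proof -
    have "p - 1 - fst z < p" using that by auto
    then show "?r z div p = q - 1 - snd z" "?r z mod p = p - 1 - fst z" by simp_all
  qed
  then have "q - 1 - snd x = q - 1 - snd y" "p - 1 - fst x = p - 1 - fst y" using xy by metis+
  then show "x = y" using xy by (auto simp: prod_eq_iff)
qed

lemma rank_less:
  fixes p :: nat
  assumes "i \<le> l" "l < p" "j \<le> k" "k < q" "(l, k) \<noteq> (i, j)"
  shows "(q - 1 - k) * p + (p - 1 - l) < (q - 1 - j) * p + (p - 1 - i)"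
proof (cases "j = k")
  case True
  then show ?thesis using assms by auto
next
  case False
  then have "q - 1 - k + 1 \<le> q - 1 - j" using assms by auto
  then have "(q - 1 - k + 1) * p \<le> (q - 1 - j) * p" by (rule mult_le_mono1)
  then show ?thesis using assms by (simp add: algebra_simps)
qed

context haar_family begin

lemma corner_AE_strict: "8 \<le> m \<Longrightarrow> AE t in corner (m + 2). \<bar>t\<bar> < 1"
proof -
  assume m: "8 \<le> m"
  have "\<bar>t\<bar> < 1" if "0 < sphere_density m t" for t
  proof (rule ccontr)
    assume t: "\<not> \<bar>t\<bar> < 1"
    have "sphere_weight m t = 0"
    proof (cases "t = 1 \<or> t = -1")
      case True then show ?thesis using m by (auto simp: sphere_weight_def)
    next
      case False then show ?thesis using t by (auto simp: sphere_weight_def indicator_def)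
    qed
    then show False using that by (simp add: sphere_density_def)
  qed
  then show ?thesis unfolding corner_density[OF m] by (subst AE_density) auto
qed

text \<open>With s = sqrt (1 - t^2), s^m |ln s| is at most s |ln s| and hence at most 1, which gives
  integrability. The mean follows from ln s \<le> - t^2 / 2 and the second moment 1 / (m +
  3).\<close>

lemma corner_ln_circ:
  assumes m: "8 \<le> m"
  shows "integrable (corner (m + 2)) (\<lambda>t. ln (circ t))"
    and "(\<integral>t. ln (circ t) \<partial>corner (m + 2)) \<le> - 1 / (2 * (real m + 3))"
proof -
  note pos = sphere_moment_0_pos[OF m]
  show int: "integrable (corner (m + 2)) (\<lambda>t. ln (circ t))"
    unfolding corner_density[OF m]
  proof (subst integrable_density)
    have sm: "sphere_density m \<in> borel_measurable lborel" using sphere_density_measurable by simp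
    have cm: "(\<lambda>t. ln (circ t)) \<in> borel_measurable lborel" using circ_measurable by simp
    show "(\<lambda>t. ln (circ t)) \<in> borel_measurable lborel" by (rule cm)
    show "sphere_density m \<in> borel_measurable lborel" by (rule sm)
    show "integrable lborel (\<lambda>t. sphere_density m t *\<^sub>R ln (circ t))"
    proof (rule Bochner_Integration.integrable_bound)
      show "integrable lborel (\<lambda>t. sphere_weight 0 t * t ^ 0 / sphere_moment m 0)"
        by (intro integrable_divide sphere_weight_integrable)
      show "AE t in lborel. norm (sphere_density m t *\<^sub>R ln (circ t)) \<le> norm (sphere_weight 0 t * t ^ 0 / sphere_moment m 0)"
      proof (rule AE_I2)
        fix t :: real
        have "\<bar>sphere_weight m t * ln (circ t)\<bar> \<le> sphere_weight 0 t"
        proof (cases "\<bar>t\<bar> < 1")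
          case True
          define s where "s = sqrt (1 - t * t)"
          have s: "circ t = s" "0 < s" using circ_pos[of t] True by (auto simp: circ_def s_def)
          have s1: "s \<le> 1" by (simp add: s_def)
          have w: "sphere_weight m t = s ^ m" "sphere_weight 0 t = 1" using True by (auto simp: sphere_weight_def s_def abs_less_iff)
          have "ln (1 / s) \<le> 1 / s - 1" using s by (intro ln_le_minus_one) auto
          then have "s * (- ln s) \<le> s * (1 / s - 1)" using s by (intro mult_left_mono) (auto simp: ln_div)
          also have "\<dots> \<le> 1" using s s1 by (simp add: algebra_simps)
          finally have 1: "s * (- ln s) \<le> 1" .
          have "s ^ m \<le> s ^ 1" using s s1 m by (intro power_decreasing) auto
          then have "s ^ m * (- ln s) \<le> s * (- ln s)" using s s1 by (intro mult_right_mono) auto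
          then have "s ^ m * (- ln s) \<le> 1" using 1 by linarith
          moreover have "\<bar>s ^ m * ln s\<bar> = s ^ m * (- ln s)" using s s1 by (simp add: abs_mult)
          ultimately show ?thesis by (simp add: s w)
        next
          case False
          then have "ln (circ t) = 0" by (simp add: circ_def)
          then show ?thesis by simp
        qed
        then show "norm (sphere_density m t *\<^sub>R ln (circ t)) \<le> norm (sphere_weight 0 t * t ^ 0 / sphere_moment m 0)"
          using pos by (simp add: sphere_density_def abs_mult divide_right_mono)
      qed
    qed (intro borel_measurable_scaleR sm cm)
  qed (use sphere_density_nonneg[OF m] in auto)
  have "(\<integral>t. ln (circ t) \<partial>corner (m + 2)) \<le> (\<integral>t. - (t ^ 2) / 2 \<partial>corner (m + 2))"
  proof (rule integral_mono_AE[OF int])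
    show "integrable (corner (m + 2)) (\<lambda>t. - (t ^ 2) / 2)"
      using corner_power_integrable[of "m + 2" 2] by auto
    show "AE t in corner (m + 2). ln (circ t) \<le> - (t ^ 2) / 2"
      using corner_AE_strict[OF m]
    proof eventually_elim
      fix t :: real assume t: "\<bar>t\<bar> < 1"
      then have p: "1 - t * t > 0" using abs_square_less_1[of t] by (simp add: power2_eq_square)
      have "ln (1 - t * t) \<le> (1 - t * t) - 1" by (rule ln_le_minus_one[OF p])
      then show "ln (circ t) \<le> - (t ^ 2) / 2" using t p by (simp add: circ_def ln_sqrt power2_eq_square)
    qed
  qed
  also have "\<dots> = - 1 / (2 * (real m + 3))"
    using corner_second_moment[of "m + 2"] corner_power_integrable[of "m + 2" 2] by (simp add: field_simps)
  finally show "(\<integral>t. ln (circ t) \<partial>corner (m + 2)) \<le> - 1 / (2 * (real m + 3))" .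
qed

text \<open>The relative entropy is the mean of the logarithm of the density ratio under the law of
  the block. Pulled back to the independent coordinates this logarithm is a sum over the entries, so
  only means of single terms have to be estimated.\<close>

theorem kl_upper_bound:
  assumes p: "1 \<le> p" and q: "1 \<le> q" and d: "9 \<le> d" and n: "n = d + p + q"
  shows "kl_div (distr (H n) (mat_space p q) (scaled_block n p q)) (gauss_mat p q)
    \<le> ereal (real (p * q) * (real (p * q) / (real n * real d) + 15 / (real d - 1)) / 2)"
proof -
  interpret S: haar n "H n" by (rule haar_H)
  interpret G: gauss p q using p q by unfold_locales auto
  let ?I = "{..<p} \<times> {..<q}"
  let ?L = "mat_space p q"
  let ?\<mu> = "distr (H n) ?L (scaled_block n p q)" and ?\<nu> = "gauss_mat p q"
  interpret pp: prob_pair ?\<mu> ?\<nu> using S.block_prob_pair[of p q] p q n by simp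
  have L: "?L = PiM ?I (\<lambda>_. lborel)" by (simp add: mat_space_def)
  have n0: "real n > 0" "sqrt (real n) > 0" using n d by auto
  have comp: "(\<lambda>T. T x) \<in> borel_measurable ?L" if "x \<in> ?I" for x
    using that by (cases x) auto
  have sb: "scaled_block n p q \<in> measurable (H n) ?L"
    using scaled_block_measurable[of p n q] n by (subst measurable_cong_sets[OF S.sets_H refl]) simp
  define rank where "rank x = (q - 1 - snd x) * p + (p - 1 - fst x)" for x :: "nat \<times> nat"
  define Z where "Z = block_coords circ p q"
  \<comment> \<open>The derivative of a scaled entry in its own coordinate; the product of these
    over the block is the Jacobian determinant \<open>B\<close> of \<open>\<Phi>\<close>.\<close>
  define b where "b x T = sqrt (real n) * ((\<Prod>l\<in>{fst x<..<p}. circ (T (l, snd x))) * (\<Prod>k\<in>{snd x<..<q}. circ (T (fst x, k))))"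
    for x and T :: "nat \<times> nat \<Rightarrow> real"
  define a where "a x T = sqrt (real n) * Z (T(x := 0)) x" for x and T :: "nat \<times> nat \<Rightarrow> real"
  define \<Phi> where "\<Phi> T = (\<lambda>x\<in>?I. sqrt (real n) * Z T x)" for T
  have b_pos: "0 < b x T" for x T
    unfolding b_def using n0 by (intro mult_pos_pos prod_pos) (auto intro: circ_pos)
  have \<Phi>_affine: "(\<lambda>x\<in>?I. a x T + b x T * T x) = \<Phi> T" for T
  proof (rule ext)
    fix x
    show "(\<lambda>x\<in>?I. a x T + b x T * T x) x = \<Phi> T x"
    proof (cases "x \<in> ?I")
      case True
      then obtain i j where x: "x = (i, j)" "i < p" "j < q" by auto
      have "\<Phi> T x = sqrt (real n) * Z T (i, j)" using True by (simp add: \<Phi>_def x(1))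
      also have "\<dots> = sqrt (real n) * (Z (T((i, j) := 0)) (i, j)
          + (\<Prod>l\<in>{i<..<p}. circ (T (l, j))) * (\<Prod>k\<in>{j<..<q}. circ (T (i, k))) * T (i, j))"
        unfolding Z_def by (rule arg_cong[OF block_coords_affine[OF x(2,3)]])
      also have "\<dots> = a x T + b x T * T x" unfolding a_def b_def x(1) fst_conv snd_conv by (simp only: algebra_simps)
      finally show ?thesis using True by simp
    qed (simp add: \<Phi>_def)
  qed
  have circ_comp: "(\<lambda>T. circ (T x)) \<in> borel_measurable ?L" if "x \<in> ?I" for x
    by (rule measurable_compose[OF comp[OF that] circ_measurable])
  have b_meas: "b x \<in> borel_measurable ?L" if "x \<in> ?I" for x
    unfolding b_def using that
    by (intro borel_measurable_times borel_measurable_prod circ_comp borel_measurable_const) auto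
  have Z_meas: "(\<lambda>T. Z T x) \<in> borel_measurable ?L" if "x \<in> ?I" for x
    unfolding Z_def using that
    by (cases x) (auto intro!: block_coords_measurable[OF circ_measurable] comp)
  have a_meas: "a x \<in> borel_measurable ?L" if "x \<in> ?I" for x
  proof -
    obtain i j where x: "x = (i, j)" "i < p" "j < q" using \<open>x \<in> ?I\<close> by auto
    have upd: "(\<lambda>T. (T(x := 0)) y) \<in> borel_measurable ?L" if "y \<in> ?I" for y
      using comp[OF that] by (cases "y = x") auto
    have "(\<lambda>T. block_coords circ p q (T(x := 0)) (i, j)) \<in> borel_measurable ?L"
      by (intro block_coords_measurable[OF circ_measurable x(2,3)]) (rule upd, simp)
    then show ?thesis unfolding a_def[abs_def] Z_def x(1) by (intro borel_measurable_times borel_measurable_const)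
  qed
  have \<Phi>_meas: "\<Phi> \<in> measurable ?L ?L"
    by (rule measurable_mat_spaceI) (use Z_meas in \<open>auto simp: \<Phi>_def[abs_def]\<close>)
  have rank_lt: "rank (l, k) < rank (i, j)" if "i \<le> l" "l < p" "j \<le> k" "k < q" "(l, k) \<noteq> (i, j)" for i j l k
    using rank_less[OF that] by (simp add: rank_def)
  have a_cong: "a x T = a x T'" if x: "x \<in> ?I" and T: "\<And>y. y \<in> ?I \<Longrightarrow> rank y < rank x \<Longrightarrow> T y = T' y" for x T T'
  proof -
    obtain i j where ij: "x = (i, j)" "i < p" "j < q" using x by auto
    have "block_coords circ p q (T(x := 0)) (i, j) = block_coords circ p q (T'(x := 0)) (i, j)"
    proof (rule block_coords_cong[OF ij(2,3)])
      fix l k assume lk: "i \<le> l" "l < p" "j \<le> k" "k < q"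
      show "(T(x := 0)) (l, k) = (T'(x := 0)) (l, k)"
        using T[of "(l, k)"] rank_lt[OF lk] lk ij by (cases "(l, k) = (i, j)") auto
    qed
    then show ?thesis by (simp add: a_def Z_def ij)
  qed
  have b_cong: "b x T = b x T'" if x: "x \<in> ?I" and T: "\<And>y. y \<in> ?I \<Longrightarrow> rank y < rank x \<Longrightarrow> T y = T' y" for x T T'
  proof -
    obtain i j where ij: "x = (i, j)" "i < p" "j < q" using x by auto
    have 1: "(\<Prod>l\<in>{i<..<p}. circ (T (l, j))) = (\<Prod>l\<in>{i<..<p}. circ (T' (l, j)))"
      by (intro prod.cong refl arg_cong[of _ _ circ] T) (use ij rank_lt in auto)
    have 2: "(\<Prod>k\<in>{j<..<q}. circ (T (i, k))) = (\<Prod>k\<in>{j<..<q}. circ (T' (i, k)))"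
      by (intro prod.cong refl arg_cong[of _ _ circ] T) (use ij rank_lt in auto)
    show ?thesis unfolding b_def ij fst_conv snd_conv 1 2 ..
  qed
  define B where "B T = (\<Prod>x\<in>?I. b x T)" for T
  have B_pos: "0 < B T" for T unfolding B_def by (intro prod_pos) (auto intro: b_pos)
  have B_meas: "B \<in> borel_measurable ?L" unfolding B_def[abs_def] by (intro borel_measurable_prod b_meas)
  have inj: "inj_on rank ?I" unfolding rank_def by (rule rank_inj)
  have tri: "(\<forall>F \<in> borel_measurable ?L. (\<integral>\<^sup>+T. F (\<Phi> T) * ennreal (B T) \<partial>?L) = (\<integral>\<^sup>+z. F z \<partial>?L))
    \<and> (\<exists>\<Psi> \<in> measurable ?L ?L. \<forall>T \<in> space ?L. \<Psi> (\<Phi> T) = T)"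
    unfolding L \<Phi>_affine[symmetric] B_def
  proof (rule triangular_change_of_variables[where rank = rank])
    show "inj_on rank ?I" by (rule inj)
    show "a x \<in> borel_measurable (PiM ?I (\<lambda>_. lborel))" if "x \<in> ?I" for x
      using a_meas[OF that] unfolding L .
    show "b x \<in> borel_measurable (PiM ?I (\<lambda>_. lborel))" if "x \<in> ?I" for x
      using b_meas[OF that] unfolding L .
    show "a x t = a x t'" if "x \<in> ?I" "\<And>y. y \<in> ?I \<Longrightarrow> rank y < rank x \<Longrightarrow> t y = t' y" for x t t'
      by (rule a_cong[OF that])
    show "b x t = b x t'" if "x \<in> ?I" "\<And>y. y \<in> ?I \<Longrightarrow> rank y < rank x \<Longrightarrow> t y = t' y" for x t t'
      by (rule b_cong[OF that])
    show "finite ?I" by simp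
  qed (rule b_pos)
  then obtain \<Psi> where \<Psi>: "\<Psi> \<in> measurable ?L ?L" "\<And>T. T \<in> space ?L \<Longrightarrow> \<Psi> (\<Phi> T) = T" by blast
  have cov: "(\<integral>\<^sup>+T. F (\<Phi> T) * ennreal (B T) \<partial>?L) = (\<integral>\<^sup>+z. F z \<partial>?L)" if "F \<in> borel_measurable ?L" for F
    using tri that by blast

  \<comment> \<open>The exponent for which \<open>coord_law d x\<close> is
    \<open>corner (m x + 2)\<close>; d \<ge> 9 brings it into the range m \<ge> 8 of
    \<open>corner_density\<close>.\<close>
  define m where "m x = d + fst x + snd x - 1" for x :: "nat \<times> nat"
  have m8: "8 \<le> m x" for x using d by (simp add: m_def)
  have law: "coord_law d x = corner (m x + 2)" for x using d by (simp add: m_def)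
  let ?P = "PiM ?I (coord_law d)"
  define D where "D T = (\<Prod>x\<in>?I. sphere_density (m x) (T x))" for T
  have P_density: "?P = density ?L (\<lambda>T. ennreal (D T))"
    unfolding L D_def
  proof (rule PiM_density)
    show "coord_law d x = density lborel (\<lambda>t. ennreal (sphere_density (m x) t))" for x unfolding law by (rule corner_density[OF m8])
    show "prob_space (coord_law d x)" for x by (rule prob_corner)
    show "0 \<le> sphere_density (m x) t" for x t by (rule sphere_density_nonneg[OF m8])
  qed simp_all
  have sets_P: "sets ?P = sets ?L" unfolding P_density by simp
  have D0: "0 \<le> D T" for T unfolding D_def by (intro prod_nonneg) (auto intro: sphere_density_nonneg m8)
  have D_meas: "D \<in> borel_measurable ?L" unfolding D_def[abs_def]
    by (intro borel_measurable_prod measurable_compose[OF comp sphere_density_measurable])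
  have AE_P: "AE T in ?P. \<forall>x\<in>?I. \<bar>T x\<bar> < 1"
  proof (rule AE_finite_allI)
    fix x assume x: "x \<in> ?I"
    have "AE t in coord_law d x. \<bar>t\<bar> < 1" unfolding law by (rule corner_AE_strict[OF m8])
    then show "AE T in ?P. \<bar>T x\<bar> < 1" using x by (intro AE_PiM_component prob_corner)
  qed simp
  have \<Phi>_meas_P: "\<Phi> \<in> measurable ?P ?L" using \<Phi>_meas by (subst measurable_cong_sets[OF sets_P refl])
  have mu_P: "?\<mu> = distr ?P ?L \<Phi>"
  proof (rule measure_eqI)
    fix A assume "A \<in> sets ?\<mu>"
    then have A: "A \<in> sets ?L" by simp
    let ?F = "\<lambda>W. indicator A (\<lambda>x\<in>?I. sqrt (real n) * W x) :: ennreal"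
    have sc: "(\<lambda>W. \<lambda>x\<in>?I. sqrt (real n) * W x) \<in> measurable ?L ?L"
      by (rule measurable_mat_spaceI) (use comp in auto)
    have iA: "(indicator A :: _ \<Rightarrow> ennreal) \<in> borel_measurable ?L" using A by simp
    have Fm: "?F \<in> borel_measurable ?L" by (rule measurable_compose[OF sc iA])
    have "emeasure ?\<mu> A = (\<integral>\<^sup>+z. indicator A z \<partial>?\<mu>)" using A by simp
    also have "\<dots> = (\<integral>\<^sup>+G. indicator A (scaled_block n p q G) \<partial>H n)"
      by (rule nn_integral_distr[OF sb]) (use iA in simp)
    also have "\<dots> = (\<integral>\<^sup>+G. indicator A (\<lambda>x\<in>?I. sqrt (real n) * corner_block n p q G x) \<partial>H n)"
      by (rule S.nn_corner_block[OF iA]) (use p q n in auto)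
    also have "\<dots> = (\<integral>\<^sup>+T. ?F (restrict (block_coords (\<lambda>t. sqrt (1 - t * t)) p q T) ?I) \<partial>?P)"
      unfolding n by (rule block_representation[OF Fm[unfolded n]])
    also have "\<dots> = (\<integral>\<^sup>+T. indicator A (\<Phi> T) \<partial>?P)"
    proof (rule nn_integral_cong_AE, use AE_P in eventually_elim)
      fix T :: "nat \<times> nat \<Rightarrow> real" assume T: "\<forall>x\<in>?I. \<bar>T x\<bar> < 1"
      have "(\<lambda>x\<in>?I. sqrt (real n) * restrict (block_coords (\<lambda>t. sqrt (1 - t * t)) p q T) ?I x) = \<Phi> T"
        unfolding \<Phi>_def Z_def
      proof (rule restrict_ext)
        fix x assume "x \<in> ?I"
        then obtain i j where x: "x = (i, j)" "i < p" "j < q" by auto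
        have "block_coords (\<lambda>t. sqrt (1 - t * t)) p q T (i, j) = block_coords circ p q T (i, j)"
          by (rule block_coords_sigma_cong[OF x(2,3)]) (use T in \<open>auto simp: circ_def\<close>)
        then show "sqrt (real n) * restrict (block_coords (\<lambda>t. sqrt (1 - t * t)) p q T) ?I x = sqrt (real n) * block_coords circ p q T x"
          using x by simp
      qed
      then show "?F (restrict (block_coords (\<lambda>t. sqrt (1 - t * t)) p q T) ?I) = indicator A (\<Phi> T)" by simp
    qed
    also have "\<dots> = (\<integral>\<^sup>+z. indicator A z \<partial>distr ?P ?L \<Phi>)"
      by (rule nn_integral_distr[OF \<Phi>_meas_P, symmetric]) (use iA in simp)
    also have "\<dots> = emeasure (distr ?P ?L \<Phi>) A" using A by simp
    finally show "emeasure ?\<mu> A = emeasure (distr ?P ?L \<Phi>) A" .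
  qed simp

  define \<phi> where "\<phi> z = (\<Prod>x\<in>?I. std_normal_density (z x))" for z :: "nat \<times> nat \<Rightarrow> real"
  have \<phi>_pos: "0 < \<phi> z" for z unfolding \<phi>_def by (intro prod_pos) (simp add: normal_density_pos)
  have \<phi>_meas: "\<phi> \<in> borel_measurable ?L" unfolding \<phi>_def[abs_def]
    by (intro borel_measurable_prod measurable_compose[OF comp]) simp_all
  have nu_density: "?\<nu> = density ?L (\<lambda>z. ennreal (\<phi> z))"
    unfolding gauss_mat_def L \<phi>_def by (rule PiM_density) (auto simp: prob_space_normal_density)
  \<comment> \<open>At z = \<open>\<Phi> T\<close> the image law has Lebesgue density D T / B T;
    this is divided by the Gaussian density.\<close>
  define f where "f z = D (\<Psi> z) / (B (\<Psi> z) * \<phi> z)" for z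
  have f0: "0 \<le> f z" for z unfolding f_def using D0 B_pos \<phi>_pos by (intro divide_nonneg_pos mult_pos_pos) auto
  have f_meas: "f \<in> borel_measurable ?L" unfolding f_def[abs_def]
    by (intro borel_measurable_divide borel_measurable_times \<phi>_meas measurable_compose[OF \<Psi>(1) D_meas] measurable_compose[OF \<Psi>(1) B_meas])
  have f_meas': "f \<in> borel_measurable ?\<nu>" using f_meas by simp
  have mu_nu: "?\<mu> = density ?\<nu> (\<lambda>z. ennreal (f z))"
  proof (rule measure_eqI)
    fix A assume "A \<in> sets ?\<mu>"
    then have A: "A \<in> sets ?L" by simp
    have iA: "(indicator A :: _ \<Rightarrow> ennreal) \<in> borel_measurable ?L" using A by simp
    have ef: "(\<lambda>z. ennreal (f z)) \<in> borel_measurable ?L" using f_meas by (rule measurable_compose) simp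
    have e\<phi>: "(\<lambda>z. ennreal (\<phi> z)) \<in> borel_measurable ?L" using \<phi>_meas by (rule measurable_compose) simp
    have eD: "(\<lambda>z. ennreal (D z)) \<in> borel_measurable ?L" using D_meas by (rule measurable_compose) simp
    define F where "F z = ennreal (D (\<Psi> z) / B (\<Psi> z)) * indicator A z" for z
    have F_meas: "F \<in> borel_measurable ?L" unfolding F_def[abs_def]
      by (intro borel_measurable_times_ennreal iA measurable_compose[OF _ measurable_ennreal] borel_measurable_divide
        measurable_compose[OF \<Psi>(1) D_meas] measurable_compose[OF \<Psi>(1) B_meas])
    have "emeasure (density ?\<nu> (\<lambda>z. ennreal (f z))) A = (\<integral>\<^sup>+z. ennreal (f z) * indicator A z \<partial>?\<nu>)"
      by (rule emeasure_density) (use ef A in auto)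
    also have "\<dots> = (\<integral>\<^sup>+z. ennreal (\<phi> z) * (ennreal (f z) * indicator A z) \<partial>?L)"
      unfolding nu_density by (rule nn_integral_density[OF e\<phi>]) (use ef iA in auto)
    also have "\<dots> = (\<integral>\<^sup>+z. F z \<partial>?L)"
    proof (rule nn_integral_cong)
      fix z
      have "\<phi> z * f z = D (\<Psi> z) / B (\<Psi> z)" unfolding f_def using \<phi>_pos[of z] by simp
      then have "ennreal (\<phi> z) * ennreal (f z) = ennreal (D (\<Psi> z) / B (\<Psi> z))"
        using f0[of z] \<phi>_pos[of z] by (simp add: ennreal_mult[symmetric])
      then show "ennreal (\<phi> z) * (ennreal (f z) * indicator A z) = F z" by (simp add: F_def mult.assoc[symmetric])
    qed
    also have "\<dots> = (\<integral>\<^sup>+T. F (\<Phi> T) * ennreal (B T) \<partial>?L)" by (rule cov[OF F_meas, symmetric])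
    also have "\<dots> = (\<integral>\<^sup>+T. ennreal (D T) * indicator A (\<Phi> T) \<partial>?L)"
    proof (rule nn_integral_cong)
      fix T assume T: "T \<in> space ?L"
      have "ennreal (D T / B T) * ennreal (B T) = ennreal (D T)"
        using D0[of T] B_pos[of T] by (simp add: ennreal_mult[symmetric])
      then show "F (\<Phi> T) * ennreal (B T) = ennreal (D T) * indicator A (\<Phi> T)"
        unfolding F_def \<Psi>(2)[OF T] by (metis mult.assoc mult.commute)
    qed
    also have "\<dots> = (\<integral>\<^sup>+T. indicator A (\<Phi> T) \<partial>?P)"
      unfolding P_density by (rule nn_integral_density[OF eD, symmetric]) (rule measurable_compose[OF \<Phi>_meas iA])
    also have "\<dots> = (\<integral>\<^sup>+z. indicator A z \<partial>distr ?P ?L \<Phi>)"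
      by (rule nn_integral_distr[OF \<Phi>_meas_P, symmetric]) (use iA in simp)
    also have "\<dots> = emeasure ?\<mu> A" unfolding mu_P using A by simp
    finally show "emeasure ?\<mu> A = emeasure (density ?\<nu> (\<lambda>z. ennreal (f z))) A" ..
  qed simp

  define c0 where "c0 = ln (2 * pi) / 2 - ln (real n) / 2"
  \<comment> \<open>The density contributes \<open>circ\<close> with exponent m x = d - 1 + i + j
    and the Jacobian takes away i + j, which leaves the same exponent d - 1 for every entry.\<close>
  define g where "g T = (\<Sum>x\<in>?I. c0 - ln (sphere_moment (m x) 0) + (real d - 1) * ln (circ (T x)) + (\<Phi> T x)\<^sup>2 / 2)" for T
  have ln_f: "AE T in ?P. ln (f (\<Phi> T)) = g T"
    using AE_P AE_space
  proof eventually_elim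
    fix T :: "nat \<times> nat \<Rightarrow> real" assume T: "\<forall>x\<in>?I. \<bar>T x\<bar> < 1" and "T \<in> space ?P"
    then have TL: "T \<in> space ?L" using sets_eq_imp_space_eq[OF sets_P] by simp
    have dens: "0 < sphere_density (m x) (T x)" "ln (sphere_density (m x) (T x)) = real (m x) * ln (circ (T x)) - ln (sphere_moment (m x) 0)"
      if x: "x \<in> ?I" for x
    proof -
      have t: "\<bar>T x\<bar> < 1" using T x by blast
      then have w: "sphere_weight (m x) (T x) = circ (T x) ^ m x" by (simp add: sphere_weight_def circ_def abs_less_iff)
      show "0 < sphere_density (m x) (T x)"
        unfolding sphere_density_def w using circ_pos sphere_moment_0_pos[OF m8] by (intro divide_pos_pos zero_less_power)
      show "ln (sphere_density (m x) (T x)) = real (m x) * ln (circ (T x)) - ln (sphere_moment (m x) 0)"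
        unfolding sphere_density_def w using circ_pos[of "T x"] sphere_moment_0_pos[OF m8[of x]] by (simp add: ln_div ln_realpow)
    qed
    have lnD: "ln (D T) = (\<Sum>x\<in>?I. real (m x) * ln (circ (T x)) - ln (sphere_moment (m x) 0))"
    proof -
      have "ln (D T) = (\<Sum>x\<in>?I. ln (sphere_density (m x) (T x)))"
        unfolding D_def
      proof (rule ln_prod)
        show "sphere_density (m x) (T x) \<noteq> 0" if "x \<in> ?I" for x using dens(1)[OF that] by linarith
      qed simp
      then show ?thesis using dens(2) by simp
    qed
    have D_pos: "0 < D T" unfolding D_def by (intro prod_pos) (use dens in auto)
    have lnb: "ln (b (i, j) T) = ln (real n) / 2 + (\<Sum>l\<in>{i<..<p}. ln (circ (T (l, j)))) + (\<Sum>k\<in>{j<..<q}. ln (circ (T (i, k))))" for i j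
    proof -
      have 1: "0 < (\<Prod>l\<in>{i<..<p}. circ (T (l, j)))" "0 < (\<Prod>k\<in>{j<..<q}. circ (T (i, k)))"
        by (auto intro!: prod_pos circ_pos)
      have "ln (\<Prod>l\<in>{i<..<p}. circ (T (l, j))) = (\<Sum>l\<in>{i<..<p}. ln (circ (T (l, j))))"
        "ln (\<Prod>k\<in>{j<..<q}. circ (T (i, k))) = (\<Sum>k\<in>{j<..<q}. ln (circ (T (i, k))))"
        by (auto intro!: ln_prod circ_pos)
      then show ?thesis unfolding b_def using 1 n0 by (simp add: ln_mult ln_sqrt)
    qed
    \<comment> \<open>The coordinate (i, j) occurs in the slopes of the i entries above it and of
      the j entries to its left, hence i + j times in all.\<close>
    have lnB: "ln (B T) = (\<Sum>x\<in>?I. ln (real n) / 2 + (real (fst x) + real (snd x)) * ln (circ (T x)))"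
    proof -
      have "ln (B T) = (\<Sum>x\<in>?I. ln (b x T))" unfolding B_def by (rule ln_prod) (use b_pos[of _ T] in \<open>auto simp: less_le\<close>)
      also have "\<dots> = (\<Sum>i<p. \<Sum>j<q. ln (b (i, j) T))" by (simp add: sum.cartesian_product)
      also have "\<dots> = (\<Sum>i<p. \<Sum>j<q. ln (real n) / 2) + (\<Sum>i<p. \<Sum>j<q. \<Sum>l\<in>{i<..<p}. ln (circ (T (l, j))))
         + (\<Sum>i<p. \<Sum>j<q. \<Sum>k\<in>{j<..<q}. ln (circ (T (i, k))))" unfolding lnb by (simp only: sum.distrib)
      also have "(\<Sum>i<p. \<Sum>j<q. \<Sum>l\<in>{i<..<p}. ln (circ (T (l, j)))) = (\<Sum>i<p. \<Sum>j<q. real i * ln (circ (T (i, j))))"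
        by (subst (1 2) sum.swap) (simp only: sum_greaterThan_triangle)
      also have "(\<Sum>i<p. \<Sum>j<q. \<Sum>k\<in>{j<..<q}. ln (circ (T (i, k)))) = (\<Sum>i<p. \<Sum>j<q. real j * ln (circ (T (i, j))))"
        by (simp only: sum_greaterThan_triangle)
      also have "(\<Sum>i<p. \<Sum>j<q. ln (real n) / 2) + (\<Sum>i<p. \<Sum>j<q. real i * ln (circ (T (i, j)))) + (\<Sum>i<p. \<Sum>j<q. real j * ln (circ (T (i, j))))
        = (\<Sum>i<p. \<Sum>j<q. ln (real n) / 2 + (real i + real j) * ln (circ (T (i, j))))"
        by (simp only: sum.distrib[symmetric] distrib_right add.assoc)
      finally show ?thesis by (simp add: sum.cartesian_product case_prod_unfold)
    qed
    have ln\<phi>: "ln (\<phi> z) = (\<Sum>x\<in>?I. - (z x)\<^sup>2 / 2 - ln (2 * pi) / 2)" for z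
    proof -
      have "ln (\<phi> z) = (\<Sum>x\<in>?I. ln (std_normal_density (z x)))" unfolding \<phi>_def by (rule ln_prod) (auto simp: normal_density_def)
      also have "\<dots> = (\<Sum>x\<in>?I. - (z x)\<^sup>2 / 2 - ln (2 * pi) / 2)"
        by (intro sum.cong refl) (simp add: std_normal_density_def ln_mult ln_div ln_sqrt)
      finally show ?thesis .
    qed
    have "ln (f (\<Phi> T)) = ln (D T) - ln (B T) - ln (\<phi> (\<Phi> T))"
      unfolding f_def \<Psi>(2)[OF TL] using D_pos B_pos[of T] \<phi>_pos[of "\<Phi> T"] by (simp add: ln_div ln_mult)
    also have "\<dots> = g T"
      unfolding lnD lnB ln\<phi> g_def sum_subtractf[symmetric]
    proof (intro sum.cong refl)
      fix x
      have rm: "real (m x) = real d - 1 + (real (fst x) + real (snd x))" using d by (simp add: m_def)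
      show "real (m x) * ln (circ (T x)) - ln (sphere_moment (m x) 0) - (ln (real n) / 2 + (real (fst x) + real (snd x)) * ln (circ (T x)))
          - (- (\<Phi> T x)\<^sup>2 / 2 - ln (2 * pi) / 2)
        = c0 - ln (sphere_moment (m x) 0) + (real d - 1) * ln (circ (T x)) + (\<Phi> T x)\<^sup>2 / 2"
        unfolding rm by (simp add: c0_def algebra_simps)
    qed
    finally show "ln (f (\<Phi> T)) = g T" .
  qed

  interpret P: prob_space ?P by (intro prob_space_PiM prob_corner)
  have circ_P: "integrable ?P (\<lambda>T. ln (circ (T x)))" "(\<integral>T. ln (circ (T x)) \<partial>?P) \<le> - 1 / (2 * (real (m x) + 3))" if x: "x \<in> ?I" for x
  proof -
    have D: "distr ?P (coord_law d x) (\<lambda>T. T x) = coord_law d x"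
      by (rule distr_PiM_component) (use x prob_corner in auto)
    have ci: "integrable (coord_law d x) (\<lambda>t. ln (circ t))" "(\<integral>t. ln (circ t) \<partial>coord_law d x) \<le> - 1 / (2 * (real (m x) + 3))"
      unfolding law by (rule corner_ln_circ[OF m8])+
    have cx: "(\<lambda>T. T x) \<in> measurable ?P (coord_law d x)" by (rule measurable_component_singleton[OF x])
    have lc: "(\<lambda>t. ln (circ t)) \<in> borel_measurable (coord_law d x)"
      by (subst measurable_cong_sets[OF sets_corner refl]) measurable
    have "integrable (distr ?P (coord_law d x) (\<lambda>T. T x)) (\<lambda>t. ln (circ t))"
      unfolding D by (rule ci)
    then show "integrable ?P (\<lambda>T. ln (circ (T x)))" using integrable_distr_eq[OF cx lc] by simp
    have "(\<integral>T. ln (circ (T x)) \<partial>?P) = (\<integral>t. ln (circ t) \<partial>distr ?P (coord_law d x) (\<lambda>T. T x))"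
      by (rule integral_distr[OF cx lc, symmetric])
    also have "\<dots> \<le> - 1 / (2 * (real (m x) + 3))" unfolding D by (rule ci)
    finally show "(\<integral>T. ln (circ (T x)) \<partial>?P) \<le> - 1 / (2 * (real (m x) + 3))" .
  qed
  \<comment> \<open>The scaled entry has second moment n * (1 / n) = 1, as in the Gaussian case, so
    the Gaussian exponent contributes exactly 1 / 2 per entry.\<close>
  have sq_P: "integrable ?P (\<lambda>T. (\<Phi> T x)\<^sup>2)" "(\<integral>T. (\<Phi> T x)\<^sup>2 \<partial>?P) = 1" if x: "x \<in> ?I" for x
  proof -
    obtain i j where ij: "x = (i, j)" "i < p" "j < q" using x by auto
    have ij': "i < n" "j < n" using ij n by auto
    have zm: "(\<lambda>z. (z x)\<^sup>2) \<in> borel_measurable ?L" using comp[OF x] by (intro borel_measurable_power)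
    have sx: "(scaled_block n p q A x)\<^sup>2 = real n * (A (i, j))\<^sup>2" for A
      using ij by (simp add: power_mult_distrib)
    have "integrable (H n) (\<lambda>A. (A (i, j))\<^sup>2)"
    proof (rule S.integrable_bounded[of _ 1])
      show "(\<lambda>A. (A (i, j))\<^sup>2) \<in> borel_measurable (mat_space n n)"
        using ij' by (intro borel_measurable_power measurable_mat_entry)
      fix A assume "orthogonal_mat n A"
      then show "\<bar>(A (i, j))\<^sup>2\<bar> \<le> 1" using orthogonal_mat_bound[of n A i j] ij' by (simp add: abs_square_le_1)
    qed
    then have "integrable ?\<mu> (\<lambda>z. (z x)\<^sup>2)" using integrable_distr_eq[OF sb zm] by (simp add: sx)
    then show "integrable ?P (\<lambda>T. (\<Phi> T x)\<^sup>2)" unfolding mu_P using integrable_distr_eq[OF \<Phi>_meas_P zm] by simp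
    have "(\<integral>T. (\<Phi> T x)\<^sup>2 \<partial>?P) = (\<integral>z. (z x)\<^sup>2 \<partial>?\<mu>)" unfolding mu_P by (rule integral_distr[OF \<Phi>_meas_P zm, symmetric])
    also have "\<dots> = (\<integral>A. real n * (A (i, j))\<^sup>2 \<partial>H n)" using integral_distr[OF sb zm] by (simp add: sx)
    also have "\<dots> = 1" using S.entry_second_moment[OF ij'] n0 by simp
    finally show "(\<integral>T. (\<Phi> T x)\<^sup>2 \<partial>?P) = 1" .
  qed
  have g_int: "integrable ?P g" unfolding g_def[abs_def]
    by (intro Bochner_Integration.integrable_sum Bochner_Integration.integrable_add integrable_mult_right integrable_divide circ_P sq_P) auto
  have lnf_meas: "(\<lambda>z. ln (f z)) \<in> borel_measurable ?L" using f_meas by (rule measurable_compose) simp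
  have lnf_meas_P: "(\<lambda>T. ln (f (\<Phi> T))) \<in> borel_measurable ?P" by (rule measurable_compose[OF \<Phi>_meas_P lnf_meas])
  have "integrable ?P (\<lambda>T. ln (f (\<Phi> T)))"
    by (rule integrable_cong_AE_imp[OF g_int lnf_meas_P]) (use ln_f in \<open>auto elim!: eventually_mono\<close>)
  then have int_mu: "integrable ?\<mu> (\<lambda>z. ln (f z))" unfolding mu_P using integrable_distr_eq[OF \<Phi>_meas_P lnf_meas] by simp
  have lnf_nu: "(\<lambda>z. ln (f z)) \<in> borel_measurable ?\<nu>" using lnf_meas by simp
  have int_nu: "integrable ?\<nu> (\<lambda>z. f z * ln (f z))"
    using int_mu unfolding mu_nu by (subst (asm) integrable_density[OF lnf_nu f_meas']) (use f0 in auto)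
  have kl: "kl_div ?\<mu> ?\<nu> = ereal (\<integral>z. f z * ln (f z) \<partial>?\<nu>)"
    by (rule pp.kl_density[OF f_meas' f0 mu_nu int_nu])
  have "(\<integral>z. f z * ln (f z) \<partial>?\<nu>) = (\<integral>z. ln (f z) \<partial>?\<mu>)"
    unfolding mu_nu by (subst integral_density[OF lnf_nu f_meas']) (use f0 in auto)
  also have "\<dots> = (\<integral>T. ln (f (\<Phi> T)) \<partial>?P)" unfolding mu_P by (rule integral_distr[OF \<Phi>_meas_P lnf_meas])
  also have "\<dots> = (\<integral>T. g T \<partial>?P)"
    by (rule integral_cong_AE[OF lnf_meas_P borel_measurable_integrable[OF g_int] ln_f])
  also have "\<dots> = (\<Sum>x\<in>?I. c0 - ln (sphere_moment (m x) 0) + (real d - 1) * (\<integral>T. ln (circ (T x)) \<partial>?P) + 1 / 2)"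
  proof -
    have "(\<integral>T. g T \<partial>?P) = (\<Sum>x\<in>?I. \<integral>T. c0 - ln (sphere_moment (m x) 0) + (real d - 1) * ln (circ (T x)) + (\<Phi> T x)\<^sup>2 / 2 \<partial>?P)"
      unfolding g_def by (intro Bochner_Integration.integral_sum Bochner_Integration.integrable_add integrable_mult_right integrable_divide circ_P sq_P) auto
    also have "\<dots> = (\<Sum>x\<in>?I. c0 - ln (sphere_moment (m x) 0) + (real d - 1) * (\<integral>T. ln (circ (T x)) \<partial>?P) + 1 / 2)"
    proof (intro sum.cong refl)
      fix x assume x: "x \<in> ?I"
      show "(\<integral>T. c0 - ln (sphere_moment (m x) 0) + (real d - 1) * ln (circ (T x)) + (\<Phi> T x)\<^sup>2 / 2 \<partial>?P)
        = c0 - ln (sphere_moment (m x) 0) + (real d - 1) * (\<integral>T. ln (circ (T x)) \<partial>?P) + 1 / 2"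
        using circ_P(1)[OF x] sq_P[OF x] P.prob_space by simp
    qed
    finally show ?thesis .
  qed
  also have "\<dots> \<le> (\<Sum>x\<in>?I. (ln (real (d + fst x + snd x + 2) / real n) + real (fst x + snd x + 3) / real (d + fst x + snd x + 2) + 12 / real (d + fst x + snd x - 1)) / 2)"
  proof (rule sum_mono)
    fix x assume x: "x \<in> ?I"
    let ?N = "real (d + fst x + snd x + 2)"
    have mN: "real (m x) + 3 = ?N" "real (m x) = real (d + fst x + snd x - 1)" using d by (auto simp: m_def)
    have m0: "real (m x) > 0" using m8[of x] by simp
    have "- ln (sphere_moment (m x) 0) = ln (1 / sphere_moment (m x) 0)" using sphere_moment_0_pos[OF m8] by (simp add: ln_div)
    also have "\<dots> \<le> ln (real (m x) / (2 * pi)) / 2 + 6 / real (m x)" by (rule sphere_norm_upper[OF m8])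
    finally have 1: "- ln (sphere_moment (m x) 0) \<le> ln (real (m x) / (2 * pi)) / 2 + 6 / real (m x)" .
    have "(real d - 1) * (\<integral>T. ln (circ (T x)) \<partial>?P) \<le> (real d - 1) * (- 1 / (2 * ?N))"
      using circ_P(2)[OF x] d unfolding mN by (intro mult_left_mono) auto
    \<comment> \<open>With N = d + i + j + 2 the numerator is N - (d - 1) = i + j + 3.\<close>
    also have "(real d - 1) * (- 1 / (2 * ?N)) + 1 / 2 = real (fst x + snd x + 3) / ?N / 2"
      using d by (simp add: field_simps)
    finally have 2: "(real d - 1) * (\<integral>T. ln (circ (T x)) \<partial>?P) + 1 / 2 \<le> real (fst x + snd x + 3) / ?N / 2" by simp
    have "ln (real (m x) / (2 * pi)) + ln (2 * pi) - ln (real n) = ln (real (m x) / real n)"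
      using m0 n0 by (simp add: ln_div)
    also have "\<dots> \<le> ln (?N / real n)" using m0 n0 mN(1) by (simp add: divide_right_mono)
    finally have 3: "ln (real (m x) / (2 * pi)) / 2 + c0 \<le> ln (?N / real n) / 2" by (simp add: c0_def)
    have 4: "6 / real (m x) = 12 / real (d + fst x + snd x - 1) / 2" unfolding mN(2) by simp
    have combine: "c0 - s + e + 1 / 2 \<le> (A + B + C) / 2"
      if "- s \<le> l / 2 + u" "e + 1 / 2 \<le> B / 2" "l / 2 + c0 \<le> A / 2" "u = C / 2" for s e A B C l u :: real
      using that by (simp add: field_simps)
    show "c0 - ln (sphere_moment (m x) 0) + (real d - 1) * (\<integral>T. ln (circ (T x)) \<partial>?P) + 1 / 2
      \<le> (ln (?N / real n) + real (fst x + snd x + 3) / ?N + 12 / real (d + fst x + snd x - 1)) / 2"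
      by (rule combine[OF 1 2 3 4])
  qed
  also have "\<dots> = (\<Sum>i<p. \<Sum>j<q. ln (real (d + i + j + 2) / real n) + real (i + j + 3) / real (d + i + j + 2) + 12 / real (d + i + j - 1)) / 2"
    by (simp only: sum_divide_distrib sum.cartesian_product case_prod_unfold)
  also have "\<dots> \<le> real (p * q) * (real (p * q) / (real n * real d) + 15 / (real d - 1)) / 2"
    by (intro divide_right_mono relative_entropy_sum[OF d n]) simp
  finally show ?thesis unfolding kl by (rule ereal_less_eq(3)[THEN iffD2])
qed

end

section \<open>Passage to the limit\<close>

lemma haar_orthogonal_0: "is_haar_orthogonal 0 (mat_space 0 0)"
proof -
  have sp: "space (mat_space 0 0) = {\<lambda>_. undefined}" by (simp add: mat_space_def space_PiM)
  have e: "emeasure (mat_space 0 0) (space (mat_space 0 0)) = 1"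
    unfolding sp unfolding mat_space_def lessThan_0 Times_empty[THEN iffD2, OF disjI1[OF refl]] by (rule emeasure_PiM_empty)
  have d: "distr (mat_space 0 0) (mat_space 0 0) (mat_mult 0 G) = mat_space 0 0" for G
  proof -
    have "distr (mat_space 0 0) (mat_space 0 0) (mat_mult 0 G) = distr (mat_space 0 0) (mat_space 0 0) (\<lambda>A. A)"
      by (rule distr_cong) (auto simp: sp mat_mult_def)
    then show ?thesis by (simp add: distr_id)
  qed
  show ?thesis
    unfolding is_haar_orthogonal_def using e d
    by (auto intro!: prob_spaceI AE_I2 simp: orthogonal_mat_def)
qed

lemma eventually_kl_bound:
  assumes haar: "\<And>n. n \<ge> 1 \<Longrightarrow> is_haar_orthogonal n (Haar n)"
    and range: "\<And>n. n \<ge> 1 \<Longrightarrow> 1 \<le> p n \<and> p n \<le> n \<and> 1 \<le> q n \<and> q n \<le> n"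
    and lim: "(\<lambda>n. real (p n * q n) / real n) \<longlonglongrightarrow> 0"
  shows "eventually (\<lambda>n. kl_div (distr (Haar n) (mat_space (p n) (q n)) (scaled_block n (p n) (q n))) (gauss_mat (p n) (q n))
    \<le> ereal (31 * (real (p n * q n) / real n))) sequentially"
proof -
  have "haar_family (\<lambda>n. if n = 0 then mat_space 0 0 else Haar n)"
    using haar haar_orthogonal_0 by unfold_locales auto
  then interpret F: haar_family "\<lambda>n. if n = 0 then mat_space 0 0 else Haar n" .
  have "eventually (\<lambda>n. real (p n * q n) / real n < 1 / 4) sequentially"
    using lim by (rule order_tendstoD) simp
  then show ?thesis using eventually_ge_at_top[of 40]
  proof eventually_elim
    fix n :: nat assume small: "real (p n * q n) / real n < 1 / 4" and n: "40 \<le> n"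
    let ?P = "p n" and ?Q = "q n"
    define x where "x = real (?P * ?Q) / real n"
    have pq: "1 \<le> ?P" "1 \<le> ?Q" using range[of n] n by auto
    have x: "0 \<le> x" "x < 1 / 4" "real (?P * ?Q) = x * real n" using small n by (auto simp: x_def)
    \<comment> \<open>From (p - 1) (q - 1) \<ge> 0 one gets p + q \<le> pq + 1: a small product
      forces a small sum, and d keeps at least half of n.\<close>
    obtain P' Q' where "?P = Suc P'" "?Q = Suc Q'" using pq by (cases ?P; cases ?Q) auto
    then have "?P + ?Q \<le> ?P * ?Q + 1" by simp
    then have "real (?P + ?Q) \<le> real (?P * ?Q) + 1" by linarith
    also have "\<dots> \<le> real n / 4 + 1" using x n by (simp add: mult_right_mono)
    finally have s: "real (?P + ?Q) \<le> real n / 4 + 1" .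
    then have "real (?P + ?Q) \<le> real n" using n by simp
    then have le: "?P + ?Q \<le> n" by linarith
    define d where "d = n - (?P + ?Q)"
    have nd: "n = d + ?P + ?Q" using le by (simp add: d_def)
    have "real d = real n - real (?P + ?Q)" using le by (simp add: d_def of_nat_diff)
    then have dn: "real n / 2 \<le> real d" "real n / 2 \<le> real d - 1" using s n by auto
    then have d9: "9 \<le> d" using n by linarith
    have "x * real n / (real n * real d) \<le> 2 * x / real n"
    proof -
      have "x * real n / (real n * real d) = x / real d" using n by simp
      also have "\<dots> \<le> x / (real n / 2)" using dn n x by (intro divide_left_mono) auto
      also have "\<dots> = 2 * x / real n" by simp
      finally show ?thesis .
    qed
    moreover have "15 / (real d - 1) \<le> 30 / real n"
    proof -
      have "15 / (real d - 1) \<le> 15 / (real n / 2)" using dn n by (intro divide_left_mono) auto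
      then show ?thesis by simp
    qed
    ultimately have "x * real n / (real n * real d) + 15 / (real d - 1) \<le> (2 * x + 30) / real n" by (simp add: add_divide_distrib)
    then have "x * real n * (x * real n / (real n * real d) + 15 / (real d - 1)) \<le> x * real n * ((2 * x + 30) / real n)"
      using x by (intro mult_left_mono) auto
    also have "\<dots> = x * (2 * x + 30)" using n by simp
    also have "\<dots> \<le> x * 62" using x by (intro mult_left_mono) auto
    finally have b: "x * real n * (x * real n / (real n * real d) + 15 / (real d - 1)) / 2 \<le> 31 * x" by simp
    have "kl_div (distr (Haar n) (mat_space ?P ?Q) (scaled_block n ?P ?Q)) (gauss_mat ?P ?Q)
       \<le> ereal (x * real n * (x * real n / (real n * real d) + 15 / (real d - 1)) / 2)"
      using F.kl_upper_bound[OF pq d9 nd] n unfolding x(3) by simp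
    also have "\<dots> \<le> ereal (31 * x)" using b by simp
    finally show "kl_div (distr (Haar n) (mat_space ?P ?Q) (scaled_block n ?P ?Q)) (gauss_mat ?P ?Q)
      \<le> ereal (31 * (real (?P * ?Q) / real n))" unfolding x_def .
  qed
qed

text \<open>For large n, pq / n exceeds \<sigma> / 2, which fixes \<rho>. Moreover n \<ge> 4 /
  \<sigma> gives pq \<ge> 2, so that the rows or the columns can be split.\<close>

lemma eventually_tv_lower:
  assumes laws: "\<And>n. n \<ge> 1 \<Longrightarrow> is_haar_orthogonal n (Haar n)"
    and range: "\<And>n. n \<ge> 1 \<Longrightarrow> 1 \<le> p n \<and> p n \<le> n \<and> 1 \<le> q n \<and> q n \<le> n"
    and \<sigma>: "0 < \<sigma>" and lim: "(\<lambda>n. real (p n * q n) / real n) \<longlonglongrightarrow> \<sigma>"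
  obtains c where "0 < c" "eventually (\<lambda>n. c \<le> tv_dist (distr (Haar n) (mat_space (p n) (q n)) (scaled_block n (p n) (q n)))
    (gauss_mat (p n) (q n))) sequentially"
proof
  define \<rho> where "\<rho> = (\<sigma> / 2)\<^sup>2 / 8"
  have \<rho>: "0 < \<rho>" using \<sigma> by (simp add: \<rho>_def)
  let ?c = "min (1/480) (1/(256*(960/\<rho>+14400))) :: real"
  have "0 < 256*(960/\<rho>+14400)" using \<rho> by (simp add: add_pos_pos)
  then show "0 < ?c" by simp
  have "eventually (\<lambda>n. \<sigma> / 2 < real (p n * q n) / real n) sequentially"
    using lim by (rule order_tendstoD) (use \<sigma> in simp)
  then show "eventually (\<lambda>n. ?c \<le> tv_dist (distr (Haar n) (mat_space (p n) (q n)) (scaled_block n (p n) (q n)))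
    (gauss_mat (p n) (q n))) sequentially"
    using eventually_ge_at_top[of "max 4 (nat \<lceil>4 / \<sigma>\<rceil>)"]
  proof eventually_elim
    fix n :: nat assume big: "\<sigma> / 2 < real (p n * q n) / real n" and n: "max 4 (nat \<lceil>4 / \<sigma>\<rceil>) \<le> n"
    then interpret haar n "Haar n" using laws[of n] by unfold_locales simp
    have n4: "4 \<le> n" and "4 / \<sigma> \<le> real n" using n by linarith+
    then have "2 \<le> \<sigma> / 2 * real n" using \<sigma> by (simp add: field_simps)
    also have "\<dots> < real (p n * q n)" using big n4 by (simp add: field_simps)
    finally have pq: "2 \<le> p n * q n" by linarith
    have "(\<sigma> / 2)\<^sup>2 \<le> (real (p n * q n) / real n)\<^sup>2" using big \<sigma> by (intro power_mono) auto
    then have r: "\<rho> \<le> (real (p n * q n) / real n)\<^sup>2 / 8" by (simp add: \<rho>_def)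
    have pq': "1 \<le> p n" "p n \<le> n" "1 \<le> q n" "q n \<le> n" using range[of n] n4 by auto
    show "?c \<le> tv_dist (distr (Haar n) (mat_space (p n) (q n)) (scaled_block n (p n) (q n))) (gauss_mat (p n) (q n))"
      by (rule tv_lower_bound'[OF _ pq' pq n4 \<rho> r]) (use laws in blast)
  qed
qed

lemma liminf_pos:
  fixes f :: "nat \<Rightarrow> ereal"
  assumes "0 < c" "eventually (\<lambda>n. ereal c \<le> f n) sequentially"
  shows "0 < liminf f"
proof -
  have "ereal c \<le> liminf f" by (rule Liminf_bounded) (rule assms(2))
  then show ?thesis using assms(1) by (metis ereal_less(2) less_le_trans)
qed

theorem theorem1p1:
  fixes p q :: "nat \<Rightarrow> nat"
    and Haar :: "nat \<Rightarrow> (nat \<times> nat \<Rightarrow> real) measure"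
    and \<mu> \<nu> :: "nat \<Rightarrow> (nat \<times> nat \<Rightarrow> real) measure"
  assumes pq_range: "\<And>n. n \<ge> 1 \<Longrightarrow> 1 \<le> p n \<and> p n \<le> n \<and> 1 \<le> q n \<and> q n \<le> n"
    and haar: "\<And>n. n \<ge> 1 \<Longrightarrow> is_haar_orthogonal n (Haar n)"
    and mu_def: "\<And>n. \<mu> n = distr (Haar n) (mat_space (p n) (q n)) (scaled_block n (p n) (q n))"
    and nu_def: "\<And>n. \<nu> n = gauss_mat (p n) (q n)"
  shows "((\<lambda>n. real (p n * q n) / real n) \<longlonglongrightarrow> 0 \<longrightarrow>
            ((\<lambda>n. tv_dist (\<mu> n) (\<nu> n)) \<longlonglongrightarrow> 0) \<and>
            ((\<lambda>n. hellinger (\<mu> n) (\<nu> n)) \<longlonglongrightarrow> 0) \<and>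
            ((\<lambda>n. kl_div (\<mu> n) (\<nu> n)) \<longlonglongrightarrow> 0))
       \<and> (\<forall>\<sigma>::real. \<sigma> > 0 \<and> (\<lambda>n. real (p n * q n) / real n) \<longlonglongrightarrow> \<sigma> \<longrightarrow>
            liminf (\<lambda>n. ereal (tv_dist (\<mu> n) (\<nu> n))) > 0 \<and>
            liminf (\<lambda>n. ereal (hellinger (\<mu> n) (\<nu> n))) > 0 \<and>
            liminf (\<lambda>n. kl_div (\<mu> n) (\<nu> n)) > 0)"
proof -
  have pair: "prob_pair (\<mu> n) (\<nu> n)" if n: "1 \<le> n" for n
  proof -
    interpret haar n "Haar n" by unfold_locales (rule haar[OF n])
    show ?thesis unfolding mu_def nu_def by (rule block_prob_pair) (use pq_range[OF n] in auto)
  qed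
  have compare: "0 \<le> tv_dist (\<mu> n) (\<nu> n)" "tv_dist (\<mu> n) (\<nu> n) \<le> 6 * hellinger (\<mu> n) (\<nu> n)"
    "0 \<le> hellinger (\<mu> n) (\<nu> n)" "hellinger (\<mu> n) (\<nu> n) \<le> sqrt (tv_dist (\<mu> n) (\<nu> n))"
    "kl_div (\<mu> n) (\<nu> n) = \<infinity> \<or> (\<exists>\<kappa>\<ge>0. kl_div (\<mu> n) (\<nu> n) = ereal \<kappa> \<and> tv_dist (\<mu> n) (\<nu> n) \<le> 4 * sqrt \<kappa>)"
    if n: "1 \<le> n" for n
  proof -
    interpret prob_pair "\<mu> n" "\<nu> n" by (rule pair[OF n])
    show "0 \<le> tv_dist (\<mu> n) (\<nu> n)" by (rule tv_nonneg)
    then show "hellinger (\<mu> n) (\<nu> n) \<le> sqrt (tv_dist (\<mu> n) (\<nu> n))"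
      unfolding hellinger_def using hellinger_sq_le_tv by (intro real_sqrt_le_mono) linarith
  qed (rule prob_pair.tv_le_hellinger[OF pair[OF n]] prob_pair.hellinger_nonneg[OF pair[OF n]] prob_pair.tv_le_kl[OF pair[OF n]])+
  have ev1: "eventually (\<lambda>n. 1 \<le> n) sequentially" by (rule eventually_ge_at_top)
  show ?thesis
  proof (intro conjI impI allI)
    assume lim: "(\<lambda>n. real (p n * q n) / real n) \<longlonglongrightarrow> 0"
    let ?x = "\<lambda>n. real (p n * q n) / real n"
    have kl: "eventually (\<lambda>n. kl_div (\<mu> n) (\<nu> n) \<le> ereal (31 * ?x n)) sequentially"
      unfolding mu_def nu_def by (rule eventually_kl_bound[OF haar pq_range lim])
    have lim31: "(\<lambda>n. 31 * ?x n) \<longlonglongrightarrow> 0" by (rule tendsto_mult_right_zero[OF lim])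
    show "(\<lambda>n. kl_div (\<mu> n) (\<nu> n)) \<longlonglongrightarrow> 0"
    proof (rule tendsto_sandwich[OF _ kl])
      show "eventually (\<lambda>n. 0 \<le> kl_div (\<mu> n) (\<nu> n)) sequentially"
        using ev1 by eventually_elim (use compare(5) in fastforce)
      show "(\<lambda>n. ereal (31 * ?x n)) \<longlonglongrightarrow> 0" unfolding zero_ereal_def lim_ereal by (rule lim31)
    qed simp
    have tv_le: "eventually (\<lambda>n. tv_dist (\<mu> n) (\<nu> n) \<le> 4 * sqrt (31 * ?x n)) sequentially"
      using ev1 kl
    proof eventually_elim
      fix n :: nat assume n: "1 \<le> n" and le: "kl_div (\<mu> n) (\<nu> n) \<le> ereal (31 * ?x n)"
      \<comment> \<open>The real upper bound excludes the infinite alternative.\<close>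
      then obtain \<kappa> where \<kappa>: "kl_div (\<mu> n) (\<nu> n) = ereal \<kappa>" "tv_dist (\<mu> n) (\<nu> n) \<le> 4 * sqrt \<kappa>"
        using compare(5)[OF n] by auto
      have "\<kappa> \<le> 31 * ?x n" using le unfolding \<kappa>(1) by simp
      then have "sqrt \<kappa> \<le> sqrt (31 * ?x n)" by (rule real_sqrt_le_mono)
      then show "tv_dist (\<mu> n) (\<nu> n) \<le> 4 * sqrt (31 * ?x n)" using \<kappa>(2) by linarith
    qed
    show tv: "(\<lambda>n. tv_dist (\<mu> n) (\<nu> n)) \<longlonglongrightarrow> 0"
    proof (rule tendsto_sandwich[OF _ tv_le])
      show "eventually (\<lambda>n. 0 \<le> tv_dist (\<mu> n) (\<nu> n)) sequentially"
        using ev1 by eventually_elim (rule compare(1))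
      show "(\<lambda>n. 4 * sqrt (31 * ?x n)) \<longlonglongrightarrow> 0"
        using tendsto_mult_right_zero[OF tendsto_real_sqrt[OF lim31, unfolded real_sqrt_zero], of 4] .
    qed simp
    show "(\<lambda>n. hellinger (\<mu> n) (\<nu> n)) \<longlonglongrightarrow> 0"
    proof (rule tendsto_sandwich)
      show "eventually (\<lambda>n. 0 \<le> hellinger (\<mu> n) (\<nu> n)) sequentially"
        using ev1 by eventually_elim (rule compare(3))
      show "eventually (\<lambda>n. hellinger (\<mu> n) (\<nu> n) \<le> sqrt (tv_dist (\<mu> n) (\<nu> n))) sequentially"
        using ev1 by eventually_elim (rule compare(4))
      show "(\<lambda>n. sqrt (tv_dist (\<mu> n) (\<nu> n))) \<longlonglongrightarrow> 0" by (rule tendsto_real_sqrt[OF tv, unfolded real_sqrt_zero])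
    qed simp
  next
    fix \<sigma> :: real assume \<sigma>: "\<sigma> > 0 \<and> (\<lambda>n. real (p n * q n) / real n) \<longlonglongrightarrow> \<sigma>"
    obtain c where c: "0 < c" and ev: "eventually (\<lambda>n. c \<le> tv_dist (\<mu> n) (\<nu> n)) sequentially"
      unfolding mu_def nu_def using eventually_tv_lower[OF haar pq_range conjunct1[OF \<sigma>] conjunct2[OF \<sigma>]] by blast
    show "liminf (\<lambda>n. ereal (tv_dist (\<mu> n) (\<nu> n))) > 0"
      by (rule liminf_pos[OF c]) (use ev in simp)
    show "liminf (\<lambda>n. ereal (hellinger (\<mu> n) (\<nu> n))) > 0"
    proof (rule liminf_pos)
      show "eventually (\<lambda>n. ereal (c / 6) \<le> ereal (hellinger (\<mu> n) (\<nu> n))) sequentially"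
        using ev1 ev
      proof eventually_elim
        fix n :: nat assume "1 \<le> n" "c \<le> tv_dist (\<mu> n) (\<nu> n)"
        then show "ereal (c / 6) \<le> ereal (hellinger (\<mu> n) (\<nu> n))" using compare(2)[of n] by simp
      qed
    qed (use c in simp)
    show "liminf (\<lambda>n. kl_div (\<mu> n) (\<nu> n)) > 0"
    proof (rule liminf_pos)
      show "eventually (\<lambda>n. ereal ((c / 4)\<^sup>2) \<le> kl_div (\<mu> n) (\<nu> n)) sequentially"
        using ev1 ev
      proof eventually_elim
        fix n :: nat assume n: "1 \<le> n" and le: "c \<le> tv_dist (\<mu> n) (\<nu> n)"
        \<comment> \<open>An infinite distance satisfies the bound trivially; a finite one does
          because c \<le> 4 sqrt \<kappa>.\<close>
        show "ereal ((c / 4)\<^sup>2) \<le> kl_div (\<mu> n) (\<nu> n)"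
          using compare(5)[OF n]
        proof (elim disjE exE conjE)
          fix \<kappa> assume \<kappa>: "0 \<le> \<kappa>" "kl_div (\<mu> n) (\<nu> n) = ereal \<kappa>" "tv_dist (\<mu> n) (\<nu> n) \<le> 4 * sqrt \<kappa>"
          have "(c / 4)\<^sup>2 \<le> (sqrt \<kappa>)\<^sup>2" using c le \<kappa> by (intro power_mono) auto
          then show ?thesis using \<kappa> by simp
        qed simp
      qed
    qed (use c in simp)
  qed
qed

end
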